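(* (i) The following decision problem is $\mathbf{NP}$-complete: given a planar $3$-colorable graph $G$, decide whether $G$ has an edge-labeling by product from $\mathbb{N}_2=\{1,2\}$. (ii) The following decision problem is $\mathbf{NP}$-complete: given a $3$-regular graph $G$, decide whether $G$ has an edge-labeling by product from $\mathbb{N}_2$.
   Context: All graphs are finite and simple. For a positive integer $k$, $\mathbb{N}_k=\{1,\ldots,k\}$. An edge-labeling by product from $\mathbb{N}_k$ of a graph $G$ is a map $f:E(G)\to\mathbb{N}_k$ such that the vertex coloring $c(v)=\prod_{e\ni v} f(e)$ (product over edges incident with $v$) is a proper vertex coloring, i.e. $c(u)\neq c(v)$ for every edge $uv$. *)

theory Defs
  imports "HOL-Analysis.Analysis" "HOL-Computational_Algebra.Polynomial"
begin

section \<open>Deterministic multi-tape Turing machines\<close>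

text \<open>Tapes are two-way infinite. The symbols \<open>0\<close>, \<open>1\<close>, \<open>2\<close> stand for the blank and for the input
  letters \<^term>\<open>False\<close> and \<^term>\<open>True\<close>; larger numbers are work symbols. The initial state is
  \<open>0\<close>, and the machine halts when the transition function returns \<^term>\<open>None\<close>.\<close>

datatype head_move = Move_Left | Move_Stay | Move_Right

record turing_machine =
  num_tapes :: nat
  num_states :: nat
  num_syms :: nat
  delta :: "nat \<Rightarrow> nat list \<Rightarrow> (nat \<times> (nat \<times> head_move) list) option"

definition wf_tm :: "turing_machine \<Rightarrow> bool" where
  "wf_tm M \<longleftrightarrow>
     num_tapes M \<ge> 1 \<and> num_states M \<ge> 1 \<and> num_syms M \<ge> 3 \<and>
     (\<forall>q ss q' acts. q < num_states M \<and> length ss = num_tapes M \<and>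
        set ss \<subseteq> {..<num_syms M} \<and> delta M q ss = Some (q', acts) \<longrightarrow>
        q' < num_states M \<and> length acts = num_tapes M \<and>
        fst ` set acts \<subseteq> {..<num_syms M})"

type_synonym tape = "(int \<Rightarrow> nat) \<times> int"
type_synonym config = "nat \<times> tape list"

fun offset :: "head_move \<Rightarrow> int" where
  "offset Move_Left = -1"
| "offset Move_Stay = 0"
| "offset Move_Right = 1"

fun tape_read :: "tape \<Rightarrow> nat" where
  "tape_read (c, h) = c h"

fun tape_act :: "nat \<times> head_move \<Rightarrow> tape \<Rightarrow> tape" where
  "tape_act (s, m) (c, h) = (c(h := s), h + offset m)"

fun tm_step :: "turing_machine \<Rightarrow> config \<Rightarrow> config" where
  "tm_step M (q, ts) =
     (case delta M q (map tape_read ts) of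
        None \<Rightarrow> (q, ts)
      | Some (q', acts) \<Rightarrow> (q', map2 tape_act acts ts))"

fun tm_halted :: "turing_machine \<Rightarrow> config \<Rightarrow> bool" where
  "tm_halted M (q, ts) \<longleftrightarrow> delta M q (map tape_read ts) = None"

definition word_cells :: "bool list \<Rightarrow> int \<Rightarrow> nat" where
  "word_cells x i =
     (if 0 \<le> i \<and> i < int (length x) then (if x ! nat i then 2 else 1) else 0)"

definition tm_init :: "turing_machine \<Rightarrow> bool list \<Rightarrow> config" where
  "tm_init M x = (0, (word_cells x, 0) # replicate (num_tapes M - 1) (word_cells [], 0))"

text \<open>The input is on the first tape, the output on the last one.\<close>

definition tm_computes_within :: "turing_machine \<Rightarrow> bool list \<Rightarrow> nat \<Rightarrow> bool list \<Rightarrow> bool" where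
  "tm_computes_within M x T y \<longleftrightarrow>
     (\<exists>t\<le>T. let c = (tm_step M ^^ t) (tm_init M x)
             in tm_halted M c \<and> fst (last (snd c)) = word_cells y)"


section \<open>Polynomial time and NP\<close>

definition polytime :: "(bool list \<Rightarrow> bool list) \<Rightarrow> bool" where
  "polytime f \<longleftrightarrow>
     (\<exists>M (p :: nat poly). wf_tm M \<and>
        (\<forall>x. tm_computes_within M x (poly p (length x)) (f x)))"

definition polytime_decidable :: "bool list set \<Rightarrow> bool" where
  "polytime_decidable L \<longleftrightarrow> polytime (\<lambda>x. [x \<in> L])"

text \<open>Pairing of words: the letters of the first component are doubled, so that the first aligned
  block of two different letters marks its end.\<close>

definition word_pair :: "bool list \<Rightarrow> bool list \<Rightarrow> bool list" where
  "word_pair x w = concat (map (\<lambda>b. [b, b]) x) @ [True, False] @ w"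

definition NP :: "bool list set set" where
  "NP = {L. \<exists>V (p :: nat poly). polytime_decidable V \<and>
           (\<forall>x. x \<in> L \<longleftrightarrow> (\<exists>w. length w \<le> poly p (length x) \<and> word_pair x w \<in> V))}"

text \<open>A decision problem "given an instance in \<open>I\<close>, decide membership in \<open>Y\<close>". Nothing is
  required of a procedure solving it on inputs outside \<open>I\<close>, while a reduction to it must always
  produce elements of \<open>I\<close>. In particular hardness cannot stem from the difficulty of
  recognising \<open>I\<close>, which matters for 3-colorable planar graphs.\<close>

definition in_NP_on :: "bool list set \<Rightarrow> bool list set \<Rightarrow> bool" where
  "in_NP_on I Y \<longleftrightarrow> (\<exists>L\<in>NP. \<forall>x\<in>I. x \<in> L \<longleftrightarrow> x \<in> Y)"

definition NP_hard_on :: "bool list set \<Rightarrow> bool list set \<Rightarrow> bool" where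
  "NP_hard_on I Y \<longleftrightarrow>
     (\<forall>L\<in>NP. \<exists>f. polytime f \<and> (\<forall>x. f x \<in> I \<and> (x \<in> L \<longleftrightarrow> f x \<in> Y)))"

definition NP_complete_on :: "bool list set \<Rightarrow> bool list set \<Rightarrow> bool" where
  "NP_complete_on I Y \<longleftrightarrow> in_NP_on I Y \<and> NP_hard_on I Y"


section \<open>Graphs\<close>

definition simple_graph :: "'a set \<Rightarrow> 'a set set \<Rightarrow> bool" where
  "simple_graph V E \<longleftrightarrow> finite V \<and> (\<forall>e\<in>E. e \<subseteq> V \<and> card e = 2)"

definition proper_coloring :: "'a set set \<Rightarrow> ('a \<Rightarrow> nat) \<Rightarrow> bool" where
  "proper_coloring E c \<longleftrightarrow> (\<forall>u v. {u, v} \<in> E \<longrightarrow> c u \<noteq> c v)"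

definition colorable :: "nat \<Rightarrow> 'a set \<Rightarrow> 'a set set \<Rightarrow> bool" where
  "colorable k V E \<longleftrightarrow> (\<exists>c \<in> V \<rightarrow> {1..k}. proper_coloring E c)"

definition regular :: "nat \<Rightarrow> 'a set \<Rightarrow> 'a set set \<Rightarrow> bool" where
  "regular d V E \<longleftrightarrow> (\<forall>v\<in>V. card {e \<in> E. v \<in> e} = d)"

text \<open>A graph is planar if it can be drawn in the plane, with vertices as distinct points and edges
  as simple arcs between their end vertices that meet only in common end vertices.\<close>

definition planar :: "'a set \<Rightarrow> 'a set set \<Rightarrow> bool" where
  "planar V E \<longleftrightarrow>
     (\<exists>(pos :: 'a \<Rightarrow> complex) (\<gamma> :: 'a set \<Rightarrow> real \<Rightarrow> complex).
        inj_on pos V \<and>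
        (\<forall>e\<in>E. arc (\<gamma> e) \<and> {pathstart (\<gamma> e), pathfinish (\<gamma> e)} = pos ` e \<and>
                path_image (\<gamma> e) \<inter> pos ` V = pos ` e) \<and>
        (\<forall>e\<in>E. \<forall>e'\<in>E. e \<noteq> e' \<longrightarrow>
            path_image (\<gamma> e) \<inter> path_image (\<gamma> e') = pos ` (e \<inter> e')))"

definition edge_labeling_by_product :: "nat \<Rightarrow> 'a set set \<Rightarrow> ('a set \<Rightarrow> nat) \<Rightarrow> bool" where
  "edge_labeling_by_product k E f \<longleftrightarrow>
     f \<in> E \<rightarrow> {1..k} \<and> proper_coloring E (\<lambda>v. \<Prod>e\<in>{e \<in> E. v \<in> e}. f e)"

text \<open>Graphs on the vertices \<open>0, \<dots>, n - 1\<close> are encoded by their adjacency matrix, row by row;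
  the length of the code determines \<open>n\<close>.\<close>

definition graph_code :: "nat \<Rightarrow> nat set set \<Rightarrow> bool list" where
  "graph_code n E = concat (map (\<lambda>i. map (\<lambda>j. {i, j} \<in> E) [0..<n]) [0..<n])"

definition graph_codes :: "(nat set \<Rightarrow> nat set set \<Rightarrow> bool) \<Rightarrow> bool list set" where
  "graph_codes P = {graph_code n E | n E. simple_graph {..<n} E \<and> P {..<n} E}"

end

theory Submission
  imports Defs
begin

text \<open>
  A labelling with labels 1 and 2 is the choice of a subgraph in which adjacent vertices have different
  degrees. Membership in \<open>NP\<close> holds because such a subgraph can be checked by counting.

  For hardness, both classes of instances are served by a single reduction, whose output is planar,
  3-regular and 3-colorable at the same time. The graph is tiled by small cubic gadgets with up to four
  ports, found by a computer search. A gadget restricts the labels of its port edges: two wires can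
  cross, a horizontal wire can start or end at a vertical one, and it can absorb a literal. A grid of
  these tiles expresses that a CNF formula is satisfiable: columns carry the literals and rows the clauses.

  The formula describes an accepting run of a verifier. It is given by finitely many clause templates
  with indices of polynomial size, so the adjacency matrix of the tiled graph is definable by formulas
  with polynomially bounded counting quantifiers; such formulas are evaluated by loop programs over
  counters, which multi-tape machines simulate in polynomial time.
\<close>

text \<open>The basic device is the diamond, K4 minus an edge: if its two nonadjacent vertices each
  have one edge leaving, these two edges get equal labels and the degrees of both vertices are
  determined. The obstacle is that equal labels at a port do not suffice. The ends of a port edge
  must also differ in degree, and their degrees depend on what happens inside both tiles. Therefore
  every port edge joins a link to a tile of another kind. A link transmits the label, but the degree
  of its port vertices can be shifted by 0, 1 or 2, and one of three values always avoids the two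
  degrees met outside. The same alternation yields the 3-coloring: links have color 1 at their
  ports, all other tiles color 2 or 3. The crossing negates the horizontal wire instead of copying
  it, so labels are read relative to the parity of the column. No gadget fixes an absolute truth
  value; a reference column plays the part of false.\<close>

section \<open>Cubic gadgets and the constraints on their ports\<close>

datatype dir = dL | dR | dD | dU

datatype tgt = In nat | Po dir

text \<open>\<open>TX\<close> is the crossing and \<open>TA\<close> the tile that can absorb a
  literal; \<open>TS\<close> and \<open>TE\<close> start and end a horizontal wire at a vertical
  one. \<open>TH\<close> and \<open>TV\<close> are the links. The four \<open>C\<close> tiles have
  one port, on the named side, and finish off a wire there; \<open>TN\<close> is the empty
  tile.\<close>

datatype ty = TX | TA | TS | TE | TH | TV | CL | CR | CD | CU | TN

text \<open>Entry \<open>k\<close> lists the three edges at vertex \<open>k\<close>: to an inner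
  vertex, or out through a port. \<open>TS\<close> and \<open>TE\<close> are disconnected: their
  vertices 9 to 13 only close the horizontal port on the side where no wire runs.\<close>

fun tab :: "ty \<Rightarrow> tgt list list" where
"tab TX = [[In 1, In 2, Po dL], [In 0, In 2, In 3], [In 0, In 1, In 3], [In 1, In 2, In 4], [In 3,
    In 5, Po dD], [In 4, In 6, Po dU], [In 5, In 7, In 8], [In 6, In 8, In 9], [In 6, In 7, In 9],
    [In 7, In 8, Po dR]]"
| "tab TA = [[In 1, In 2, In 3], [In 0, In 3, In 4], [In 0, In 5, Po dL], [In 0, In 1, Po dU], [In
    1, In 5, Po dR], [In 4, In 2, In 6], [In 5, In 7, In 8], [In 6, In 8, In 9], [In 6, In 7, In
    9], [In 7, In 8, Po dD]]"
| "tab TS = [[In 1, In 5, Po dU], [In 0, In 2, In 3], [In 1, In 3, In 4], [In 1, In 2, In 4], [In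
    2, In 3, Po dD], [In 0, In 6, In 7], [In 5, In 7, In 8], [In 5, In 6, In 8], [In 6, In 7, Po
    dR], [In 10, In 11, Po dL], [In 9, In 12, In 13], [In 9, In 12, In 13], [In 10, In 13, In 11],
    [In 10, In 12, In 11]]"
| "tab TE = [[In 1, In 5, Po dU], [In 0, In 2, In 3], [In 1, In 3, In 4], [In 1, In 2, In 4], [In
    2, In 3, Po dD], [In 0, In 6, In 7], [In 5, In 7, In 8], [In 5, In 6, In 8], [In 6, In 7, Po
    dL], [In 10, In 11, Po dR], [In 9, In 12, In 13], [In 9, In 12, In 13], [In 10, In 13, In 11],
    [In 10, In 12, In 11]]"
| "tab TH = [[In 2, In 3, Po dL], [In 2, In 3, Po dR], [In 0, In 1, In 4], [In 0, In 1, In 7], [In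
    2, In 5, In 6], [In 4, In 6, In 7], [In 4, In 5, In 7], [In 3, In 5, In 6]]"
| "tab TV = [[In 2, In 3, Po dD], [In 2, In 3, Po dU], [In 0, In 1, In 4], [In 0, In 1, In 7], [In
    2, In 5, In 6], [In 4, In 6, In 7], [In 4, In 5, In 7], [In 3, In 5, In 6]]"
| "tab CL = [[In 1, In 2, Po dL], [In 0, In 3, In 4], [In 0, In 3, In 4], [In 1, In 4, In 2], [In
    1, In 3, In 2]]"
| "tab CR = [[In 1, In 2, Po dR], [In 0, In 3, In 4], [In 0, In 3, In 4], [In 1, In 4, In 2], [In
    1, In 3, In 2]]"
| "tab CD = [[In 1, In 2, Po dD], [In 0, In 3, In 4], [In 0, In 3, In 4], [In 1, In 4, In 2], [In
    1, In 3, In 2]]"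
| "tab CU = [[In 1, In 2, Po dU], [In 0, In 3, In 4], [In 0, In 3, In 4], [In 1, In 4, In 2], [In
    1, In 3, In 2]]"
| "tab TN = []"

fun tedges :: "ty \<Rightarrow> (nat \<times> nat) list" where
"tedges TX = [(0, 1), (0, 2), (1, 2), (1, 3), (2, 3), (3, 4), (4, 5), (5, 6), (6, 7), (6, 8), (7,
    8), (7, 9), (8, 9)]"
| "tedges TA = [(0, 1), (0, 2), (0, 3), (1, 3), (1, 4), (4, 5), (2, 5), (5, 6), (6, 7), (6, 8),
    (7, 8), (7, 9), (8, 9)]"
| "tedges TS = [(0, 1), (0, 5), (1, 2), (1, 3), (2, 3), (2, 4), (3, 4), (5, 6), (5, 7), (6, 7),
    (6, 8), (7, 8), (9, 10), (9, 11), (10, 12), (10, 13), (12, 13), (11, 12), (11, 13)]"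
| "tedges TE = [(0, 1), (0, 5), (1, 2), (1, 3), (2, 3), (2, 4), (3, 4), (5, 6), (5, 7), (6, 7),
    (6, 8), (7, 8), (9, 10), (9, 11), (10, 12), (10, 13), (12, 13), (11, 12), (11, 13)]"
| "tedges TH = [(0, 2), (0, 3), (1, 2), (1, 3), (2, 4), (3, 7), (4, 5), (4, 6), (5, 6), (5, 7),
    (6, 7)]"
| "tedges TV = [(0, 2), (0, 3), (1, 2), (1, 3), (2, 4), (3, 7), (4, 5), (4, 6), (5, 6), (5, 7),
    (6, 7)]"
| "tedges CL = [(0, 1), (0, 2), (1, 3), (1, 4), (3, 4), (2, 3), (2, 4)]"
| "tedges CR = [(0, 1), (0, 2), (1, 3), (1, 4), (3, 4), (2, 3), (2, 4)]"
| "tedges CD = [(0, 1), (0, 2), (1, 3), (1, 4), (3, 4), (2, 3), (2, 4)]"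
| "tedges CU = [(0, 1), (0, 2), (1, 3), (1, 4), (3, 4), (2, 3), (2, 4)]"
| "tedges TN = []"

text \<open>A straight-line drawing in a square of side 10 with the ports at the midpoints of the
  sides, so that drawings of adjacent tiles can be joined by short axis-parallel segments.\<close>

fun crd :: "ty \<Rightarrow> (int \<times> int) list" where
"crd TX = [(0, 5), (2, 4), (1, 3), (3, 2), (5, 0), (5, 10), (7, 8), (9, 7), (8, 6), (10, 5)]"
| "crd TA = [(4, 8), (6, 8), (0, 5), (5, 10), (10, 5), (5, 6), (5, 4), (4, 2), (6, 2), (5, 0)]"
| "crd TS = [(5, 10), (5, 7), (4, 4), (6, 4), (5, 0), (7, 8), (9, 7), (8, 6), (10, 5), (0, 5), (1,
    7), (1, 3), (2, 5), (3, 5)]"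
| "crd TE = [(5, 10), (5, 7), (6, 4), (4, 4), (5, 0), (3, 8), (1, 7), (2, 6), (0, 5), (10, 5), (9,
    7), (9, 3), (8, 5), (7, 5)]"
| "crd TH = [(0, 5), (10, 5), (5, 9), (3, 1), (5, 7), (4, 5), (6, 5), (5, 3)]"
| "crd TV = [(5, 0), (5, 10), (9, 5), (1, 3), (7, 5), (5, 4), (5, 6), (3, 5)]"
| "crd CL = [(0, 5), (1, 7), (1, 3), (2, 5), (3, 5)]"
| "crd CR = [(10, 5), (9, 7), (9, 3), (8, 5), (7, 5)]"
| "crd CD = [(5, 0), (7, 1), (3, 1), (5, 2), (5, 3)]"
| "crd CU = [(5, 10), (7, 9), (3, 9), (5, 8), (5, 7)]"
| "crd TN = []"

fun tcol :: "ty \<Rightarrow> nat list" where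
"tcol TX = [3, 1, 2, 3, 2, 3, 2, 1, 3, 2]"
| "tcol TA = [1, 3, 3, 2, 2, 1, 2, 1, 3, 2]"
| "tcol TS = [2, 3, 1, 2, 3, 3, 1, 2, 3, 2, 3, 3, 1, 2]"
| "tcol TE = [2, 3, 1, 2, 3, 3, 1, 2, 3, 2, 3, 3, 1, 2]"
| "tcol TH = [1, 1, 2, 3, 1, 2, 3, 1]"
| "tcol TV = [1, 1, 2, 3, 1, 2, 3, 1]"
| "tcol CL = [2, 3, 3, 1, 2]"
| "tcol CR = [2, 3, 3, 1, 2]"
| "tcol CD = [2, 3, 3, 1, 2]"
| "tcol CU = [2, 3, 3, 1, 2]"
| "tcol TN = []"

text \<open>The diamond with ends \<open>a\<close>, \<open>d\<close> and middle edge
  \<open>b\<close>, \<open>c\<close>, when both edges leaving it have label \<open>x\<close>. The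
  ends get degree 1 or 2 according to \<open>x\<close>; \<open>b\<close> and \<open>c\<close> get
  degrees 1 and 3 if \<open>x\<close> holds and 2 and 0 otherwise.\<close>

definition dia :: "nat \<Rightarrow> nat \<Rightarrow> nat \<Rightarrow> nat \<Rightarrow> bool \<Rightarrow> ((nat \<times> nat) \<times> bool) list" where
  "dia a b c d x = [((a, b), \<not> x), ((a, c), x), ((b, c), x), ((b, d), \<not> x), ((c, d), x)]"

text \<open>Labellings of the inner edges for given labels of the ports. The number \<open>j\<close> is the
  contribution of the inner edges to the degree of the ports of the links \<open>TH\<close> and \<open>TV\<close>, which can
  be chosen freely.\<close>

fun sol :: "ty \<Rightarrow> (dir \<Rightarrow> bool) \<Rightarrow> nat \<Rightarrow> ((nat \<times> nat) \<times> bool) list" where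
  "sol TX p j = dia 0 1 2 3 (p dL) @ [((3, 4), p dL), ((4, 5), p dD), ((5, 6), \<not> p dL)] @ dia 6 7 8 9 (\<not> p dL)"
| "sol TA p j = [((0, 1), \<not> p dD), ((0, 2), \<not> p dD), ((0, 3), \<not> p dR), ((1, 3), p dR), ((1, 4), \<not> p dD),
     ((4, 5), p dD), ((2, 5), p dD), ((5, 6), p dD)] @ dia 6 7 8 9 (p dD)"
| "sol TS p j = [((0, 1), p dD), ((0, 5), p dD), ((9, 10), p dL), ((9, 11), p dL)] @
     dia 1 2 3 4 (p dD) @ dia 5 6 7 8 (p dD) @ dia 10 12 13 11 (p dL)"
| "sol TE p j = [((0, 1), p dD), ((0, 5), p dD), ((9, 10), p dR), ((9, 11), p dR)] @
     dia 1 2 3 4 (p dD) @ dia 5 6 7 8 (p dD) @ dia 10 12 13 11 (p dR)"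
| "sol TH p j = [((0, 2), j \<ge> 1), ((1, 2), j \<ge> 1), ((0, 3), j = 2), ((1, 3), j = 2),
     ((2, 4), p dL = (j = 1)), ((3, 7), p dL = (j = 1))] @ dia 4 5 6 7 (p dL = (j = 1))"
| "sol TV p j = [((0, 2), j \<ge> 1), ((1, 2), j \<ge> 1), ((0, 3), j = 2), ((1, 3), j = 2),
     ((2, 4), p dD = (j = 1)), ((3, 7), p dD = (j = 1))] @ dia 4 5 6 7 (p dD = (j = 1))"
| "sol CL p j = [((0, 1), p dL), ((0, 2), p dL)] @ dia 1 3 4 2 (p dL)"
| "sol CR p j = [((0, 1), p dR), ((0, 2), p dR)] @ dia 1 3 4 2 (p dR)"
| "sol CD p j = [((0, 1), p dD), ((0, 2), p dD)] @ dia 1 3 4 2 (p dD)"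
| "sol CU p j = [((0, 1), p dU), ((0, 2), p dU)] @ dia 1 3 4 2 (p dU)"
| "sol TN p j = []"

fun look :: "((nat \<times> nat) \<times> bool) list \<Rightarrow> nat \<Rightarrow> nat \<Rightarrow> bool" where
  "look [] k k' = False"
| "look (((a, b), v) # xs) k k' = (if a = k \<and> b = k' \<or> a = k' \<and> b = k then v else look xs k k')"

definition hsol :: "ty \<Rightarrow> (dir \<Rightarrow> bool) \<Rightarrow> nat \<Rightarrow> nat \<Rightarrow> nat \<Rightarrow> bool" where
  "hsol ty p j = look (sol ty p j)"

fun tlab :: "(nat \<Rightarrow> nat \<Rightarrow> bool) \<Rightarrow> (dir \<Rightarrow> bool) \<Rightarrow> nat \<Rightarrow> tgt \<Rightarrow> bool" where
  "tlab h p k (In k') = h k k'"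
| "tlab h p k (Po d) = p d"

definition d3 :: "bool \<Rightarrow> bool \<Rightarrow> bool \<Rightarrow> nat" where
  "d3 a b c = of_bool a + of_bool b + of_bool c"

fun dgl :: "(nat \<Rightarrow> nat \<Rightarrow> bool) \<Rightarrow> (dir \<Rightarrow> bool) \<Rightarrow> nat \<Rightarrow> tgt list \<Rightarrow> nat" where
  "dgl h p k [a, b, c] = d3 (tlab h p k a) (tlab h p k b) (tlab h p k c)"
| "dgl h p k _ = 0"

definition dgt :: "ty \<Rightarrow> (nat \<Rightarrow> nat \<Rightarrow> bool) \<Rightarrow> (dir \<Rightarrow> bool) \<Rightarrow> nat \<Rightarrow> nat" where
  "dgt ty h p k = dgl h p k (tab ty ! k)"

text \<open>Only edges inside the tile are checked. The degree condition along a port edge involves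
  two tiles and is settled when tiles are glued.\<close>

definition tile_ok :: "ty \<Rightarrow> (nat \<Rightarrow> nat \<Rightarrow> bool) \<Rightarrow> (dir \<Rightarrow> bool) \<Rightarrow> bool" where
  "tile_ok ty h p \<longleftrightarrow> list_all (\<lambda>(k, k'). dgt ty h p k \<noteq> dgt ty h p k') (tedges ty)"

text \<open>The constraints that the tiles impose on the labels of their ports.\<close>

fun trel :: "ty \<Rightarrow> (dir \<Rightarrow> bool) \<Rightarrow> bool" where
  "trel TX p \<longleftrightarrow> p dU = p dD \<and> p dR = (\<not> p dL)"
| "trel TA p \<longleftrightarrow> p dU = p dD \<and> \<not> (p dL = p dR \<and> p dL \<noteq> p dD)"
| "trel TS p \<longleftrightarrow> p dU = p dD \<and> p dR = p dD"
| "trel TE p \<longleftrightarrow> p dU = p dD \<and> p dL = p dD"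
| "trel TH p \<longleftrightarrow> p dL = p dR"
| "trel TV p \<longleftrightarrow> p dD = p dU"
| "trel _ p \<longleftrightarrow> True"

lemma look_sym: "look xs k k' = look xs k' k"
  by (induction xs k k' rule: look.induct) auto

lemma hsol_sym: "hsol ty p j k k' = hsol ty p j k' k"
  by (simp add: hsol_def look_sym)

lemma tile_ok_hsol:
  assumes "trel ty p" "j \<le> 2"
  shows "tile_ok ty (hsol ty p j) p"
proof -
  have j: "j = 0 \<or> j = 1 \<or> j = 2" using assms(2) by linarith
  note defs = tile_ok_def dgt_def hsol_def dia_def d3_def
  show ?thesis
  proof (cases ty)
    case TX
    then show ?thesis using assms(1) by (cases "p dL"; cases "p dD"; simp add: defs)
  next
    case TA
    then show ?thesis using assms(1) by (cases "p dL"; cases "p dD"; cases "p dR"; simp add: defs)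
  next
    case TS
    then show ?thesis using assms(1) by (cases "p dL"; cases "p dD"; simp add: defs)
  next
    case TE
    then show ?thesis using assms(1) by (cases "p dR"; cases "p dD"; simp add: defs)
  next
    case TH
    then show ?thesis using assms(1) j by (cases "p dL"; elim disjE; simp add: defs)
  next
    case TV
    then show ?thesis using assms(1) j by (cases "p dD"; elim disjE; simp add: defs)
  next
    case CL
    then show ?thesis by (cases "p dL"; simp add: defs)
  next
    case CR
    then show ?thesis by (cases "p dR"; simp add: defs)
  next
    case CD
    then show ?thesis by (cases "p dD"; simp add: defs)
  next
    case CU
    then show ?thesis by (cases "p dU"; simp add: defs)
  qed (simp add: defs)
qed

text \<open>Both port vertices of a link are adjacent to the inner vertices 2 and 3, and in
  \<open>sol\<close> they treat these two edges alike; \<open>j\<close> counts how many of the two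
  are labelled 2. Hence the two port degrees move together, independently of the transmitted
  label.\<close>

lemma link_port_degree:
  assumes "j \<le> 2" "k = 0 \<or> k = 1"
  shows "trel TH p \<Longrightarrow> dgt TH (hsol TH p j) p k = of_bool (p dL) + j"
    "trel TV p \<Longrightarrow> dgt TV (hsol TV p j) p k = of_bool (p dD) + j"
proof -
  have "j = 0 \<or> j = 1 \<or> j = 2" using assms(1) by linarith
  then show "trel TH p \<Longrightarrow> dgt TH (hsol TH p j) p k = of_bool (p dL) + j"
    "trel TV p \<Longrightarrow> dgt TV (hsol TV p j) p k = of_bool (p dD) + j"
    using assms(2) by (auto simp: dgt_def hsol_def dia_def d3_def)
qed

text \<open>A finite check over the seven labels involved. Besides propagating the label it pins
  down the degrees of both ends, which is all that the rest of a tile sees of a diamond.\<close>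

lemma diamond:
  assumes "da = d3 ab ac x" "db = d3 ab bc bd" "dc = d3 ac bc cd" "dd = d3 bd cd y"
    "da \<noteq> db" "da \<noteq> dc" "db \<noteq> dc" "db \<noteq> dd" "dc \<noteq> dd"
  shows "y = x \<and> da = 1 + of_bool x \<and> dd = 1 + of_bool x"
  using assms(5-9) unfolding assms(1-4) d3_def
  by (cases ab; cases ac; cases bc; cases bd; cases cd; cases x; cases y; simp)

text \<open>Diamonds are eliminated by lemma \<open>diamond\<close>, which leaves few labels to
  split on. The symmetry of \<open>h\<close> is used to write each edge in one orientation, so that
  the degree equations at its two ends share a variable.\<close>

lemma trel_of_tile_ok:
  assumes ok: "tile_ok ty h p" and sym: "\<And>k k'. h k k' = h k' k"
  shows "trel ty p"
proof -
  define g where "g = dgt ty h p"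
  have ne: "list_all (\<lambda>(k, k'). g k \<noteq> g k') (tedges ty)" using ok by (simp add: tile_ok_def g_def)
  show ?thesis
  proof (cases ty)
    case TX
    note e = ne[unfolded TX, simplified]
    have r0: "g 0 = d3 (h 0 1) (h 0 2) (p dL)"
      by (simp add: g_def dgt_def TX d3_def ac_simps )
    have r1: "g 1 = d3 (h 0 1) (h 1 2) (h 1 3)"
      by (simp add: g_def dgt_def TX d3_def ac_simps sym[of "Suc 0" 0])
    have r2: "g 2 = d3 (h 0 2) (h 1 2) (h 2 3)"
      by (simp add: g_def dgt_def TX d3_def ac_simps sym[of 2 0] sym[of 2 "Suc 0"])
    have r3: "g 3 = d3 (h 1 3) (h 2 3) (h 3 4)"
      by (simp add: g_def dgt_def TX d3_def ac_simps sym[of 3 "Suc 0"] sym[of 3 2])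
    have r4: "g 4 = d3 (h 3 4) (h 4 5) (p dD)"
      by (simp add: g_def dgt_def TX d3_def ac_simps sym[of 4 3])
    have r5: "g 5 = d3 (h 4 5) (h 5 6) (p dU)"
      by (simp add: g_def dgt_def TX d3_def ac_simps sym[of 5 4])
    have r6: "g 6 = d3 (h 6 7) (h 6 8) (h 5 6)"
      by (simp add: g_def dgt_def TX d3_def ac_simps sym[of 6 5])
    have r7: "g 7 = d3 (h 6 7) (h 7 8) (h 7 9)"
      by (simp add: g_def dgt_def TX d3_def ac_simps sym[of 7 6])
    have r8: "g 8 = d3 (h 6 8) (h 7 8) (h 8 9)"
      by (simp add: g_def dgt_def TX d3_def ac_simps sym[of 8 6] sym[of 8 7])
    have r9: "g 9 = d3 (h 7 9) (h 8 9) (p dR)"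
      by (simp add: g_def dgt_def TX d3_def ac_simps sym[of 9 7] sym[of 9 8])
    have q0: "(h 3 4) = (p dL) \<and> g 0 = 1 + of_bool (p dL) \<and> g 3 = 1 + of_bool (p dL)"
      by (rule diamond[OF r0 r1 r2 r3]) (use e in simp_all)
    have q1: "(p dR) = (h 5 6) \<and> g 6 = 1 + of_bool (h 5 6) \<and> g 9 = 1 + of_bool (h 5 6)"
      by (rule diamond[OF r6 r7 r8 r9]) (use e in simp_all)
    have "g 3 \<noteq> g 4" "g 4 \<noteq> g 5" "g 5 \<noteq> g 6"
      using e by simp_all
    then show ?thesis using q0 q1 unfolding r4 r5 d3_def TX
      by (cases "p dL"; cases "p dR"; cases "h 4 5"; cases "p dD"; cases "p dU"; simp)
  next
    case TA
    note e = ne[unfolded TA, simplified]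
    have r0: "g 0 = d3 (h 0 1) (h 0 2) (h 0 3)"
      by (simp add: g_def dgt_def TA d3_def ac_simps )
    have r1: "g 1 = d3 (h 0 1) (h 1 3) (h 1 4)"
      by (simp add: g_def dgt_def TA d3_def ac_simps sym[of "Suc 0" 0])
    have r2: "g 2 = d3 (h 0 2) (h 2 5) (p dL)"
      by (simp add: g_def dgt_def TA d3_def ac_simps sym[of 2 0])
    have r3: "g 3 = d3 (h 0 3) (h 1 3) (p dU)"
      by (simp add: g_def dgt_def TA d3_def ac_simps sym[of 3 0] sym[of 3 "Suc 0"])
    have r4: "g 4 = d3 (h 1 4) (h 4 5) (p dR)"
      by (simp add: g_def dgt_def TA d3_def ac_simps sym[of 4 "Suc 0"])
    have r5: "g 5 = d3 (h 4 5) (h 2 5) (h 5 6)"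
      by (simp add: g_def dgt_def TA d3_def ac_simps sym[of 5 4] sym[of 5 2])
    have r6: "g 6 = d3 (h 6 7) (h 6 8) (h 5 6)"
      by (simp add: g_def dgt_def TA d3_def ac_simps sym[of 6 5])
    have r7: "g 7 = d3 (h 6 7) (h 7 8) (h 7 9)"
      by (simp add: g_def dgt_def TA d3_def ac_simps sym[of 7 6])
    have r8: "g 8 = d3 (h 6 8) (h 7 8) (h 8 9)"
      by (simp add: g_def dgt_def TA d3_def ac_simps sym[of 8 6] sym[of 8 7])
    have r9: "g 9 = d3 (h 7 9) (h 8 9) (p dD)"
      by (simp add: g_def dgt_def TA d3_def ac_simps sym[of 9 7] sym[of 9 8])
    have q0: "(p dD) = (h 5 6) \<and> g 6 = 1 + of_bool (h 5 6) \<and> g 9 = 1 + of_bool (h 5 6)"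
      by (rule diamond[OF r6 r7 r8 r9]) (use e in simp_all)
    have "g 0 \<noteq> g 1" "g 0 \<noteq> g 2" "g 0 \<noteq> g 3" "g 1 \<noteq> g 3" "g 1 \<noteq> g 4" "g 4 \<noteq> g 5" "g 2 \<noteq> g 5" "g 5 \<noteq> g 6"
      using e by simp_all
    \<comment> \<open>Eleven labels remain. Simplifying after each split discards the inconsistent
      branches before the next label is split.\<close>
    then show ?thesis using q0 unfolding r0 r1 r2 r3 r4 r5 d3_def TA
      by (cases "p dD"; simp?; cases "h 4 5"; simp?; cases "h 2 5"; simp?; cases "h 0 2"; simp?; cases "h 1 4"; simp?; cases "p dL"; simp?; cases "p dR"; simp?; cases "h 0 1"; simp?; cases "h 0 3"; simp?; cases "h 1 3"; simp?; cases "p dU"; simp?)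
  next
    case TS
    note e = ne[unfolded TS, simplified]
    have r0: "g 0 = d3 (h 0 1) (h 0 5) (p dU)"
      by (simp add: g_def dgt_def TS d3_def ac_simps )
    have r1: "g 1 = d3 (h 1 2) (h 1 3) (h 0 1)"
      by (simp add: g_def dgt_def TS d3_def ac_simps sym[of "Suc 0" 0])
    have r2: "g 2 = d3 (h 1 2) (h 2 3) (h 2 4)"
      by (simp add: g_def dgt_def TS d3_def ac_simps sym[of 2 "Suc 0"])
    have r3: "g 3 = d3 (h 1 3) (h 2 3) (h 3 4)"
      by (simp add: g_def dgt_def TS d3_def ac_simps sym[of 3 "Suc 0"] sym[of 3 2])
    have r4: "g 4 = d3 (h 2 4) (h 3 4) (p dD)"
      by (simp add: g_def dgt_def TS d3_def ac_simps sym[of 4 2] sym[of 4 3])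
    have r5: "g 5 = d3 (h 5 6) (h 5 7) (h 0 5)"
      by (simp add: g_def dgt_def TS d3_def ac_simps sym[of 5 0])
    have r6: "g 6 = d3 (h 5 6) (h 6 7) (h 6 8)"
      by (simp add: g_def dgt_def TS d3_def ac_simps sym[of 6 5])
    have r7: "g 7 = d3 (h 5 7) (h 6 7) (h 7 8)"
      by (simp add: g_def dgt_def TS d3_def ac_simps sym[of 7 5] sym[of 7 6])
    have r8: "g 8 = d3 (h 6 8) (h 7 8) (p dR)"
      by (simp add: g_def dgt_def TS d3_def ac_simps sym[of 8 6] sym[of 8 7])
    have q0: "(p dD) = (h 0 1) \<and> g 1 = 1 + of_bool (h 0 1) \<and> g 4 = 1 + of_bool (h 0 1)"
      by (rule diamond[OF r1 r2 r3 r4]) (use e in simp_all)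
    have q1: "(p dR) = (h 0 5) \<and> g 5 = 1 + of_bool (h 0 5) \<and> g 8 = 1 + of_bool (h 0 5)"
      by (rule diamond[OF r5 r6 r7 r8]) (use e in simp_all)
    have "g 0 \<noteq> g 1" "g 0 \<noteq> g 5"
      using e by simp_all
    then show ?thesis using q0 q1 unfolding r0 d3_def TS
      by (cases "p dD"; cases "p dR"; cases "p dU"; simp)
  next
    case TE
    note e = ne[unfolded TE, simplified]
    have r0: "g 0 = d3 (h 0 1) (h 0 5) (p dU)"
      by (simp add: g_def dgt_def TE d3_def ac_simps )
    have r1: "g 1 = d3 (h 1 2) (h 1 3) (h 0 1)"
      by (simp add: g_def dgt_def TE d3_def ac_simps sym[of "Suc 0" 0])
    have r2: "g 2 = d3 (h 1 2) (h 2 3) (h 2 4)"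
      by (simp add: g_def dgt_def TE d3_def ac_simps sym[of 2 "Suc 0"])
    have r3: "g 3 = d3 (h 1 3) (h 2 3) (h 3 4)"
      by (simp add: g_def dgt_def TE d3_def ac_simps sym[of 3 "Suc 0"] sym[of 3 2])
    have r4: "g 4 = d3 (h 2 4) (h 3 4) (p dD)"
      by (simp add: g_def dgt_def TE d3_def ac_simps sym[of 4 2] sym[of 4 3])
    have r5: "g 5 = d3 (h 5 6) (h 5 7) (h 0 5)"
      by (simp add: g_def dgt_def TE d3_def ac_simps sym[of 5 0])
    have r6: "g 6 = d3 (h 5 6) (h 6 7) (h 6 8)"
      by (simp add: g_def dgt_def TE d3_def ac_simps sym[of 6 5])
    have r7: "g 7 = d3 (h 5 7) (h 6 7) (h 7 8)"
      by (simp add: g_def dgt_def TE d3_def ac_simps sym[of 7 5] sym[of 7 6])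
    have r8: "g 8 = d3 (h 6 8) (h 7 8) (p dL)"
      by (simp add: g_def dgt_def TE d3_def ac_simps sym[of 8 6] sym[of 8 7])
    have q0: "(p dD) = (h 0 1) \<and> g 1 = 1 + of_bool (h 0 1) \<and> g 4 = 1 + of_bool (h 0 1)"
      by (rule diamond[OF r1 r2 r3 r4]) (use e in simp_all)
    have q1: "(p dL) = (h 0 5) \<and> g 5 = 1 + of_bool (h 0 5) \<and> g 8 = 1 + of_bool (h 0 5)"
      by (rule diamond[OF r5 r6 r7 r8]) (use e in simp_all)
    have "g 0 \<noteq> g 1" "g 0 \<noteq> g 5"
      using e by simp_all
    then show ?thesis using q0 q1 unfolding r0 d3_def TE
      by (cases "p dD"; cases "p dL"; cases "p dU"; simp)
  next
    case TH
    note e = ne[unfolded TH, simplified]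
    have r0: "g 0 = d3 (h 0 2) (h 0 3) (p dL)"
      by (simp add: g_def dgt_def TH d3_def ac_simps )
    have r1: "g 1 = d3 (h 1 2) (h 1 3) (p dR)"
      by (simp add: g_def dgt_def TH d3_def ac_simps )
    have r2: "g 2 = d3 (h 0 2) (h 1 2) (h 2 4)"
      by (simp add: g_def dgt_def TH d3_def ac_simps sym[of 2 0] sym[of 2 "Suc 0"])
    have r3: "g 3 = d3 (h 0 3) (h 1 3) (h 3 7)"
      by (simp add: g_def dgt_def TH d3_def ac_simps sym[of 3 0] sym[of 3 "Suc 0"])
    have r4: "g 4 = d3 (h 4 5) (h 4 6) (h 2 4)"
      by (simp add: g_def dgt_def TH d3_def ac_simps sym[of 4 2])
    have r5: "g 5 = d3 (h 4 5) (h 5 6) (h 5 7)"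
      by (simp add: g_def dgt_def TH d3_def ac_simps sym[of 5 4])
    have r6: "g 6 = d3 (h 4 6) (h 5 6) (h 6 7)"
      by (simp add: g_def dgt_def TH d3_def ac_simps sym[of 6 4] sym[of 6 5])
    have r7: "g 7 = d3 (h 5 7) (h 6 7) (h 3 7)"
      by (simp add: g_def dgt_def TH d3_def ac_simps sym[of 7 3] sym[of 7 5] sym[of 7 6])
    have q0: "(h 3 7) = (h 2 4) \<and> g 4 = 1 + of_bool (h 2 4) \<and> g 7 = 1 + of_bool (h 2 4)"
      by (rule diamond[OF r4 r5 r6 r7]) (use e in simp_all)
    have "g 0 \<noteq> g 2" "g 0 \<noteq> g 3" "g 1 \<noteq> g 2" "g 1 \<noteq> g 3" "g 2 \<noteq> g 4" "g 3 \<noteq> g 7"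
      using e by simp_all
    then show ?thesis using q0 unfolding r0 r1 r2 r3 d3_def TH
      by (cases "h 2 4"; simp?; cases "h 0 2"; simp?; cases "h 1 2"; simp?; cases "h 0 3"; simp?; cases "h 1 3"; simp?; cases "p dL"; simp?; cases "p dR"; simp?)
  next
    case TV
    note e = ne[unfolded TV, simplified]
    have r0: "g 0 = d3 (h 0 2) (h 0 3) (p dD)"
      by (simp add: g_def dgt_def TV d3_def ac_simps )
    have r1: "g 1 = d3 (h 1 2) (h 1 3) (p dU)"
      by (simp add: g_def dgt_def TV d3_def ac_simps )
    have r2: "g 2 = d3 (h 0 2) (h 1 2) (h 2 4)"
      by (simp add: g_def dgt_def TV d3_def ac_simps sym[of 2 0] sym[of 2 "Suc 0"])
    have r3: "g 3 = d3 (h 0 3) (h 1 3) (h 3 7)"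
      by (simp add: g_def dgt_def TV d3_def ac_simps sym[of 3 0] sym[of 3 "Suc 0"])
    have r4: "g 4 = d3 (h 4 5) (h 4 6) (h 2 4)"
      by (simp add: g_def dgt_def TV d3_def ac_simps sym[of 4 2])
    have r5: "g 5 = d3 (h 4 5) (h 5 6) (h 5 7)"
      by (simp add: g_def dgt_def TV d3_def ac_simps sym[of 5 4])
    have r6: "g 6 = d3 (h 4 6) (h 5 6) (h 6 7)"
      by (simp add: g_def dgt_def TV d3_def ac_simps sym[of 6 4] sym[of 6 5])
    have r7: "g 7 = d3 (h 5 7) (h 6 7) (h 3 7)"
      by (simp add: g_def dgt_def TV d3_def ac_simps sym[of 7 3] sym[of 7 5] sym[of 7 6])
    have q0: "(h 3 7) = (h 2 4) \<and> g 4 = 1 + of_bool (h 2 4) \<and> g 7 = 1 + of_bool (h 2 4)"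
      by (rule diamond[OF r4 r5 r6 r7]) (use e in simp_all)
    have "g 0 \<noteq> g 2" "g 0 \<noteq> g 3" "g 1 \<noteq> g 2" "g 1 \<noteq> g 3" "g 2 \<noteq> g 4" "g 3 \<noteq> g 7"
      using e by simp_all
    then show ?thesis using q0 unfolding r0 r1 r2 r3 d3_def TV
      by (cases "h 2 4"; simp?; cases "h 0 2"; simp?; cases "h 1 2"; simp?; cases "h 0 3"; simp?; cases "h 1 3"; simp?; cases "p dD"; simp?; cases "p dU"; simp?)
  qed simp_all
qed

section \<open>Labellings by 1 and 2 as subgraphs\<close>

definition edges_of :: "('a \<Rightarrow> 'a \<Rightarrow> bool) \<Rightarrow> 'a set set" where
  "edges_of A = {{u, v} | u v. A u v}"

lemma edges_of_incident:
  assumes "\<And>u v. A u v \<Longrightarrow> A v u" "\<And>u. \<not> A u u"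
  shows "{e \<in> edges_of A. u \<in> e} = (\<lambda>v. {u, v}) ` {v. A u v}" "inj_on (\<lambda>v. {u, v}) {v. A u v}"
proof -
  show "{e \<in> edges_of A. u \<in> e} = (\<lambda>v. {u, v}) ` {v. A u v}"
    using assms(1) by (auto simp: edges_of_def insert_commute)
  show "inj_on (\<lambda>v. {u, v}) {v. A u v}" by (auto simp: inj_on_def doubleton_eq_iff)
qed

lemma card_edges_of:
  assumes "\<And>u. \<not> A u u" "e \<in> edges_of A"
  shows "card e = 2"
proof -
  obtain u v where e: "e = {u, v}" "A u v" using assms(2) by (auto simp: edges_of_def)
  then have "u \<noteq> v" using assms(1) by auto
  then show ?thesis using e(1) by simp
qed

lemma edges_of_pair:
  assumes "\<And>u v. A u v \<Longrightarrow> A v u"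
  shows "{u, v} \<in> edges_of A \<longleftrightarrow> A u v"
  using assms by (auto simp: edges_of_def doubleton_eq_iff)

text \<open>Let \<open>H\<close> mark the edges with label 2. The product at a vertex is 2 to the
  number of marked edges there, and powers of 2 differ exactly when the exponents do. Off the edges
  \<open>H\<close> is arbitrary, since degrees are counted in the intersection of \<open>A\<close>
  and \<open>H\<close>.\<close>

lemma labeling_iff_subgraph:
  assumes sym: "\<And>u v. A u v \<Longrightarrow> A v u" and irr: "\<And>u. \<not> A u u" and fin: "\<And>u. finite {v. A u v}"
  shows "(\<exists>f. edge_labeling_by_product 2 (edges_of A) f) \<longleftrightarrow>
    (\<exists>H. (\<forall>u v. H u v = H v u) \<and>
      (\<forall>u v. A u v \<longrightarrow> card {w. A u w \<and> H u w} \<noteq> card {w. A v w \<and> H v w}))"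
proof -
  have inc: "{e \<in> edges_of A. u \<in> e} = (\<lambda>v. {u, v}) ` {v. A u v}" "inj_on (\<lambda>v. {u, v}) {v. A u v}" for u
    by (rule edges_of_incident; use sym irr in blast)+
  have prod: "(\<Prod>e\<in>{e \<in> edges_of A. u \<in> e}. f e) = 2 ^ card {w. A u w \<and> f {u, w} = 2}"
    if f: "f \<in> edges_of A \<rightarrow> {1..2::nat}" for f u
  proof -
    have "(\<Prod>e\<in>{e \<in> edges_of A. u \<in> e}. f e) = (\<Prod>v\<in>{v. A u v}. f {u, v})"
      unfolding inc(1) by (subst prod.reindex[OF inc(2)]) (simp_all add: o_def)
    also have "\<dots> = (\<Prod>v\<in>{v. A u v}. if f {u, v} = 2 then 2 else 1)"
    proof (rule prod.cong[OF refl])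
      fix v assume "v \<in> {v. A u v}"
      then have "{u, v} \<in> edges_of A" by (auto simp: edges_of_def)
      then have "f {u, v} \<in> {1..2}" using f by blast
      then show "f {u, v} = (if f {u, v} = 2 then 2 else 1)" by auto
    qed
    also have "\<dots> = (\<Prod>v\<in>{v. A u v \<and> f {u, v} = 2}. 2)"
      by (subst prod.inter_filter[symmetric]) (use fin in \<open>auto intro!: arg_cong[where f = "\<lambda>S. prod _ S"]\<close>)
    finally show ?thesis by simp
  qed
  show ?thesis
  proof
    assume "\<exists>f. edge_labeling_by_product 2 (edges_of A) f"
    then obtain f where f: "f \<in> edges_of A \<rightarrow> {1..2}"
      "proper_coloring (edges_of A) (\<lambda>v. \<Prod>e\<in>{e \<in> edges_of A. v \<in> e}. f e)"
      unfolding edge_labeling_by_product_def by blast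
    define H where "H u v \<longleftrightarrow> f {u, v} = 2" for u v
    have "H u v = H v u" for u v by (simp add: H_def insert_commute)
    moreover have "card {w. A u w \<and> H u w} \<noteq> card {w. A v w \<and> H v w}" if "A u v" for u v
    proof -
      have "{u, v} \<in> edges_of A" using that by (auto simp: edges_of_def)
      then show ?thesis using f(2) unfolding proper_coloring_def prod[OF f(1)] H_def by auto
    qed
    ultimately show "\<exists>H. (\<forall>u v. H u v = H v u) \<and>
      (\<forall>u v. A u v \<longrightarrow> card {w. A u w \<and> H u w} \<noteq> card {w. A v w \<and> H v w})" by blast
  next
    assume "\<exists>H. (\<forall>u v. H u v = H v u) \<and>
      (\<forall>u v. A u v \<longrightarrow> card {w. A u w \<and> H u w} \<noteq> card {w. A v w \<and> H v w})"
    then obtain H where H: "\<And>u v. H u v = H v u"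
      "\<And>u v. A u v \<Longrightarrow> card {w. A u w \<and> H u w} \<noteq> card {w. A v w \<and> H v w}" by blast
    define f where "f e = (if \<exists>u v. e = {u, v} \<and> H u v then 2 else 1::nat)" for e
    have f2: "f {u, v} = 2 \<longleftrightarrow> H u v" for u v
      using H(1) by (auto simp: f_def doubleton_eq_iff)
    have f: "f \<in> edges_of A \<rightarrow> {1..2}" by (auto simp: f_def)
    have "edge_labeling_by_product 2 (edges_of A) f"
      unfolding edge_labeling_by_product_def proper_coloring_def prod[OF f] f2
      using f H(2) by (auto simp: edges_of_pair[of A, OF sym])
    then show "\<exists>f. edge_labeling_by_product 2 (edges_of A) f" by blast
  qed
qed

section \<open>Gluing tiles: regularity and 3-coloring\<close>

definition hasp :: "ty \<Rightarrow> dir \<Rightarrow> bool" where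
  "hasp ty d \<longleftrightarrow> list_ex (\<lambda>ts. Po d \<in> set ts) (tab ty)"

definition lnk :: "ty \<Rightarrow> bool" where
  "lnk ty \<longleftrightarrow> ty = TH \<or> ty = TV"

text \<open>The vertex carrying port \<open>d\<close>, which is unique by \<open>chk\<close>. For an
  absent port the value is the number of vertices, hence not a vertex of the tile.\<close>

definition pk :: "ty \<Rightarrow> dir \<Rightarrow> nat" where
  "pk ty d = length (takeWhile (\<lambda>ts. Po d \<notin> set ts) (tab ty))"

text \<open>Everything about the tables that gluing relies on, in executable form: three distinct
  targets per vertex, symmetry, agreement of \<open>tab\<close> and \<open>tedges\<close>, a proper
  coloring inside, one vertex per port, color 1 at ports exactly in links, and port vertices of
  links among 0 and 1, the two vertices treated in \<open>link_port_degree\<close>.\<close>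

definition chk :: "ty \<Rightarrow> bool" where
  "chk ty \<longleftrightarrow> length (tcol ty) = length (tab ty) \<and> length (crd ty) = length (tab ty) \<and>
    list_all (\<lambda>k. length (tab ty ! k) = 3 \<and> distinct (tab ty ! k) \<and> tcol ty ! k \<in> {1, 2, 3} \<and>
     list_all (\<lambda>t. case t of
        In k' \<Rightarrow> k' < length (tab ty) \<and> k' \<noteq> k \<and> In k \<in> set (tab ty ! k') \<and>
          ((k, k') \<in> set (tedges ty) \<or> (k', k) \<in> set (tedges ty)) \<and> tcol ty ! k \<noteq> tcol ty ! k'
      | Po d \<Rightarrow> k = pk ty d \<and> (tcol ty ! k = 1 \<longleftrightarrow> lnk ty) \<and> (lnk ty \<longrightarrow> k \<le> 1)) (tab ty ! k)) [0..<length (tab ty)] \<and>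
    list_all (\<lambda>(k, k'). k < length (tab ty) \<and> In k' \<in> set (tab ty ! k)) (tedges ty)"

lemma chk: "chk ty"
  by (cases ty; simp only:; code_simp)

lemma tab_len: "k < length (tab ty) \<Longrightarrow> length (tab ty ! k) = 3 \<and> distinct (tab ty ! k) \<and> tcol ty ! k \<in> {1, 2, 3}"
  using chk[of ty] unfolding chk_def list_all_iff by auto

lemma tab_In: "k < length (tab ty) \<Longrightarrow> In k' \<in> set (tab ty ! k) \<Longrightarrow> k' < length (tab ty) \<and> k' \<noteq> k \<and>
   In k \<in> set (tab ty ! k') \<and> ((k, k') \<in> set (tedges ty) \<or> (k', k) \<in> set (tedges ty)) \<and> tcol ty ! k \<noteq> tcol ty ! k'"
  using chk[of ty] unfolding chk_def list_all_iff by fastforce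

lemma tab_Po: "k < length (tab ty) \<Longrightarrow> Po d \<in> set (tab ty ! k) \<Longrightarrow>
   k = pk ty d \<and> (tcol ty ! k = 1 \<longleftrightarrow> lnk ty) \<and> (lnk ty \<longrightarrow> k \<le> 1)"
  using chk[of ty] unfolding chk_def list_all_iff by fastforce

lemma tedges_tab: "(k, k') \<in> set (tedges ty) \<Longrightarrow> k < length (tab ty) \<and> In k' \<in> set (tab ty ! k)"
  using chk[of ty] unfolding chk_def list_all_iff by fastforce

lemma tab_crd: "length (crd ty) = length (tab ty)"
  using chk[of ty] unfolding chk_def by auto

lemma hasp_iff: "hasp ty d \<longleftrightarrow> (\<exists>k<length (tab ty). Po d \<in> set (tab ty ! k))"
  unfolding hasp_def list_ex_iff by (metis in_set_conv_nth)

lemma hasp_pk: "hasp ty d \<Longrightarrow> pk ty d < length (tab ty) \<and> Po d \<in> set (tab ty ! pk ty d)"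
  unfolding hasp_iff using tab_Po by blast

lemma hasp_I: "k < length (tab ty) \<Longrightarrow> Po d \<in> set (tab ty ! k) \<Longrightarrow> hasp ty d"
  unfolding hasp_iff by blast

lemma lnk_port: "lnk ty \<Longrightarrow> hasp ty dR \<or> hasp ty dL \<Longrightarrow> ty = TH" "lnk ty \<Longrightarrow> hasp ty dU \<or> hasp ty dD \<Longrightarrow> ty = TV"
  by (auto simp: lnk_def hasp_def)

type_synonym vertex = "nat \<times> nat \<times> nat"

fun isv :: "(nat \<Rightarrow> nat \<Rightarrow> ty) \<Rightarrow> vertex \<Rightarrow> bool" where
  "isv \<tau> (I, J, k) \<longleftrightarrow> k < length (tab (\<tau> I J))"

fun tgs :: "(nat \<Rightarrow> nat \<Rightarrow> ty) \<Rightarrow> vertex \<Rightarrow> tgt list" where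
  "tgs \<tau> (I, J, k) = tab (\<tau> I J) ! k"

fun adjT :: "(nat \<Rightarrow> nat \<Rightarrow> ty) \<Rightarrow> vertex \<Rightarrow> vertex \<Rightarrow> bool" where
  "adjT \<tau> (I, J, k) (I', J', k') \<longleftrightarrow> isv \<tau> (I, J, k) \<and> isv \<tau> (I', J', k') \<and>
    (I' = I \<and> J' = J \<and> In k' \<in> set (tgs \<tau> (I, J, k)) \<or>
     I' = I \<and> J' = Suc J \<and> Po dR \<in> set (tgs \<tau> (I, J, k)) \<and> Po dL \<in> set (tgs \<tau> (I', J', k')) \<or>
     I' = I \<and> J = Suc J' \<and> Po dL \<in> set (tgs \<tau> (I, J, k)) \<and> Po dR \<in> set (tgs \<tau> (I', J', k')) \<or>
     I' = Suc I \<and> J' = J \<and> Po dU \<in> set (tgs \<tau> (I, J, k)) \<and> Po dD \<in> set (tgs \<tau> (I', J', k')) \<or>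
     I = Suc I' \<and> J' = J \<and> Po dD \<in> set (tgs \<tau> (I, J, k)) \<and> Po dU \<in> set (tgs \<tau> (I', J', k')))"

text \<open>The other end of an edge. In row or column 0 the truncated subtraction would give a
  wrong tile, but the locale \<open>tiling\<close> forbids ports \<open>dD\<close> and
  \<open>dL\<close> there.\<close>

fun nb :: "(nat \<Rightarrow> nat \<Rightarrow> ty) \<Rightarrow> vertex \<Rightarrow> tgt \<Rightarrow> vertex" where
  "nb \<tau> (I, J, k) (In k') = (I, J, k')"
| "nb \<tau> (I, J, k) (Po dR) = (I, Suc J, pk (\<tau> I (Suc J)) dL)"
| "nb \<tau> (I, J, k) (Po dL) = (I, J - 1, pk (\<tau> I (J - 1)) dR)"
| "nb \<tau> (I, J, k) (Po dU) = (Suc I, J, pk (\<tau> (Suc I) J) dD)"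
| "nb \<tau> (I, J, k) (Po dD) = (I - 1, J, pk (\<tau> (I - 1) J) dU)"

text \<open>By \<open>alt_right\<close> and \<open>alt_up\<close> every port edge joins a link and a
  tile that is not a link. Both the coloring and the repair of degrees across tile borders rest on
  this alternation.\<close>

locale tiling =
  fixes \<tau> :: "nat \<Rightarrow> nat \<Rightarrow> ty"
  assumes right: "hasp (\<tau> I J) dR \<longleftrightarrow> hasp (\<tau> I (Suc J)) dL"
    and up: "hasp (\<tau> I J) dU \<longleftrightarrow> hasp (\<tau> (Suc I) J) dD"
    and left0: "\<not> hasp (\<tau> I 0) dL" and down0: "\<not> hasp (\<tau> 0 J) dD"
    and alt_right: "hasp (\<tau> I J) dR \<Longrightarrow> lnk (\<tau> I J) \<noteq> lnk (\<tau> I (Suc J))"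
    and alt_up: "hasp (\<tau> I J) dU \<Longrightarrow> lnk (\<tau> I J) \<noteq> lnk (\<tau> (Suc I) J)"
    and fin: "finite {(I, J). \<tau> I J \<noteq> TN}"
begin

lemma adj_sym: "adjT \<tau> u v \<Longrightarrow> adjT \<tau> v u"
  by (cases u; cases v) (use tab_In in auto)

lemma adj_irrefl: "\<not> adjT \<tau> u u"
  by (cases u) (use tab_In in auto)

lemma adj_isv: "adjT \<tau> u v \<Longrightarrow> isv \<tau> u \<and> isv \<tau> v"
  by (cases u; cases v) simp

lemma adj_iff_nb:
  assumes "isv \<tau> u"
  shows "adjT \<tau> u v \<longleftrightarrow> (\<exists>t\<in>set (tgs \<tau> u). v = nb \<tau> u t)"
proof -
  obtain I J k where u: "u = (I, J, k)" by (cases u)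
  obtain I' J' k' where v: "v = (I', J', k')" by (cases v)
  have k: "k < length (tab (\<tau> I J))" using assms u by simp
  have ports: "Po dR \<in> set (tab (\<tau> I J) ! k) \<Longrightarrow> hasp (\<tau> I (Suc J)) dL"
    "Po dL \<in> set (tab (\<tau> I J) ! k) \<Longrightarrow> J > 0 \<and> hasp (\<tau> I (J - 1)) dR"
    "Po dU \<in> set (tab (\<tau> I J) ! k) \<Longrightarrow> hasp (\<tau> (Suc I) J) dD"
    "Po dD \<in> set (tab (\<tau> I J) ! k) \<Longrightarrow> I > 0 \<and> hasp (\<tau> (I - 1) J) dU"
  proof -
    show "hasp (\<tau> I (Suc J)) dL" if "Po dR \<in> set (tab (\<tau> I J) ! k)" using hasp_I[OF k that] right by blast
    show "J > 0 \<and> hasp (\<tau> I (J - 1)) dR" if "Po dL \<in> set (tab (\<tau> I J) ! k)"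
      using hasp_I[OF k that] right[of I "J - 1"] left0[of I] by (cases J) auto
    show "hasp (\<tau> (Suc I) J) dD" if "Po dU \<in> set (tab (\<tau> I J) ! k)" using hasp_I[OF k that] up by blast
    show "I > 0 \<and> hasp (\<tau> (I - 1) J) dU" if "Po dD \<in> set (tab (\<tau> I J) ! k)"
      using hasp_I[OF k that] up[of "I - 1" J] down0[of J] by (cases I) auto
  qed
  show ?thesis
  proof
    assume "adjT \<tau> u v"
    then have k': "k' < length (tab (\<tau> I' J'))" and d:
     "I' = I \<and> J' = J \<and> In k' \<in> set (tgs \<tau> u) \<or>
      I' = I \<and> J' = Suc J \<and> Po dR \<in> set (tgs \<tau> u) \<and> Po dL \<in> set (tgs \<tau> v) \<or>
      I' = I \<and> J = Suc J' \<and> Po dL \<in> set (tgs \<tau> u) \<and> Po dR \<in> set (tgs \<tau> v) \<or>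
      I' = Suc I \<and> J' = J \<and> Po dU \<in> set (tgs \<tau> u) \<and> Po dD \<in> set (tgs \<tau> v) \<or>
      I = Suc I' \<and> J' = J \<and> Po dD \<in> set (tgs \<tau> u) \<and> Po dU \<in> set (tgs \<tau> v)"
      by (auto simp: u v)
    have pk: "Po d \<in> set (tgs \<tau> v) \<Longrightarrow> k' = pk (\<tau> I' J') d" for d using tab_Po[OF k'] by (simp add: v)
    from d show "\<exists>t\<in>set (tgs \<tau> u). v = nb \<tau> u t"
    proof (elim disjE conjE)
      assume "I' = I" "J' = J" "In k' \<in> set (tgs \<tau> u)"
      then show ?thesis by (intro bexI[of _ "In k'"]) (simp_all add: u v)
    next
      assume "I' = I" "J' = Suc J" "Po dR \<in> set (tgs \<tau> u)" "Po dL \<in> set (tgs \<tau> v)"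
      then show ?thesis using pk[of dL] by (intro bexI[of _ "Po dR"]) (simp_all add: u v)
    next
      assume "I' = I" "J = Suc J'" "Po dL \<in> set (tgs \<tau> u)" "Po dR \<in> set (tgs \<tau> v)"
      then show ?thesis using pk[of dR] by (intro bexI[of _ "Po dL"]) (simp_all add: u v)
    next
      assume "I' = Suc I" "J' = J" "Po dU \<in> set (tgs \<tau> u)" "Po dD \<in> set (tgs \<tau> v)"
      then show ?thesis using pk[of dD] by (intro bexI[of _ "Po dU"]) (simp_all add: u v)
    next
      assume "I = Suc I'" "J' = J" "Po dD \<in> set (tgs \<tau> u)" "Po dU \<in> set (tgs \<tau> v)"
      then show ?thesis using pk[of dU] by (intro bexI[of _ "Po dD"]) (simp_all add: u v)
    qed
  next
    assume "\<exists>t\<in>set (tgs \<tau> u). v = nb \<tau> u t"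
    then obtain t where t: "t \<in> set (tab (\<tau> I J) ! k)" "v = nb \<tau> u t" by (auto simp: u)
    show "adjT \<tau> u v"
    proof (cases t)
      case (In l)
      then show ?thesis using t tab_In[OF k] k by (auto simp: u)
    next
      case (Po d)
      then show ?thesis
        using t k ports hasp_pk by (cases d) (auto simp: u)
    qed
  qed
qed

text \<open>Targets that lead to different tiles are separated by the tile indices, which
  \<open>shift\<close> classifies; this needs that indices are positive where 1 is subtracted. Two
  inner targets are separated by the vertex number.\<close>

lemma nb_inj:
  assumes "isv \<tau> u"
  shows "inj_on (nb \<tau> u) (set (tgs \<tau> u))"
proof -
  obtain I J k where u: "u = (I, J, k)" by (cases u)
  have k: "k < length (tab (\<tau> I J))" using assms u by simp
  have pos: "Po dL \<in> set (tab (\<tau> I J) ! k) \<Longrightarrow> J > 0" "Po dD \<in> set (tab (\<tau> I J) ! k) \<Longrightarrow> I > 0"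
    using hasp_I[OF k] left0 down0 by (metis gr0I)+
  define shift where "shift = case_tgt (\<lambda>_. 0) (case_dir (2::nat) 1 4 3)"
  show ?thesis
  proof (rule inj_onI)
    fix s t assume st: "s \<in> set (tgs \<tau> u)" "t \<in> set (tgs \<tau> u)" "nb \<tau> u s = nb \<tau> u t"
    have loc: "fst (nb \<tau> u r) = (if shift r = 3 then Suc I else if shift r = 4 then I - 1 else I) \<and>
      fst (snd (nb \<tau> u r)) = (if shift r = 1 then Suc J else if shift r = 2 then J - 1 else J) \<and>
      (shift r = 2 \<longrightarrow> J > 0) \<and> (shift r = 4 \<longrightarrow> I > 0) \<and> shift r \<le> 4" if "r \<in> set (tgs \<tau> u)" for r
      using that pos by (cases r rule: tgt.exhaust) (auto simp: u shift_def split: dir.splits)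
    have "shift s = shift t"
      using loc[OF st(1)] loc[OF st(2)] st(3) by (auto split: if_splits)
    then show "s = t"
      using st(3) by (cases s; cases t) (auto simp: u shift_def split: dir.splits)
  qed
qed

lemma neighbours: "isv \<tau> u \<Longrightarrow> {v. adjT \<tau> u v} = nb \<tau> u ` set (tgs \<tau> u)"
  using adj_iff_nb by auto

lemma finite_neighbours: "finite {v. adjT \<tau> u v}"
proof (cases "isv \<tau> u")
  case False
  then have "{v. adjT \<tau> u v} = {}" using adj_isv by blast
  then show ?thesis by (metis finite.emptyI)
qed (simp add: neighbours)

lemma card_neighbours: "isv \<tau> u \<Longrightarrow> card {v. adjT \<tau> u v} = 3"
  using neighbours nb_inj tab_len by (cases u) (auto simp: card_image distinct_card)

text \<open>By \<open>nb_inj\<close>, counting neighbours amounts to counting targets, so the degree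
  computed from the table of a single tile is the degree in the glued graph.\<close>

lemma degree_in_subgraph:
  assumes "isv \<tau> (I, J, k)" "\<And>t. t \<in> set (tab (\<tau> I J) ! k) \<Longrightarrow> H (I, J, k) (nb \<tau> (I, J, k) t) = tlab h p k t"
  shows "card {w. adjT \<tau> (I, J, k) w \<and> H (I, J, k) w} = dgt (\<tau> I J) h p k"
proof -
  let ?u = "(I, J, k)"
  have k: "k < length (tab (\<tau> I J))" using assms(1) by simp
  then obtain a b c where abc: "tab (\<tau> I J) ! k = [a, b, c]" "distinct [a, b, c]"
    using tab_len[OF k] by (auto simp: length_Suc_conv numeral_3_eq_3)
  have "{w. adjT \<tau> ?u w \<and> H ?u w} = nb \<tau> ?u ` {t \<in> set (tgs \<tau> ?u). tlab h p k t}"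
    using adj_iff_nb[OF assms(1)] assms(2) by auto
  also have "card \<dots> = card {t \<in> set (tgs \<tau> ?u). tlab h p k t}"
    by (rule card_image, rule inj_on_subset[OF nb_inj[OF assms(1)]]) auto
  also have "{t \<in> set (tgs \<tau> ?u). tlab h p k t} = (if tlab h p k a then {a} else {}) \<union>
      (if tlab h p k b then {b} else {}) \<union> (if tlab h p k c then {c} else {})"
    using abc by auto
  also have "card \<dots> = d3 (tlab h p k a) (tlab h p k b) (tlab h p k c)"
    using abc(2) by (auto simp: d3_def)
  finally show ?thesis using abc by (simp add: dgt_def)
qed

lemma simple_graph_tiling: "simple_graph {u. isv \<tau> u} (edges_of (adjT \<tau>))"
proof -
  have "{u. isv \<tau> u} \<subseteq> (\<Union>(I, J)\<in>{(I, J). \<tau> I J \<noteq> TN}. (\<lambda>k. (I, J, k)) ` {..<length (tab (\<tau> I J))})"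
  proof
    fix u assume "u \<in> {u. isv \<tau> u}"
    then obtain I J k where u: "u = (I, J, k)" "k < length (tab (\<tau> I J))" by (cases u) auto
    then have "\<tau> I J \<noteq> TN" by auto
    then show "u \<in> (\<Union>(I, J)\<in>{(I, J). \<tau> I J \<noteq> TN}. (\<lambda>k. (I, J, k)) ` {..<length (tab (\<tau> I J))})"
      using u by auto
  qed
  then have "finite {u. isv \<tau> u}" by (rule finite_subset) (use fin in auto)
  moreover have "card e = 2" if "e \<in> edges_of (adjT \<tau>)" for e
    using card_edges_of[OF adj_irrefl that] .
  ultimately show ?thesis
    using adj_isv unfolding simple_graph_def edges_of_def by blast
qed

lemma regular_tiling: "regular 3 {u. isv \<tau> u} (edges_of (adjT \<tau>))"
  unfolding regular_def
  by (auto simp: edges_of_incident[of "adjT \<tau>", OF adj_sym adj_irrefl] card_image card_neighbours)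

text \<open>The colors of the tiles fit together without change: a port edge has color 1 at its end
  in the link and color 2 or 3 at the other end.\<close>

lemma colorable_tiling: "colorable 3 {u. isv \<tau> u} (edges_of (adjT \<tau>))"
proof -
  define c where "c u = (case u of (I, J, k) \<Rightarrow> tcol (\<tau> I J) ! k)" for u
  have "c u \<in> {1..3}" if "isv \<tau> u" for u
  proof -
    obtain I J k where u: "u = (I, J, k)" by (cases u)
    then have "c u \<in> {1, 2, 3}" using tab_len[of k "\<tau> I J"] that by (simp add: c_def)
    then show ?thesis by auto
  qed
  moreover have "c u \<noteq> c v" if "adjT \<tau> u v" for u v
  proof -
    obtain I J k where u: "u = (I, J, k)" by (cases u)
    obtain I' J' k' where v: "v = (I', J', k')" by (cases v)
    have k: "k < length (tab (\<tau> I J))" "k' < length (tab (\<tau> I' J'))" using adj_isv[OF that] u v by auto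
    note po = tab_Po[OF k(1)] tab_Po[OF k(2)] hasp_I[OF k(1)] hasp_I[OF k(2)]
    from that have d: "I' = I \<and> J' = J \<and> In k' \<in> set (tab (\<tau> I J) ! k) \<or>
      I' = I \<and> J' = Suc J \<and> Po dR \<in> set (tab (\<tau> I J) ! k) \<and> Po dL \<in> set (tab (\<tau> I' J') ! k') \<or>
      I' = I \<and> J = Suc J' \<and> Po dL \<in> set (tab (\<tau> I J) ! k) \<and> Po dR \<in> set (tab (\<tau> I' J') ! k') \<or>
      I' = Suc I \<and> J' = J \<and> Po dU \<in> set (tab (\<tau> I J) ! k) \<and> Po dD \<in> set (tab (\<tau> I' J') ! k') \<or>
      I = Suc I' \<and> J' = J \<and> Po dD \<in> set (tab (\<tau> I J) ! k) \<and> Po dU \<in> set (tab (\<tau> I' J') ! k')"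
      by (auto simp: u v)
    then show ?thesis
    proof (elim disjE conjE)
      assume "I' = I" "J' = J" "In k' \<in> set (tab (\<tau> I J) ! k)"
      then show ?thesis using tab_In[OF k(1)] by (simp add: c_def u v)
    next
      assume a: "I' = I" "J' = Suc J" "Po dR \<in> set (tab (\<tau> I J) ! k)" "Po dL \<in> set (tab (\<tau> I' J') ! k')"
      then have "lnk (\<tau> I J) \<noteq> lnk (\<tau> I' J')" using alt_right[OF po(3)] by simp
      then show ?thesis using po(1)[OF a(3)] po(2)[OF a(4)] by (auto simp: c_def u v)
    next
      assume a: "I' = I" "J = Suc J'" "Po dL \<in> set (tab (\<tau> I J) ! k)" "Po dR \<in> set (tab (\<tau> I' J') ! k')"
      then have "lnk (\<tau> I J) \<noteq> lnk (\<tau> I' J')" using alt_right[OF po(4)] by auto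
      then show ?thesis using po(1)[OF a(3)] po(2)[OF a(4)] by (auto simp: c_def u v)
    next
      assume a: "I' = Suc I" "J' = J" "Po dU \<in> set (tab (\<tau> I J) ! k)" "Po dD \<in> set (tab (\<tau> I' J') ! k')"
      then have "lnk (\<tau> I J) \<noteq> lnk (\<tau> I' J')" using alt_up[OF po(3)] by simp
      then show ?thesis using po(1)[OF a(3)] po(2)[OF a(4)] by (auto simp: c_def u v)
    next
      assume a: "I = Suc I'" "J' = J" "Po dD \<in> set (tab (\<tau> I J) ! k)" "Po dU \<in> set (tab (\<tau> I' J') ! k')"
      then have "lnk (\<tau> I J) \<noteq> lnk (\<tau> I' J')" using alt_up[OF po(4)] by auto
      then show ?thesis using po(1)[OF a(3)] po(2)[OF a(4)] by (auto simp: c_def u v)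
    qed
  qed
  ultimately show ?thesis
    unfolding colorable_def proper_coloring_def
    by (intro bexI[of _ c]) (auto simp: edges_of_pair[of "adjT \<tau>", OF adj_sym])
qed

end

section \<open>Labellings of the glued graph and port assignments\<close>

definition avoid :: "nat \<Rightarrow> nat \<Rightarrow> nat \<Rightarrow> nat" where
  "avoid l a b = (SOME j. j \<le> 2 \<and> l + j \<noteq> a \<and> l + j \<noteq> b)"

text \<open>Three shifts against two forbidden degrees: the two ports of a link face two other
  tiles, and this is why the range of \<open>j\<close> has size three.\<close>

lemma avoid: "avoid l a b \<le> 2 \<and> l + avoid l a b \<noteq> a \<and> l + avoid l a b \<noteq> b"
proof -
  have "\<exists>j. j \<le> 2 \<and> l + j \<noteq> a \<and> l + j \<noteq> b"
  proof (rule ccontr)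
    assume "\<not> ?thesis"
    then have "l + 0 = a \<or> l + 0 = b" "l + 1 = a \<or> l + 1 = b" "l + 2 = a \<or> l + 2 = b"
      by (meson le0 one_le_numeral order_refl)+
    then show False by auto
  qed
  then show ?thesis unfolding avoid_def by (rule someI_ex)
qed

context tiling
begin

definition port_assignment :: "(nat \<Rightarrow> nat \<Rightarrow> dir \<Rightarrow> bool) \<Rightarrow> bool" where
  "port_assignment p \<longleftrightarrow> (\<forall>I J. trel (\<tau> I J) (p I J)) \<and>
    (\<forall>I J. hasp (\<tau> I J) dR \<longrightarrow> p I J dR = p I (Suc J) dL) \<and>
    (\<forall>I J. hasp (\<tau> I J) dU \<longrightarrow> p I J dU = p (Suc I) J dD)"

text \<open>All edges of a tile are edges of the glued graph, so a labelling restricts to a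
  \<open>tile_ok\<close> labelling of each tile. At an absent port \<open>p\<close> has a
  meaningless value, which \<open>tile_ok\<close> never reads.\<close>

lemma port_assignment_of_labeling:
  assumes sym: "\<And>u v. H u v = H v u"
    and ne: "\<And>u v. adjT \<tau> u v \<Longrightarrow> card {w. adjT \<tau> u w \<and> H u w} \<noteq> card {w. adjT \<tau> v w \<and> H v w}"
  shows "\<exists>p. port_assignment p"
proof -
  define p where "p I J d = H (I, J, pk (\<tau> I J) d) (nb \<tau> (I, J, pk (\<tau> I J) d) (Po d))" for I J d
  define h where "h I J k k' = H (I, J, k) (I, J, k')" for I J k k'
  have deg: "card {w. adjT \<tau> (I, J, k) w \<and> H (I, J, k) w} = dgt (\<tau> I J) (h I J) (p I J) k"
    if "k < length (tab (\<tau> I J))" for I J k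
  proof (rule degree_in_subgraph)
    fix t assume t: "t \<in> set (tab (\<tau> I J) ! k)"
    show "H (I, J, k) (nb \<tau> (I, J, k) t) = tlab (h I J) (p I J) k t"
    proof (cases t)
      case (Po d)
      then have "k = pk (\<tau> I J) d" using tab_Po[OF that] t by blast
      then show ?thesis using Po by (simp add: p_def)
    qed (simp add: h_def)
  qed (simp add: that)
  have "tile_ok (\<tau> I J) (h I J) (p I J)" for I J
    unfolding tile_ok_def list_all_iff
  proof clarify
    fix k k' assume e: "(k, k') \<in> set (tedges (\<tau> I J))" and eq: "dgt (\<tau> I J) (h I J) (p I J) k = dgt (\<tau> I J) (h I J) (p I J) k'"
    have k: "k < length (tab (\<tau> I J))" "In k' \<in> set (tab (\<tau> I J) ! k)" using tedges_tab[OF e] by auto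
    then have k': "k' < length (tab (\<tau> I J))" using tab_In by blast
    have "adjT \<tau> (I, J, k) (I, J, k')" using k k' by simp
    from ne[OF this] show False using eq deg[OF k(1)] deg[OF k'] by simp
  qed
  then have "trel (\<tau> I J) (p I J)" for I J
    by (rule trel_of_tile_ok) (simp add: h_def sym)
  moreover have "p I J dR = p I (Suc J) dL" if "hasp (\<tau> I J) dR" for I J
    unfolding p_def using sym by simp
  moreover have "p I J dU = p (Suc I) J dD" if "hasp (\<tau> I J) dU" for I J
    unfolding p_def using sym by simp
  ultimately show ?thesis unfolding port_assignment_def by blast
qed

text \<open>Each tile is solved on its own for the given port labels. What remains are the degrees
  along port edges, and there the link at one of the ends can give way.\<close>

lemma labeling_of_port_assignment:
  assumes p: "port_assignment p"
  shows "\<exists>H. (\<forall>u v. H u v = H v u) \<and>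
    (\<forall>u v. adjT \<tau> u v \<longrightarrow> card {w. adjT \<tau> u w \<and> H u w} \<noteq> card {w. adjT \<tau> v w \<and> H v w})"
proof -
  have tr: "trel (\<tau> I J) (p I J)" for I J using p unfolding port_assignment_def by blast
  have pR: "hasp (\<tau> I J) dR \<Longrightarrow> p I J dR = p I (Suc J) dL" for I J using p unfolding port_assignment_def by blast
  have pU: "hasp (\<tau> I J) dU \<Longrightarrow> p I J dU = p (Suc I) J dD" for I J using p unfolding port_assignment_def by blast
  \<comment> \<open>The degree at a port of a tile that is not a link. Such solutions ignore their
    last argument, hence 0; so the choices \<open>j\<close> of the links do not influence the
    degrees that they have to avoid.\<close>
  define c where "c I J d = dgt (\<tau> I J) (hsol (\<tau> I J) (p I J) 0) (p I J) (pk (\<tau> I J) d)" for I J d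
  define j where "j I J = (if \<tau> I J = TH then avoid (of_bool (p I J dL)) (c I (J - 1) dR) (c I (Suc J) dL)
     else if \<tau> I J = TV then avoid (of_bool (p I J dD)) (c (I - 1) J dU) (c (Suc I) J dD) else 0)" for I J
  have j2: "j I J \<le> 2" for I J using avoid by (simp add: j_def)
  define h where "h I J = hsol (\<tau> I J) (p I J) (j I J)" for I J
  define g where "g I J = dgt (\<tau> I J) (h I J) (p I J)" for I J
  have core: "g I J (pk (\<tau> I J) d) = c I J d" if "\<not> lnk (\<tau> I J)" for I J d
    using that by (simp add: g_def h_def c_def j_def lnk_def)
  have gH: "g I J k = of_bool (p I J dL) + j I J" if "\<tau> I J = TH" "k = 0 \<or> k = 1" for I J k
    using link_port_degree(1)[OF j2 that(2), of "p I J" I J] tr[of I J] that(1) by (simp add: g_def h_def)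
  have gV: "g I J k = of_bool (p I J dD) + j I J" if "\<tau> I J = TV" "k = 0 \<or> k = 1" for I J k
    using link_port_degree(2)[OF j2 that(2), of "p I J" I J] tr[of I J] that(1) by (simp add: g_def h_def)
  have pk01: "pk ty d = 0 \<or> pk ty d = 1" if "lnk ty" "hasp ty d" for ty d
    using hasp_pk[OF that(2)] tab_Po[of "pk ty d" ty d] that(1) by auto
  have neR: "g I J (pk (\<tau> I J) dR) \<noteq> g I (Suc J) (pk (\<tau> I (Suc J)) dL)" if "hasp (\<tau> I J) dR" for I J
  proof -
    have hl: "hasp (\<tau> I (Suc J)) dL" using that right by blast
    show ?thesis
    proof (cases "lnk (\<tau> I J)")
      case True
      then have t: "\<tau> I J = TH" "\<not> lnk (\<tau> I (Suc J))" using lnk_port(1) that alt_right by blast+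
      then show ?thesis
        using gH[OF t(1) pk01[OF True that]] core[OF t(2)]
          avoid[of "of_bool (p I J dL)" "c I (J - 1) dR" "c I (Suc J) dL"] by (simp add: j_def)
    next
      case False
      then have "lnk (\<tau> I (Suc J))" using alt_right that by blast
      moreover from this have t: "\<tau> I (Suc J) = TH" using lnk_port(1) hl by blast
      ultimately show ?thesis
        using gH[OF t pk01[OF _ hl]] core[OF False]
          avoid[of "of_bool (p I (Suc J) dL)" "c I (Suc J - 1) dR" "c I (Suc (Suc J)) dL"] by (simp add: j_def)
    qed
  qed
  have neU: "g I J (pk (\<tau> I J) dU) \<noteq> g (Suc I) J (pk (\<tau> (Suc I) J) dD)" if "hasp (\<tau> I J) dU" for I J
  proof -
    have hl: "hasp (\<tau> (Suc I) J) dD" using that up by blast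
    show ?thesis
    proof (cases "lnk (\<tau> I J)")
      case True
      then have t: "\<tau> I J = TV" "\<not> lnk (\<tau> (Suc I) J)" using lnk_port(2) that alt_up by blast+
      then show ?thesis
        using gV[OF t(1) pk01[OF True that]] core[OF t(2)]
          avoid[of "of_bool (p I J dD)" "c (I - 1) J dU" "c (Suc I) J dD"] by (simp add: j_def)
    next
      case False
      then have "lnk (\<tau> (Suc I) J)" using alt_up that by blast
      moreover from this have t: "\<tau> (Suc I) J = TV" using lnk_port(2) hl by blast
      ultimately show ?thesis
        using gV[OF t pk01[OF _ hl]] core[OF False]
          avoid[of "of_bool (p (Suc I) J dD)" "c (Suc I - 1) J dU" "c (Suc (Suc I)) J dD"] by (simp add: j_def)
    qed
  qed
  \<comment> \<open>The conjunct \<open>adjT\<close> makes \<open>H\<close> false off the edges, so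
    symmetry has to be verified along edges only. The neighbouring tile is recognised by comparing
    indices, and the port label is taken from the tile of \<open>u\<close>.\<close>
  define H where "H u v = (case u of (I, J, k) \<Rightarrow> case v of (I', J', k') \<Rightarrow> adjT \<tau> u v \<and>
     (if I' = I \<and> J' = J then h I J k k' else if I' = I \<and> J' = Suc J then p I J dR
      else if I' = I then p I J dL else if I' = Suc I then p I J dU else p I J dD))" for u v
  have Hnb: "H (I, J, k) (nb \<tau> (I, J, k) t) = tlab (h I J) (p I J) k t"
    if k: "k < length (tab (\<tau> I J))" and t: "t \<in> set (tab (\<tau> I J) ! k)" for I J k t
  proof -
    have a: "adjT \<tau> (I, J, k) (nb \<tau> (I, J, k) t)" using adj_iff_nb[of "(I, J, k)"] k t by auto
    have pos: "t = Po dL \<Longrightarrow> J > 0" "t = Po dD \<Longrightarrow> I > 0"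
      using hasp_I[OF k] left0 down0 t by (metis gr0I)+
    show ?thesis
    proof (cases t)
      case (In l)
      then show ?thesis using a by (simp add: H_def del: adjT.simps)
    next
      case (Po d)
      then show ?thesis using a pos by (cases d) (auto simp: H_def simp del: adjT.simps)
    qed
  qed
  have deg: "card {w. adjT \<tau> (I, J, k) w \<and> H (I, J, k) w} = g I J k" if "k < length (tab (\<tau> I J))" for I J k
    unfolding g_def by (rule degree_in_subgraph) (use that Hnb in auto)
  have Hsym: "H u v = H v u" if a: "adjT \<tau> u v" for u v
  proof -
    obtain I J k where u: "u = (I, J, k)" by (cases u)
    obtain I' J' k' where v: "v = (I', J', k')" by (cases v)
    have k: "k < length (tab (\<tau> I J))" "k' < length (tab (\<tau> I' J'))" using adj_isv[OF a] u v by auto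
    note po = hasp_I[OF k(1)] hasp_I[OF k(2)]
    have a': "adjT \<tau> v u" using a adj_sym by blast
    from a have "I' = I \<and> J' = J \<or> I' = I \<and> J' = Suc J \<and> hasp (\<tau> I J) dR \<or> I' = I \<and> J = Suc J' \<and> hasp (\<tau> I' J') dR \<or>
      I' = Suc I \<and> J' = J \<and> hasp (\<tau> I J) dU \<or> I = Suc I' \<and> J' = J \<and> hasp (\<tau> I' J') dU"
      using po by (auto simp: u v)
    then show ?thesis
      using a a' pR pU hsol_sym[of "\<tau> I J" "p I J" "j I J"]
      by (elim disjE conjE) (simp_all add: H_def u v h_def del: adjT.simps)
  qed
  have "H u v = H v u" for u v
    using Hsym[of u v] adj_sym[of u v] adj_sym[of v u] by (cases "adjT \<tau> u v") (auto simp: H_def split: prod.splits simp del: adjT.simps)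
  moreover have "card {w. adjT \<tau> u w \<and> H u w} \<noteq> card {w. adjT \<tau> v w \<and> H v w}" if a: "adjT \<tau> u v" for u v
  proof -
    obtain I J k where u: "u = (I, J, k)" by (cases u)
    obtain I' J' k' where v: "v = (I', J', k')" by (cases v)
    have k: "k < length (tab (\<tau> I J))" "k' < length (tab (\<tau> I' J'))" using adj_isv[OF a] u v by auto
    note po = hasp_I[OF k(1)] hasp_I[OF k(2)]
    note pkk = tab_Po[OF k(1)] tab_Po[OF k(2)]
    have "I' = I \<and> J' = J \<and> In k' \<in> set (tab (\<tau> I J) ! k) \<or>
      I' = I \<and> J' = Suc J \<and> Po dR \<in> set (tab (\<tau> I J) ! k) \<and> Po dL \<in> set (tab (\<tau> I' J') ! k') \<or>
      I' = I \<and> J = Suc J' \<and> Po dL \<in> set (tab (\<tau> I J) ! k) \<and> Po dR \<in> set (tab (\<tau> I' J') ! k') \<or>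
      I' = Suc I \<and> J' = J \<and> Po dU \<in> set (tab (\<tau> I J) ! k) \<and> Po dD \<in> set (tab (\<tau> I' J') ! k') \<or>
      I = Suc I' \<and> J' = J \<and> Po dD \<in> set (tab (\<tau> I J) ! k) \<and> Po dU \<in> set (tab (\<tau> I' J') ! k')"
      using a by (auto simp: u v)
    then have "g I J k \<noteq> g I' J' k'"
    proof (elim disjE conjE)
      assume i: "I' = I" "J' = J" "In k' \<in> set (tab (\<tau> I J) ! k)"
      have "tile_ok (\<tau> I J) (h I J) (p I J)" unfolding h_def by (rule tile_ok_hsol[OF tr j2])
      then have "dgt (\<tau> I J) (h I J) (p I J) a \<noteq> dgt (\<tau> I J) (h I J) (p I J) b" if "(a, b) \<in> set (tedges (\<tau> I J))" for a b
        using that unfolding tile_ok_def list_all_iff by auto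
      then show ?thesis using tab_In[OF k(1) i(3)] i unfolding g_def by metis
    next
      assume i: "I' = I" "J' = Suc J" "Po dR \<in> set (tab (\<tau> I J) ! k)" "Po dL \<in> set (tab (\<tau> I' J') ! k')"
      then show ?thesis using neR[OF po(1)[OF i(3)]] pkk(1)[OF i(3)] pkk(2)[OF i(4)] by simp
    next
      assume i: "I' = I" "J = Suc J'" "Po dL \<in> set (tab (\<tau> I J) ! k)" "Po dR \<in> set (tab (\<tau> I' J') ! k')"
      then show ?thesis using neR[OF po(2)[OF i(4)]] pkk(1)[OF i(3)] pkk(2)[OF i(4)] by simp
    next
      assume i: "I' = Suc I" "J' = J" "Po dU \<in> set (tab (\<tau> I J) ! k)" "Po dD \<in> set (tab (\<tau> I' J') ! k')"
      then show ?thesis using neU[OF po(1)[OF i(3)]] pkk(1)[OF i(3)] pkk(2)[OF i(4)] by simp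
    next
      assume i: "I = Suc I'" "J' = J" "Po dD \<in> set (tab (\<tau> I J) ! k)" "Po dU \<in> set (tab (\<tau> I' J') ! k')"
      then show ?thesis using neU[OF po(2)[OF i(4)]] pkk(1)[OF i(3)] pkk(2)[OF i(4)] by simp
    qed
    then show ?thesis using deg[OF k(1)] deg[OF k(2)] by (simp add: u v del: adjT.simps)
  qed
  ultimately show ?thesis by blast
qed

theorem labeling_iff_port_assignment:
  "(\<exists>f. edge_labeling_by_product 2 (edges_of (adjT \<tau>)) f) \<longleftrightarrow> (\<exists>p. port_assignment p)"
proof -
  have eq: "(\<exists>f. edge_labeling_by_product 2 (edges_of (adjT \<tau>)) f) \<longleftrightarrow>
    (\<exists>H. (\<forall>u v. H u v = H v u) \<and>
      (\<forall>u v. adjT \<tau> u v \<longrightarrow> card {w. adjT \<tau> u w \<and> H u w} \<noteq> card {w. adjT \<tau> v w \<and> H v w}))"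
    by (rule labeling_iff_subgraph) (rule adj_sym adj_irrefl finite_neighbours, assumption?)+
  show ?thesis
    unfolding eq
  proof (rule iffI; elim exE conjE)
    fix H assume s: "\<forall>u v. H u v = H v u"
      and n: "\<forall>u v. adjT \<tau> u v \<longrightarrow> card {w. adjT \<tau> u w \<and> H u w} \<noteq> card {w. adjT \<tau> v w \<and> H v w}"
    show "\<exists>p. port_assignment p"
      by (rule port_assignment_of_labeling[of H]) (rule s[rule_format], rule n[rule_format])
  next
    fix p assume "port_assignment p"
    then show "\<exists>H. (\<forall>u v. H u v = H v u) \<and>
      (\<forall>u v. adjT \<tau> u v \<longrightarrow> card {w. adjT \<tau> u w \<and> H u w} \<noteq> card {w. adjT \<tau> v w \<and> H v w})"
      by (rule labeling_of_port_assignment)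
  qed
qed

end

section \<open>Planarity by straight-line drawings\<close>

text \<open>Twice the signed area of the triangle \<open>a\<close>, \<open>b\<close>,
  \<open>c\<close>; its sign tells on which side of the line through \<open>a\<close> and
  \<open>b\<close> the point \<open>c\<close> lies.\<close>

definition cross :: "complex \<Rightarrow> complex \<Rightarrow> complex \<Rightarrow> real" where
  "cross a b c = (Re b - Re a) * (Im c - Im a) - (Im b - Im a) * (Re c - Re a)"

lemma cross_affine:
  "cross a b ((1 - t) *\<^sub>R c + t *\<^sub>R d) = (1 - t) * cross a b c + t * cross a b d"
  by (simp add: cross_def algebra_simps)

lemma cross_segment: "z \<in> closed_segment a b \<Longrightarrow> cross a b z = 0"
  by (auto simp: closed_segment_def cross_affine) (simp_all add: cross_def)

text \<open>Both \<open>c\<close> and \<open>d\<close> lie strictly on one side of the line through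
  \<open>a\<close> and \<open>b\<close>. As \<open>cross\<close> is affine in its last argument, so
  does the whole segment between them.\<close>

lemma segments_disjoint:
  assumes "cross a b c * cross a b d > 0"
  shows "closed_segment a b \<inter> closed_segment c d = {}"
proof (rule equals0I)
  fix z assume z: "z \<in> closed_segment a b \<inter> closed_segment c d"
  then obtain t where t: "0 \<le> t" "t \<le> 1" "z = (1 - t) *\<^sub>R c + t *\<^sub>R d" by (auto simp: closed_segment_def)
  have 0: "(1 - t) * cross a b c + t * cross a b d = 0"
    using cross_segment[of z a b] z t(3) cross_affine by simp
  consider "cross a b c > 0" "cross a b d > 0" | "cross a b c < 0" "cross a b d < 0"
    using assms by (auto simp: zero_less_mult_iff)
  then show False
  proof cases
    case 1
    then have "(1 - t) * cross a b c \<ge> 0" "t * cross a b d \<ge> 0" using t by auto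
    then have "(1 - t) * cross a b c = 0" "t * cross a b d = 0" using 0 by linarith+
    then show False using 1 by simp
  next
    case 2
    then have "(1 - t) * cross a b c \<le> 0" "t * cross a b d \<le> 0" using t by (auto simp: mult_nonneg_nonpos)
    then have "(1 - t) * cross a b c = 0" "t * cross a b d = 0" using 0 by linarith+
    then show False using 2 by simp
  qed
qed

lemma segments_meet:
  assumes "cross s u v \<noteq> 0"
  shows "closed_segment s u \<inter> closed_segment s v \<subseteq> {s}"
proof
  fix z assume z: "z \<in> closed_segment s u \<inter> closed_segment s v"
  then obtain t where t: "z = (1 - t) *\<^sub>R s + t *\<^sub>R v" by (auto simp: closed_segment_def)
  have "(1 - t) * cross s u s + t * cross s u v = 0"
    using cross_segment[of z s u] z t cross_affine by simp
  moreover have "cross s u s = 0" by (simp add: cross_def)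
  ultimately have "t = 0" using assms by simp
  then show "z \<in> {s}" using t by simp
qed

text \<open>Planarity also demands that an edge avoids all foreign vertices. Since every vertex lies
  on some edge, this follows from the condition on pairs of edges, which is therefore all that has
  to be checked.\<close>

lemma planar_straight_line:
  fixes pos :: "'a \<Rightarrow> complex"
  assumes inj: "inj_on pos V" and V: "simple_graph V E" and cover: "\<And>v. v \<in> V \<Longrightarrow> \<exists>e\<in>E. v \<in> e"
    and meet: "\<And>e e'. e \<in> E \<Longrightarrow> e' \<in> E \<Longrightarrow> e \<noteq> e' \<Longrightarrow>
      convex hull (pos ` e) \<inter> convex hull (pos ` e') \<subseteq> pos ` (e \<inter> e')"
  shows "planar V E"
proof -
  define ends where "ends e = (SOME ab. e = {fst ab, snd ab})" for e :: "'a set"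
  define \<gamma> where "\<gamma> e = linepath (pos (fst (ends e))) (pos (snd (ends e)))" for e
  have e2: "e = {fst (ends e), snd (ends e)}" "fst (ends e) \<noteq> snd (ends e)" "e \<subseteq> V" if "e \<in> E" for e
  proof -
    have e: "card e = 2" "e \<subseteq> V" using V that unfolding simple_graph_def by auto
    then obtain a b where "e = {a, b}" by (auto simp: card_2_iff)
    then have "e = {fst (a, b), snd (a, b)}" by simp
    then show 1: "e = {fst (ends e), snd (ends e)}" unfolding ends_def by (rule someI)
    show "fst (ends e) \<noteq> snd (ends e)" using e(1) 1 by (metis card_1_singleton_iff insert_absorb2 numeral_eq_one_iff semiring_norm(85) One_nat_def)
    show "e \<subseteq> V" by (rule e(2))
  qed
  have img: "path_image (\<gamma> e) = convex hull (pos ` e)" if "e \<in> E" for e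
  proof -
    have "pos ` e = {pos (fst (ends e)), pos (snd (ends e))}" using e2(1)[OF that] by (metis image_empty image_insert)
    then show ?thesis by (simp add: \<gamma>_def segment_convex_hull)
  qed
  have sub: "pos ` e \<subseteq> convex hull (pos ` e)" for e by (rule hull_subset)
  show ?thesis
    unfolding planar_def
  proof (intro exI[of _ pos] exI[of _ \<gamma>] conjI ballI impI)
    fix e assume e: "e \<in> E"
    have "fst (ends e) \<in> V" "snd (ends e) \<in> V" using e2[OF e] by auto
    then have "pos (fst (ends e)) \<noteq> pos (snd (ends e))" using e2(2)[OF e] inj by (auto simp: inj_on_def)
    then show "arc (\<gamma> e)" by (simp add: \<gamma>_def arc_linepath)
    show "{pathstart (\<gamma> e), pathfinish (\<gamma> e)} = pos ` e"
      unfolding \<gamma>_def pathstart_linepath pathfinish_linepath using e2(1)[OF e] by (metis image_empty image_insert)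
    show "path_image (\<gamma> e) \<inter> pos ` V = pos ` e"
    proof
      show "pos ` e \<subseteq> path_image (\<gamma> e) \<inter> pos ` V" unfolding img[OF e] using sub e2(3)[OF e] by blast
      show "path_image (\<gamma> e) \<inter> pos ` V \<subseteq> pos ` e"
      proof
        fix z assume "z \<in> path_image (\<gamma> e) \<inter> pos ` V"
        then obtain v where v: "v \<in> V" "z = pos v" "pos v \<in> convex hull (pos ` e)" using img[OF e] by auto
        obtain e' where e': "e' \<in> E" "v \<in> e'" using cover[OF v(1)] by blast
        show "z \<in> pos ` e"
        proof (cases "e' = e")
          case False
          have "pos v \<in> convex hull (pos ` e')" using sub e'(2) by blast
          then have "pos v \<in> pos ` (e \<inter> e')" using meet[OF e e'(1)] False v(3) by blast
          then show ?thesis using v(2) by blast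
        qed (use e'(2) v(2) in blast)
      qed
    qed
  next
    fix e e' assume e: "e \<in> E" "e' \<in> E" "e \<noteq> e'"
    show "path_image (\<gamma> e) \<inter> path_image (\<gamma> e') = pos ` (e \<inter> e')"
      unfolding img[OF e(1)] img[OF e(2)] using meet[OF e] sub[of e] sub[of e'] by blast
  qed (rule inj)
qed

fun crossz :: "int \<times> int \<Rightarrow> int \<times> int \<Rightarrow> int \<times> int \<Rightarrow> int" where
  "crossz (xa, ya) (xb, yb) (xc, yc) = (xb - xa) * (yc - ya) - (yb - ya) * (xc - xa)"

text \<open>A sufficient integer test that two segments meet only in a common end: if they share an
  end, the three points must not be collinear; otherwise one segment has to lie strictly on one side
  of the line through the other.\<close>

definition pair_ok :: "(int \<times> int) list \<Rightarrow> nat \<times> nat \<Rightarrow> nat \<times> nat \<Rightarrow> bool" where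
  "pair_ok c e e' = (case (e, e') of ((p, q), (r, s)) \<Rightarrow>
     (p = r \<and> q = s) \<or>
     (if p = r then crossz (c ! p) (c ! q) (c ! s) \<noteq> 0
      else if p = s then crossz (c ! p) (c ! q) (c ! r) \<noteq> 0
      else if q = r then crossz (c ! q) (c ! p) (c ! s) \<noteq> 0
      else if q = s then crossz (c ! q) (c ! p) (c ! r) \<noteq> 0
      else crossz (c ! p) (c ! q) (c ! r) * crossz (c ! p) (c ! q) (c ! s) > 0 \<or>
        crossz (c ! r) (c ! s) (c ! p) * crossz (c ! r) (c ! s) (c ! q) > 0))"

text \<open>Beside the test for crossings inside a tile, this states that the boundary of the square
  is touched by port vertices only, each at the midpoint of its side.\<close>

definition geo :: "ty \<Rightarrow> bool" where
  "geo ty \<longleftrightarrow> distinct (crd ty) \<and>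
    list_all (\<lambda>k. case crd ty ! k of (x, y) \<Rightarrow> 0 \<le> x \<and> x \<le> 10 \<and> 0 \<le> y \<and> y \<le> 10 \<and>
      (x = 0 \<longleftrightarrow> Po dL \<in> set (tab ty ! k)) \<and> (x = 10 \<longleftrightarrow> Po dR \<in> set (tab ty ! k)) \<and>
      (y = 0 \<longleftrightarrow> Po dD \<in> set (tab ty ! k)) \<and> (y = 10 \<longleftrightarrow> Po dU \<in> set (tab ty ! k)) \<and>
      (x = 0 \<or> x = 10 \<longrightarrow> y = 5) \<and> (y = 0 \<or> y = 10 \<longrightarrow> x = 5)) [0..<length (tab ty)] \<and>
    list_all (\<lambda>e. list_all (pair_ok (crd ty) e) (tedges ty)) (tedges ty)"

lemma geo: "geo ty"
  by (cases ty; simp only:; code_simp)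

text \<open>An affine function attains its maximum over a segment only at an end, unless it is
  constant there. It is applied to the four sides of a tile: an inner edge can touch a side only
  with a port vertex.\<close>

lemma segment_extreme:
  fixes f :: "complex \<Rightarrow> real"
  assumes aff: "\<And>t. f ((1 - t) *\<^sub>R a + t *\<^sub>R b) = (1 - t) * f a + t * f b"
    and z: "z \<in> closed_segment a b" and le: "f a \<le> M" "f b \<le> M" and ne: "\<not> (f a = M \<and> f b = M)"
  shows "f z \<le> M" "f z = M \<Longrightarrow> (z = a \<and> f a = M) \<or> (z = b \<and> f b = M)"
proof -
  obtain t where t: "0 \<le> t" "t \<le> 1" "z = (1 - t) *\<^sub>R a + t *\<^sub>R b" using z by (auto simp: closed_segment_def)
  have "f z = (1 - t) * f a + t * f b" unfolding t(3) by (rule aff)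
  then have fz: "M - f z = (1 - t) * (M - f a) + t * (M - f b)" by (simp add: algebra_simps)
  have nn: "(1 - t) * (M - f a) \<ge> 0" "t * (M - f b) \<ge> 0" using t le by auto
  show "f z \<le> M" using fz nn by linarith
  assume "f z = M"
  then have "(1 - t) * (M - f a) = 0" "t * (M - f b) = 0" using fz nn by linarith+
  then show "(z = a \<and> f a = M) \<or> (z = b \<and> f b = M)" using ne t(3) by auto
qed

context tiling
begin

text \<open>The pitch 12 leaves strips of width 2 between the squares of side 10; the strips contain
  nothing but the port edges.\<close>

definition pos :: "vertex \<Rightarrow> complex" where
  "pos u = (case u of (I, J, k) \<Rightarrow> Complex (12 * real J + of_int (fst (crd (\<tau> I J) ! k)))
     (12 * real I + of_int (snd (crd (\<tau> I J) ! k))))"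

lemma crd_bounds:
  assumes "k < length (tab (\<tau> I J))"
  defines "x \<equiv> fst (crd (\<tau> I J) ! k)" and "y \<equiv> snd (crd (\<tau> I J) ! k)"
  shows "0 \<le> x" "x \<le> 10" "0 \<le> y" "y \<le> 10" "x = 0 \<longleftrightarrow> Po dL \<in> set (tab (\<tau> I J) ! k)"
    "x = 10 \<longleftrightarrow> Po dR \<in> set (tab (\<tau> I J) ! k)" "y = 0 \<longleftrightarrow> Po dD \<in> set (tab (\<tau> I J) ! k)"
    "y = 10 \<longleftrightarrow> Po dU \<in> set (tab (\<tau> I J) ! k)" "x = 0 \<or> x = 10 \<Longrightarrow> y = 5" "y = 0 \<or> y = 10 \<Longrightarrow> x = 5"
proof -
  have mem: "k \<in> set [0..<length (tab (\<tau> I J))]" using assms(1) by simp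
  have "\<forall>k\<in>set [0..<length (tab (\<tau> I J))]. case crd (\<tau> I J) ! k of (x, y) \<Rightarrow> 0 \<le> x \<and> x \<le> 10 \<and> 0 \<le> y \<and> y \<le> 10 \<and>
      (x = 0 \<longleftrightarrow> Po dL \<in> set (tab (\<tau> I J) ! k)) \<and> (x = 10 \<longleftrightarrow> Po dR \<in> set (tab (\<tau> I J) ! k)) \<and>
      (y = 0 \<longleftrightarrow> Po dD \<in> set (tab (\<tau> I J) ! k)) \<and> (y = 10 \<longleftrightarrow> Po dU \<in> set (tab (\<tau> I J) ! k)) \<and>
      (x = 0 \<or> x = 10 \<longrightarrow> y = 5) \<and> (y = 0 \<or> y = 10 \<longrightarrow> x = 5)"
    using geo[of "\<tau> I J"] unfolding geo_def list_all_iff by (elim conjE)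
  from bspec[OF this mem] have "0 \<le> x \<and> x \<le> 10 \<and> 0 \<le> y \<and> y \<le> 10 \<and>
      (x = 0 \<longleftrightarrow> Po dL \<in> set (tab (\<tau> I J) ! k)) \<and> (x = 10 \<longleftrightarrow> Po dR \<in> set (tab (\<tau> I J) ! k)) \<and>
      (y = 0 \<longleftrightarrow> Po dD \<in> set (tab (\<tau> I J) ! k)) \<and> (y = 10 \<longleftrightarrow> Po dU \<in> set (tab (\<tau> I J) ! k)) \<and>
      (x = 0 \<or> x = 10 \<longrightarrow> y = 5) \<and> (y = 0 \<or> y = 10 \<longrightarrow> x = 5)"
    unfolding x_def y_def case_prod_beta .
  then show "0 \<le> x" "x \<le> 10" "0 \<le> y" "y \<le> 10" "x = 0 \<longleftrightarrow> Po dL \<in> set (tab (\<tau> I J) ! k)"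
    "x = 10 \<longleftrightarrow> Po dR \<in> set (tab (\<tau> I J) ! k)" "y = 0 \<longleftrightarrow> Po dD \<in> set (tab (\<tau> I J) ! k)"
    "y = 10 \<longleftrightarrow> Po dU \<in> set (tab (\<tau> I J) ! k)" "x = 0 \<or> x = 10 \<Longrightarrow> y = 5" "y = 0 \<or> y = 10 \<Longrightarrow> x = 5"
    by blast+
qed

lemma pos_inj: "inj_on pos {u. isv \<tau> u}"
proof (rule inj_onI)
  fix u v assume uv: "u \<in> {u. isv \<tau> u}" "v \<in> {u. isv \<tau> u}" "pos u = pos v"
  obtain I J k where u: "u = (I, J, k)" by (cases u)
  obtain I' J' k' where v: "v = (I', J', k')" by (cases v)
  have k: "k < length (tab (\<tau> I J))" "k' < length (tab (\<tau> I' J'))" using uv u v by auto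
  have "real_of_int (12 * int J + fst (crd (\<tau> I J) ! k)) = real_of_int (12 * int J' + fst (crd (\<tau> I' J') ! k'))"
    "real_of_int (12 * int I + snd (crd (\<tau> I J) ! k)) = real_of_int (12 * int I' + snd (crd (\<tau> I' J') ! k'))"
    using uv(3) by (simp_all add: pos_def u v)
  then have eq: "12 * int J + fst (crd (\<tau> I J) ! k) = 12 * int J' + fst (crd (\<tau> I' J') ! k')"
    "12 * int I + snd (crd (\<tau> I J) ! k) = 12 * int I' + snd (crd (\<tau> I' J') ! k')"
    by (simp_all only: of_int_eq_iff)
  have "int J = int J'" "int I = int I'"
    using eq crd_bounds(1-4)[OF k(1)] crd_bounds(1-4)[OF k(2)] by linarith+
  then have "J = J'" "I = I'" by simp_all
  then have "crd (\<tau> I J) ! k = crd (\<tau> I J) ! k'"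
    using eq by (simp add: prod_eq_iff)
  then show "u = v"
    using geo[of "\<tau> I J"] k \<open>I = I'\<close> \<open>J = J'\<close> nth_eq_iff_index_eq[of "crd (\<tau> I J)" k k'] tab_crd
    by (simp add: geo_def u v)
qed

lemma cross_pos:
  "cross (pos (I, J, a)) (pos (I, J, b)) (pos (I, J, c)) =
    of_int (crossz (crd (\<tau> I J) ! a) (crd (\<tau> I J) ! b) (crd (\<tau> I J) ! c))"
  by (cases "crd (\<tau> I J) ! a"; cases "crd (\<tau> I J) ! b"; cases "crd (\<tau> I J) ! c")
    (simp add: pos_def cross_def algebra_simps)

definition inner :: "nat \<Rightarrow> nat \<Rightarrow> vertex set \<Rightarrow> bool" where
  "inner I J e \<longleftrightarrow> (\<exists>p q. (p, q) \<in> set (tedges (\<tau> I J)) \<and> e = {(I, J, p), (I, J, q)})"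

definition right_link :: "nat \<Rightarrow> nat \<Rightarrow> vertex set \<Rightarrow> bool" where
  "right_link I J e \<longleftrightarrow> hasp (\<tau> I J) dR \<and> e = {(I, J, pk (\<tau> I J) dR), (I, Suc J, pk (\<tau> I (Suc J)) dL)}"

definition up_link :: "nat \<Rightarrow> nat \<Rightarrow> vertex set \<Rightarrow> bool" where
  "up_link I J e \<longleftrightarrow> hasp (\<tau> I J) dU \<and> e = {(I, J, pk (\<tau> I J) dU), (Suc I, J, pk (\<tau> (Suc I) J) dD)}"

lemma edge_kinds:
  assumes "e \<in> edges_of (adjT \<tau>)"
  shows "\<exists>I J. inner I J e \<or> right_link I J e \<or> up_link I J e"
proof -
  obtain u v where e: "e = {u, v}" "adjT \<tau> u v" using assms by (auto simp: edges_of_def)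
  obtain I J k where u: "u = (I, J, k)" by (cases u)
  obtain I' J' k' where v: "v = (I', J', k')" by (cases v)
  have k: "k < length (tab (\<tau> I J))" "k' < length (tab (\<tau> I' J'))" using adj_isv[OF e(2)] u v by auto
  note po = tab_Po[OF k(1)] tab_Po[OF k(2)] hasp_I[OF k(1)] hasp_I[OF k(2)]
  have "I' = I \<and> J' = J \<and> In k' \<in> set (tab (\<tau> I J) ! k) \<or>
      I' = I \<and> J' = Suc J \<and> Po dR \<in> set (tab (\<tau> I J) ! k) \<and> Po dL \<in> set (tab (\<tau> I' J') ! k') \<or>
      I' = I \<and> J = Suc J' \<and> Po dL \<in> set (tab (\<tau> I J) ! k) \<and> Po dR \<in> set (tab (\<tau> I' J') ! k') \<or>
      I' = Suc I \<and> J' = J \<and> Po dU \<in> set (tab (\<tau> I J) ! k) \<and> Po dD \<in> set (tab (\<tau> I' J') ! k') \<or>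
      I = Suc I' \<and> J' = J \<and> Po dD \<in> set (tab (\<tau> I J) ! k) \<and> Po dU \<in> set (tab (\<tau> I' J') ! k')"
    using e(2) by (auto simp: u v)
  then show ?thesis
  proof (elim disjE conjE)
    assume a: "I' = I" "J' = J" "In k' \<in> set (tab (\<tau> I J) ! k)"
    then have "(k, k') \<in> set (tedges (\<tau> I J)) \<or> (k', k) \<in> set (tedges (\<tau> I J))" using tab_In[OF k(1)] by blast
    then have "inner I J e" using e(1) a unfolding inner_def u v by (auto simp: insert_commute)
    then show ?thesis by blast
  next
    assume a: "I' = I" "J' = Suc J" "Po dR \<in> set (tab (\<tau> I J) ! k)" "Po dL \<in> set (tab (\<tau> I' J') ! k')"
    then have "right_link I J e" using e(1) po(1)[OF a(3)] po(2)[OF a(4)] po(3)[OF a(3)]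
      unfolding right_link_def u v by simp
    then show ?thesis by blast
  next
    assume a: "I' = I" "J = Suc J'" "Po dL \<in> set (tab (\<tau> I J) ! k)" "Po dR \<in> set (tab (\<tau> I' J') ! k')"
    then have "right_link I' J' e" using e(1) po(1)[OF a(3)] po(2)[OF a(4)] po(4)[OF a(4)]
      unfolding right_link_def u v by (simp add: insert_commute)
    then show ?thesis by blast
  next
    assume a: "I' = Suc I" "J' = J" "Po dU \<in> set (tab (\<tau> I J) ! k)" "Po dD \<in> set (tab (\<tau> I' J') ! k')"
    then have "up_link I J e" using e(1) po(1)[OF a(3)] po(2)[OF a(4)] po(3)[OF a(3)]
      unfolding up_link_def u v by simp
    then show ?thesis by blast
  next
    assume a: "I = Suc I'" "J' = J" "Po dD \<in> set (tab (\<tau> I J) ! k)" "Po dU \<in> set (tab (\<tau> I' J') ! k')"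
    then have "up_link I' J' e" using e(1) po(1)[OF a(3)] po(2)[OF a(4)] po(4)[OF a(4)]
      unfolding up_link_def u v by (simp add: insert_commute)
    then show ?thesis by blast
  qed
qed

lemma inner_points:
  assumes "inner I J e" "z \<in> convex hull (pos ` e)"
  shows "12 * real J \<le> Re z" "Re z \<le> 12 * real J + 10" "12 * real I \<le> Im z" "Im z \<le> 12 * real I + 10"
    "Re z = 12 * real J \<Longrightarrow> (I, J, pk (\<tau> I J) dL) \<in> e \<and> z = pos (I, J, pk (\<tau> I J) dL)"
    "Re z = 12 * real J + 10 \<Longrightarrow> (I, J, pk (\<tau> I J) dR) \<in> e \<and> z = pos (I, J, pk (\<tau> I J) dR)"
    "Im z = 12 * real I \<Longrightarrow> (I, J, pk (\<tau> I J) dD) \<in> e \<and> z = pos (I, J, pk (\<tau> I J) dD)"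
    "Im z = 12 * real I + 10 \<Longrightarrow> (I, J, pk (\<tau> I J) dU) \<in> e \<and> z = pos (I, J, pk (\<tau> I J) dU)"
proof -
  obtain p q where pq: "(p, q) \<in> set (tedges (\<tau> I J))" and e: "e = {(I, J, p), (I, J, q)}"
    using assms(1) unfolding inner_def by blast
  have k: "p < length (tab (\<tau> I J))" "q < length (tab (\<tau> I J))" "p \<noteq> q"
    using tedges_tab[OF pq] tab_In by blast+
  have z: "z \<in> closed_segment (pos (I, J, p)) (pos (I, J, q))"
    using assms(2) by (simp add: e segment_convex_hull)
  have re: "Re (pos (I, J, k)) = 12 * real J + of_int (fst (crd (\<tau> I J) ! k))"
    and im: "Im (pos (I, J, k)) = 12 * real I + of_int (snd (crd (\<tau> I J) ! k))" for k
    by (simp_all add: pos_def)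
  note b = crd_bounds[OF k(1)] crd_bounds[OF k(2)]
  \<comment> \<open>A port belongs to a single vertex, so an inner edge cannot have both ends on the
    same side of the square. This is the exception excluded in
    \<open>segment_extreme\<close>.\<close>
  have uniq: "\<not> (Po d \<in> set (tab (\<tau> I J) ! p) \<and> Po d \<in> set (tab (\<tau> I J) ! q))" for d
    using tab_Po[OF k(1)] tab_Po[OF k(2)] k(3) by metis
  have pp: "Po d \<in> set (tab (\<tau> I J) ! p) \<Longrightarrow> p = pk (\<tau> I J) d" "Po d \<in> set (tab (\<tau> I J) ! q) \<Longrightarrow> q = pk (\<tau> I J) d" for d
    using tab_Po[OF k(1)] tab_Po[OF k(2)] by blast+
  have cb: "real_of_int (fst (crd (\<tau> I J) ! k)) \<le> 10" "0 \<le> real_of_int (fst (crd (\<tau> I J) ! k))"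
    "real_of_int (snd (crd (\<tau> I J) ! k)) \<le> 10" "0 \<le> real_of_int (snd (crd (\<tau> I J) ! k))"
    if "k < length (tab (\<tau> I J))" for k
    using crd_bounds(1-4)[OF that] by simp_all
  have r10: "real_of_int i = 10 \<longleftrightarrow> i = 10" for i by linarith
  have nR: "\<not> (Re (pos (I, J, p)) = 12 * real J + 10 \<and> Re (pos (I, J, q)) = 12 * real J + 10)"
    unfolding re using b(6) b(16) uniq[of dR] by (simp add: r10)
  have nL: "\<not> (- Re (pos (I, J, p)) = - (12 * real J) \<and> - Re (pos (I, J, q)) = - (12 * real J))"
    unfolding re using b(5) b(15) uniq[of dL] by simp
  have nU: "\<not> (Im (pos (I, J, p)) = 12 * real I + 10 \<and> Im (pos (I, J, q)) = 12 * real I + 10)"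
    unfolding im using b(8) b(18) uniq[of dU] by (simp add: r10)
  have nD: "\<not> (- Im (pos (I, J, p)) = - (12 * real I) \<and> - Im (pos (I, J, q)) = - (12 * real I))"
    unfolding im using b(7) b(17) uniq[of dD] by simp
  have affs: "Re ((1 - t) *\<^sub>R a + t *\<^sub>R b) = (1 - t) * Re a + t * Re b"
    "Im ((1 - t) *\<^sub>R a + t *\<^sub>R b) = (1 - t) * Im a + t * Im b"
    "- Re ((1 - t) *\<^sub>R a + t *\<^sub>R b) = (1 - t) * - Re a + t * - Re b"
    "- Im ((1 - t) *\<^sub>R a + t *\<^sub>R b) = (1 - t) * - Im a + t * - Im b" for t a b
    by (simp_all add: algebra_simps)
  have leR: "Re (pos (I, J, p)) \<le> 12 * real J + 10" "Re (pos (I, J, q)) \<le> 12 * real J + 10"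
    "- Re (pos (I, J, p)) \<le> - (12 * real J)" "- Re (pos (I, J, q)) \<le> - (12 * real J)"
    "Im (pos (I, J, p)) \<le> 12 * real I + 10" "Im (pos (I, J, q)) \<le> 12 * real I + 10"
    "- Im (pos (I, J, p)) \<le> - (12 * real I)" "- Im (pos (I, J, q)) \<le> - (12 * real I)"
    unfolding re im using cb[OF k(1)] cb[OF k(2)] by linarith+
  \<comment> \<open>Left and lower side are treated as maxima of the negated coordinate.\<close>
  note R = segment_extreme[of Re, OF affs(1) z leR(1,2) nR]
  note L = segment_extreme[of "\<lambda>z. - Re z", OF affs(3) z leR(3,4) nL]
  note U = segment_extreme[of Im, OF affs(2) z leR(5,6) nU]
  note D = segment_extreme[of "\<lambda>z. - Im z", OF affs(4) z leR(7,8) nD]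
  show "12 * real J \<le> Re z" "Re z \<le> 12 * real J + 10" "12 * real I \<le> Im z" "Im z \<le> 12 * real I + 10"
    using L(1) R(1) U(1) D(1) by simp_all
  show "(I, J, pk (\<tau> I J) dL) \<in> e \<and> z = pos (I, J, pk (\<tau> I J) dL)" if "Re z = 12 * real J"
  proof -
    have "(z = pos (I, J, p) \<and> fst (crd (\<tau> I J) ! p) = 0) \<or> (z = pos (I, J, q) \<and> fst (crd (\<tau> I J) ! q) = 0)"
      using L(2) that unfolding re by simp
    then show ?thesis using b(5) b(15) pp[of dL] unfolding e by blast
  qed
  show "(I, J, pk (\<tau> I J) dR) \<in> e \<and> z = pos (I, J, pk (\<tau> I J) dR)" if "Re z = 12 * real J + 10"
  proof -
    have "(z = pos (I, J, p) \<and> fst (crd (\<tau> I J) ! p) = 10) \<or> (z = pos (I, J, q) \<and> fst (crd (\<tau> I J) ! q) = 10)"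
      using R(2)[OF that] unfolding re by (simp add: r10)
    then show ?thesis using b(6) b(16) pp[of dR] unfolding e by blast
  qed
  show "(I, J, pk (\<tau> I J) dD) \<in> e \<and> z = pos (I, J, pk (\<tau> I J) dD)" if "Im z = 12 * real I"
  proof -
    have "(z = pos (I, J, p) \<and> snd (crd (\<tau> I J) ! p) = 0) \<or> (z = pos (I, J, q) \<and> snd (crd (\<tau> I J) ! q) = 0)"
      using D(2) that unfolding im by simp
    then show ?thesis using b(7) b(17) pp[of dD] unfolding e by blast
  qed
  show "(I, J, pk (\<tau> I J) dU) \<in> e \<and> z = pos (I, J, pk (\<tau> I J) dU)" if "Im z = 12 * real I + 10"
  proof -
    have "(z = pos (I, J, p) \<and> snd (crd (\<tau> I J) ! p) = 10) \<or> (z = pos (I, J, q) \<and> snd (crd (\<tau> I J) ! q) = 10)"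
      using U(2)[OF that] unfolding im by (simp add: r10)
    then show ?thesis using b(8) b(18) pp[of dU] unfolding e by blast
  qed
qed

lemma right_link_points:
  assumes "right_link I J e" "z \<in> convex hull (pos ` e)"
  shows "Im z = 12 * real I + 5" "12 * real J + 10 \<le> Re z" "Re z \<le> 12 * real J + 12"
proof -
  let ?a = "(I, J, pk (\<tau> I J) dR)" and ?b = "(I, Suc J, pk (\<tau> I (Suc J)) dL)"
  have h: "hasp (\<tau> I J) dR" "hasp (\<tau> I (Suc J)) dL" and e: "e = {?a, ?b}"
    using assms(1) right unfolding right_link_def by blast+
  have "z \<in> closed_segment (pos ?a) (pos ?b)" using assms(2) by (simp add: e segment_convex_hull)
  then obtain t where t: "0 \<le> t" "t \<le> 1" "z = (1 - t) *\<^sub>R pos ?a + t *\<^sub>R pos ?b" by (auto simp: closed_segment_def)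
  have a: "pos ?a = Complex (12 * real J + 10) (12 * real I + 5)"
    using hasp_pk[OF h(1)] crd_bounds(6,9)[of "pk (\<tau> I J) dR" I J] by (simp add: pos_def)
  have b: "pos ?b = Complex (12 * real J + 12) (12 * real I + 5)"
    using hasp_pk[OF h(2)] crd_bounds(5,9)[of "pk (\<tau> I (Suc J)) dL" I "Suc J"] by (simp add: pos_def)
  have "z = Complex (12 * real J + 10 + 2 * t) (12 * real I + 5)"
    unfolding t(3) a b by (simp add: complex_eq_iff algebra_simps)
  then show "Im z = 12 * real I + 5" "12 * real J + 10 \<le> Re z" "Re z \<le> 12 * real J + 12" using t by simp_all
qed

lemma up_link_points:
  assumes "up_link I J e" "z \<in> convex hull (pos ` e)"
  shows "Re z = 12 * real J + 5" "12 * real I + 10 \<le> Im z" "Im z \<le> 12 * real I + 12"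
proof -
  let ?a = "(I, J, pk (\<tau> I J) dU)" and ?b = "(Suc I, J, pk (\<tau> (Suc I) J) dD)"
  have h: "hasp (\<tau> I J) dU" "hasp (\<tau> (Suc I) J) dD" and e: "e = {?a, ?b}"
    using assms(1) up unfolding up_link_def by blast+
  have "z \<in> closed_segment (pos ?a) (pos ?b)" using assms(2) by (simp add: e segment_convex_hull)
  then obtain t where t: "0 \<le> t" "t \<le> 1" "z = (1 - t) *\<^sub>R pos ?a + t *\<^sub>R pos ?b" by (auto simp: closed_segment_def)
  have a: "pos ?a = Complex (12 * real J + 5) (12 * real I + 10)"
    using hasp_pk[OF h(1)] crd_bounds(8,10)[of "pk (\<tau> I J) dU" I J] by (simp add: pos_def)
  have b: "pos ?b = Complex (12 * real J + 5) (12 * real I + 12)"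
    using hasp_pk[OF h(2)] crd_bounds(7,10)[of "pk (\<tau> (Suc I) J) dD" "Suc I" J] by (simp add: pos_def)
  have "z = Complex (12 * real J + 5) (12 * real I + 10 + 2 * t)"
    unfolding t(3) a b by (simp add: complex_eq_iff algebra_simps)
  then show "Re z = 12 * real J + 5" "12 * real I + 10 \<le> Im z" "Im z \<le> 12 * real I + 12" using t by simp_all
qed

lemma inner_inner_meet:
  assumes "inner I J e" "inner I J e'" "e \<noteq> e'"
  shows "convex hull (pos ` e) \<inter> convex hull (pos ` e') \<subseteq> pos ` (e \<inter> e')"
proof -
  obtain p q where pq: "(p, q) \<in> set (tedges (\<tau> I J))" and e: "e = {(I, J, p), (I, J, q)}"
    using assms(1) unfolding inner_def by blast
  obtain r s where rs: "(r, s) \<in> set (tedges (\<tau> I J))" and e': "e' = {(I, J, r), (I, J, s)}"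
    using assms(2) unfolding inner_def by blast
  let ?c = "crd (\<tau> I J)"
  have ok: "pair_ok ?c (p, q) (r, s)" using geo[of "\<tau> I J"] pq rs unfolding geo_def list_all_iff by blast
  have ne: "\<not> (p = r \<and> q = s)" using assms(3) e e' by auto
  have seg: "convex hull (pos ` e) = closed_segment (pos (I, J, p)) (pos (I, J, q))"
    "convex hull (pos ` e') = closed_segment (pos (I, J, r)) (pos (I, J, s))"
    by (simp_all add: e e' segment_convex_hull)
  note cr = cross_pos[of I J]
  consider "p = r" "crossz (?c ! p) (?c ! q) (?c ! s) \<noteq> 0" | "p = s" "crossz (?c ! p) (?c ! q) (?c ! r) \<noteq> 0"
    | "q = r" "crossz (?c ! q) (?c ! p) (?c ! s) \<noteq> 0" | "q = s" "crossz (?c ! q) (?c ! p) (?c ! r) \<noteq> 0"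
    | "crossz (?c ! p) (?c ! q) (?c ! r) * crossz (?c ! p) (?c ! q) (?c ! s) > 0"
    | "crossz (?c ! r) (?c ! s) (?c ! p) * crossz (?c ! r) (?c ! s) (?c ! q) > 0"
    using ok ne unfolding pair_ok_def by (auto split: if_splits)
  then show ?thesis
  proof cases
    case 1
    then have "closed_segment (pos (I, J, p)) (pos (I, J, q)) \<inter> closed_segment (pos (I, J, p)) (pos (I, J, s)) \<subseteq> {pos (I, J, p)}"
      by (intro segments_meet) (simp add: cr)
    then show ?thesis unfolding seg using 1(1) by (auto simp: e e')
  next
    case 2
    then have "closed_segment (pos (I, J, p)) (pos (I, J, q)) \<inter> closed_segment (pos (I, J, p)) (pos (I, J, r)) \<subseteq> {pos (I, J, p)}"
      by (intro segments_meet) (simp add: cr)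
    moreover have "convex hull (pos ` e') = closed_segment (pos (I, J, p)) (pos (I, J, r))"
      unfolding seg 2(1) by (rule closed_segment_commute)
    ultimately have "convex hull (pos ` e) \<inter> convex hull (pos ` e') \<subseteq> {pos (I, J, p)}" unfolding seg(1) by simp
    moreover have "(I, J, p) \<in> e \<inter> e'" using 2(1) by (simp add: e e')
    ultimately show ?thesis by blast
  next
    case 3
    then have "closed_segment (pos (I, J, q)) (pos (I, J, p)) \<inter> closed_segment (pos (I, J, q)) (pos (I, J, s)) \<subseteq> {pos (I, J, q)}"
      by (intro segments_meet) (simp add: cr)
    moreover have "convex hull (pos ` e) = closed_segment (pos (I, J, q)) (pos (I, J, p))"
      unfolding seg by (rule closed_segment_commute)
    ultimately have "convex hull (pos ` e) \<inter> convex hull (pos ` e') \<subseteq> {pos (I, J, q)}" unfolding seg(2) 3(1) by simp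
    moreover have "(I, J, q) \<in> e \<inter> e'" using 3(1) by (simp add: e e')
    ultimately show ?thesis by blast
  next
    case 4
    then have "closed_segment (pos (I, J, q)) (pos (I, J, p)) \<inter> closed_segment (pos (I, J, q)) (pos (I, J, r)) \<subseteq> {pos (I, J, q)}"
      by (intro segments_meet) (simp add: cr)
    moreover have "convex hull (pos ` e) = closed_segment (pos (I, J, q)) (pos (I, J, p))"
      unfolding seg by (rule closed_segment_commute)
    moreover have "convex hull (pos ` e') = closed_segment (pos (I, J, q)) (pos (I, J, r))"
      unfolding seg 4(1) by (rule closed_segment_commute)
    ultimately have "convex hull (pos ` e) \<inter> convex hull (pos ` e') \<subseteq> {pos (I, J, q)}" by simp
    moreover have "(I, J, q) \<in> e \<inter> e'" using 4(1) by (simp add: e e')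
    ultimately show ?thesis by blast
  next
    case 5
    then have "closed_segment (pos (I, J, p)) (pos (I, J, q)) \<inter> closed_segment (pos (I, J, r)) (pos (I, J, s)) = {}"
      by (intro segments_disjoint) (simp add: cr flip: of_int_mult)
    then show ?thesis unfolding seg by simp
  next
    case 6
    then have "closed_segment (pos (I, J, r)) (pos (I, J, s)) \<inter> closed_segment (pos (I, J, p)) (pos (I, J, q)) = {}"
      by (intro segments_disjoint) (simp add: cr flip: of_int_mult)
    then show ?thesis unfolding seg by blast
  qed
qed

lemma real_grid_le: "12 * real a \<le> 12 * real b + c \<Longrightarrow> c < 12 \<Longrightarrow> a \<le> b"
proof (rule ccontr)
  assume *: "12 * real a \<le> 12 * real b + c" "c < 12" "\<not> a \<le> b"
  then have "real b + 1 \<le> real a" by linarith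
  then show False using *(1,2) by linarith
qed

text \<open>Comparing coordinates modulo 12 leaves two ways in which distinct edges can meet: inner
  edges of the same tile, covered by the integer test, and a port edge with an inner edge, which
  share the port vertex.\<close>

lemma planar_tiling: "planar {u. isv \<tau> u} (edges_of (adjT \<tau>))"
proof (rule planar_straight_line[OF pos_inj simple_graph_tiling])
  fix v assume "v \<in> {u. isv \<tau> u}"
  then have "card {w. adjT \<tau> v w} = 3" using card_neighbours by simp
  then obtain w where "adjT \<tau> v w" by (metis (no_types, lifting) Collect_empty_eq card.empty zero_neq_numeral)
  then have "{v, w} \<in> edges_of (adjT \<tau>)" unfolding edges_of_def by blast
  then show "\<exists>e\<in>edges_of (adjT \<tau>). v \<in> e" by blast
next
  have in_right: "z \<in> pos ` (e \<inter> e')" if e: "inner I J e" "right_link I' J' e'"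
    and z: "z \<in> convex hull (pos ` e)" "z \<in> convex hull (pos ` e')" for e e' z I J I' J'
  proof -
    note p = inner_points[OF e(1) z(1)] and q = right_link_points[OF e(2) z(2)]
    have I: "I = I'" using real_grid_le[of I I' 5] real_grid_le[of I' I 5] p q by simp
    have "J' \<le> J" "J \<le> Suc J'"
      using real_grid_le[of J' J 0] real_grid_le[of J "Suc J'" 0] p q by simp_all
    then consider "J = J'" | "J = Suc J'" by linarith
    then show ?thesis
    proof cases
      case 1
      then have "Re z = 12 * real J + 10" using p(2) q(2) by simp
      from p(6)[OF this] show ?thesis using e(2) I 1 unfolding right_link_def by blast
    next
      case 2
      then have "Re z = 12 * real J" using p(1) q(3) by simp
      from p(5)[OF this] show ?thesis using e(2) I 2 unfolding right_link_def by blast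
    qed
  qed
  have in_up: "z \<in> pos ` (e \<inter> e')" if e: "inner I J e" "up_link I' J' e'"
    and z: "z \<in> convex hull (pos ` e)" "z \<in> convex hull (pos ` e')" for e e' z I J I' J'
  proof -
    note p = inner_points[OF e(1) z(1)] and q = up_link_points[OF e(2) z(2)]
    have J: "J = J'" using real_grid_le[of J J' 5] real_grid_le[of J' J 5] p q by simp
    have "I' \<le> I" "I \<le> Suc I'"
      using real_grid_le[of I' I 0] real_grid_le[of I "Suc I'" 0] p q by simp_all
    then consider "I = I'" | "I = Suc I'" by linarith
    then show ?thesis
    proof cases
      case 1
      then have "Im z = 12 * real I + 10" using p(4) q(2) by simp
      from p(8)[OF this] show ?thesis using e(2) J 1 unfolding up_link_def by blast
    next
      case 2
      then have "Im z = 12 * real I" using p(3) q(3) by simp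
      from p(7)[OF this] show ?thesis using e(2) J 2 unfolding up_link_def by blast
    qed
  qed
  \<comment> \<open>An upward port edge has real part 5 modulo 12, whereas the real parts on a port
    edge to the right lie between 10 and 12 modulo 12.\<close>
  have right_up: False if e: "right_link I J e" "up_link I' J' e'"
    and z: "z \<in> convex hull (pos ` e)" "z \<in> convex hull (pos ` e')" for e e' z I J I' J'
  proof -
    note p = right_link_points[OF e(1) z(1)] and q = up_link_points[OF e(2) z(2)]
    have "J' \<le> J" using real_grid_le[of J' J 7] p q by simp
    then have "real J' \<le> real J" by simp
    then show False using p q by linarith
  qed
  fix e e' assume e: "e \<in> edges_of (adjT \<tau>)" "e' \<in> edges_of (adjT \<tau>)" "e \<noteq> e'"
  show "convex hull (pos ` e) \<inter> convex hull (pos ` e') \<subseteq> pos ` (e \<inter> e')"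
  proof
    fix z assume zz: "z \<in> convex hull (pos ` e) \<inter> convex hull (pos ` e')"
    then have z: "z \<in> convex hull (pos ` e)" "z \<in> convex hull (pos ` e')" by auto
    obtain I J where k: "inner I J e \<or> right_link I J e \<or> up_link I J e" using edge_kinds[OF e(1)] by blast
    obtain I' J' where k': "inner I' J' e' \<or> right_link I' J' e' \<or> up_link I' J' e'" using edge_kinds[OF e(2)] by blast
    from k k' show "z \<in> pos ` (e \<inter> e')"
    proof (elim disjE)
      assume i: "inner I J e" "inner I' J' e'"
      note p = inner_points[OF i(1) z(1)] and q = inner_points[OF i(2) z(2)]
      have "I = I'" "J = J'"
        using real_grid_le[of I I' 10] real_grid_le[of I' I 10] real_grid_le[of J J' 10] real_grid_le[of J' J 10] p q
        by simp_all
      then show ?thesis using inner_inner_meet[of I J e e'] i e(3) zz by blast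
    next
      assume i: "right_link I J e" "right_link I' J' e'"
      note p = right_link_points[OF i(1) z(1)] and q = right_link_points[OF i(2) z(2)]
      have "I = I'" "J = J'" using real_grid_le[of J J' 2] real_grid_le[of J' J 2] p q by simp_all
      then show ?thesis using i e(3) unfolding right_link_def by simp
    next
      assume i: "up_link I J e" "up_link I' J' e'"
      note p = up_link_points[OF i(1) z(1)] and q = up_link_points[OF i(2) z(2)]
      have "I = I'" "J = J'" using real_grid_le[of I I' 2] real_grid_le[of I' I 2] p q by simp_all
      then show ?thesis using i e(3) unfolding up_link_def by simp
    next
      assume "inner I J e" "right_link I' J' e'"
      then show ?thesis using in_right z by blast
    next
      assume "inner I J e" "up_link I' J' e'"
      then show ?thesis using in_up z by blast
    next
      assume "right_link I J e" "inner I' J' e'"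
      then show ?thesis using in_right[of I' J' e' I J e z] z by (simp add: Int_commute)
    next
      assume "right_link I J e" "up_link I' J' e'"
      then show ?thesis using right_up z by blast
    next
      assume "up_link I J e" "inner I' J' e'"
      then show ?thesis using in_up[of I' J' e' I J e z] z by (simp add: Int_commute)
    next
      assume "up_link I J e" "right_link I' J' e'"
      then show ?thesis using right_up z by blast
    qed
  qed
qed

end

section \<open>Rectangular grids of tiles\<close>

text \<open>Cell (i, j) of the abstract grid sits at tile (2 i + 2, 2 j + 2). The odd positions in
  between and next to the border hold links, and every row and column is capped at index 0 and
  behind its last link, which makes the finite grid cubic.\<close>

definition grid_ty :: "nat \<Rightarrow> nat \<Rightarrow> (nat \<Rightarrow> nat \<Rightarrow> ty) \<Rightarrow> nat \<Rightarrow> nat \<Rightarrow> ty" where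
  "grid_ty R C ct I J =
    (if even I \<and> 2 \<le> I \<and> I \<le> 2 * R then
       (if J = 0 then CR else if J = 2 * C + 2 then CL else if 2 * C + 2 < J then TN
        else if odd J then TH else ct (I div 2 - 1) (J div 2 - 1))
     else if even J \<and> 2 \<le> J \<and> J \<le> 2 * C then
       (if I = 0 then CU else if I = 2 * R + 2 then CD else if 2 * R + 2 < I then TN else TV)
     else TN)"

definition core :: "ty set" where "core = {TX, TA, TS, TE}"

lemma hasp_simps [simp]:
  "ty \<in> core \<Longrightarrow> hasp ty dir" "ty \<in> core \<Longrightarrow> \<not> lnk ty"
  "hasp TH dir \<longleftrightarrow> dir = dL \<or> dir = dR" "hasp TV dir \<longleftrightarrow> dir = dD \<or> dir = dU"
  "hasp CL dir \<longleftrightarrow> dir = dL" "hasp CR dir \<longleftrightarrow> dir = dR" "hasp CD dir \<longleftrightarrow> dir = dD" "hasp CU dir \<longleftrightarrow> dir = dU"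
  "\<not> hasp TN dir" "lnk TH" "lnk TV" "\<not> lnk CL" "\<not> lnk CR" "\<not> lnk CD" "\<not> lnk CU" "\<not> lnk TN"
  by (cases dir; auto simp: hasp_def core_def lnk_def)+

fun cellrel :: "ty \<Rightarrow> bool \<Rightarrow> bool \<Rightarrow> bool \<Rightarrow> bool" where
  "cellrel TX l r v \<longleftrightarrow> r = (\<not> l)"
| "cellrel TA l r v \<longleftrightarrow> \<not> (l = r \<and> l \<noteq> v)"
| "cellrel TS l r v \<longleftrightarrow> r = v"
| "cellrel TE l r v \<longleftrightarrow> l = v"
| "cellrel _ l r v \<longleftrightarrow> True"

lemma trel_core: "ty \<in> core \<Longrightarrow> trel ty p \<longleftrightarrow> p dU = p dD \<and> cellrel ty (p dL) (p dR) (p dD)"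
  by (auto simp: core_def)

locale grid =
  fixes R C :: nat and ct :: "nat \<Rightarrow> nat \<Rightarrow> ty"
  assumes ct: "ct i j \<in> core"
begin

abbreviation "\<tau> \<equiv> grid_ty R C ct"

lemma hasp_R: "hasp (\<tau> I J) dR \<longleftrightarrow> even I \<and> 2 \<le> I \<and> I \<le> 2 * R \<and> J < 2 * C + 2"
  using ct by (auto simp: grid_ty_def)

lemma hasp_L: "hasp (\<tau> I J) dL \<longleftrightarrow> even I \<and> 2 \<le> I \<and> I \<le> 2 * R \<and> 0 < J \<and> J \<le> 2 * C + 2"
  using ct by (auto simp: grid_ty_def)

lemma hasp_U: "hasp (\<tau> I J) dU \<longleftrightarrow> even J \<and> 2 \<le> J \<and> J \<le> 2 * C \<and> I < 2 * R + 2"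
proof -
  have "odd (Suc (2 * C))" "even I \<Longrightarrow> \<not> I \<le> 2 * R \<Longrightarrow> I < 2 * R + 2 \<Longrightarrow> False" by presburger+
  then show ?thesis using ct by (auto simp: grid_ty_def)
qed

lemma hasp_D: "hasp (\<tau> I J) dD \<longleftrightarrow> even J \<and> 2 \<le> J \<and> J \<le> 2 * C \<and> 0 < I \<and> I \<le> 2 * R + 2"
  using ct by (auto simp: grid_ty_def)

lemma lnk_iff: "lnk (\<tau> I J) \<longleftrightarrow> (even I \<and> 2 \<le> I \<and> I \<le> 2 * R \<and> odd J \<and> J < 2 * C + 2) \<or>
   (even J \<and> 2 \<le> J \<and> J \<le> 2 * C \<and> odd I \<and> I < 2 * R + 2)"
  using ct by (auto simp: grid_ty_def; presburger)

sublocale tiling \<tau>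
proof
  show "hasp (\<tau> I J) dR = hasp (\<tau> I (Suc J)) dL" for I J unfolding hasp_R hasp_L by auto
  show "hasp (\<tau> I J) dU = hasp (\<tau> (Suc I) J) dD" for I J unfolding hasp_U hasp_D by auto
  show "\<not> hasp (\<tau> I 0) dL" "\<not> hasp (\<tau> 0 J) dD" for I J unfolding hasp_L hasp_D by auto
  show "lnk (\<tau> I J) \<noteq> lnk (\<tau> I (Suc J))" if "hasp (\<tau> I J) dR" for I J
    using that unfolding hasp_R lnk_iff by (auto; presburger)
  show "lnk (\<tau> I J) \<noteq> lnk (\<tau> (Suc I) J)" if "hasp (\<tau> I J) dU" for I J
    using that unfolding hasp_U lnk_iff by (auto; presburger)
  have "{(I, J). \<tau> I J \<noteq> TN} \<subseteq> {..2 * R + 2} \<times> {..2 * C + 2}"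
    by (auto simp: grid_ty_def split: if_splits)
  then show "finite {(I, J). \<tau> I J \<noteq> TN}" by (rule finite_subset) simp
qed

text \<open>All cells and links pass the vertical label on, so a column carries one value
  \<open>v j\<close>. The label \<open>h i j\<close> enters cell \<open>j\<close> of row
  \<open>i\<close> from the left and leaves the previous cell unchanged through the link between
  them.\<close>

theorem port_assignment_iff:
  "(\<exists>p. port_assignment p) \<longleftrightarrow>
    (\<exists>v h. \<forall>i<R. \<forall>j<C. cellrel (ct i j) (h i j) (h i (Suc j)) (v j))"
proof
  assume "\<exists>p. port_assignment p"
  then obtain p where tr: "\<And>I J. trel (\<tau> I J) (p I J)"
    and pR: "\<And>I J. hasp (\<tau> I J) dR \<Longrightarrow> p I J dR = p I (Suc J) dL"
    and pU: "\<And>I J. hasp (\<tau> I J) dU \<Longrightarrow> p I J dU = p (Suc I) J dD"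
    unfolding port_assignment_def by blast
  define v where "v j = p (2 * 0 + 2) (2 * j + 2) dD" for j
  define h where "h i j = p (2 * i + 2) (2 * j + 2) dL" for i j
  have cell: "\<tau> (2 * i + 2) (2 * j + 2) = ct i j" if "i < R" "j < C" for i j
    using that by (simp add: grid_ty_def)
  have vv: "p (2 * i + 2) (2 * j + 2) dD = v j" if "i < R" "j < C" for i j
    using that(1)
  proof (induction i)
    case (Suc i)
    have t: "\<tau> (2 * i + 2) (2 * j + 2) = ct i j" using cell[of i j] Suc.prems that(2) by simp
    have s4: "Suc (2 * i + 3) = 2 * Suc i + 2" by simp
    have V: "\<tau> (2 * i + 3) (2 * j + 2) = TV" using Suc.prems that(2) by (simp add: grid_ty_def; presburger)
    have "p (2 * i + 2) (2 * j + 2) dD = p (2 * i + 2) (2 * j + 2) dU"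
      using tr[of "2 * i + 2" "2 * j + 2"] unfolding t trel_core[OF ct] by simp
    also have "\<dots> = p (2 * i + 3) (2 * j + 2) dD"
      using pU[of "2 * i + 2" "2 * j + 2"] Suc.prems that(2) unfolding hasp_U by (simp add: numeral_3_eq_3)
    also have "\<dots> = p (2 * i + 3) (2 * j + 2) dU"
      using tr[of "2 * i + 3" "2 * j + 2"] unfolding V by simp
    also have "\<dots> = p (2 * Suc i + 2) (2 * j + 2) dD"
      using pU[of "2 * i + 3" "2 * j + 2"] Suc.prems that(2) s4 unfolding hasp_U by simp
    finally show ?case using Suc by simp
  qed (simp add: v_def)
  have hh: "p (2 * i + 2) (2 * j + 2) dR = h i (Suc j)" if "i < R" "j < C" for i j
  proof -
    have s4: "Suc (2 * j + 3) = 2 * Suc j + 2" by simp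
    have H: "\<tau> (2 * i + 2) (2 * j + 3) = TH" using that by (simp add: grid_ty_def; presburger)
    have "p (2 * i + 2) (2 * j + 2) dR = p (2 * i + 2) (2 * j + 3) dL"
      using pR[of "2 * i + 2" "2 * j + 2"] that unfolding hasp_R by (simp add: numeral_3_eq_3)
    also have "\<dots> = p (2 * i + 2) (2 * j + 3) dR" using tr[of "2 * i + 2" "2 * j + 3"] unfolding H by simp
    also have "\<dots> = h i (Suc j)"
      using pR[of "2 * i + 2" "2 * j + 3"] that s4 unfolding hasp_R h_def by simp
    finally show ?thesis .
  qed
  have "cellrel (ct i j) (h i j) (h i (Suc j)) (v j)" if "i < R" "j < C" for i j
    using tr[of "2 * i + 2" "2 * j + 2"] unfolding cell[OF that] trel_core[OF ct]
    by (simp only: vv[OF that] hh[OF that] flip: h_def)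
  then show "\<exists>v h. \<forall>i<R. \<forall>j<C. cellrel (ct i j) (h i j) (h i (Suc j)) (v j)" by blast
next
  assume "\<exists>v h. \<forall>i<R. \<forall>j<C. cellrel (ct i j) (h i j) (h i (Suc j)) (v j)"
  then obtain v h where vh: "\<And>i j. i < R \<Longrightarrow> j < C \<Longrightarrow> cellrel (ct i j) (h i j) (h i (Suc j)) (v j)" by blast
  \<comment> \<open>The rounding is chosen so that both sides of a horizontal link get the same
    index, while the two sides of the cell at column 2 j + 2 get \<open>j\<close> and
    \<open>j + 1\<close>.\<close>
  define p where "p I J = case_dir (h (I div 2 - 1) ((J - 1) div 2)) (h (I div 2 - 1) (J div 2))
     (v (J div 2 - 1)) (v (J div 2 - 1))" for I J :: nat
  have p: "p I J dL = h (I div 2 - 1) ((J - 1) div 2)" "p I J dR = h (I div 2 - 1) (J div 2)"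
    "p I J dD = v (J div 2 - 1)" "p I J dU = v (J div 2 - 1)" for I J by (simp_all add: p_def)
  have "trel (\<tau> I J) (p I J)" for I J
  proof (cases "even I \<and> 2 \<le> I \<and> I \<le> 2 * R \<and> even J \<and> 0 < J \<and> J < 2 * C + 2")
    case True
    then obtain a b where ab: "I = 2 * a" "J = 2 * b" by (auto elim!: evenE)
    define i j where "i = a - 1" and "j = b - 1"
    have ij: "I = 2 * i + 2" "J = 2 * j + 2" "i < R" "j < C" using True ab by (auto simp: i_def j_def)
    have "\<tau> I J = ct i j" using ij by (simp add: grid_ty_def)
    then show ?thesis using vh[OF ij(3,4)] by (simp add: trel_core[OF ct] p ij)
  next
    case False
    have "(J - 1) div 2 = J div 2" if "odd J" using that by (auto elim!: oddE)
    then show ?thesis using False by (auto simp: grid_ty_def p)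
  qed
  then have "port_assignment p" unfolding port_assignment_def by (simp add: p)
  then show "\<exists>p. port_assignment p" by blast
qed

end

section \<open>Rows as clauses and grids as CNF formulas\<close>

definition row_type :: "nat \<Rightarrow> nat \<Rightarrow> nat set \<Rightarrow> nat \<Rightarrow> ty" where
  "row_type a b L j = (if j = a then TS else if j = b then TE else if j \<in> L then TA else TX)"

text \<open>Call \<open>v j \<noteq> odd j\<close> the corrected value of column \<open>j\<close>. A
  wire started in column \<open>a\<close> is inverted at every crossing, so it arrives at column
  \<open>j\<close> with label \<open>v j\<close> exactly if the corrected values of \<open>j\<close>
  and \<open>a\<close> differ. Only then may \<open>TA\<close> break the alternation or
  \<open>TE\<close> accept an unbroken wire. A row without literals thus expresses that two columns
  differ, and in general it is a clause in which the value of column \<open>a\<close> counts as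
  false.\<close>

lemma row_type_sat:
  assumes ab: "a < b" and L: "L \<subseteq> {a<..<b}" and bC: "b < C"
  shows "(\<exists>h. \<forall>j<C. cellrel (row_type a b L j) (h j) (h (Suc j)) (v j)) \<longleftrightarrow>
    (\<exists>j\<in>insert b L. (v j \<noteq> odd j) \<noteq> (v a \<noteq> odd a))"
proof
  assume "\<exists>h. \<forall>j<C. cellrel (row_type a b L j) (h j) (h (Suc j)) (v j)"
  then obtain h where h: "\<And>j. j < C \<Longrightarrow> cellrel (row_type a b L j) (h j) (h (Suc j)) (v j)" by blast
  define c where "c = (v a \<noteq> odd a)"
  show "\<exists>j\<in>insert b L. (v j \<noteq> odd j) \<noteq> (v a \<noteq> odd a)"
  proof (rule ccontr)
    assume "\<not> ?thesis"
    then have eq: "v j \<longleftrightarrow> c \<noteq> odd j" if "j \<in> insert b L" for j using that by (auto simp: c_def)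
    \<comment> \<open>If no column differs from column \<open>a\<close>, the alternation cannot be
      broken on the way, and the wire reaches \<open>b\<close> with the wrong label.\<close>
    have "Suc (a + k) \<le> b \<longrightarrow> h (Suc (a + k)) = (c \<noteq> even (Suc (a + k)))" for k
    proof (induction k)
      case 0
      have "h (Suc a) = v a" using h[of a] ab bC by (simp add: row_type_def)
      then show ?case by (auto simp: c_def)
    next
      case (Suc k)
      show ?case
      proof
        assume le: "Suc (a + Suc k) \<le> b"
        let ?j = "Suc (a + k)"
        have IH: "h ?j = (c \<noteq> even ?j)" using Suc le by simp
        have "h (Suc ?j) = (\<not> h ?j)"
          using h[of ?j] le bC eq[of ?j] IH by (cases "?j \<in> L") (auto simp: row_type_def)
        then show "h (Suc (a + Suc k)) = (c \<noteq> even (Suc (a + Suc k)))" using IH by auto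
      qed
    qed
    from this[of "b - Suc a"] have "h b = (c \<noteq> even b)" using ab by simp
    moreover have "h b = v b" using h[of b] ab bC by (simp add: row_type_def)
    ultimately show False using eq[of b] by auto
  qed
next
  assume "\<exists>j\<in>insert b L. (v j \<noteq> odd j) \<noteq> (v a \<noteq> odd a)"
  then obtain j0 where j0: "j0 \<in> insert b L" "(v j0 \<noteq> odd j0) \<noteq> (v a \<noteq> odd a)" by blast
  have j0ab: "a < j0" "j0 \<le> b" using j0(1) L ab by auto
  define c where "c = (v a \<noteq> odd a)"
  \<comment> \<open>The polarity that column \<open>b\<close> accepts. The wire runs with polarity
    \<open>c\<close> up to \<open>j0\<close> and with \<open>c'\<close> from there on; before
    \<open>a\<close> and after \<open>b\<close> plain alternation satisfies all crossings.\<close>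
  define c' where "c' = (v b = odd b)"
  define h where "h j = (if j \<le> a then even j else if j \<le> j0 then c \<noteq> even j
     else if j \<le> b then c' \<noteq> even j else even j)" for j
  have "cellrel (row_type a b L j) (h j) (h (Suc j)) (v j)" for j
  proof -
    consider "j < a" | "j = a" | "a < j" "j < j0" | "j = j0" "j0 < b" | "j = b" | "j0 < j" "j < b" | "b < j"
      using j0ab by linarith
    then show ?thesis
    proof cases
      case 1
      then have "j \<notin> L" using L by auto
      then show ?thesis using 1 ab by (auto simp: row_type_def h_def)
    next
      case 2
      then show ?thesis using j0ab by (auto simp: row_type_def h_def c_def)
    next
      case 3
      then have "h (Suc j) = (\<not> h j)" by (auto simp: h_def)
      then show ?thesis using 3 j0ab by (auto simp: row_type_def)
    next
      case 4
      then have "h j = v j" using j0ab j0(2) by (auto simp: h_def c_def)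
      moreover have "row_type a b L j = TA" using 4 j0ab j0(1) by (auto simp: row_type_def)
      ultimately show ?thesis by auto
    next
      case 5
      have "h b = v b" using j0ab j0(2) ab by (cases "j0 = b") (auto simp: h_def c_def c'_def)
      then show ?thesis using 5 ab by (auto simp: row_type_def)
    next
      case 6
      then have "h (Suc j) = (\<not> h j)" using j0ab by (auto simp: h_def)
      then show ?thesis using 6 j0ab by (auto simp: row_type_def)
    next
      case 7
      then have "j \<notin> L" using L by auto
      then show ?thesis using 7 ab j0ab by (auto simp: row_type_def h_def)
    qed
  qed
  then show "\<exists>h. \<forall>j<C. cellrel (row_type a b L j) (h j) (h (Suc j)) (v j)" by blast
qed

lemma blank_row_sat: "\<exists>h. \<forall>j<C. cellrel TX (h j) (h (Suc j)) (v j)"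
  by (rule exI[of _ even]) simp

text \<open>Columns 2 y + 2 and 2 y + 3 carry the literals of variable \<open>y\<close>, kept
  complementary by row y + 2. Column 0 stands for false, and the column \<open>2 * nv + 2\<close>
  where clause rows end must be false as well, or every clause would hold trivially. Rows without
  literals express inequalities only, so this equality takes two rows and the auxiliary column 1.
  Indices outside \<open>g\<close> give blank rows, so the numbering of clauses may have
  gaps.\<close>

definition cnf_cell :: "nat \<Rightarrow> (nat \<Rightarrow> bool) \<Rightarrow> (nat \<Rightarrow> nat \<Rightarrow> bool \<Rightarrow> bool) \<Rightarrow> nat \<Rightarrow> nat \<Rightarrow> ty" where
  "cnf_cell nv g lit i j =
    (if i = 0 then row_type 0 1 {} j
     else if i = 1 then row_type 1 (2 * nv + 2) {} j
     else if i < nv + 2 then row_type (2 * (i - 2) + 2) (2 * (i - 2) + 3) {} j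
     else if g (i - (nv + 2)) then row_type 0 (2 * nv + 2)
       ({2 * y + 2 | y. y < nv \<and> lit (i - (nv + 2)) y True} \<union> {2 * y + 3 | y. y < nv \<and> lit (i - (nv + 2)) y False}) j
     else TX)"

lemma cnf_cell_core: "cnf_cell nv g lit i j \<in> core"
  by (auto simp: cnf_cell_def row_type_def core_def)

lemma cnf_grid_sat:
  "(\<exists>v h. \<forall>i<nv + 2 + M. \<forall>j<2 * nv + 3. cellrel (cnf_cell nv g lit i j) (h i j) (h i (Suc j)) (v j)) \<longleftrightarrow>
   (\<exists>\<alpha>. \<forall>i<M. g i \<longrightarrow> (\<exists>y<nv. \<exists>s. lit i y s \<and> \<alpha> y = s))"
proof -
  define Lit where "Lit i = {2 * y + 2 | y. y < nv \<and> lit i y True} \<union> {2 * y + 3 | y. y < nv \<and> lit i y False}" for i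
  define row where "row v i \<longleftrightarrow> (\<exists>h. \<forall>j<2 * nv + 3. cellrel (cnf_cell nv g lit i j) (h j) (h (Suc j)) (v j))" for v i
  define w where "w v j = (v j \<noteq> odd j)" for v and j :: nat
  \<comment> \<open>For fixed column values the rows are independent, so the horizontal labels can
    be chosen row by row.\<close>
  have "(\<exists>v h. \<forall>i<nv + 2 + M. \<forall>j<2 * nv + 3. cellrel (cnf_cell nv g lit i j) (h i j) (h i (Suc j)) (v j)) \<longleftrightarrow>
    (\<exists>v. \<forall>i<nv + 2 + M. row v i)"
    unfolding row_def by (intro ex_cong1) meson
  also have "\<dots> \<longleftrightarrow> (\<exists>v. row v 0 \<and> row v 1 \<and> (\<forall>y<nv. row v (y + 2)) \<and> (\<forall>i<M. row v (i + (nv + 2))))"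
  proof (intro ex_cong1 iffI conjI allI impI)
    fix v i assume *: "row v 0 \<and> row v 1 \<and> (\<forall>y<nv. row v (y + 2)) \<and> (\<forall>i<M. row v (i + (nv + 2)))"
      and i: "i < nv + 2 + M"
    consider "i = 0" | "i = 1" | "2 \<le> i" "i < nv + 2" | "nv + 2 \<le> i" by linarith
    then show "row v i"
    proof cases
      case 3
      define y where "y = i - 2"
      have "i = y + 2" "y < nv" using 3 by (auto simp: y_def)
      then show ?thesis using * by blast
    next
      case 4
      define l where "l = i - (nv + 2)"
      have "i = l + (nv + 2)" "l < M" using 4 i by (auto simp: l_def)
      then show ?thesis using * by blast
    qed (use * in auto)
  qed auto
  also have "\<dots> \<longleftrightarrow> (\<exists>v. w v 1 \<noteq> w v 0 \<and> w v (2 * nv + 2) \<noteq> w v 1 \<and> (\<forall>y<nv. w v (2 * y + 3) \<noteq> w v (2 * y + 2)) \<and>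
      (\<forall>i<M. g i \<longrightarrow> (\<exists>j\<in>insert (2 * nv + 2) (Lit i). w v j \<noteq> w v 0)))"
  proof -
    have c: "cnf_cell nv g lit 0 = row_type 0 1 {}" "cnf_cell nv g lit 1 = row_type 1 (2 * nv + 2) {}"
      "y < nv \<Longrightarrow> cnf_cell nv g lit (y + 2) = row_type (2 * y + 2) (2 * y + 3) {}"
      "g i \<Longrightarrow> cnf_cell nv g lit (i + (nv + 2)) = row_type 0 (2 * nv + 2) (Lit i)"
      "\<not> g i \<Longrightarrow> cnf_cell nv g lit (i + (nv + 2)) j = TX" for y i j
      by (auto simp: cnf_cell_def Lit_def fun_eq_iff)
    have "row v 0 \<longleftrightarrow> w v 1 \<noteq> w v 0" for v
      unfolding row_def c by (subst row_type_sat) (auto simp: w_def)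
    moreover have "row v 1 \<longleftrightarrow> w v (2 * nv + 2) \<noteq> w v 1" for v
      unfolding row_def c by (subst row_type_sat) (auto simp: w_def)
    moreover have "row v (y + 2) \<longleftrightarrow> w v (2 * y + 3) \<noteq> w v (2 * y + 2)" if "y < nv" for v y
      unfolding row_def c(3)[OF that] by (subst row_type_sat) (use that in \<open>auto simp: w_def\<close>)
    moreover have "row v (i + (nv + 2)) \<longleftrightarrow> (g i \<longrightarrow> (\<exists>j\<in>insert (2 * nv + 2) (Lit i). w v j \<noteq> w v 0))" for v i
    proof (cases "g i")
      case True
      have "Lit i \<subseteq> {0<..<2 * nv + 2}" by (auto simp: Lit_def)
      then show ?thesis unfolding row_def c(4)[OF True] w_def by (subst row_type_sat) (use True in simp_all)
    next
      case False
      then show ?thesis unfolding row_def c(5)[OF False] using blank_row_sat by simp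
    qed
    ultimately show ?thesis by (intro ex_cong1) simp
  qed
  also have "\<dots> \<longleftrightarrow> (\<exists>\<alpha>. \<forall>i<M. g i \<longrightarrow> (\<exists>y<nv. \<exists>s. lit i y s \<and> \<alpha> y = s))"
  proof
    assume "\<exists>v. w v 1 \<noteq> w v 0 \<and> w v (2 * nv + 2) \<noteq> w v 1 \<and> (\<forall>y<nv. w v (2 * y + 3) \<noteq> w v (2 * y + 2)) \<and>
      (\<forall>i<M. g i \<longrightarrow> (\<exists>j\<in>insert (2 * nv + 2) (Lit i). w v j \<noteq> w v 0))"
    then obtain v where v: "w v (2 * nv + 2) = w v 0" "\<And>y. y < nv \<Longrightarrow> w v (2 * y + 3) \<noteq> w v (2 * y + 2)"
      "\<And>i. i < M \<Longrightarrow> g i \<Longrightarrow> \<exists>j\<in>insert (2 * nv + 2) (Lit i). w v j \<noteq> w v 0" by auto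
    have "\<exists>y<nv. \<exists>s. lit i y s \<and> (w v (2 * y + 2) \<noteq> w v 0) = s" if "i < M" "g i" for i
      using v(3)[OF that] v(1,2) unfolding Lit_def by blast
    then show "\<exists>\<alpha>. \<forall>i<M. g i \<longrightarrow> (\<exists>y<nv. \<exists>s. lit i y s \<and> \<alpha> y = s)"
      by (intro exI[of _ "\<lambda>y. w v (2 * y + 2) \<noteq> w v 0"]) blast
  next
    assume "\<exists>\<alpha>. \<forall>i<M. g i \<longrightarrow> (\<exists>y<nv. \<exists>s. lit i y s \<and> \<alpha> y = s)"
    then obtain \<alpha> where \<alpha>: "\<And>i. i < M \<Longrightarrow> g i \<Longrightarrow> \<exists>y<nv. \<exists>s. lit i y s \<and> \<alpha> y = s" by blast
    \<comment> \<open>The corrected column values that belong to \<open>\<alpha>\<close>; the labels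
      \<open>v\<close> below undo the parity correction.\<close>
    define u where "u j = (if j = 0 \<or> j = 2 * nv + 2 then False else if j = 1 then True
      else if even j then \<alpha> (j div 2 - 1) else \<not> \<alpha> (j div 2 - 1))" for j :: nat
    define v where "v j = (u j \<noteq> odd j)" for j
    have w: "w v j = u j" for j by (auto simp: w_def v_def)
    have u: "u 0 = False" "u 1 = True" "u (2 * nv + 2) = False" "y < nv \<Longrightarrow> u (2 * y + 2) = \<alpha> y"
      "y < nv \<Longrightarrow> u (2 * y + 3) = (\<not> \<alpha> y)" for y
      by (auto simp: u_def)
    have "\<exists>j\<in>insert (2 * nv + 2) (Lit i). u j \<noteq> u 0" if i: "i < M" "g i" for i
    proof -
      obtain y where y: "y < nv" "lit i y (\<alpha> y)" using \<alpha>[OF i] by blast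
      show ?thesis
      proof (cases "\<alpha> y")
        case True
        then have "2 * y + 2 \<in> Lit i" using y by (auto simp: Lit_def)
        then show ?thesis using u(1) u(4)[OF y(1)] True by auto
      next
        case False
        then have "2 * y + 3 \<in> Lit i" using y by (auto simp: Lit_def)
        then show ?thesis using u(1) u(5)[OF y(1)] False by auto
      qed
    qed
    then show "\<exists>v. w v 1 \<noteq> w v 0 \<and> w v (2 * nv + 2) \<noteq> w v 1 \<and> (\<forall>y<nv. w v (2 * y + 3) \<noteq> w v (2 * y + 2)) \<and>
      (\<forall>i<M. g i \<longrightarrow> (\<exists>j\<in>insert (2 * nv + 2) (Lit i). w v j \<noteq> w v 0))"
      using u by (intro exI[of _ v]) (simp add: w)
  qed
  finally show ?thesis .
qed

section \<open>Renumbering of vertices and codes of graphs\<close>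

lemma planar_iso:
  assumes f: "bij_betw f V' V" and E': "\<And>e. e \<in> E' \<Longrightarrow> e \<subseteq> V' \<and> f ` e \<in> E" and "planar V E"
  shows "planar V' E'"
proof -
  obtain pos :: "'b \<Rightarrow> complex" and \<gamma> where p: "inj_on pos V"
    "\<forall>e\<in>E. arc (\<gamma> e) \<and> {pathstart (\<gamma> e), pathfinish (\<gamma> e)} = pos ` e \<and> path_image (\<gamma> e) \<inter> pos ` V = pos ` e"
    "\<forall>e\<in>E. \<forall>e'\<in>E. e \<noteq> e' \<longrightarrow> path_image (\<gamma> e) \<inter> path_image (\<gamma> e') = pos ` (e \<inter> e')"
    using assms(3) unfolding planar_def by (elim exE conjE) (rule that, assumption+)
  have inj: "inj_on f V'" and im: "f ` V' = V" using f by (auto simp: bij_betw_def)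
  show ?thesis
    unfolding planar_def
  proof (intro exI[of _ "pos \<circ> f"] exI[of _ "\<lambda>e. \<gamma> (f ` e)"] conjI ballI impI)
    show "inj_on (pos \<circ> f) V'" using inj im p(1) by (simp add: comp_inj_on)
  next
    fix e assume e: "e \<in> E'"
    note q = bspec[OF p(2) conjunct2[OF E'[OF e]]]
    show "arc (\<gamma> (f ` e))" using q by (elim conjE)
    show "{pathstart (\<gamma> (f ` e)), pathfinish (\<gamma> (f ` e))} = (pos \<circ> f) ` e"
      unfolding image_comp[symmetric] using q by (elim conjE)
    show "path_image (\<gamma> (f ` e)) \<inter> (pos \<circ> f) ` V' = (pos \<circ> f) ` e"
      unfolding image_comp[symmetric] im using q by (elim conjE)
  next
    fix e e' assume e: "e \<in> E'" "e' \<in> E'" "e \<noteq> e'"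
    have sub: "e \<subseteq> V'" "e' \<subseteq> V'" using E' e by auto
    then have ne: "f ` e \<noteq> f ` e'" using e(3) inj_on_image_eq_iff[OF inj] by blast
    have "path_image (\<gamma> (f ` e)) \<inter> path_image (\<gamma> (f ` e')) = pos ` (f ` e \<inter> f ` e')"
      by (rule bspec[OF bspec[OF p(3) conjunct2[OF E'[OF e(1)]]] conjunct2[OF E'[OF e(2)]], THEN mp, OF ne])
    also have "f ` e \<inter> f ` e' = f ` (e \<inter> e')" using inj_on_image_Int[OF inj sub] by simp
    finally show "path_image (\<gamma> (f ` e)) \<inter> path_image (\<gamma> (f ` e')) = (pos \<circ> f) ` (e \<inter> e')"
      unfolding image_comp[symmetric] .
  qed
qed

text \<open>The products range over all edges at a vertex, so the edges of the two graphs have to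
  correspond exactly, whereas for planarity it is enough that edges are mapped to edges.\<close>

lemma labeling_iso:
  assumes f: "bij_betw f V' V" and E': "\<And>e. e \<in> E' \<longleftrightarrow> e \<subseteq> V' \<and> f ` e \<in> E" and E: "\<And>e. e \<in> E \<Longrightarrow> e \<subseteq> V"
    and "edge_labeling_by_product k E F"
  shows "edge_labeling_by_product k E' (\<lambda>e. F (f ` e))"
proof -
  have inj: "inj_on f V'" and im: "f ` V' = V" using f by (auto simp: bij_betw_def)
  have F: "F \<in> E \<rightarrow> {1..k}" "\<And>u v. {u, v} \<in> E \<Longrightarrow> (\<Prod>e\<in>{e \<in> E. u \<in> e}. F e) \<noteq> (\<Prod>e\<in>{e \<in> E. v \<in> e}. F e)"
    using assms(4) unfolding edge_labeling_by_product_def proper_coloring_def by blast+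
  have inc: "{e \<in> E. f v \<in> e} = image f ` {e \<in> E'. v \<in> e}" "inj_on (image f) {e \<in> E'. v \<in> e}" if v: "v \<in> V'" for v
  proof -
    show "inj_on (image f) {e \<in> E'. v \<in> e}"
      by (rule inj_onI) (use E' inj in \<open>auto simp: inj_on_image_eq_iff\<close>)
    show "{e \<in> E. f v \<in> e} = image f ` {e \<in> E'. v \<in> e}"
    proof (intro equalityI subsetI)
      fix e assume e: "e \<in> {e \<in> E. f v \<in> e}"
      define e' where "e' = {u \<in> V'. f u \<in> e}"
      have "f ` e' = e" using E e im by (auto simp: e'_def)
      then have "e' \<in> {e \<in> E'. v \<in> e}" using E' e v by (auto simp: e'_def)
      then show "e \<in> image f ` {e \<in> E'. v \<in> e}" using \<open>f ` e' = e\<close> by blast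
    qed (use E' in auto)
  qed
  have prod: "(\<Prod>e\<in>{e \<in> E'. v \<in> e}. F (f ` e)) = (\<Prod>e\<in>{e \<in> E. f v \<in> e}. F e)" if "v \<in> V'" for v
    unfolding inc(1)[OF that] by (subst prod.reindex[OF inc(2)[OF that]]) simp
  show ?thesis
    unfolding edge_labeling_by_product_def proper_coloring_def
  proof (intro conjI allI impI)
    show "(\<lambda>e. F (f ` e)) \<in> E' \<rightarrow> {1..k}" using F(1) E' by auto
    fix u v assume uv: "{u, v} \<in> E'"
    then have "u \<in> V'" "v \<in> V'" "{f u, f v} \<in> E" using E'[of "{u, v}"] by auto
    then show "(\<Prod>e\<in>{e \<in> E'. u \<in> e}. F (f ` e)) \<noteq> (\<Prod>e\<in>{e \<in> E'. v \<in> e}. F (f ` e))"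
      using F(2)[of "f u" "f v"] prod by simp
  qed
qed

definition list_graph :: "'a list \<Rightarrow> ('a \<Rightarrow> 'a \<Rightarrow> bool) \<Rightarrow> nat set set" where
  "list_graph vs A = {{i, j} | i j. i < length vs \<and> j < length vs \<and> A (vs ! i) (vs ! j)}"

lemma graph_code_list_graph:
  assumes sym: "\<And>u v. A u v \<Longrightarrow> A v u"
  shows "graph_code (length vs) (list_graph vs A) = concat (map (\<lambda>u. map (A u) vs) vs)"
proof -
  have mem: "{i, j} \<in> list_graph vs A \<longleftrightarrow> A (vs ! i) (vs ! j)" if "i < length vs" "j < length vs" for i j
    using that sym unfolding list_graph_def by (auto simp: doubleton_eq_iff)
  have "map (\<lambda>i. map (\<lambda>j. {i, j} \<in> list_graph vs A) [0..<length vs]) [0..<length vs] =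
    map (\<lambda>i. map (\<lambda>j. A (vs ! i) (vs ! j)) [0..<length vs]) [0..<length vs]"
    by (rule map_cong[OF refl], rule map_cong[OF refl]) (simp add: mem)
  also have "\<dots> = map (\<lambda>i. map (A (vs ! i)) vs) [0..<length vs]"
    by (rule map_cong[OF refl]) (rule nth_equalityI, simp_all)
  also have "\<dots> = map (\<lambda>u. map (A u) vs) vs"
    by (rule nth_equalityI) simp_all
  finally show ?thesis unfolding graph_code_def by simp
qed

lemma list_graph_iso:
  assumes sym: "\<And>u v. A u v \<Longrightarrow> A v u" and vs: "distinct vs" and V: "\<And>u v. A u v \<Longrightarrow> u \<in> set vs \<and> v \<in> set vs"
  shows "bij_betw ((!) vs) {..<length vs} (set vs)"
    "e \<in> list_graph vs A \<longleftrightarrow> e \<subseteq> {..<length vs} \<and> (!) vs ` e \<in> edges_of A"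
proof -
  show bij: "bij_betw ((!) vs) {..<length vs} (set vs)" by (rule bij_betw_nth[OF vs]) auto
  show "e \<in> list_graph vs A \<longleftrightarrow> e \<subseteq> {..<length vs} \<and> (!) vs ` e \<in> edges_of A"
  proof
    assume "e \<in> list_graph vs A"
    then show "e \<subseteq> {..<length vs} \<and> (!) vs ` e \<in> edges_of A"
      unfolding list_graph_def edges_of_def by auto
  next
    assume a: "e \<subseteq> {..<length vs} \<and> (!) vs ` e \<in> edges_of A"
    then obtain u v where uv: "(!) vs ` e = {u, v}" "A u v" unfolding edges_of_def by auto
    obtain i where i: "i \<in> e" "vs ! i = u" using uv(1) by (metis image_iff insertI1)
    obtain j where j: "j \<in> e" "vs ! j = v" using uv(1) by (metis image_iff insertI1 insert_commute)
    have inj: "inj_on ((!) vs) {..<length vs}" using bij by (simp add: bij_betw_def)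
    have "e = {i, j}"
    proof (rule inj_on_image_eq_iff[THEN iffD1, OF inj])
      show "(!) vs ` e = (!) vs ` {i, j}" using uv(1) i j by simp
    qed (use a i j in auto)
    then show "e \<in> list_graph vs A" using a uv(2) i j unfolding list_graph_def by auto
  qed
qed

text \<open>The length of the code is the square of \<open>n\<close>, and the matrix determines all
  pairs below \<open>n\<close>. Hence membership in \<open>graph_codes\<close> is a property of the
  encoded graph and not of one of several representations.\<close>

lemma graph_code_inj:
  assumes "simple_graph {..<n} E" "simple_graph {..<n'} E'" "graph_code n E = graph_code n' E'"
  shows "n = n' \<and> E = E'"
proof -
  have len: "length (graph_code n E) = n * n" for n E
    unfolding graph_code_def length_concat by (simp add: o_def sum_list_triv)
  have "n ^ 2 = n' ^ 2" using len[of n E] len[of n' E'] assms(3) by (simp add: power2_eq_square)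
  then have n: "n = n'" by (rule power_eq_imp_eq_base) simp_all
  have "map (\<lambda>i. map (\<lambda>j. {i, j} \<in> E) [0..<n]) [0..<n] = map (\<lambda>i. map (\<lambda>j. {i, j} \<in> E') [0..<n]) [0..<n]"
    using assms(3) unfolding graph_code_def n[symmetric]
    by (rule concat_injective) (auto simp: set_zip)
  then have eq: "{i, j} \<in> E \<longleftrightarrow> {i, j} \<in> E'" if "i < n" "j < n" for i j
    using that by (auto simp: map_eq_conv)
  have "e \<in> E \<longleftrightarrow> e \<in> E'" for e
  proof -
    have "\<exists>i j. e = {i, j} \<and> i < n \<and> j < n" if "e \<in> E \<or> e \<in> E'"
    proof -
      have "card e = 2" "e \<subseteq> {..<n}" using that assms(1,2) n unfolding simple_graph_def by auto
      then show ?thesis by (auto simp: card_2_iff)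
    qed
    then show ?thesis using eq by blast
  qed
  then show ?thesis using n by blast
qed

section \<open>Structured programs on multi-tape machines\<close>

text \<open>\<open>Act\<close> rewrites the scanned cells and moves all heads in one step; the other
  constructors are pure control. The control state during a run is the stack of programs that are
  still to be executed.\<close>

datatype low = Skip | Act "nat list \<Rightarrow> (nat \<times> head_move) list" | Seqn low low
  | Ite "nat list \<Rightarrow> bool" low low | Loop "nat list \<Rightarrow> bool" low

definition noact :: "nat list \<Rightarrow> (nat \<times> head_move) list" where
  "noact ss = map (\<lambda>s. (s, Move_Stay)) ss"

fun lnext :: "low list \<Rightarrow> nat list \<Rightarrow> (low list \<times> (nat \<times> head_move) list) option" where
  "lnext [] ss = None"
| "lnext (Skip # k) ss = Some (k, noact ss)"
| "lnext (Act f # k) ss = Some (k, f ss)"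
| "lnext (Seqn a b # k) ss = Some (a # b # k, noact ss)"
| "lnext (Ite P a b # k) ss = Some ((if P ss then a else b) # k, noact ss)"
| "lnext (Loop P a # k) ss = Some (if P ss then a # Loop P a # k else k, noact ss)"

fun lstep :: "low list \<times> tape list \<Rightarrow> low list \<times> tape list" where
  "lstep (k, ts) = (case lnext k (map tape_read ts) of None \<Rightarrow> (k, ts)
     | Some (k', acts) \<Rightarrow> (k', map2 tape_act acts ts))"

text \<open>The number of steps does not depend on the stack \<open>k\<close> underneath. This
  uniformity makes the relation compositional, since every construct runs its parts on top of a
  larger stack.\<close>

definition exe :: "low \<Rightarrow> tape list \<Rightarrow> nat \<Rightarrow> tape list \<Rightarrow> bool" where
  "exe c ts T ts' \<longleftrightarrow> (\<exists>t\<le>T. \<forall>k. (lstep ^^ t) (c # k, ts) = (k, ts'))"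

lemma tape_act_noact: "map2 tape_act (noact (map tape_read ts)) ts = ts"
proof (induction ts)
  case (Cons t ts)
  then show ?case by (cases t) (simp add: noact_def)
qed (simp add: noact_def)

lemma exe_Skip: "1 \<le> T \<Longrightarrow> exe Skip ts T ts"
  unfolding exe_def by (rule exI[of _ 1]) (simp add: tape_act_noact)

lemma exe_Act: "1 \<le> T \<Longrightarrow> ts' = map2 tape_act (f (map tape_read ts)) ts \<Longrightarrow> exe (Act f) ts T ts'"
  unfolding exe_def by (rule exI[of _ 1]) simp

lemma exe_mono: "exe c ts T ts' \<Longrightarrow> T \<le> T' \<Longrightarrow> exe c ts T' ts'"
  unfolding exe_def by (meson le_trans)

lemma lsteps_add: "(lstep ^^ t) c = c' \<Longrightarrow> (lstep ^^ t') c' = c'' \<Longrightarrow> (lstep ^^ (t + t')) c = c''"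
  by (simp only: add.commute[of t] funpow_add comp_apply)

lemma exe_Seqn:
  assumes "exe a ts T1 ts1" "exe b ts1 T2 ts2" "1 + T1 + T2 \<le> T"
  shows "exe (Seqn a b) ts T ts2"
proof -
  obtain t1 t2 where t: "t1 \<le> T1" "t2 \<le> T2" "\<And>k. (lstep ^^ t1) (a # k, ts) = (k, ts1)"
    "\<And>k. (lstep ^^ t2) (b # k, ts1) = (k, ts2)"
    using assms(1,2) unfolding exe_def by blast
  have "(lstep ^^ (1 + (t1 + t2))) (Seqn a b # k, ts) = (k, ts2)" for k
    by (rule lsteps_add[OF _ lsteps_add[OF t(3) t(4)]]) (simp add: tape_act_noact)
  moreover have "1 + (t1 + t2) \<le> T" using t(1,2) assms(3) by linarith
  ultimately show ?thesis unfolding exe_def by blast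
qed

lemma exe_Ite:
  assumes "exe (if P (map tape_read ts) then a else b) ts T1 ts1" "1 + T1 \<le> T"
  shows "exe (Ite P a b) ts T ts1"
proof -
  obtain t1 where t: "t1 \<le> T1"
    "\<And>k. (lstep ^^ t1) ((if P (map tape_read ts) then a else b) # k, ts) = (k, ts1)"
    using assms(1) unfolding exe_def by blast
  have "(lstep ^^ (1 + t1)) (Ite P a b # k, ts) = (k, ts1)" for k
    by (rule lsteps_add[OF _ t(2)]) (simp add: tape_act_noact)
  moreover have "1 + t1 \<le> T" using t(1) assms(2) by linarith
  ultimately show ?thesis unfolding exe_def by blast
qed

lemma exe_Loop_False:
  assumes "\<not> P (map tape_read ts)" "1 \<le> T"
  shows "exe (Loop P a) ts T ts"
  unfolding exe_def by (rule exI[of _ 1]) (use assms in \<open>simp add: tape_act_noact\<close>)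

lemma exe_Loop_True:
  assumes "P (map tape_read ts)" "exe a ts T1 ts1" "exe (Loop P a) ts1 T2 ts2" "1 + T1 + T2 \<le> T"
  shows "exe (Loop P a) ts T ts2"
proof -
  obtain t1 t2 where t: "t1 \<le> T1" "t2 \<le> T2" "\<And>k. (lstep ^^ t1) (a # k, ts) = (k, ts1)"
    "\<And>k. (lstep ^^ t2) (Loop P a # k, ts1) = (k, ts2)"
    using assms(2,3) unfolding exe_def by blast
  have "(lstep ^^ (1 + (t1 + t2))) (Loop P a # k, ts) = (k, ts2)" for k
    by (rule lsteps_add[OF _ lsteps_add[OF t(3) t(4)]]) (simp add: tape_act_noact assms(1))
  moreover have "1 + (t1 + t2) \<le> T" using t(1,2) assms(4) by linarith
  ultimately show ?thesis unfolding exe_def by blast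
qed

lemma exe_Loop_count:
  assumes "\<And>i. i < n \<Longrightarrow> P (map tape_read (S i))" "\<And>i. i < n \<Longrightarrow> exe a (S i) T1 (S (Suc i))"
    "\<not> P (map tape_read (S n))" "n * (T1 + 1) + 1 \<le> T"
  shows "exe (Loop P a) (S 0) T (S n)"
proof -
  have "exe (Loop P a) (S (n - j)) (j * (T1 + 1) + 1) (S n)" if "j \<le> n" for j
    using that
  proof (induction j)
    case 0
    then show ?case using assms(3) by (auto intro: exe_Loop_False)
  next
    case (Suc j)
    then have *: "n - Suc j < n" "Suc (n - Suc j) = n - j" by auto
    show ?case
      by (rule exe_Loop_True[where P = P, OF assms(1)[OF *(1)] assms(2)[OF *(1)]]) (use Suc * in auto)
  qed
  from this[of n] show ?thesis using assms(4) by (auto intro: exe_mono)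
qed

text \<open>The stacks that can occur before \<open>k\<close> is uncovered. A loop puts itself back
  under its body, so the recursion follows the syntax and the set is finite, as needed for the
  states of a machine.\<close>

fun conts :: "low \<Rightarrow> low list \<Rightarrow> low list set" where
  "conts Skip k = {Skip # k}"
| "conts (Act f) k = {Act f # k}"
| "conts (Seqn a b) k = insert (Seqn a b # k) (conts a (b # k) \<union> conts b k)"
| "conts (Ite P a b) k = insert (Ite P a b # k) (conts a k \<union> conts b k)"
| "conts (Loop P a) k = insert (Loop P a # k) (conts a (Loop P a # k))"

lemma finite_conts: "finite (conts c k)"
  by (induction c arbitrary: k) auto

lemma conts_self: "c # k \<in> conts c k"
  by (cases c) auto

lemma conts_closed:
  "s \<in> conts c k \<Longrightarrow> lnext s ss = Some (s', acts) \<Longrightarrow> s' \<in> insert k (conts c k)"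
proof (induction c arbitrary: k)
  case (Seqn a b)
  consider "s = Seqn a b # k" | "s \<in> conts a (b # k)" | "s \<in> conts b k" using Seqn.prems(1) by auto
  then show ?case
  proof cases
    case 1
    then show ?thesis using Seqn.prems(2) conts_self[of a "b # k"] by simp
  next
    case 2
    then show ?thesis using Seqn.IH(1)[OF 2 Seqn.prems(2)] conts_self[of b k] by auto
  next
    case 3
    then show ?thesis using Seqn.IH(2)[OF 3 Seqn.prems(2)] by auto
  qed
next
  case (Ite P a b)
  consider "s = Ite P a b # k" | "s \<in> conts a k" | "s \<in> conts b k" using Ite.prems(1) by auto
  then show ?case
  proof cases
    case 1
    then show ?thesis using Ite.prems(2) conts_self[of a k] conts_self[of b k] by (auto split: if_splits)
  next
    case 2
    then show ?thesis using Ite.IH(1)[OF 2 Ite.prems(2)] by auto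
  next
    case 3
    then show ?thesis using Ite.IH(2)[OF 3 Ite.prems(2)] by auto
  qed
next
  case (Loop P a)
  consider "s = Loop P a # k" | "s \<in> conts a (Loop P a # k)" using Loop.prems(1) by auto
  then show ?case
  proof cases
    case 1
    then show ?thesis using Loop.prems(2) conts_self[of a "Loop P a # k"] by (auto split: if_splits)
  next
    case 2
    then show ?thesis using Loop.IH[OF 2 Loop.prems(2)] by auto
  qed
qed auto

fun wf_low :: "nat \<Rightarrow> nat \<Rightarrow> low \<Rightarrow> bool" where
  "wf_low n G Skip \<longleftrightarrow> True"
| "wf_low n G (Act f) \<longleftrightarrow> (\<forall>ss. length ss = n \<and> set ss \<subseteq> {..<G} \<longrightarrow>
     length (f ss) = n \<and> fst ` set (f ss) \<subseteq> {..<G})"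
| "wf_low n G (Seqn a b) \<longleftrightarrow> wf_low n G a \<and> wf_low n G b"
| "wf_low n G (Ite P a b) \<longleftrightarrow> wf_low n G a \<and> wf_low n G b"
| "wf_low n G (Loop P a) \<longleftrightarrow> wf_low n G a"

lemma conts_wf: "wf_low n G c \<Longrightarrow> list_all (wf_low n G) k \<Longrightarrow> s \<in> conts c k \<Longrightarrow> list_all (wf_low n G) s"
proof (induction c arbitrary: k)
  case (Seqn a b)
  then show ?case using Seqn.IH(1)[of "b # k"] Seqn.IH(2)[of k] by auto
next
  case (Loop P a)
  then show ?case using Loop.IH[of "Loop P a # k"] by auto
qed auto

lemma lnext_wf:
  assumes "list_all (wf_low n G) s" "length ss = n" "set ss \<subseteq> {..<G}" "lnext s ss = Some (s', acts)"
  shows "length acts = n \<and> fst ` set acts \<subseteq> {..<G}"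
proof -
  have na: "length (noact ss) = n \<and> fst ` set (noact ss) \<subseteq> {..<G}"
    using assms(2,3) by (auto simp: noact_def)
  obtain c k where s: "s = c # k" using assms(4) by (cases s) simp_all
  show ?thesis
  proof (cases c)
    case (Act f)
    then have "acts = f ss" "wf_low n G (Act f)" using assms(1,4) s by simp_all
    then show ?thesis using assms(2,3) unfolding wf_low.simps by blast
  qed (use na assms(4) s in simp_all)
qed

lemma low_to_tm:
  assumes wf: "wf_low n G c" and n: "n \<ge> 1" and G: "G \<ge> 3"
  shows "\<exists>M. wf_tm M \<and> (\<forall>x T ts'.
      exe c ((word_cells x, 0) # replicate (n - 1) (word_cells [], 0)) T ts' \<longrightarrow>
      (\<exists>t\<le>T. \<exists>q. (tm_step M ^^ t) (tm_init M x) = (q, ts') \<and> tm_halted M (q, ts')))"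
proof -
  define S where "S = insert [] (conts c [])"
  have finS: "finite S" by (simp add: S_def finite_conts)
  obtain zs where zs: "set zs = S - {[c]}" "distinct zs"
    using finite_distinct_list[of "S - {[c]}"] finS by auto
  \<comment> \<open>Machines start in state 0, so the stack holding the whole program is enumerated
    first. The empty stack has no successor and becomes the halting state.\<close>
  define ys where "ys = [c] # zs"
  have ys: "set ys = S" "distinct ys" "ys ! 0 = [c]" "ys \<noteq> []"
    using zs conts_self[of c "[]"] by (auto simp: ys_def S_def)
  define enc where "enc k = (SOME q. q < length ys \<and> ys ! q = k)" for k
  have enc: "enc k < length ys \<and> ys ! enc k = k" if "k \<in> S" for k
    unfolding enc_def by (rule someI_ex) (use that ys(1) in \<open>metis in_set_conv_nth\<close>)
  have enc0: "enc [c] = 0"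
    using enc[of "[c]"] ys nth_eq_iff_index_eq[of ys "enc [c]" 0] conts_self[of c "[]"]
    by (auto simp: S_def)
  define M where "M = \<lparr>num_tapes = n, num_states = length ys, num_syms = G,
     delta = (\<lambda>q ss. if q < length ys then map_option (\<lambda>(k, a). (enc k, a)) (lnext (ys ! q) ss) else None)\<rparr>"
  have closed: "k' \<in> S" if "k \<in> S" "lnext k ss = Some (k', a)" for k k' ss a
    using that conts_closed[of k c "[]"] by (auto simp: S_def)
  have wfS: "list_all (wf_low n G) k" if "k \<in> S" for k
    using that conts_wf[OF wf, of "[]"] by (auto simp: S_def)
  have "wf_tm M"
    unfolding wf_tm_def
  proof (intro conjI allI impI)
    fix q ss q' acts
    assume A: "q < num_states M \<and> length ss = num_tapes M \<and> set ss \<subseteq> {..<num_syms M} \<and>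
      delta M q ss = Some (q', acts)"
    then obtain k' where k': "lnext (ys ! q) ss = Some (k', acts)" "q' = enc k'"
      by (auto simp: M_def split: if_splits)
    have q: "ys ! q \<in> S" using A ys(1) by (auto simp: M_def)
    show "q' < num_states M" using enc[OF closed[OF q k'(1)]] k'(2) by (simp add: M_def)
    show "length acts = num_tapes M" "fst ` set acts \<subseteq> {..<num_syms M}"
      using lnext_wf[OF wfS[OF q] _ _ k'(1)] A by (auto simp: M_def)
  qed (use n G ys(4) in \<open>auto simp: M_def Suc_le_eq\<close>)
  have step: "tm_step M (enc k, ts) = (case lstep (k, ts) of (k', ts') \<Rightarrow> (enc k', ts'))" if "k \<in> S" for k ts
    using enc[OF that] by (auto simp: M_def split: option.splits)
  have steps: "fst ((lstep ^^ t) (k, ts)) \<in> S \<and>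
      (tm_step M ^^ t) (enc k, ts) = (case (lstep ^^ t) (k, ts) of (k', ts') \<Rightarrow> (enc k', ts'))"
    if "k \<in> S" for k ts t
  proof (induction t)
    case (Suc t)
    obtain k1 ts1 where k1: "(lstep ^^ t) (k, ts) = (k1, ts1)" by force
    with Suc have *: "k1 \<in> S" "(tm_step M ^^ t) (enc k, ts) = (enc k1, ts1)" by auto
    have "fst (lstep (k1, ts1)) \<in> S" using *(1) closed[OF *(1)] by (auto split: option.splits)
    then show ?case using k1 *(2) step[OF *(1), of ts1] by (simp del: tm_step.simps lstep.simps)
  qed (use that in simp)
  have "\<exists>t\<le>T. \<exists>q. (tm_step M ^^ t) (tm_init M x) = (q, ts') \<and> tm_halted M (q, ts')"
    if "exe c ((word_cells x, 0) # replicate (n - 1) (word_cells [], 0)) T ts'" for x T ts'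
  proof -
    define ts where "ts = (word_cells x, 0::int) # replicate (n - 1) (word_cells [], 0)"
    from that obtain t where "t \<le> T" and all: "\<forall>k. (lstep ^^ t) (c # k, ts) = (k, ts')"
      unfolding exe_def ts_def by (elim exE conjE)
    with spec[OF all, of "[]"] have t: "t \<le> T" "(lstep ^^ t) ([c], ts) = ([], ts')" by simp_all
    have "[c] \<in> S" using conts_self[of c "[]"] by (simp add: S_def)
    from steps[OF this, of t ts] t(2) have "(tm_step M ^^ t) (0, ts) = (enc [], ts')"
      by (simp add: enc0)
    moreover have "tm_init M x = (0, ts)" by (simp add: tm_init_def ts_def M_def)
    moreover have "tm_halted M (enc [], ts')" using enc[of "[]"] by (simp add: M_def S_def)
    ultimately show ?thesis using t(1) by auto
  qed
  with \<open>wf_tm M\<close> show ?thesis by blast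
qed

section \<open>Loop programs over counters and their compilation\<close>

text \<open>The only loop runs exactly \<open>length x + 2\<close> times, so every program is
  polynomial by construction. The summand 2 keeps the number of rounds at least 2 for short inputs,
  so that nested loops eventually exceed every polynomial in the length. \<open>IfIn\<close>
  inspects the input letter at the position held in a register.\<close>

datatype cmd = Inc nat | Reset nat | Out bool | Nop | Seq cmd cmd | Rep cmd
  | IfLt nat nat cmd cmd | IfIn nat nat cmd cmd

type_synonym store = "(nat \<Rightarrow> nat) \<times> bool list"

fun exec :: "bool list \<Rightarrow> cmd \<Rightarrow> store \<Rightarrow> store" where
  "exec x (Inc r) (\<rho>, out) = (\<rho>(r := \<rho> r + 1), out)"
| "exec x (Reset r) (\<rho>, out) = (\<rho>(r := 0), out)"
| "exec x (Out b) (\<rho>, out) = (\<rho>, out @ [b])"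
| "exec x Nop s = s"
| "exec x (Seq a b) s = exec x b (exec x a s)"
| "exec x (Rep c) s = (exec x c ^^ (length x + 2)) s"
| "exec x (IfLt r s c d) (\<rho>, out) = (if \<rho> r < \<rho> s then exec x c (\<rho>, out) else exec x d (\<rho>, out))"
| "exec x (IfIn r y c d) (\<rho>, out) =
     (if word_cells x (int (\<rho> r)) = y then exec x c (\<rho>, out) else exec x d (\<rho>, out))"

fun regs :: "cmd \<Rightarrow> nat" where
  "regs (Inc r) = Suc r"
| "regs (Reset r) = Suc r"
| "regs (Out b) = 0"
| "regs Nop = 0"
| "regs (Seq a b) = max (regs a) (regs b)"
| "regs (Rep c) = regs c"
| "regs (IfLt r s c d) = max (max (Suc r) (Suc s)) (max (regs c) (regs d))"
| "regs (IfIn r y c d) = max (Suc r) (max (regs c) (regs d))"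

fun depth :: "cmd \<Rightarrow> nat" where
  "depth (Seq a b) = max (depth a) (depth b)"
| "depth (Rep c) = Suc (depth c)"
| "depth (IfLt r s c d) = max (depth c) (depth d)"
| "depth (IfIn r y c d) = max (depth c) (depth d)"
| "depth _ = 0"

text \<open>Bounds the growth of any register, for \<open>m\<close> rounds per loop. It does not
  depend on the register contents; otherwise nested loops could compound the growth.\<close>

fun incs :: "cmd \<Rightarrow> nat \<Rightarrow> nat" where
  "incs (Inc r) m = 1"
| "incs (Seq a b) m = incs a m + incs b m"
| "incs (Rep c) m = m * incs c m"
| "incs (IfLt r s c d) m = incs c m + incs d m"
| "incs (IfIn r y c d) m = incs c m + incs d m"
| "incs _ m = 0"

text \<open>A time bound for the compiled program when all registers start at \<open>B\<close> or
  below. Since counters are unary, resetting and comparing take time linear in the values, and later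
  parts have to be charged for the growth caused by earlier ones.\<close>

fun steps :: "cmd \<Rightarrow> nat \<Rightarrow> nat \<Rightarrow> nat" where
  "steps (Inc r) m B = 1"
| "steps (Reset r) m B = B * 2 + 1"
| "steps (Out b) m B = 1"
| "steps Nop m B = 1"
| "steps (Seq a b) m B = 1 + steps a m B + steps b m (B + incs a m)"
| "steps (Rep c) m B = m * (steps c m (B + m * incs c m) + 3) + m * 2 + 3"
| "steps (IfLt r s c d) m B = B * 4 + 5 + steps c m B + steps d m B"
| "steps (IfIn r y c d) m B = B * 4 + 5 + steps c m B + steps d m B"

text \<open>Symbol 3 marks cell 0 of every counter tape and symbol 4 the cell \<open>m\<close>; the value of a
  counter is its head position.\<close>

definition counter_cells :: "nat \<Rightarrow> int \<Rightarrow> nat" where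
  "counter_cells m i = (if i = 0 then 3 else if i = int m then 4 else 0)"

text \<open>Tape 0 holds the input, tape 1 is a scratch counter, then come the registers, the loop
  counters and the output.\<close>

definition tapes :: "nat \<Rightarrow> bool list \<Rightarrow> (nat \<Rightarrow> nat) \<Rightarrow> bool list \<Rightarrow> tape list" where
  "tapes n x v out = map (\<lambda>i. if i = 0 then (word_cells x, int (v 0))
     else if i = n - 1 then (word_cells out, int (length out))
     else (counter_cells (length x + 2), int (v i))) [0..<n]"

definition mact :: "nat \<Rightarrow> (nat \<Rightarrow> nat option) \<Rightarrow> (nat \<Rightarrow> head_move) \<Rightarrow> low" where
  "mact n w mv = Act (\<lambda>ss. map (\<lambda>i. (case w i of None \<Rightarrow> ss ! i | Some s \<Rightarrow> s, mv i)) [0..<n])"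

lemma wf_mact: "(\<And>i s. w i = Some s \<Longrightarrow> s < G) \<Longrightarrow> wf_low n G (mact n w mv)"
  by (force simp: mact_def split: option.splits)

lemma exe_mact:
  assumes "1 \<le> T" "\<And>i. i < n \<Longrightarrow> T2 i = (case T1 i of (c, h) \<Rightarrow>
      ((case w i of None \<Rightarrow> c | Some s \<Rightarrow> c(h := s)), h + offset (mv i)))"
  shows "exe (mact n w mv) (map T1 [0..<n]) T (map T2 [0..<n])"
  unfolding mact_def
proof (rule exe_Act[OF assms(1)], rule nth_equalityI)
  fix i assume "i < length (map T2 [0..<n])"
  then have i: "i < n" by simp
  obtain c h where c: "T1 i = (c, h)" by force
  show "map T2 [0..<n] ! i = map2 tape_act (map (\<lambda>i. (case w i of None \<Rightarrow>
      map tape_read (map T1 [0..<n]) ! i | Some s \<Rightarrow> s, mv i)) [0..<n]) (map T1 [0..<n]) ! i"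
    using i c by (simp add: assms(2) split: option.splits)
qed simp

definition moves :: "nat \<Rightarrow> nat set \<Rightarrow> nat set \<Rightarrow> low" where
  "moves n up dn = mact n (\<lambda>_. None)
     (\<lambda>i. if i \<in> up then Move_Right else if i \<in> dn then Move_Left else Move_Stay)"

lemma wf_moves: "wf_low n G (moves n up dn)"
  unfolding moves_def by (rule wf_mact) simp

lemma exe_moves:
  assumes "up \<subseteq> {..<n - 1}" "dn \<subseteq> {..<n - 1}" "\<And>i. i \<in> dn \<Longrightarrow> i \<notin> up \<Longrightarrow> 0 < v i"
    "\<And>i. i < n - 1 \<Longrightarrow> v' i = (if i \<in> up then v i + 1 else if i \<in> dn then v i - 1 else v i)" "1 \<le> T" "n > 1"
  shows "exe (moves n up dn) (tapes n x v out) T (tapes n x v' out)"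
  unfolding tapes_def moves_def
proof (rule exe_mact[OF assms(5)])
  fix i assume "i < n"
  consider "i = n - 1" | "i < n - 1" "i \<in> up" | "i < n - 1" "i \<notin> up" "i \<in> dn"
    | "i < n - 1" "i \<notin> up" "i \<notin> dn" using \<open>i < n\<close> by linarith
  then show "(if i = 0 then (word_cells x, int (v' 0)) else if i = n - 1 then (word_cells out, int (length out))
      else (counter_cells (length x + 2), int (v' i))) =
     (case if i = 0 then (word_cells x, int (v 0)) else if i = n - 1 then (word_cells out, int (length out))
      else (counter_cells (length x + 2), int (v i)) of (c, h) \<Rightarrow>
      (case None of None \<Rightarrow> c | Some s \<Rightarrow> c(h := s), h + offset
        (if i \<in> up then Move_Right else if i \<in> dn then Move_Left else Move_Stay)))"
  proof cases
    case 1
    then have "i \<notin> up" "i \<notin> dn" "i \<noteq> 0" using assms(1,2,6) by auto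
    then show ?thesis using 1 by simp
  next
    case 3
    then have "v i > 0" using assms(3) by simp
    then show ?thesis using 3 assms(4)[of i] by (auto simp: of_nat_diff)
  qed (use assms(4)[of i] in auto)
qed

lemma tapes_nth:
  assumes "0 < i" "i < n - 1"
  shows "map tape_read (tapes n x v out) ! i = 3 \<longleftrightarrow> v i = 0"
    "map tape_read (tapes n x v out) ! i = Suc (Suc (Suc 0)) \<longleftrightarrow> v i = 0"
    "map tape_read (tapes n x v out) ! i = 4 \<longleftrightarrow> v i = length x + 2"
  using assms by (auto simp: tapes_def counter_cells_def)

lemma tapes_nth0: "n > 0 \<Longrightarrow> map tape_read (tapes n x v out) ! 0 = word_cells x (int (v 0))"
  by (simp add: tapes_def)

context
  fixes R D :: nat
begin

definition nt :: nat where "nt = R + D + 3"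

definition vof :: "(nat \<Rightarrow> nat) \<Rightarrow> (nat \<Rightarrow> nat) \<Rightarrow> nat \<Rightarrow> nat" where
  "vof \<rho> lp i = (if i < 2 then 0 else if i < R + 2 then \<rho> (i - 2) else lp (i - R - 2))"

text \<open>The argument \<open>l\<close> counts the enclosing loops and selects a free loop
  counter. To compare, both counters run down together while the scratch counter records the number
  of rounds; the test looks whether the second one is still positive, and each branch first restores
  the counters. Reading a letter moves the input head to the right in the same fashion.\<close>

fun comp :: "nat \<Rightarrow> cmd \<Rightarrow> low" where
  "comp l (Inc r) = moves nt {r + 2} {}"
| "comp l (Reset r) = Loop (\<lambda>ss. ss ! (r + 2) \<noteq> 3) (moves nt {} {r + 2})"
| "comp l (Out b) = mact nt (\<lambda>i. if i = nt - 1 then Some (if b then 2 else 1) else None)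
     (\<lambda>i. if i = nt - 1 then Move_Right else Move_Stay)"
| "comp l Nop = Skip"
| "comp l (Seq a b) = Seqn (comp l a) (comp l b)"
| "comp l (Rep c) = Seqn (Loop (\<lambda>ss. ss ! (R + 2 + l) \<noteq> 4) (Seqn (comp (Suc l) c) (moves nt {R + 2 + l} {})))
     (Loop (\<lambda>ss. ss ! (R + 2 + l) \<noteq> 3) (moves nt {} {R + 2 + l}))"
| "comp l (IfLt r s c d) = Seqn (Loop (\<lambda>ss. ss ! (r + 2) \<noteq> 3 \<and> ss ! (s + 2) \<noteq> 3) (moves nt {1} {r + 2, s + 2}))
     (Ite (\<lambda>ss. ss ! (s + 2) \<noteq> 3)
       (Seqn (Loop (\<lambda>ss. ss ! 1 \<noteq> 3) (moves nt {r + 2, s + 2} {1})) (comp l c))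
       (Seqn (Loop (\<lambda>ss. ss ! 1 \<noteq> 3) (moves nt {r + 2, s + 2} {1})) (comp l d)))"
| "comp l (IfIn r y c d) = Seqn (Loop (\<lambda>ss. ss ! (r + 2) \<noteq> 3) (moves nt {0, 1} {r + 2}))
     (Ite (\<lambda>ss. ss ! 0 = y)
       (Seqn (Loop (\<lambda>ss. ss ! 1 \<noteq> 3) (moves nt {r + 2} {0, 1})) (comp l c))
       (Seqn (Loop (\<lambda>ss. ss ! 1 \<noteq> 3) (moves nt {r + 2} {0, 1})) (comp l d)))"

lemma wf_comp: "wf_low nt 5 (comp l c)"
  by (induction c arbitrary: l) (auto intro!: wf_moves wf_mact split: if_splits)

end

lemma steps_mono: "B \<le> B' \<Longrightarrow> steps c m B \<le> steps c m B'"
proof (induction c arbitrary: B B')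
  case (Seq a b)
  show ?case using Seq.IH(1)[OF Seq.prems] Seq.IH(2)[of "B + incs a m" "B' + incs a m"] Seq.prems by auto
next
  case (Rep c)
  show ?case using Rep.IH[of "B + m * incs c m" "B' + m * incs c m"] Rep.prems by auto
next
  case (IfLt r s c d)
  show ?case using IfLt.IH(1)[OF IfLt.prems] IfLt.IH(2)[OF IfLt.prems] IfLt.prems by auto
next
  case (IfIn r y c d)
  show ?case using IfIn.IH(1)[OF IfIn.prems] IfIn.IH(2)[OF IfIn.prems] IfIn.prems by auto
qed auto

lemma exec_bound:
  "exec x c (\<rho>, out) = (\<rho>', out') \<Longrightarrow> (\<And>i. \<rho> i \<le> B) \<Longrightarrow> \<rho>' i \<le> B + incs c (length x + 2)"
proof (induction c arbitrary: \<rho> out \<rho>' out' B i)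
  case (Inc r)
  then have "\<rho>' i \<le> Suc (\<rho> i)" by auto
  with Inc.prems(2)[of i] show ?case by simp
next
  case (Reset r)
  then show ?case by auto
next
  case (Seq a b)
  obtain \<rho>1 o1 where 1: "exec x a (\<rho>, out) = (\<rho>1, o1)" by force
  show ?case
    using Seq.IH(2)[of \<rho>1 o1 \<rho>' out' "B + incs a (length x + 2)" i] Seq.IH(1)[OF 1 Seq.prems(2)] Seq.prems(1) 1
    by (simp add: add.assoc)
next
  case (Rep c)
  have "\<forall>\<rho>' out' i. (exec x c ^^ k) (\<rho>, out) = (\<rho>', out') \<longrightarrow> \<rho>' i \<le> B + k * incs c (length x + 2)" for k
  proof (induction k)
    case (Suc k)
    obtain \<rho>1 o1 where 1: "(exec x c ^^ k) (\<rho>, out) = (\<rho>1, o1)" by force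
    then have "\<rho>1 i \<le> B + k * incs c (length x + 2)" for i using Suc by simp
    then show ?case using Rep.IH[of \<rho>1 o1 _ _ "B + k * incs c (length x + 2)"] 1
      by (auto simp: algebra_simps)
  qed (use Rep.prems in auto)
  from this[of "length x + 2"] show ?case using Rep.prems(1) by simp
next
  case (IfLt r s c d)
  show ?case
  proof (cases "\<rho> r < \<rho> s")
    case True
    then show ?thesis using IfLt.IH(1)[of \<rho> out \<rho>' out' B i] IfLt.prems by auto
  next
    case False
    then show ?thesis using IfLt.IH(2)[of \<rho> out \<rho>' out' B i] IfLt.prems by auto
  qed
next
  case (IfIn r y c d)
  show ?case
  proof (cases "word_cells x (int (\<rho> r)) = y")
    case True
    then show ?thesis using IfIn.IH(1)[of \<rho> out \<rho>' out' B i] IfIn.prems by auto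
  next
    case False
    then show ?thesis using IfIn.IH(2)[of \<rho> out \<rho>' out' B i] IfIn.prems by auto
  qed
qed auto

lemma tapes_cong: "(\<And>i. i < n - 1 \<Longrightarrow> v i = v' i) \<Longrightarrow> 1 < n \<Longrightarrow> tapes n x v out = tapes n x v' out"
  unfolding tapes_def by (rule map_cong) auto

lemma comp_correct:
  assumes "regs c \<le> R" "l + depth c \<le> D" "\<And>j. j \<ge> l \<Longrightarrow> lp j = 0" "\<And>i. \<rho> i \<le> B"
    "exec x c (\<rho>, out) = (\<rho>', out')"
  shows "exe (comp R D l c) (tapes (nt R D) x (vof R \<rho> lp) out) (steps c (length x + 2) B)
    (tapes (nt R D) x (vof R \<rho>' lp) out')"
  using assms
proof (induction c arbitrary: l lp \<rho> out \<rho>' out' B)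
  case (Inc r)
  then have r: "r < R" "\<rho>' = \<rho>(r := \<rho> r + 1)" "out' = out" by auto
  show ?case unfolding comp.simps r(3)
    by (rule exe_moves) (use r in \<open>auto simp: nt_def vof_def\<close>)
next
  case (Reset r)
  then have r: "r < R" "\<rho>' = \<rho>(r := 0)" "out' = out" by auto
  define S where "S i = tapes (nt R D) x (vof R (\<rho>(r := \<rho> r - i)) lp) out" for i
  have S: "tapes (nt R D) x (vof R \<rho> lp) out = S 0" "tapes (nt R D) x (vof R \<rho>' lp) out' = S (\<rho> r)"
    using r by (simp_all add: S_def)
  show ?case unfolding comp.simps S
  proof (rule exe_Loop_count)
    fix i assume i: "i < \<rho> r"
    show "map tape_read (S i) ! (r + 2) \<noteq> 3"
      unfolding S_def using i r(1) by (subst tapes_nth) (auto simp: nt_def vof_def)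
    show "exe (moves (nt R D) {} {r + 2}) (S i) 1 (S (Suc i))"
      unfolding S_def by (rule exe_moves) (use i r(1) in \<open>auto simp: nt_def vof_def\<close>)
  next
    show "\<not> map tape_read (S (\<rho> r)) ! (r + 2) \<noteq> 3"
      unfolding S_def using r(1) by (subst tapes_nth) (auto simp: nt_def vof_def)
  qed (use Reset.prems(4)[of r] in simp)
next
  case (Out b)
  then have o: "\<rho>' = \<rho>" "out' = out @ [b]" by auto
  have w: "(word_cells out)(int (length out) := if b then 2 else 1) = word_cells (out @ [b])"
    by (auto simp: word_cells_def fun_eq_iff nth_append)
  show ?case unfolding comp.simps tapes_def o
    by (rule exe_mact) (use w in \<open>auto simp: nt_def\<close>)
next
  case Nop
  then show ?case by (auto intro: exe_Skip)
next
  case (Seq a b)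
  obtain \<rho>1 o1 where 1: "exec x a (\<rho>, out) = (\<rho>1, o1)" by force
  then have 2: "exec x b (\<rho>1, o1) = (\<rho>', out')" using Seq.prems(5) by simp
  show ?case unfolding comp.simps
    by (rule exe_Seqn[OF Seq.IH(1)[OF _ _ _ _ 1] Seq.IH(2)[OF _ _ _ _ 2]])
      (use Seq.prems exec_bound[OF 1 Seq.prems(4)] in auto)
next
  case (Rep c)
  define m where "m = length x + 2"
  define P where "P i = (exec x c ^^ i) (\<rho>, out)" for i
  \<comment> \<open>Each round adds at most \<open>incs c m\<close> to a register, so this bounds
    the registers at the beginning of every round.\<close>
  define B' where "B' = B + m * incs c m"
  define t where "t = R + 2 + l"
  have t: "0 < t" "t < nt R D - 1" using Rep.prems(2) by (auto simp: t_def nt_def)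
  have bound: "\<forall>j. fst (P i) j \<le> B + i * incs c m" for i
  proof (induction i)
    case (Suc i)
    obtain \<rho>1 o1 where 1: "P i = (\<rho>1, o1)" by force
    then have "\<rho>1 j \<le> B + i * incs c m" for j using Suc by simp
    then show ?case
      using exec_bound[of x c \<rho>1 o1 "fst (P (Suc i))" "snd (P (Suc i))" "B + i * incs c m"] 1
      by (simp add: P_def m_def add.commute add.left_commute)
  qed (use Rep.prems in \<open>simp add: P_def\<close>)
  have bound': "fst (P i) j \<le> B'" if "i < m" for i j
    using bound[of i] that unfolding B'_def
    by (meson add_left_mono le_trans less_imp_le mult_le_mono1)
  define S where "S i = tapes (nt R D) x (vof R (fst (P i)) (lp(l := i))) (snd (P i))" for i
  \<comment> \<open>The second loop drives the loop counter back to 0. Counters from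
    \<open>l\<close> on must be 0 when a program of this depth starts, since the next loop will use
    the same one.\<close>
  define S' where "S' i = tapes (nt R D) x (vof R \<rho>' (lp(l := m - i))) out'" for i
  have Pm: "P m = (\<rho>', out')" using Rep.prems(5) by (simp add: P_def m_def)
  have l0: "lp(l := 0) = lp" using Rep.prems(3)[of l] by auto
  have S0: "tapes (nt R D) x (vof R \<rho> lp) out = S 0" by (simp add: S_def P_def l0)
  have Sm: "S m = S' 0" by (simp add: S_def S'_def Pm)
  have S'm: "S' m = tapes (nt R D) x (vof R \<rho>' lp) out'" by (simp add: S'_def l0)
  have v: "vof R r (lp(l := i)) t = i" for r i by (simp add: vof_def t_def)
  have A: "exe (Loop (\<lambda>ss. ss ! t \<noteq> 4) (Seqn (comp R D (Suc l) c) (moves (nt R D) {t} {}))) (S 0)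
      (m * ((1 + steps c m B' + 1) + 1) + 1) (S m)"
  proof (rule exe_Loop_count)
    fix i assume i: "i < m"
    show "map tape_read (S i) ! t \<noteq> 4"
      unfolding S_def using i tapes_nth[OF t] by (simp add: v m_def)
    have "exec x c (fst (P i), snd (P i)) = (fst (P (Suc i)), snd (P (Suc i)))" by (simp add: P_def)
    then have 1: "exe (comp R D (Suc l) c) (S i) (steps c m B')
        (tapes (nt R D) x (vof R (fst (P (Suc i))) (lp(l := i))) (snd (P (Suc i))))"
      unfolding S_def m_def using Rep.prems(1,2,3) bound'[OF i] by (intro Rep.IH) auto
    have 2: "exe (moves (nt R D) {t} {})
        (tapes (nt R D) x (vof R (fst (P (Suc i))) (lp(l := i))) (snd (P (Suc i)))) 1 (S (Suc i))"
      unfolding S_def by (rule exe_moves) (use t in \<open>auto simp: vof_def t_def\<close>)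
    show "exe (Seqn (comp R D (Suc l) c) (moves (nt R D) {t} {})) (S i) (1 + steps c m B' + 1) (S (Suc i))"
      by (rule exe_Seqn[OF 1 2]) simp
  next
    show "\<not> map tape_read (S m) ! t \<noteq> 4"
      unfolding S_def using tapes_nth[OF t] by (simp add: v m_def)
  qed simp
  have C: "exe (Loop (\<lambda>ss. ss ! t \<noteq> 3) (moves (nt R D) {} {t})) (S' 0) (m * (1 + 1) + 1) (S' m)"
  proof (rule exe_Loop_count)
    fix i assume i: "i < m"
    show "map tape_read (S' i) ! t \<noteq> 3"
      unfolding S'_def using i tapes_nth[OF t] by (simp add: v)
    show "exe (moves (nt R D) {} {t}) (S' i) 1 (S' (Suc i))"
      unfolding S'_def by (rule exe_moves) (use t i in \<open>auto simp: vof_def t_def\<close>)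
  next
    show "\<not> map tape_read (S' m) ! t \<noteq> 3"
      unfolding S'_def using tapes_nth[OF t] by (simp add: v)
  qed simp
  show ?case
    unfolding comp.simps S0 S'm[symmetric] t_def[symmetric]
    by (rule exe_Seqn[OF A[unfolded Sm] C]) (simp add: m_def B'_def algebra_simps)
next
  case (IfLt r s c d)
  define k where "k = min (\<rho> r) (\<rho> s)"
  \<comment> \<open>The tapes after \<open>i\<close> rounds: both counters have lost
    \<open>i\<close> and the scratch tape has gained it. Treating the two registers in one function
    also covers the case that they coincide.\<close>
  define W where "W i = (vof R (\<lambda>q. if q = r \<or> q = s then \<rho> q - i else \<rho> q) lp)(1 := i)" for i
  define S where "S i = tapes (nt R D) x (W i) out" for i
  have rs: "r < R" "s < R" using IfLt.prems(1) by auto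
  have W0: "W 0 = vof R \<rho> lp" by (auto simp: W_def vof_def)
  have S0: "tapes (nt R D) x (vof R \<rho> lp) out = S 0" by (simp add: S_def W0)
  have nth: "0 < r + 2" "r + 2 < nt R D - 1" "0 < s + 2" "s + 2 < nt R D - 1" "0 < (1::nat)" "1 < nt R D - 1"
    using rs by (auto simp: nt_def)
  have Wv: "W i (r + 2) = \<rho> r - i" "W i (s + 2) = \<rho> s - i" "W i 1 = i" for i
    using rs by (auto simp: W_def vof_def)
  have A: "exe (Loop (\<lambda>ss. ss ! (r + 2) \<noteq> 3 \<and> ss ! (s + 2) \<noteq> 3) (moves (nt R D) {1} {r + 2, s + 2}))
      (S 0) (k * (1 + 1) + 1) (S k)"
  proof (rule exe_Loop_count)
    fix i assume i: "i < k"
    show "map tape_read (S i) ! (r + 2) \<noteq> 3 \<and> map tape_read (S i) ! (s + 2) \<noteq> 3"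
      unfolding S_def tapes_nth(1)[OF nth(1,2)] tapes_nth(1)[OF nth(3,4)] Wv using i by (auto simp: k_def)
    show "exe (moves (nt R D) {1} {r + 2, s + 2}) (S i) 1 (S (Suc i))"
      unfolding S_def by (rule exe_moves) (use nth i rs in \<open>auto simp: W_def vof_def k_def\<close>)
  next
    show "\<not> (map tape_read (S k) ! (r + 2) \<noteq> 3 \<and> map tape_read (S k) ! (s + 2) \<noteq> 3)"
      unfolding S_def tapes_nth(1)[OF nth(1,2)] tapes_nth(1)[OF nth(3,4)] Wv by (auto simp: k_def)
  qed simp
  have C: "exe (Loop (\<lambda>ss. ss ! 1 \<noteq> 3) (moves (nt R D) {r + 2, s + 2} {1})) (S k) (k * (1 + 1) + 1) (S 0)"
  proof -
    have "exe (Loop (\<lambda>ss. ss ! 1 \<noteq> 3) (moves (nt R D) {r + 2, s + 2} {1})) ((\<lambda>i. S (k - i)) 0)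
       (k * (1 + 1) + 1) ((\<lambda>i. S (k - i)) k)"
    proof (rule exe_Loop_count)
      fix i assume i: "i < k"
      show "map tape_read (S (k - i)) ! 1 \<noteq> 3"
        unfolding S_def tapes_nth(1)[OF nth(5,6)] Wv using i by auto
      define j where "j = k - Suc i"
      have j: "k - i = Suc j" "j < \<rho> r" "j < \<rho> s" using i by (auto simp: k_def j_def)
      show "exe (moves (nt R D) {r + 2, s + 2} {1}) (S (k - i)) 1 (S (k - Suc i))"
        unfolding S_def j_def[symmetric] j(1)
        by (rule exe_moves) (use nth j(2,3) rs in \<open>auto simp: W_def vof_def\<close>)
    next
      show "\<not> map tape_read (S (k - k)) ! 1 \<noteq> 3"
        unfolding S_def tapes_nth(1)[OF nth(5,6)] Wv by simp
    qed simp
    then show ?thesis by simp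
  qed
  have cond: "map tape_read (S k) ! (s + 2) \<noteq> 3 \<longleftrightarrow> \<rho> r < \<rho> s"
    unfolding S_def tapes_nth(1)[OF nth(3,4)] Wv by (auto simp: k_def)
  have kB: "k \<le> B" using IfLt.prems(4)[of r] by (auto simp: k_def)
  have br: "exe (if \<rho> r < \<rho> s then comp R D l c else comp R D l d) (S 0)
      (steps c (length x + 2) B + steps d (length x + 2) B) (tapes (nt R D) x (vof R \<rho>' lp) out')"
  proof (cases "\<rho> r < \<rho> s")
    case True
    have "exe (comp R D l c) (S 0) (steps c (length x + 2) B) (tapes (nt R D) x (vof R \<rho>' lp) out')"
      unfolding S0[symmetric] using IfLt.prems True by (intro IfLt.IH(1)) auto
    then show ?thesis using True exe_mono by simp
  next
    case False
    have "exe (comp R D l d) (S 0) (steps d (length x + 2) B) (tapes (nt R D) x (vof R \<rho>' lp) out')"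
      unfolding S0[symmetric] using IfLt.prems False by (intro IfLt.IH(2)) auto
    then show ?thesis using False exe_mono by simp
  qed
  have "exe (Seqn (Loop (\<lambda>ss. ss ! 1 \<noteq> 3) (moves (nt R D) {r + 2, s + 2} {1}))
      (if \<rho> r < \<rho> s then comp R D l c else comp R D l d)) (S k)
      (2 * k + 2 + (steps c (length x + 2) B + steps d (length x + 2) B)) (tapes (nt R D) x (vof R \<rho>' lp) out')"
    by (rule exe_Seqn[OF C br]) simp
  then show ?case
    unfolding comp.simps S0
    by (intro exe_Seqn[OF A] exe_Ite) (use cond kB in auto)
next
  case (IfIn r y c d)
  define k where "k = \<rho> r"
  \<comment> \<open>Here the input head on tape 0 advances together with the scratch counter, so
    that it ends on the cell whose number was stored in the register.\<close>
  define W where "W i = (vof R (\<rho>(r := \<rho> r - i)) lp)(0 := i, 1 := i)" for i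
  define S where "S i = tapes (nt R D) x (W i) out" for i
  have rs: "r < R" using IfIn.prems(1) by auto
  have W0: "W 0 = vof R \<rho> lp" by (auto simp: W_def vof_def)
  have S0: "tapes (nt R D) x (vof R \<rho> lp) out = S 0" by (simp add: S_def W0)
  have nth: "0 < r + 2" "r + 2 < nt R D - 1" "0 < (1::nat)" "1 < nt R D - 1"
    using rs by (auto simp: nt_def)
  have Wv: "W i (r + 2) = \<rho> r - i" "W i 0 = i" "W i 1 = i" for i
    using rs by (auto simp: W_def vof_def)
  have A: "exe (Loop (\<lambda>ss. ss ! (r + 2) \<noteq> 3) (moves (nt R D) {0, 1} {r + 2}))
      (S 0) (k * (1 + 1) + 1) (S k)"
  proof (rule exe_Loop_count)
    fix i assume i: "i < k"
    show "map tape_read (S i) ! (r + 2) \<noteq> 3"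
      unfolding S_def tapes_nth(1)[OF nth(1,2)] Wv using i by (auto simp: k_def)
    show "exe (moves (nt R D) {0, 1} {r + 2}) (S i) 1 (S (Suc i))"
      unfolding S_def by (rule exe_moves) (use nth i rs in \<open>auto simp: W_def vof_def k_def\<close>)
  next
    show "\<not> map tape_read (S k) ! (r + 2) \<noteq> 3"
      unfolding S_def tapes_nth(1)[OF nth(1,2)] Wv by (auto simp: k_def)
  qed simp
  have C: "exe (Loop (\<lambda>ss. ss ! 1 \<noteq> 3) (moves (nt R D) {r + 2} {0, 1})) (S k) (k * (1 + 1) + 1) (S 0)"
  proof -
    have "exe (Loop (\<lambda>ss. ss ! 1 \<noteq> 3) (moves (nt R D) {r + 2} {0, 1})) ((\<lambda>i. S (k - i)) 0)
       (k * (1 + 1) + 1) ((\<lambda>i. S (k - i)) k)"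
    proof (rule exe_Loop_count)
      fix i assume i: "i < k"
      show "map tape_read (S (k - i)) ! 1 \<noteq> 3"
        unfolding S_def tapes_nth(1)[OF nth(3,4)] Wv using i by auto
      define j where "j = k - Suc i"
      have j: "k - i = Suc j" "j < \<rho> r" using i by (auto simp: k_def j_def)
      show "exe (moves (nt R D) {r + 2} {0, 1}) (S (k - i)) 1 (S (k - Suc i))"
        unfolding S_def j_def[symmetric] j(1)
        by (rule exe_moves) (use nth j(2) rs in \<open>auto simp: W_def vof_def\<close>)
    next
      show "\<not> map tape_read (S (k - k)) ! 1 \<noteq> 3"
        unfolding S_def tapes_nth(1)[OF nth(3,4)] Wv by simp
    qed simp
    then show ?thesis by simp
  qed
  have cond: "map tape_read (S k) ! 0 = y \<longleftrightarrow> word_cells x (int (\<rho> r)) = y"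
    unfolding S_def by (subst tapes_nth0) (simp_all add: nt_def Wv k_def)
  have kB: "k \<le> B" using IfIn.prems(4)[of r] by (auto simp: k_def)
  have br: "exe (if word_cells x (int (\<rho> r)) = y then comp R D l c else comp R D l d) (S 0)
      (steps c (length x + 2) B + steps d (length x + 2) B) (tapes (nt R D) x (vof R \<rho>' lp) out')"
  proof (cases "word_cells x (int (\<rho> r)) = y")
    case True
    have "exe (comp R D l c) (S 0) (steps c (length x + 2) B) (tapes (nt R D) x (vof R \<rho>' lp) out')"
      unfolding S0[symmetric] using IfIn.prems True by (intro IfIn.IH(1)) auto
    then show ?thesis using True exe_mono by simp
  next
    case False
    have "exe (comp R D l d) (S 0) (steps d (length x + 2) B) (tapes (nt R D) x (vof R \<rho>' lp) out')"
      unfolding S0[symmetric] using IfIn.prems False by (intro IfIn.IH(2)) auto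
    then show ?thesis using False exe_mono by simp
  qed
  have "exe (Seqn (Loop (\<lambda>ss. ss ! 1 \<noteq> 3) (moves (nt R D) {r + 2} {0, 1}))
      (if word_cells x (int (\<rho> r)) = y then comp R D l c else comp R D l d)) (S k)
      (2 * k + 2 + (steps c (length x + 2) B + steps d (length x + 2) B)) (tapes (nt R D) x (vof R \<rho>' lp) out')"
    by (rule exe_Seqn[OF C br]) simp
  then show ?case
    unfolding comp.simps S0
    by (intro exe_Seqn[OF A] exe_Ite) (use cond kB in auto)
qed

section \<open>Setting up the counter tapes\<close>

definition stage :: "nat \<Rightarrow> bool list \<Rightarrow> (int \<Rightarrow> nat) \<Rightarrow> int \<Rightarrow> int \<Rightarrow> tape list" where
  "stage n x c a p = map (\<lambda>i. if i = 0 then (word_cells x, a)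
     else if i = n - 1 then (word_cells [], 0) else (c, p)) [0..<n]"

definition mark :: "nat \<Rightarrow> nat \<Rightarrow> nat \<Rightarrow> nat option" where
  "mark n s i = (if 0 < i \<and> i < n - 1 then Some s else None)"

definition between :: "nat \<Rightarrow> nat \<Rightarrow> head_move \<Rightarrow> nat \<Rightarrow> head_move" where
  "between a n mv i = (if a \<le> i \<and> i < n - 1 then mv else Move_Stay)"

text \<open>The upper mark must lie at \<open>length x + 2\<close>, the number of rounds of a loop.
  It is found by walking along the input with all counter heads and then two cells further. The two
  single moves to the left realign the counter heads with the input head, and the last loop returns
  all of them to cell 0.\<close>

definition prepare :: "nat \<Rightarrow> low" where
  "prepare n = Seqn (mact n (mark n 3) (\<lambda>_. Move_Stay))
    (Seqn (Loop (\<lambda>ss. ss ! 0 \<noteq> 0) (mact n (\<lambda>_. None) (between 0 n Move_Right)))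
    (Seqn (mact n (\<lambda>_. None) (between 1 n Move_Right))
    (Seqn (mact n (\<lambda>_. None) (between 1 n Move_Right))
    (Seqn (mact n (mark n 4) (between 1 n Move_Left))
    (Seqn (mact n (\<lambda>_. None) (between 1 n Move_Left))
    (Loop (\<lambda>ss. ss ! 1 \<noteq> 3) (mact n (\<lambda>_. None) (between 0 n Move_Left))))))))"

lemma wf_prepare: "wf_low n 5 (prepare n)"
  by (auto simp: prepare_def mark_def intro!: wf_mact split: if_splits)

lemma exe_prepare:
  assumes n: "n > 2"
  shows "exe (prepare n) ((word_cells x, 0) # replicate (n - 1) (word_cells [], 0)) (4 * length x + 13)
    (tapes n x (\<lambda>_. 0) [])"
proof -
  let ?l = "length x"
  define c3 where "c3 = (\<lambda>_::int. 0::nat)(0 := 3)"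
  have wc: "word_cells [] = (\<lambda>_. 0)" by (auto simp: word_cells_def)
  have init: "(word_cells x, 0) # replicate (n - 1) (word_cells [], 0) = stage n x (word_cells []) 0 0"
    using n by (intro nth_equalityI) (auto simp: stage_def nth_Cons split: nat.splits)
  have fin: "tapes n x (\<lambda>_. 0) [] = stage n x (counter_cells (?l + 2)) 0 0"
    by (simp add: tapes_def stage_def)
  have s1: "exe (mact n (mark n 3) (\<lambda>_. Move_Stay)) (stage n x (word_cells []) 0 0) 1 (stage n x c3 0 0)"
    unfolding stage_def by (rule exe_mact) (auto simp: mark_def c3_def wc)
  have mr: "exe (mact n (\<lambda>_. None) (between a n Move_Right)) (stage n x c h p) 1
     (stage n x c (if a = 0 then h + 1 else h) (p + 1))" if "a \<le> 1" for a c h p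
    unfolding stage_def by (rule exe_mact) (use that n in \<open>auto simp: between_def\<close>)
  have ml: "exe (mact n (\<lambda>_. None) (between a n Move_Left)) (stage n x c h p) 1
     (stage n x c (if a = 0 then h - 1 else h) (p - 1))" if "a \<le> 1" for a c h p
    unfolding stage_def by (rule exe_mact) (use that n in \<open>auto simp: between_def\<close>)
  have rd0: "map tape_read (stage n x c h p) ! 0 = word_cells x h" for c h p
    using n by (simp add: stage_def)
  have n1: "Suc 0 \<noteq> n - Suc 0" using n by simp
  have rd1: "map tape_read (stage n x c h p) ! 1 = c p" for c h p
    using n n1 by (simp add: stage_def)
  have s2: "exe (Loop (\<lambda>ss. ss ! 0 \<noteq> 0) (mact n (\<lambda>_. None) (between 0 n Move_Right)))
     ((\<lambda>i. stage n x c3 (int i) (int i)) 0) (?l * (1 + 1) + 1) ((\<lambda>i. stage n x c3 (int i) (int i)) ?l)"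
  proof (rule exe_Loop_count)
    fix i assume "i < ?l"
    then show "map tape_read (stage n x c3 (int i) (int i)) ! 0 \<noteq> 0"
      unfolding rd0 by (simp add: word_cells_def)
    show "exe (mact n (\<lambda>_. None) (between 0 n Move_Right)) (stage n x c3 (int i) (int i)) 1
       (stage n x c3 (int (Suc i)) (int (Suc i)))"
      using mr[of 0 c3 "int i" "int i"] by (simp add: add.commute)
  next
    show "\<not> map tape_read (stage n x c3 (int ?l) (int ?l)) ! 0 \<noteq> 0"
      unfolding rd0 by (simp add: word_cells_def)
  qed simp
  have s3: "exe (mact n (\<lambda>_. None) (between 1 n Move_Right)) (stage n x c3 ?l ?l) 1 (stage n x c3 ?l (?l + 1))"
    using mr[of 1 c3 ?l ?l] by (simp add: algebra_simps)
  have s4: "exe (mact n (\<lambda>_. None) (between 1 n Move_Right)) (stage n x c3 ?l (?l + 1)) 1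
      (stage n x c3 ?l (?l + 2))"
    using mr[of 1 c3 ?l "?l + 1"] by (simp add: algebra_simps)
  have s5: "exe (mact n (mark n 4) (between 1 n Move_Left)) (stage n x c3 ?l (?l + 2)) 1
      (stage n x (counter_cells (?l + 2)) ?l (?l + 1))"
    unfolding stage_def
    by (rule exe_mact) (auto simp: mark_def c3_def between_def counter_cells_def fun_eq_iff)
  have s6: "exe (mact n (\<lambda>_. None) (between 1 n Move_Left)) (stage n x (counter_cells (?l + 2)) ?l (?l + 1)) 1
      (stage n x (counter_cells (?l + 2)) ?l ?l)"
    using ml[of 1 "counter_cells (?l + 2)" ?l "?l + 1"] by (simp add: algebra_simps)
  have s7: "exe (Loop (\<lambda>ss. ss ! 1 \<noteq> 3) (mact n (\<lambda>_. None) (between 0 n Move_Left)))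
     ((\<lambda>i. stage n x (counter_cells (?l + 2)) (int (?l - i)) (int (?l - i))) 0) (?l * (1 + 1) + 1)
     ((\<lambda>i. stage n x (counter_cells (?l + 2)) (int (?l - i)) (int (?l - i))) ?l)"
  proof (rule exe_Loop_count)
    fix i assume i: "i < ?l"
    then show "map tape_read (stage n x (counter_cells (?l + 2)) (int (?l - i)) (int (?l - i))) ! 1 \<noteq> 3"
      unfolding rd1 by (simp add: counter_cells_def)
    show "exe (mact n (\<lambda>_. None) (between 0 n Move_Left))
       (stage n x (counter_cells (?l + 2)) (int (?l - i)) (int (?l - i))) 1
       (stage n x (counter_cells (?l + 2)) (int (?l - Suc i)) (int (?l - Suc i)))"
      using ml[of 0 "counter_cells (?l + 2)" "int (?l - i)" "int (?l - i)"] i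
      by (simp add: of_nat_diff algebra_simps)
  next
    show "\<not> map tape_read (stage n x (counter_cells (?l + 2)) (int (?l - ?l)) (int (?l - ?l))) ! 1 \<noteq> 3"
      unfolding rd1 by (simp add: counter_cells_def)
  qed simp
  show ?thesis
    unfolding prepare_def init fin
    by (rule exe_Seqn[OF s1 exe_Seqn[OF s2[simplified of_nat_0] exe_Seqn[OF s3 exe_Seqn[OF s4 exe_Seqn[OF s5
          exe_Seqn[OF s6 s7[simplified diff_zero diff_self_eq_0 of_nat_0]]]]]]]) (rule order_refl | simp)+
qed

section \<open>Counter programs run in polynomial time\<close>

definition poly_bounded :: "(nat \<Rightarrow> nat) \<Rightarrow> bool" where
  "poly_bounded g \<longleftrightarrow> (\<exists>p :: nat poly. \<forall>n. g n \<le> poly p n)"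

lemma poly_bounded_const: "poly_bounded (\<lambda>_. c)"
  unfolding poly_bounded_def by (rule exI[of _ "[:c:]"]) simp

lemma poly_bounded_id: "poly_bounded (\<lambda>n. n)"
  unfolding poly_bounded_def by (rule exI[of _ "[:0, 1:]"]) simp

lemma poly_bounded_add: "poly_bounded f \<Longrightarrow> poly_bounded g \<Longrightarrow> poly_bounded (\<lambda>n. f n + g n)"
  unfolding poly_bounded_def by (metis add_mono poly_add)

lemma poly_bounded_mult: "poly_bounded f \<Longrightarrow> poly_bounded g \<Longrightarrow> poly_bounded (\<lambda>n. f n * g n)"
  unfolding poly_bounded_def by (metis mult_le_mono poly_mult)

lemmas poly_bounded_intros = poly_bounded_const poly_bounded_id poly_bounded_add poly_bounded_mult

lemma poly_bounded_incs: "poly_bounded (\<lambda>n. incs c (n + 2))"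
  by (induction c) (simp_all only: incs.simps, (intro poly_bounded_intros | assumption)+)

text \<open>\<open>B\<close> has to be a function of the input length in the induction, because the
  second part of a sequence and the body of a loop start from larger bounds.\<close>

lemma poly_bounded_steps: "poly_bounded B \<Longrightarrow> poly_bounded (\<lambda>n. steps c (n + 2) (B n))"
proof (induction c arbitrary: B)
  case (Seq a b)
  have "poly_bounded (\<lambda>n. steps b (n + 2) (B n + incs a (n + 2)))"
    by (rule Seq.IH(2)) (intro poly_bounded_intros Seq.prems poly_bounded_incs)
  with Seq.IH(1)[OF Seq.prems] show ?case unfolding steps.simps by (intro poly_bounded_intros)
next
  case (Rep c)
  have "poly_bounded (\<lambda>n. steps c (n + 2) (B n + (n + 2) * incs c (n + 2)))"
    by (rule Rep.IH) (intro poly_bounded_intros Rep.prems poly_bounded_incs)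
  then show ?case unfolding steps.simps by (intro poly_bounded_intros)
next
  case (IfLt r s c d)
  show ?case unfolding steps.simps
    by (intro poly_bounded_intros IfLt.prems IfLt.IH(1)[OF IfLt.prems] IfLt.IH(2)[OF IfLt.prems])
next
  case (IfIn r y c d)
  show ?case unfolding steps.simps
    by (intro poly_bounded_intros IfIn.prems IfIn.IH(1)[OF IfIn.prems] IfIn.IH(2)[OF IfIn.prems])
qed (unfold steps.simps, (intro poly_bounded_intros | assumption)+)

theorem polytime_exec: "polytime (\<lambda>x. snd (exec x c (\<lambda>_. 0, [])))"
proof -
  define R D where "R = regs c" and "D = depth c"
  define low where "low = Seqn (prepare (nt R D)) (comp R D 0 c)"
  have n: "nt R D > 2" by (simp add: nt_def)
  \<comment> \<open>Five symbols: the blank, the two letters and the two marks.\<close>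
  have wf: "wf_low (nt R D) 5 low" by (simp add: low_def wf_prepare wf_comp)
  obtain M where M: "wf_tm M" "\<And>x T ts'.
      exe low ((word_cells x, 0) # replicate (nt R D - 1) (word_cells [], 0)) T ts' \<Longrightarrow>
      \<exists>t\<le>T. \<exists>q. (tm_step M ^^ t) (tm_init M x) = (q, ts') \<and> tm_halted M (q, ts')"
    using low_to_tm[OF wf] n by auto
  have "poly_bounded (\<lambda>n. (4 * n + 13) + (1 + steps c (n + 2) 0))"
    by (intro poly_bounded_intros poly_bounded_steps)
  then obtain p :: "nat poly" where p: "\<And>n. (4 * n + 13) + (1 + steps c (n + 2) 0) \<le> poly p n"
    unfolding poly_bounded_def by blast
  have "tm_computes_within M x (poly p (length x)) (snd (exec x c (\<lambda>_. 0, [])))" for x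
  proof -
    obtain \<rho>' out' where e: "exec x c (\<lambda>_. 0, []) = (\<rho>', out')" by force
    have v0: "(\<lambda>_. 0) = vof R (\<lambda>_. 0) (\<lambda>_. 0)" by (simp add: vof_def fun_eq_iff)
    have "exe (comp R D 0 c) (tapes (nt R D) x (\<lambda>_. 0) []) (steps c (length x + 2) 0)
       (tapes (nt R D) x (vof R \<rho>' (\<lambda>_. 0)) out')"
      by (subst v0) (rule comp_correct, auto simp: R_def D_def e)
    then have "exe low ((word_cells x, 0) # replicate (nt R D - 1) (word_cells [], 0)) (poly p (length x))
       (tapes (nt R D) x (vof R \<rho>' (\<lambda>_. 0)) out')"
      unfolding low_def using p[of "length x"] by (intro exe_Seqn[OF exe_prepare[OF n]]) auto
    from M(2)[OF this] obtain t q where t: "t \<le> poly p (length x)"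
      "(tm_step M ^^ t) (tm_init M x) = (q, tapes (nt R D) x (vof R \<rho>' (\<lambda>_. 0)) out')"
      "tm_halted M (q, tapes (nt R D) x (vof R \<rho>' (\<lambda>_. 0)) out')" by blast
    moreover have "fst (last (tapes (nt R D) x (vof R \<rho>' (\<lambda>_. 0)) out')) = word_cells out'"
      using n by (simp add: tapes_def last_map)
    ultimately show ?thesis unfolding tm_computes_within_def Let_def using e by auto
  qed
  with M(1) show ?thesis unfolding polytime_def by blast
qed

section \<open>Bounded arithmetic evaluated by counter programs\<close>

text \<open>\<open>Sum\<close> is the only binder. Quantifiers become positivity of a sum, and
  degrees or numerical polynomials are sums of conditional terms. There is no product of terms;
  \<open>Scale\<close> multiplies by a fixed power of \<open>length x + 2\<close>, which a nest of
  loops performs directly.\<close>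

datatype trm = V nat | K nat | Scale nat trm | Plus trm trm | Sum nat trm | Cond fm trm
  and fm = Lt trm trm | At nat trm | Neg fm | Conj fm fm

text \<open>Variables range over the numbers below \<open>(|x| + 2) ^ d\<close>; reading a variable truncates it to
  this bound.\<close>

definition rng :: "nat \<Rightarrow> bool list \<Rightarrow> nat" where
  "rng d x = (length x + 2) ^ d"

primrec tval :: "nat \<Rightarrow> bool list \<Rightarrow> trm \<Rightarrow> (nat \<Rightarrow> nat) \<Rightarrow> nat"
  and fval :: "nat \<Rightarrow> bool list \<Rightarrow> fm \<Rightarrow> (nat \<Rightarrow> nat) \<Rightarrow> bool" where
  "tval d x (V i) e = min (rng d x) (e i)"
| "tval d x (K c) e = c"
| "tval d x (Scale b t) e = (length x + 2) ^ b * tval d x t e"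
| "tval d x (Plus s t) e = tval d x s e + tval d x t e"
| "tval d x (Sum i t) e = (\<Sum>v<rng d x. tval d x t (e(i := v)))"
| "tval d x (Cond f t) e = (if fval d x f e then tval d x t e else 0)"
| "fval d x (Lt s t) e \<longleftrightarrow> tval d x s e < tval d x t e"
| "fval d x (At y t) e \<longleftrightarrow> word_cells x (int (tval d x t e)) = y"
| "fval d x (Neg f) e \<longleftrightarrow> \<not> fval d x f e"
| "fval d x (Conj f g) e \<longleftrightarrow> fval d x f e \<and> fval d x g e"

fun rep :: "nat \<Rightarrow> cmd \<Rightarrow> cmd" where
  "rep 0 c = c"
| "rep (Suc k) c = Rep (rep k c)"

fun add_const :: "nat \<Rightarrow> nat \<Rightarrow> cmd" where
  "add_const 0 r = Nop"
| "add_const (Suc c) r = Seq (Inc r) (add_const c r)"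

text \<open>\<open>acc\<close> adds the value of a term to register \<open>dst\<close>, and \<open>tst\<close> branches on a formula. The
  variable \<open>i\<close> lives in register \<open>\<sigma> i\<close>, and the registers from \<open>n\<close> on are free.\<close>

primrec acc :: "nat \<Rightarrow> trm \<Rightarrow> nat \<Rightarrow> (nat \<Rightarrow> nat) \<Rightarrow> nat \<Rightarrow> cmd"
  and tst :: "nat \<Rightarrow> fm \<Rightarrow> nat \<Rightarrow> (nat \<Rightarrow> nat) \<Rightarrow> cmd \<Rightarrow> cmd \<Rightarrow> cmd" where
  "acc d (V i) n \<sigma> dst = Seq (Reset n) (rep d (IfLt n (\<sigma> i) (Seq (Inc n) (Inc dst)) Nop))"
| "acc d (K c) n \<sigma> dst = add_const c dst"
| "acc d (Scale b t) n \<sigma> dst = rep b (acc d t n \<sigma> dst)"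
| "acc d (Plus s t) n \<sigma> dst = Seq (acc d s n \<sigma> dst) (acc d t n \<sigma> dst)"
| "acc d (Sum i t) n \<sigma> dst = Seq (Reset n) (rep d (Seq (acc d t (Suc n) (\<sigma>(i := n)) dst) (Inc n)))"
| "acc d (Cond f t) n \<sigma> dst = tst d f n \<sigma> (acc d t n \<sigma> dst) Nop"
| "tst d (Lt s t) n \<sigma> c1 c2 = Seq (Reset n) (Seq (acc d s (n + 2) \<sigma> n) (Seq (Reset (n + 1))
     (Seq (acc d t (n + 2) \<sigma> (n + 1)) (IfLt n (n + 1) c1 c2))))"
| "tst d (At y t) n \<sigma> c1 c2 = Seq (Reset n) (Seq (acc d t (n + 1) \<sigma> n) (IfIn n y c1 c2))"
| "tst d (Neg f) n \<sigma> c1 c2 = tst d f n \<sigma> c2 c1"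
| "tst d (Conj f g) n \<sigma> c1 c2 = tst d f n \<sigma> (tst d g n \<sigma> c1 c2) c2"

definition agree :: "nat \<Rightarrow> (nat \<Rightarrow> nat) \<Rightarrow> (nat \<Rightarrow> nat) \<Rightarrow> bool" where
  "agree n \<rho> \<rho>' \<longleftrightarrow> (\<forall>i<n. \<rho> i = \<rho>' i)"

lemma exec_rep: "exec x (rep k c) s = (exec x c ^^ ((length x + 2) ^ k)) s"
proof (induction k arbitrary: s)
  case (Suc k)
  have "exec x (rep k c) = exec x c ^^ ((length x + 2) ^ k)" by (rule ext) (rule Suc)
  then show ?case by (simp add: funpow_mult mult.commute del: funpow.simps)
qed simp

lemma exec_add_const: "exec x (add_const c r) (\<rho>, out) = (\<rho>(r := \<rho> r + c), out)"
  by (induction c arbitrary: \<rho>) simp_all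

lemma exec_rep_inv:
  assumes "I 0 \<rho>" "\<And>j \<rho>. j < k \<Longrightarrow> I j \<rho> \<Longrightarrow> \<exists>\<rho>'. exec x c (\<rho>, out) = (\<rho>', out) \<and> I (Suc j) \<rho>'"
  shows "\<exists>\<rho>'. (exec x c ^^ k) (\<rho>, out) = (\<rho>', out) \<and> I k \<rho>'"
  using assms(2)
proof (induction k)
  case (Suc k)
  then obtain \<rho>1 where 1: "(exec x c ^^ k) (\<rho>, out) = (\<rho>1, out)" "I k \<rho>1" by fastforce
  with Suc.prems[of k \<rho>1] show ?case by auto
qed (use assms(1) in simp)

text \<open>Registers below \<open>n\<close> form a frame in which only \<open>dst\<close> changes.
  As \<open>tst\<close> takes both branches as programs, its run is compared with a run of the
  selected branch from a store that agrees with the old one on the frame.\<close>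

lemma acc_tst_correct:
  "(\<forall>i. \<sigma> i < n \<and> \<sigma> i \<noteq> dst) \<Longrightarrow> dst < n \<Longrightarrow> \<exists>\<rho>'. exec x (acc d t n \<sigma> dst) (\<rho>, out) = (\<rho>', out) \<and>
     agree n \<rho>' (\<rho>(dst := \<rho> dst + tval d x t (\<rho> \<circ> \<sigma>)))"
  "(\<forall>i. \<sigma> i < n) \<Longrightarrow> \<exists>\<rho>'. exec x (tst d f n \<sigma> c1 c2) (\<rho>, out) =
     exec x (if fval d x f (\<rho> \<circ> \<sigma>) then c1 else c2) (\<rho>', out) \<and> agree n \<rho>' \<rho>"
proof (induction t and f arbitrary: n \<sigma> dst \<rho> out and n \<sigma> \<rho> out c1 c2)
  case (V i)
  \<comment> \<open>The free register \<open>n\<close> and \<open>dst\<close> are incremented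
    together until the former reaches the value of the variable, which is left intact. The loop has
    only \<open>rng d x\<close> rounds; this is the origin of the truncation in
    \<open>tval\<close>.\<close>
  define I where "I j \<rho>' \<longleftrightarrow> \<rho>' n = min j (\<rho> (\<sigma> i)) \<and>
    agree n \<rho>' (\<rho>(dst := \<rho> dst + min j (\<rho> (\<sigma> i))))" for j and \<rho>' :: "nat \<Rightarrow> nat"
  have "\<exists>\<rho>'. (exec x (IfLt n (\<sigma> i) (Seq (Inc n) (Inc dst)) Nop) ^^ rng d x) (\<rho>(n := 0), out) = (\<rho>', out)
      \<and> I (rng d x) \<rho>'"
  proof (rule exec_rep_inv)
    show "I 0 (\<rho>(n := 0))" by (auto simp: I_def agree_def)
  next
    fix j \<rho>1 assume I: "I j \<rho>1"
    have s: "\<rho>1 (\<sigma> i) = \<rho> (\<sigma> i)" using I V by (auto simp: I_def agree_def)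
    show "\<exists>\<rho>'. exec x (IfLt n (\<sigma> i) (Seq (Inc n) (Inc dst)) Nop) (\<rho>1, out) = (\<rho>', out) \<and> I (Suc j) \<rho>'"
      using I V(2) by (auto simp: s I_def agree_def min_def)
  qed
  then obtain \<rho>' where "(exec x (IfLt n (\<sigma> i) (Seq (Inc n) (Inc dst)) Nop) ^^ rng d x) (\<rho>(n := 0), out) = (\<rho>', out)"
    "I (rng d x) \<rho>'" by blast
  then show ?case by (intro exI[of _ \<rho>']) (simp add: exec_rep rng_def I_def fun_upd_def o_def)
next
  case (K c)
  then show ?case by (simp add: exec_add_const agree_def o_def)
next
  case (Scale b t)
  define I where "I j \<rho>' \<longleftrightarrow> agree n \<rho>' (\<rho>(dst := \<rho> dst + j * tval d x t (\<rho> \<circ> \<sigma>)))"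
    for j and \<rho>' :: "nat \<Rightarrow> nat"
  have "\<exists>\<rho>'. (exec x (acc d t n \<sigma> dst) ^^ ((length x + 2) ^ b)) (\<rho>, out) = (\<rho>', out) \<and>
      I ((length x + 2) ^ b) \<rho>'"
  proof (rule exec_rep_inv)
    show "I 0 \<rho>" by (auto simp: I_def agree_def)
  next
    fix j \<rho>1 assume I: "I j \<rho>1"
    have e: "\<rho>1 \<circ> \<sigma> = \<rho> \<circ> \<sigma>" using I Scale.prems by (auto simp: I_def agree_def fun_eq_iff)
    obtain \<rho>2 where 2: "exec x (acc d t n \<sigma> dst) (\<rho>1, out) = (\<rho>2, out)"
      "agree n \<rho>2 (\<rho>1(dst := \<rho>1 dst + tval d x t (\<rho> \<circ> \<sigma>)))"
      using Scale.IH[OF Scale.prems, of \<rho>1 out] unfolding e by blast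
    then show "\<exists>\<rho>'. exec x (acc d t n \<sigma> dst) (\<rho>1, out) = (\<rho>', out) \<and> I (Suc j) \<rho>'"
      using I Scale.prems(2) by (auto simp: I_def agree_def)
  qed
  then obtain \<rho>' where "(exec x (acc d t n \<sigma> dst) ^^ ((length x + 2) ^ b)) (\<rho>, out) = (\<rho>', out)"
    "I ((length x + 2) ^ b) \<rho>'" by blast
  then show ?case by (intro exI[of _ \<rho>']) (simp add: exec_rep I_def fun_upd_def o_def)
next
  case (Plus s t)
  obtain \<rho>1 where 1: "exec x (acc d s n \<sigma> dst) (\<rho>, out) = (\<rho>1, out)"
    "agree n \<rho>1 (\<rho>(dst := \<rho> dst + tval d x s (\<rho> \<circ> \<sigma>)))" using Plus.IH(1)[OF Plus.prems] by blast
  obtain \<rho>2 where 2: "exec x (acc d t n \<sigma> dst) (\<rho>1, out) = (\<rho>2, out)"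
    "agree n \<rho>2 (\<rho>1(dst := \<rho>1 dst + tval d x t (\<rho>1 \<circ> \<sigma>)))" using Plus.IH(2)[OF Plus.prems] by blast
  have "\<rho>1 \<circ> \<sigma> = \<rho> \<circ> \<sigma>" using 1(2) Plus.prems by (auto simp: agree_def fun_eq_iff)
  then show ?case using 1 2 Plus.prems by (auto simp: agree_def o_def)
next
  case (Sum i t)
  \<comment> \<open>Register \<open>n\<close> holds the summation variable, and the body may use the
    registers above it.\<close>
  define I where "I j \<rho>' \<longleftrightarrow> \<rho>' n = j \<and>
    agree n \<rho>' (\<rho>(dst := \<rho> dst + (\<Sum>v<j. tval d x t ((\<rho> \<circ> \<sigma>)(i := v)))))" for j and \<rho>' :: "nat \<Rightarrow> nat"
  have "\<exists>\<rho>'. (exec x (Seq (acc d t (Suc n) (\<sigma>(i := n)) dst) (Inc n)) ^^ rng d x) (\<rho>(n := 0), out) = (\<rho>', out)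
      \<and> I (rng d x) \<rho>'"
  proof (rule exec_rep_inv)
    show "I 0 (\<rho>(n := 0))" by (auto simp: I_def agree_def)
  next
    fix j \<rho>1 assume I: "I j \<rho>1"
    have s: "\<rho>1 \<circ> \<sigma>(i := n) = (\<rho> \<circ> \<sigma>)(i := j)"
      using I Sum.prems by (auto simp: I_def agree_def fun_eq_iff)
    have "\<forall>k. (\<sigma>(i := n)) k < Suc n \<and> (\<sigma>(i := n)) k \<noteq> dst" "dst < Suc n"
      using Sum.prems by (auto intro: less_SucI)
    from Sum.IH[OF this, of \<rho>1 out] obtain \<rho>2 where
      2: "exec x (acc d t (Suc n) (\<sigma>(i := n)) dst) (\<rho>1, out) = (\<rho>2, out)"
      "agree (Suc n) \<rho>2 (\<rho>1(dst := \<rho>1 dst + tval d x t ((\<rho> \<circ> \<sigma>)(i := j))))" unfolding s by blast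
    have "I (Suc j) (\<rho>2(n := Suc (\<rho>2 n)))"
      using 2(2) I Sum.prems(2) by (auto simp: I_def agree_def)
    then show "\<exists>\<rho>'. exec x (Seq (acc d t (Suc n) (\<sigma>(i := n)) dst) (Inc n)) (\<rho>1, out) = (\<rho>', out) \<and>
        I (Suc j) \<rho>'" using 2(1) by simp
  qed
  then obtain \<rho>' where "(exec x (Seq (acc d t (Suc n) (\<sigma>(i := n)) dst) (Inc n)) ^^ rng d x) (\<rho>(n := 0), out) = (\<rho>', out)"
    "I (rng d x) \<rho>'" by blast
  moreover have "exec x (acc d (Sum i t) n \<sigma> dst) (\<rho>, out) =
      (exec x (Seq (acc d t (Suc n) (\<sigma>(i := n)) dst) (Inc n)) ^^ rng d x) (\<rho>(n := 0), out)"
    by (simp only: acc.simps exec.simps(5)[of x "Reset n"] exec.simps(2) exec_rep rng_def)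
  ultimately show ?case by (intro exI[of _ \<rho>']) (simp add: I_def fun_upd_def o_def)
next
  case (Cond f t)
  obtain \<rho>1 where 1: "exec x (tst d f n \<sigma> (acc d t n \<sigma> dst) Nop) (\<rho>, out) =
     exec x (if fval d x f (\<rho> \<circ> \<sigma>) then acc d t n \<sigma> dst else Nop) (\<rho>1, out)" "agree n \<rho>1 \<rho>"
    using Cond.IH(1)[of \<sigma> n] Cond.prems by blast
  have e: "\<rho>1 \<circ> \<sigma> = \<rho> \<circ> \<sigma>" using 1(2) Cond.prems by (auto simp: agree_def fun_eq_iff)
  show ?case
  proof (cases "fval d x f (\<rho> \<circ> \<sigma>)")
    case True
    then show ?thesis using 1 Cond.IH(2)[OF Cond.prems, of \<rho>1 out] e Cond.prems(2) by (auto simp: agree_def o_def)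
  next
    case False
    then show ?thesis using 1 by (auto simp: agree_def o_def)
  qed
next
  case (Lt s t)
  have p: "\<forall>i. \<sigma> i < n + 2 \<and> \<sigma> i \<noteq> n" "n < n + 2" "\<forall>i. \<sigma> i < n + 2 \<and> \<sigma> i \<noteq> n + 1" "n + 1 < n + 2"
    using Lt.prems by (auto simp: nat_neq_iff less_SucI)
  obtain \<rho>1 where 1: "exec x (acc d s (n + 2) \<sigma> n) (\<rho>(n := 0), out) = (\<rho>1, out)"
    "agree (n + 2) \<rho>1 ((\<rho>(n := 0))(n := (\<rho>(n := 0)) n + tval d x s (\<rho>(n := 0) \<circ> \<sigma>)))"
    using Lt.IH(1)[OF p(1,2)] by blast
  define \<rho>1' where "\<rho>1' = \<rho>1(n + 1 := 0)"
  obtain \<rho>2 where 2: "exec x (acc d t (n + 2) \<sigma> (n + 1)) (\<rho>1', out) = (\<rho>2, out)"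
    "agree (n + 2) \<rho>2 (\<rho>1'(n + 1 := \<rho>1' (n + 1) + tval d x t (\<rho>1' \<circ> \<sigma>)))"
    using Lt.IH(2)[OF p(3,4)] by blast
  have lt: "\<sigma> i < n" for i using Lt.prems by blast
  have ne: "\<sigma> i \<noteq> n" "\<sigma> i \<noteq> Suc n" "\<sigma> i < Suc (Suc n)" for i using lt[of i] by auto
  have e1: "\<rho>(n := 0) \<circ> \<sigma> = \<rho> \<circ> \<sigma>" using ne by (auto simp: fun_eq_iff)
  have e2: "\<rho>1' \<circ> \<sigma> = \<rho> \<circ> \<sigma>" using ne 1(2) by (auto simp: fun_eq_iff \<rho>1'_def agree_def)
  have v1: "\<rho>2 n = tval d x s (\<rho> \<circ> \<sigma>)" using 1(2) 2(2) e1 by (auto simp: agree_def \<rho>1'_def)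
  have v2: "\<rho>2 (Suc n) = tval d x t (\<rho> \<circ> \<sigma>)" using 2(2) e2 by (auto simp: agree_def \<rho>1'_def)
  have "agree n \<rho>2 \<rho>" using 1(2) 2(2) by (auto simp: agree_def \<rho>1'_def)
  then show ?case using 1(1) 2(1) v1 v2 by (intro exI[of _ \<rho>2]) (simp add: \<rho>1'_def o_def)
next
  case (At y t)
  have lt: "\<sigma> i < n" for i using At.prems by blast
  have ne: "\<sigma> i \<noteq> n" "\<sigma> i < Suc n" for i using lt[of i] by auto
  have p: "\<forall>i. \<sigma> i < n + 1 \<and> \<sigma> i \<noteq> n" "n < n + 1" using ne by auto
  obtain \<rho>1 where 1: "exec x (acc d t (n + 1) \<sigma> n) (\<rho>(n := 0), out) = (\<rho>1, out)"
    "agree (n + 1) \<rho>1 ((\<rho>(n := 0))(n := (\<rho>(n := 0)) n + tval d x t (\<rho>(n := 0) \<circ> \<sigma>)))"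
    using At.IH[OF p] by blast
  have e1: "\<rho>(n := 0) \<circ> \<sigma> = \<rho> \<circ> \<sigma>" using ne by (auto simp: fun_eq_iff)
  have "\<rho>1 n = tval d x t (\<rho> \<circ> \<sigma>)" "agree n \<rho>1 \<rho>" using 1(2) e1 by (auto simp: agree_def)
  then show ?case using 1(1) by (intro exI[of _ \<rho>1]) (simp add: o_def)
next
  case (Neg f)
  show ?case using Neg.IH[OF Neg.prems, of c2 c1 \<rho> out] by (auto simp: o_def)
next
  case (Conj f g)
  obtain \<rho>1 where 1: "exec x (tst d f n \<sigma> (tst d g n \<sigma> c1 c2) c2) (\<rho>, out) =
     exec x (if fval d x f (\<rho> \<circ> \<sigma>) then tst d g n \<sigma> c1 c2 else c2) (\<rho>1, out)" "agree n \<rho>1 \<rho>"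
    using Conj.IH(1)[OF Conj.prems] by blast
  have e: "\<rho>1 \<circ> \<sigma> = \<rho> \<circ> \<sigma>" using 1(2) Conj.prems by (auto simp: agree_def fun_eq_iff)
  show ?case
  proof (cases "fval d x f (\<rho> \<circ> \<sigma>)")
    case True
    then show ?thesis using 1 Conj.IH(2)[OF Conj.prems, of c1 c2 \<rho>1 out] e by (auto simp: agree_def o_def)
  next
    case False
    then show ?thesis using 1 by (auto simp: agree_def o_def)
  qed
qed

theorem polytime_decidable_fval: "polytime_decidable {x. fval d x f (\<lambda>_. 0)}"
proof -
  have "snd (exec x (tst d f 1 (\<lambda>_. 0) (Out True) (Out False)) (\<lambda>_. 0, [])) = [x \<in> {x. fval d x f (\<lambda>_. 0)}]" for x
  proof -
    have "(\<lambda>_. 0) \<circ> (\<lambda>_. 0) = (\<lambda>_::nat. 0::nat)" by auto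
    then show ?thesis using acc_tst_correct(2)[of "\<lambda>_. 0" 1 x d f "Out True" "Out False" "\<lambda>_. 0" "[]"]
      by auto
  qed
  then show ?thesis unfolding polytime_decidable_def
    using polytime_exec[of "tst d f 1 (\<lambda>_. 0) (Out True) (Out False)"] by simp
qed

section \<open>Programs that print an adjacency matrix\<close>

text \<open>The printed word may depend only on registers below \<open>n\<close>. Whatever earlier
  parts leave in their free registers is then irrelevant for later ones, and the words can simply be
  concatenated.\<close>

definition emits :: "nat \<Rightarrow> cmd \<Rightarrow> (bool list \<Rightarrow> (nat \<Rightarrow> nat) \<Rightarrow> bool list) \<Rightarrow> bool" where
  "emits n c g \<longleftrightarrow> (\<forall>x \<rho> out. \<exists>\<rho>'. exec x c (\<rho>, out) = (\<rho>', out @ g x \<rho>) \<and> agree n \<rho>' \<rho>) \<and>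
     (\<forall>x \<rho> \<rho>'. agree n \<rho> \<rho>' \<longrightarrow> g x \<rho> = g x \<rho>')"

lemma emits_Out: "emits n (Out b) (\<lambda>x \<rho>. [b])" and emits_Nop: "emits n Nop (\<lambda>x \<rho>. [])"
  by (auto simp: emits_def agree_def)

lemma emits_Seq:
  assumes "emits n a g" "emits n b h"
  shows "emits n (Seq a b) (\<lambda>x \<rho>. g x \<rho> @ h x \<rho>)"
  unfolding emits_def
proof (intro conjI allI impI)
  fix x \<rho> out
  obtain \<rho>1 where 1: "exec x a (\<rho>, out) = (\<rho>1, out @ g x \<rho>)" "agree n \<rho>1 \<rho>"
    using assms(1) unfolding emits_def by blast
  obtain \<rho>2 where 2: "exec x b (\<rho>1, out @ g x \<rho>) = (\<rho>2, (out @ g x \<rho>) @ h x \<rho>1)" "agree n \<rho>2 \<rho>1"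
    using assms(2) unfolding emits_def by blast
  have "h x \<rho>1 = h x \<rho>" using assms(2) 1(2) unfolding emits_def by blast
  then show "\<exists>\<rho>'. exec x (Seq a b) (\<rho>, out) = (\<rho>', out @ g x \<rho> @ h x \<rho>) \<and> agree n \<rho>' \<rho>"
    using 1 2 by (auto simp: agree_def)
next
  fix x \<rho> \<rho>' assume "agree n \<rho> \<rho>'"
  then have "g x \<rho> = g x \<rho>'" "h x \<rho> = h x \<rho>'" using assms unfolding emits_def by blast+
  then show "g x \<rho> @ h x \<rho> = g x \<rho>' @ h x \<rho>'" by simp
qed

lemma emits_tst:
  assumes "emits n c1 g1" "emits n c2 g2" "\<forall>i. \<sigma> i < n"
  shows "emits n (tst d f n \<sigma> c1 c2) (\<lambda>x \<rho>. if fval d x f (\<rho> \<circ> \<sigma>) then g1 x \<rho> else g2 x \<rho>)"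
  unfolding emits_def
proof (intro conjI allI impI)
  fix x \<rho> out
  obtain \<rho>1 where 1: "exec x (tst d f n \<sigma> c1 c2) (\<rho>, out) =
     exec x (if fval d x f (\<rho> \<circ> \<sigma>) then c1 else c2) (\<rho>1, out)" "agree n \<rho>1 \<rho>"
    using acc_tst_correct(2)[OF assms(3)] by blast
  have g: "g1 x \<rho>1 = g1 x \<rho>" "g2 x \<rho>1 = g2 x \<rho>" using assms(1,2) 1(2) unfolding emits_def by blast+
  obtain \<rho>2 where 2: "exec x c1 (\<rho>1, out) = (\<rho>2, out @ g1 x \<rho>)" "agree n \<rho>2 \<rho>1"
    using assms(1) g unfolding emits_def by metis
  obtain \<rho>3 where 3: "exec x c2 (\<rho>1, out) = (\<rho>3, out @ g2 x \<rho>)" "agree n \<rho>3 \<rho>1"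
    using assms(2) g unfolding emits_def by metis
  show "\<exists>\<rho>'. exec x (tst d f n \<sigma> c1 c2) (\<rho>, out) =
      (\<rho>', out @ (if fval d x f (\<rho> \<circ> \<sigma>) then g1 x \<rho> else g2 x \<rho>)) \<and> agree n \<rho>' \<rho>"
    using 1 2 3 by (auto simp: agree_def)
next
  fix x \<rho> \<rho>' assume a: "agree n \<rho> \<rho>'"
  then have "g1 x \<rho> = g1 x \<rho>'" "g2 x \<rho> = g2 x \<rho>'" using assms unfolding emits_def by blast+
  moreover have "\<rho> \<circ> \<sigma> = \<rho>' \<circ> \<sigma>" using a assms(3) by (auto simp: agree_def)
  ultimately show "(if fval d x f (\<rho> \<circ> \<sigma>) then g1 x \<rho> else g2 x \<rho>) =
      (if fval d x f (\<rho>' \<circ> \<sigma>) then g1 x \<rho>' else g2 x \<rho>')" by simp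
qed

definition for_all :: "nat \<Rightarrow> nat \<Rightarrow> cmd \<Rightarrow> cmd" where
  "for_all d n c = Seq (Reset n) (rep d (Seq c (Inc n)))"

lemma emits_for_all:
  assumes "emits (Suc n) c g"
  shows "emits n (for_all d n c) (\<lambda>x \<rho>. concat (map (\<lambda>v. g x (\<rho>(n := v))) [0..<rng d x]))"
  unfolding emits_def
proof (intro conjI allI impI)
  fix x \<rho> out
  define W where "W k = concat (map (\<lambda>v. g x (\<rho>(n := v))) [0..<k])" for k
  have W: "W 0 = []" "W (Suc k) = W k @ g x (\<rho>(n := k))" for k by (simp_all add: W_def)
  have "\<exists>\<rho>'. (exec x (Seq c (Inc n)) ^^ k) (\<rho>(n := 0), out) = (\<rho>', out @ W k) \<and>
     agree n \<rho>' \<rho> \<and> \<rho>' n = k" for k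
  proof (induction k)
    case (Suc k)
    then obtain \<rho>1 where 1: "(exec x (Seq c (Inc n)) ^^ k) (\<rho>(n := 0), out) = (\<rho>1, out @ W k)"
      "agree n \<rho>1 \<rho>" "\<rho>1 n = k" by blast
    have "agree (Suc n) \<rho>1 (\<rho>(n := k))" using 1(2,3) by (auto simp: agree_def)
    then have g: "g x \<rho>1 = g x (\<rho>(n := k))" using assms unfolding emits_def by blast
    obtain \<rho>2 where 2: "exec x c (\<rho>1, out @ W k) = (\<rho>2, (out @ W k) @ g x \<rho>1)" "agree (Suc n) \<rho>2 \<rho>1"
      using assms unfolding emits_def by blast
    have "agree n (\<rho>2(n := \<rho>2 n + 1)) \<rho>" "(\<rho>2(n := \<rho>2 n + 1)) n = Suc k"
      using 1(2,3) 2(2) by (auto simp: agree_def)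
    moreover have "(exec x (Seq c (Inc n)) ^^ Suc k) (\<rho>(n := 0), out) = (\<rho>2(n := \<rho>2 n + 1), out @ W (Suc k))"
      unfolding funpow.simps comp_apply 1(1) exec.simps(5) 2(1) exec.simps(1) g W by simp
    ultimately show ?case by blast
  qed (auto simp: agree_def W)
  then show "\<exists>\<rho>'. exec x (for_all d n c) (\<rho>, out) =
      (\<rho>', out @ concat (map (\<lambda>v. g x (\<rho>(n := v))) [0..<rng d x])) \<and> agree n \<rho>' \<rho>"
    unfolding for_all_def exec.simps(5)[of x "Reset n"] exec.simps(2) exec_rep rng_def W_def[symmetric] by blast
next
  fix x \<rho> \<rho>' assume a: "agree n \<rho> \<rho>'"
  have "g x (\<rho>(n := v)) = g x (\<rho>'(n := v))" for v
    using assms a unfolding emits_def by (auto simp: agree_def less_Suc_eq)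
  then show "concat (map (\<lambda>v. g x (\<rho>(n := v))) [0..<rng d x]) =
      concat (map (\<lambda>v. g x (\<rho>'(n := v))) [0..<rng d x])" by simp
qed

fun seqs :: "(nat \<Rightarrow> cmd) \<Rightarrow> nat list \<Rightarrow> cmd" where
  "seqs c [] = Nop"
| "seqs c (k # ks) = Seq (c k) (seqs c ks)"

lemma emits_seqs:
  "(\<And>k. emits n (c k) (g k)) \<Longrightarrow> emits n (seqs c ks) (\<lambda>x \<rho>. concat (map (\<lambda>k. g k x \<rho>) ks))"
proof (induction ks)
  case (Cons k ks)
  then show ?case using emits_Seq[of n "c k" "g k" "seqs c ks"] by simp
qed (simp add: emits_Nop)

text \<open>Prints one bit for each pair of existing vertices. Triples that are not vertices are
  skipped, which compresses the index range and renumbers the vertices from 0 on. The vertex number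
  inside a tile is below a constant, so its loop is unrolled and does not occupy a variable;
  variables from 4 on are bound inside the formulas.\<close>

definition matrix_output :: "nat \<Rightarrow> nat \<Rightarrow> (nat \<Rightarrow> nat \<Rightarrow> nat \<Rightarrow> fm) \<Rightarrow> (nat \<Rightarrow> nat \<Rightarrow> fm) \<Rightarrow> bool list \<Rightarrow> bool list" where
  "matrix_output d m ex adj x =
     concat (map (\<lambda>I. concat (map (\<lambda>J. concat (map (\<lambda>k.
     concat (map (\<lambda>I'. concat (map (\<lambda>J'. concat (map (\<lambda>k'.
       let e = (\<lambda>i. if i = 0 then I else if i = 1 then J else if i = 2 then I' else if i = 3 then J' else I) in
       if fval d x (ex k 0 1) e then (if fval d x (ex k' 2 3) e then [fval d x (adj k k') e] else []) else [])
     [0..<m])) [0..<rng d x])) [0..<rng d x])) [0..<m])) [0..<rng d x])) [0..<rng d x])"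

lemma emits_snd:
  assumes "emits n c g"
  shows "snd (exec x c (\<rho>, [])) = g x \<rho>"
proof -
  obtain \<rho>' where "exec x c (\<rho>, []) = (\<rho>', [] @ g x \<rho>)" using assms unfolding emits_def by blast
  then show ?thesis by simp
qed

theorem polytime_matrix_output: "polytime (matrix_output d m ex adj)"
proof -
  let ?n4 = "Suc (Suc (Suc (Suc 0)))"
  define \<sigma> where "\<sigma> i = (if i < 4 then i else 0::nat)" for i
  have \<sigma>: "\<forall>i. \<sigma> i < ?n4" by (simp add: \<sigma>_def)
  define body where "body k k' = tst d (ex k 0 1) ?n4 \<sigma> (tst d (ex k' 2 3) ?n4 \<sigma>
     (tst d (adj k k') ?n4 \<sigma> (Out True) (Out False)) Nop) Nop" for k k'
  define g where "g k k' x e = (if fval d x (ex k 0 1) e then (if fval d x (ex k' 2 3) e then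
         (if fval d x (adj k k') e then [True] else [False]) else []) else [])" for k k' x e
  have "emits ?n4 (body k k') (\<lambda>x \<rho>. g k k' x (\<rho> \<circ> \<sigma>))" for k k'
    unfolding body_def g_def by (intro emits_tst emits_Out emits_Nop \<sigma>)
  note e1 = emits_seqs[where ks = "[0..<m]", OF this]
  note e2 = emits_for_all[where d = d, OF emits_for_all[where d = d, OF e1]]
  note e3 = emits_for_all[where d = d, OF emits_for_all[where d = d, OF emits_seqs[where ks = "[0..<m]", OF e2]]]
  have env: "(\<lambda>_. 0)(0 := I, Suc 0 := J, Suc (Suc 0) := I', Suc (Suc (Suc 0)) := J') \<circ> \<sigma> =
    (\<lambda>i. if i = 0 then I else if i = 1 then J else if i = 2 then I' else if i = 3 then J' else I)"
    for I J I' J'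
    by (auto simp: \<sigma>_def fun_eq_iff)
  have tf: "(if b then [True] else [False]) = [b]" for b by simp
  note e4 = emits_snd[where \<rho> = "\<lambda>_. 0", OF e3, unfolded env g_def tf]
  have "matrix_output d m ex adj = (\<lambda>x. snd (exec x (for_all d 0 (for_all d (Suc 0) (seqs (\<lambda>k. for_all d (Suc (Suc 0))
     (for_all d (Suc (Suc (Suc 0))) (seqs (body k) [0..<m]))) [0..<m]))) (\<lambda>_. 0, [])))"
    unfolding e4 matrix_output_def Let_def by (rule ext) (rule refl)
  then show ?thesis using polytime_exec by simp
qed

section \<open>Clause templates\<close>

text \<open>The propositions of a run: the state, the head position on tape \<open>j\<close>, the
  symbol read on tape \<open>j\<close>, and the content of a cell of tape \<open>j\<close>. In
  \<alpha> \<kappa> a t the last index is the time and \<open>a\<close> is a shifted cell number, or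
  0 where no cell is involved.\<close>

datatype kind = St nat | Hd nat | Rd nat nat | Cl nat nat

fun kc :: "kind \<Rightarrow> nat" where
  "kc (St q) = 4 * q"
| "kc (Hd j) = 4 * j + 1"
| "kc (Rd j s) = 4 * prod_encode (j, s) + 2"
| "kc (Cl j s) = 4 * prod_encode (j, s) + 3"

lemma kc_inj: "kc a = kc b \<longleftrightarrow> a = b"
  by (cases a; cases b; simp) (presburger+)?

declare kc.simps [simp del]

type_synonym literal = "bool \<times> nat \<times> trm \<times> trm"
type_synonym template = "fm \<times> literal list"

text \<open>A template is a clause for all values below \<open>B\<close> of the variables 10, 11 and 12, subject to a guard.
  The propositional variables \<open>\<alpha> \<kappa> a b\<close> have a kind \<open>\<kappa>\<close> and two indices below \<open>B\<close>.\<close>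

definition env3 :: "nat \<Rightarrow> nat \<Rightarrow> nat \<Rightarrow> nat \<Rightarrow> nat" where
  "env3 t p p' = (\<lambda>_. 0)(10 := t, 11 := p, 12 := p')"

definition template_sat :: "nat \<Rightarrow> nat \<Rightarrow> template list \<Rightarrow> bool list \<Rightarrow> (nat \<Rightarrow> nat \<Rightarrow> nat \<Rightarrow> bool) \<Rightarrow> bool" where
  "template_sat d b ts x \<alpha> \<longleftrightarrow> (\<forall>(g, ls)\<in>set ts. \<forall>t<rng b x. \<forall>p<rng b x. \<forall>p'<rng b x.
     fval d x g (env3 t p p') \<longrightarrow> (\<exists>(s, \<kappa>, ta, tb)\<in>set ls.
       tval d x ta (env3 t p p') < rng b x \<and> tval d x tb (env3 t p p') < rng b x \<and>
       \<alpha> \<kappa> (tval d x ta (env3 t p p')) (tval d x tb (env3 t p p')) = s))"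

primrec tfv :: "trm \<Rightarrow> nat set" and ffv :: "fm \<Rightarrow> nat set" where
  "tfv (V i) = {i}"
| "tfv (K c) = {}"
| "tfv (Scale b t) = tfv t"
| "tfv (Plus s t) = tfv s \<union> tfv t"
| "tfv (Sum i t) = tfv t - {i}"
| "tfv (Cond f t) = ffv f \<union> tfv t"
| "ffv (Lt s t) = tfv s \<union> tfv t"
| "ffv (At y t) = tfv t"
| "ffv (Neg f) = ffv f"
| "ffv (Conj f g) = ffv f \<union> ffv g"

lemma val_cong:
  "(\<And>i. i \<in> tfv t \<Longrightarrow> e i = e' i) \<Longrightarrow> tval d x t e = tval d x t e'"
  "(\<And>i. i \<in> ffv f \<Longrightarrow> e i = e' i) \<Longrightarrow> fval d x f e = fval d x f e'"
proof (induction t and f arbitrary: e e' and e e')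
  case (Sum i t)
  have "tval d x t (e(i := v)) = tval d x t (e'(i := v))" for v
    by (rule Sum.IH) (use Sum.prems in auto)
  then show ?case by simp
next
  case (Cond f t)
  have "fval d x f e = fval d x f e'" by (rule Cond.IH(1)) (use Cond.prems in simp)
  moreover have "tval d x t e = tval d x t e'" by (rule Cond.IH(2)) (use Cond.prems in simp)
  ultimately show ?case by simp
next
  case (Plus s t)
  have "tval d x s e = tval d x s e'" by (rule Plus.IH(1)) (use Plus.prems in simp)
  moreover have "tval d x t e = tval d x t e'" by (rule Plus.IH(2)) (use Plus.prems in simp)
  ultimately show ?case by simp
next
  case (Lt s t)
  have "tval d x s e = tval d x s e'" by (rule Lt.IH(1)) (use Lt.prems in simp)
  moreover have "tval d x t e = tval d x t e'" by (rule Lt.IH(2)) (use Lt.prems in simp)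
  ultimately show ?case by simp
next
  case (Conj f g)
  have "fval d x f e = fval d x f e'" by (rule Conj.IH(1)) (use Conj.prems in simp)
  moreover have "fval d x g e = fval d x g e'" by (rule Conj.IH(2)) (use Conj.prems in simp)
  ultimately show ?case by simp
next
  case (Scale b t)
  have "tval d x t e = tval d x t e'" by (rule Scale.IH) (use Scale.prems in simp)
  then show ?case by simp
next
  case (At y t)
  have "tval d x t e = tval d x t e'" by (rule At.IH) (use At.prems in simp)
  then show ?case by simp
next
  case (Neg f)
  have "fval d x f e = fval d x f e'" by (rule Neg.IH) (use Neg.prems in simp)
  then show ?case by simp
qed simp_all

text \<open>Guards and index terms can then be evaluated inside larger formulas, whose further
  variables do not disturb them.\<close>

definition closed3 :: "template \<Rightarrow> bool" where
  "closed3 T \<longleftrightarrow> ffv (fst T) \<subseteq> {10, 11, 12} \<and>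
     (\<forall>(s, \<kappa>, ta, tb)\<in>set (snd T). tfv ta \<subseteq> {10, 11, 12} \<and> tfv tb \<subseteq> {10, 11, 12})"

definition Tru :: fm where "Tru = Lt (K 0) (K 1)"
definition Eq :: "trm \<Rightarrow> trm \<Rightarrow> fm" where "Eq s t = Conj (Neg (Lt s t)) (Neg (Lt t s))"
definition Le :: "trm \<Rightarrow> trm \<Rightarrow> fm" where "Le s t = Neg (Lt t s)"
definition Disj :: "fm \<Rightarrow> fm \<Rightarrow> fm" where "Disj f g = Neg (Conj (Neg f) (Neg g))"

lemma fval_derived [simp]:
  "fval d x Tru e" "fval d x (Eq s t) e \<longleftrightarrow> tval d x s e = tval d x t e"
  "fval d x (Le s t) e \<longleftrightarrow> tval d x s e \<le> tval d x t e"
  "fval d x (Disj f g) e \<longleftrightarrow> fval d x f e \<or> fval d x g e"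
  by (auto simp: Tru_def Eq_def Le_def Disj_def)

definition len_trm :: trm where "len_trm = Sum 0 (Cond (Neg (At 0 (V 0))) (K 1))"

text \<open>Horner's scheme; the multiplication by the input length is a sum of that many equal
  terms, which do not mention the bound variable.\<close>

fun poly_trm :: "nat list \<Rightarrow> trm" where
  "poly_trm [] = K 0"
| "poly_trm (a # as) = Plus (K a) (Sum 0 (Cond (Lt (V 0) len_trm) (poly_trm as)))"

lemma fv_derived [simp]:
  "ffv Tru = {}" "ffv (Eq s t) = tfv s \<union> tfv t" "ffv (Le s t) = tfv t \<union> tfv s" "ffv (Disj f g) = ffv f \<union> ffv g"
  "tfv len_trm = {}"
  by (auto simp: Tru_def Eq_def Le_def Disj_def len_trm_def)

lemma tfv_poly_trm [simp]: "tfv (poly_trm as) = {}"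
  by (induction as) auto

lemma rng_gt_length: "d \<ge> 1 \<Longrightarrow> length x < rng d x"
  using self_le_power[of "length x + 2" d] by (simp add: rng_def)

lemma tval_len_trm:
  assumes "d \<ge> 1"
  shows "tval d x len_trm e = length x"
proof -
  have "tval d x len_trm e = (\<Sum>v<rng d x. if v < length x then 1 else 0)"
    unfolding len_trm_def by (auto simp: word_cells_def intro!: sum.cong)
  also have "\<dots> = card ({..<rng d x} \<inter> {v. v < length x})" by (simp add: sum.If_cases)
  also have "{..<rng d x} \<inter> {v. v < length x} = {..<length x}" using rng_gt_length[OF assms, of x] by auto
  finally show ?thesis by simp
qed

lemma tval_poly_trm:
  assumes "d \<ge> 1"
  shows "tval d x (poly_trm as) e = poly (Poly as) (length x)"
proof (induction as arbitrary: e)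
  case (Cons a as)
  have "(\<Sum>v<rng d x. if v < length x then poly (Poly as) (length x) else 0) = length x * poly (Poly as) (length x)"
  proof -
    have "{..<rng d x} \<inter> {v. v < length x} = {..<length x}" using rng_gt_length[OF assms, of x] by auto
    then show ?thesis by (simp add: sum.If_cases)
  qed
  moreover have "(\<Sum>v<rng d x. if min (rng d x) v < length x then poly (Poly as) (length x) else 0) =
    (\<Sum>v<rng d x. if v < length x then poly (Poly as) (length x) else 0)"
    by (rule sum.cong) (auto simp: min_def)
  ultimately show ?case by (simp add: tval_len_trm[OF assms] Cons.IH cong: if_cong)
qed simp

lemma poly_le_power:
  fixes p :: "nat poly"
  shows "\<exists>b. \<forall>n. poly p n \<le> (n + 2) ^ b"
proof (induction p)
  case (pCons a p)
  then obtain b where b: "\<And>n. poly p n \<le> (n + 2) ^ b" by blast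
  \<comment> \<open>In the exponent, \<open>a\<close> absorbs the new coefficient by a + 1 \<le> (n
    + 2) ^ a, and 1 accounts for the factor \<open>n\<close>.\<close>
  have "poly (pCons a p) n \<le> (n + 2) ^ (a + b + 1)" for n
  proof -
    have a: "a + 1 \<le> (n + 2) ^ a"
    proof -
      have "a < 2 ^ a" by (rule less_exp)
      also have "2 ^ a \<le> (n + 2) ^ a" by (rule power_mono) auto
      finally show ?thesis by simp
    qed
    have "poly (pCons a p) n \<le> a * (n + 2) ^ (b + 1) + 1 * (n + 2) ^ (b + 1)"
    proof (simp only: poly_pCons, rule add_mono)
      have "1 \<le> (n + 2) ^ (b + 1)" by (rule one_le_power) simp
      then show "a \<le> a * (n + 2) ^ (b + 1)" by (metis mult.right_neutral mult_le_mono2)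
      have "n * poly p n \<le> (n + 2) * (n + 2) ^ b" using b by (intro mult_le_mono) auto
      then show "n * poly p n \<le> 1 * (n + 2) ^ (b + 1)" by simp
    qed
    also have "\<dots> = (a + 1) * (n + 2) ^ (b + 1)" by (simp add: algebra_simps)
    also have "\<dots> \<le> (n + 2) ^ a * (n + 2) ^ (b + 1)" using a by (rule mult_le_mono1)
    finally show ?thesis by (simp only: power_add mult.assoc)
  qed
  then show ?case by blast
qed simp

lemma poly_mono_nat: "a \<le> b \<Longrightarrow> poly (p :: nat poly) a \<le> poly p b"
  by (induction p) (auto intro!: add_mono mult_le_mono)

lemma word_cells_pair:
  "word_cells (word_pair x w) i =
    (if i < 0 then 0 else if i < 2 * int (length x) then word_cells x (i div 2)
     else if i = 2 * int (length x) then 2 else if i = 2 * int (length x) + 1 then 1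
     else word_cells w (i - 2 * int (length x) - 2))"
proof -
  define D where "D = concat (map (\<lambda>b. [b, b]) x)"
  have len: "length D = 2 * length x" unfolding D_def by (induction x) auto
  have nth: "D ! k = x ! (k div 2)" if "k < 2 * length x" for k
    using that unfolding D_def
  proof (induction x arbitrary: k)
    case (Cons a x)
    show ?case
    proof (cases "k < 2")
      case True
      then have "k = 0 \<or> k = 1" by linarith
      then show ?thesis by auto
    next
      case False
      then obtain l where l: "k = Suc (Suc l)" by (metis One_nat_def Suc_1 less_Suc_eq_0_disj not0_implies_Suc zero_less_Suc)
      then show ?thesis using Cons.IH[of l] Cons.prems by simp
    qed
  qed simp
  show ?thesis
  proof (cases "i < 0")
    case True
    then show ?thesis by (simp add: word_cells_def)
  next
    case False
    then obtain k where i: "i = int k" by (metis nonneg_int_cases not_less)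
    have wp: "word_pair x w = D @ True # False # w" by (simp add: word_pair_def D_def)
    consider "k < 2 * length x" | "k = 2 * length x" | "k = Suc (2 * length x)" | l where "k = 2 * length x + 2 + l"
      by (metis add_2_eq_Suc' le_Suc_ex linorder_not_less not_less_eq_eq nat_less_le order_antisym_conv add_Suc)
    then show ?thesis
    proof cases
      case 1
      then have "k div 2 < length x" by linarith
      moreover have "int k div 2 = int (k div 2)" by (simp add: zdiv_int)
      ultimately show ?thesis using 1 by (simp add: word_cells_def wp i len nth nth_append nat_div_distrib)
    next
      case (4 l)
      have idx: "(D @ True # False # w) ! k = w ! l" using 4 len by (simp add: nth_append)
      have il: "i - 2 * int (length x) - 2 = int l" using i 4 by simp
      have a: "word_cells (word_pair x w) i = word_cells w (int l)"
      proof -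
        have ni: "nat i = k" using i by simp
        have r: "(0 \<le> i \<and> i < int (length (D @ True # False # w))) = (0 \<le> int l \<and> int l < int (length w))"
          using i 4 len by auto
        show ?thesis unfolding word_cells_def wp r ni idx by simp
      qed
      have "\<not> i < 2 * int (length x)" "i \<noteq> 2 * int (length x)" "i \<noteq> 2 * int (length x) + 1" "\<not> i < 0"
        using i 4 by auto
      then show ?thesis unfolding a il by simp
    qed (auto simp: word_cells_def wp i len nth_append)
  qed
qed

definition lit_sat :: "nat \<Rightarrow> nat \<Rightarrow> bool list \<Rightarrow> (nat \<Rightarrow> nat \<Rightarrow> nat \<Rightarrow> bool) \<Rightarrow> (nat \<Rightarrow> nat) \<Rightarrow> literal \<Rightarrow> bool" where
  "lit_sat d b x \<alpha> e l = (case l of (s, \<kappa>, ta, tb) \<Rightarrow>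
     tval d x ta e < rng b x \<and> tval d x tb e < rng b x \<and> \<alpha> \<kappa> (tval d x ta e) (tval d x tb e) = s)"

definition tsat :: "nat \<Rightarrow> nat \<Rightarrow> bool list \<Rightarrow> (nat \<Rightarrow> nat \<Rightarrow> nat \<Rightarrow> bool) \<Rightarrow> template \<Rightarrow> bool" where
  "tsat d b x \<alpha> T = (\<forall>t<rng b x. \<forall>p<rng b x. \<forall>p'<rng b x.
     fval d x (fst T) (env3 t p p') \<longrightarrow> (\<exists>l\<in>set (snd T). lit_sat d b x \<alpha> (env3 t p p') l))"

lemma template_sat_iff: "template_sat d b ts x \<alpha> \<longleftrightarrow> (\<forall>T\<in>set ts. tsat d b x \<alpha> T)"
  unfolding template_sat_def tsat_def lit_sat_def by (simp add: case_prod_beta)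

section \<open>Accepting runs of a verifier as satisfiable templates\<close>

text \<open>A pair with a witness of length at most q(n) has length at most 2 n + 2 + q(n). The
  power with exponent \<open>b1\<close> bounds this length as well as the running time on it, so
  that one number serves as time bound and as space bound.\<close>

locale verifier =
  fixes M :: turing_machine and A :: "bool list set" and pV q :: "nat poly" and b1 :: nat
  assumes wf: "wf_tm M"
    and dec: "\<And>y. tm_computes_within M y (poly pV (length y)) [y \<in> A]"
    and b1: "\<And>n. poly pV (2 * n + 2 + poly q n) \<le> (n + 2) ^ b1" "\<And>n. 2 * n + 2 + poly q n \<le> (n + 2) ^ b1"
begin

text \<open>With T = (n + 2) ^ \<open>b1\<close>, the additional factor (n + 2) ^ 2 is at least 4.
  The range of the indices thus exceeds the 2 T + 1 cells and T + 1 times that are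
  described.\<close>

definition b2 :: nat where "b2 = b1 + 2"

abbreviation "k \<equiv> num_tapes M"
abbreviation "Q \<equiv> num_states M"
abbreviation "G \<equiv> num_syms M"

text \<open>The transition made total: a halted machine keeps its configuration. The run can then be
  inspected at one fixed time.\<close>

definition stp :: "nat \<Rightarrow> nat list \<Rightarrow> nat \<times> (nat \<times> head_move) list" where
  "stp s ss = (case delta M s ss of None \<Rightarrow> (s, noact ss) | Some r \<Rightarrow> r)"

lemma tm_step_stp:
  "tm_step M (s, ts) = (fst (stp s (map tape_read ts)), map2 tape_act (snd (stp s (map tape_read ts))) ts)"
  by (simp add: stp_def tape_act_noact split: option.splits prod.splits)

definition cfg :: "bool list \<Rightarrow> nat \<Rightarrow> config" where
  "cfg y t = (tm_step M ^^ t) (tm_init M y)"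

definition st :: "bool list \<Rightarrow> nat \<Rightarrow> nat" where "st y t = fst (cfg y t)"
definition cel :: "bool list \<Rightarrow> nat \<Rightarrow> nat \<Rightarrow> int \<Rightarrow> nat" where "cel y t j = fst (snd (cfg y t) ! j)"
definition hed :: "bool list \<Rightarrow> nat \<Rightarrow> nat \<Rightarrow> int" where "hed y t j = snd (snd (cfg y t) ! j)"
definition rds :: "bool list \<Rightarrow> nat \<Rightarrow> nat list" where "rds y t = map (\<lambda>j. cel y t j (hed y t j)) [0..<k]"
definition nxt :: "bool list \<Rightarrow> nat \<Rightarrow> nat \<times> (nat \<times> head_move) list" where "nxt y t = stp (st y t) (rds y t)"

lemma k1: "k \<ge> 1" and G3: "G \<ge> 3" using wf unfolding wf_tm_def by auto

lemma stp_wf: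
  assumes "s < Q" "length ss = k" "set ss \<subseteq> {..<G}"
  shows "fst (stp s ss) < Q" "length (snd (stp s ss)) = k" "fst ` set (snd (stp s ss)) \<subseteq> {..<G}"
proof -
  have "fst (stp s ss) < Q \<and> length (snd (stp s ss)) = k \<and> fst ` set (snd (stp s ss)) \<subseteq> {..<G}"
  proof (cases "delta M s ss")
    case None
    then show ?thesis using assms by (auto simp: stp_def noact_def)
  next
    case (Some r)
    obtain s' acts where r: "r = (s', acts)" by force
    have "s' < Q \<and> length acts = k \<and> fst ` set acts \<subseteq> {..<G}"
      using wf assms Some r unfolding wf_tm_def by blast
    then show ?thesis by (simp add: stp_def Some r)
  qed
  then show "fst (stp s ss) < Q" "length (snd (stp s ss)) = k" "fst ` set (snd (stp s ss)) \<subseteq> {..<G}" by blast+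
qed

text \<open>A head moves by at most one cell per step. Up to time T it therefore stays among the
  cells from -T to T, the only ones that the clauses describe.\<close>

lemma cfg_inv:
  "st y t < Q \<and> length (snd (cfg y t)) = k \<and> (\<forall>j<k. (\<forall>i. cel y t j i < G) \<and> \<bar>hed y t j\<bar> \<le> int t)"
  and cfg_rds: "map tape_read (snd (cfg y t)) = rds y t"
  and cfg_step: "st y (Suc t) = fst (nxt y t) \<and> (\<forall>j<k. cel y (Suc t) j = (cel y t j)(hed y t j := fst (snd (nxt y t) ! j)) \<and>
     hed y (Suc t) j = hed y t j + offset (snd (snd (nxt y t) ! j)))"
proof -
  have rd: "map tape_read (snd (cfg y t)) = rds y t" if "length (snd (cfg y t)) = k" for t
  proof (rule nth_equalityI)
    fix i assume "i < length (map tape_read (snd (cfg y t)))"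
    then have i: "i < k" using that by simp
    then show "map tape_read (snd (cfg y t)) ! i = rds y t ! i"
      using that by (cases "snd (cfg y t) ! i") (simp add: rds_def cel_def hed_def)
  qed (simp add: rds_def that)
  have stepf: "st y (Suc t) = fst (nxt y t) \<and> length (snd (cfg y (Suc t))) = min (length (snd (nxt y t))) (length (snd (cfg y t))) \<and>
     (length (snd (nxt y t)) = k \<longrightarrow> (\<forall>j<k. cel y (Suc t) j = (cel y t j)(hed y t j := fst (snd (nxt y t) ! j)) \<and>
     hed y (Suc t) j = hed y t j + offset (snd (snd (nxt y t) ! j))))" if len: "length (snd (cfg y t)) = k" for t
  proof -
    have "cfg y (Suc t) = tm_step M (fst (cfg y t), snd (cfg y t))" by (simp add: cfg_def)
    then have c: "cfg y (Suc t) = (fst (nxt y t), map2 tape_act (snd (nxt y t)) (snd (cfg y t)))"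
      unfolding tm_step_stp by (simp add: rd[OF len] nxt_def st_def)
    have "cel y (Suc t) j = (cel y t j)(hed y t j := fst (snd (nxt y t) ! j)) \<and>
     hed y (Suc t) j = hed y t j + offset (snd (snd (nxt y t) ! j))" if "length (snd (nxt y t)) = k" "j < k" for j
    proof -
      obtain a m where am: "snd (nxt y t) ! j = (a, m)" by force
      obtain f h where fh: "snd (cfg y t) ! j = (f, h)" by force
      have "snd (cfg y (Suc t)) ! j = tape_act (a, m) (f, h)" using that len by (simp add: c am fh)
      then show ?thesis by (simp add: cel_def hed_def am fh)
    qed
    then show ?thesis by (simp add: c st_def)
  qed
  have inv: "st y t < Q \<and> length (snd (cfg y t)) = k \<and> (\<forall>j<k. (\<forall>i. cel y t j i < G) \<and> \<bar>hed y t j\<bar> \<le> int t)" for t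
  proof (induction t)
    case 0
    have "word_cells y i < 3" for y i by (simp add: word_cells_def)
    then have "word_cells y i < G" for y i using G3 by (meson less_le_trans)
    then show ?case using wf k1
      by (auto simp: st_def cel_def hed_def cfg_def tm_init_def wf_tm_def nth_Cons split: nat.splits)
  next
    case (Suc t)
    then have len: "length (snd (cfg y t)) = k" by blast
    have sr: "set (rds y t) \<subseteq> {..<G}" using Suc by (auto simp: rds_def)
    have lr: "length (rds y t) = k" by (simp add: rds_def)
    have n: "fst (nxt y t) < Q" "length (snd (nxt y t)) = k" "fst ` set (snd (nxt y t)) \<subseteq> {..<G}"
      unfolding nxt_def by (rule stp_wf[OF conjunct1[OF Suc] lr sr])+
    note s = stepf[OF len]
    have "(\<forall>i. cel y (Suc t) j i < G) \<and> \<bar>hed y (Suc t) j\<bar> \<le> int (Suc t)" if j: "j < k" for j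
    proof -
      have "snd (nxt y t) ! j \<in> set (snd (nxt y t))" using n(2) j by simp
      then have "fst (snd (nxt y t) ! j) < G" using n(3) by blast
      moreover have "\<bar>offset m\<bar> \<le> 1" for m by (cases m) auto
      then have "\<bar>hed y t j + offset (snd (snd (nxt y t) ! j))\<bar> \<le> int (Suc t)"
      proof -
        have "\<bar>hed y t j\<bar> \<le> int t" using Suc j by blast
        then show ?thesis using \<open>\<And>m. \<bar>offset m\<bar> \<le> 1\<close>[of "snd (snd (nxt y t) ! j)"] by linarith
      qed
      moreover have "cel y (Suc t) j = (cel y t j)(hed y t j := fst (snd (nxt y t) ! j))"
        "hed y (Suc t) j = hed y t j + offset (snd (snd (nxt y t) ! j))"
        using conjunct2[OF conjunct2[OF s]] n(2) j by blast+
      moreover have "cel y t j i < G" for i using Suc j by blast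
      ultimately show ?thesis by simp
    qed
    moreover have "st y (Suc t) < Q" using s n(1) by (elim conjE) simp
    moreover have "length (snd (cfg y (Suc t))) = k" using conjunct1[OF conjunct2[OF s]] n(2) len by simp
    ultimately show ?case by blast
  qed
  show "st y t < Q \<and> length (snd (cfg y t)) = k \<and> (\<forall>j<k. (\<forall>i. cel y t j i < G) \<and> \<bar>hed y t j\<bar> \<le> int t)" by (rule inv)
  then have len: "length (snd (cfg y t)) = k" by blast
  show "map tape_read (snd (cfg y t)) = rds y t" by (rule rd[OF len])
  have sr: "set (rds y t) \<subseteq> {..<G}" using inv[of t] by (auto simp: rds_def)
  have lr: "length (rds y t) = k" by (simp add: rds_def)
  have "length (snd (nxt y t)) = k"
    unfolding nxt_def by (rule stp_wf[OF conjunct1[OF inv] lr sr])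
  then show "st y (Suc t) = fst (nxt y t) \<and> (\<forall>j<k. cel y (Suc t) j = (cel y t j)(hed y t j := fst (snd (nxt y t) ! j)) \<and>
     hed y (Suc t) j = hed y t j + offset (snd (snd (nxt y t) ! j)))" using stepf[OF len] by blast
qed

lemma cfg_0: "st y 0 = 0" "j < k \<Longrightarrow> hed y 0 j = 0" "j < k \<Longrightarrow> cel y 0 j = (if j = 0 then word_cells y else word_cells [])"
  by (auto simp: st_def hed_def cel_def cfg_def tm_init_def nth_Cons split: nat.splits)

text \<open>After halting the configuration is repeated, so the answer can be read off at any later
  time; it is the single letter in cell 0 of the last tape.\<close>

lemma cfg_final:
  assumes "poly pV (length y) \<le> T"
  shows "cel y T (k - 1) 0 = (if y \<in> A then 2 else 1)"
proof -
  obtain t where t: "t \<le> poly pV (length y)" "tm_halted M (cfg y t)" "fst (last (snd (cfg y t))) = word_cells [y \<in> A]"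
    using dec[of y] unfolding tm_computes_within_def Let_def cfg_def by blast
  have halt: "tm_step M (cfg y t) = cfg y t" using t(2) by (cases "cfg y t") simp
  have stay: "(tm_step M ^^ i) (cfg y t) = cfg y t" for i by (induction i) (simp_all add: halt)
  have "cfg y T = (tm_step M ^^ (T - t + t)) (tm_init M y)" using t(1) assms by (simp add: cfg_def)
  also have "\<dots> = cfg y t" unfolding funpow_add comp_apply using stay by (simp add: cfg_def)
  finally have "cfg y T = cfg y t" .
  moreover have "last (snd (cfg y t)) = snd (cfg y t) ! (k - 1)"
    using cfg_inv[of y t] k1 by (metis last_conv_nth list.size(3) not_one_le_zero)
  ultimately show ?thesis using t(3) by (simp add: cel_def word_cells_def)
qed

definition "tT = V 10"
definition "tP = V 11"
definition "tP' = V 12"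
text \<open>Cell numbers may be negative and are shifted by this amount, so that index
  \<open>t0\<close> stands for cell 0. Then \<open>c0\<close> is the index of the separator behind
  the doubled input.\<close>

definition "t0 = Scale b1 (K 1)"
definition "c0 = Plus t0 (Plus len_trm len_trm)"
definition "qt = poly_trm (coeffs q)"

text \<open>The negated premises of a transition clause: state \<open>s\<close> and scanned symbols
  \<open>ss\<close> at the current time.\<close>

definition base :: "nat \<Rightarrow> nat list \<Rightarrow> literal list" where
  "base s ss = (False, kc (St s), K 0, tT) # map (\<lambda>j. (False, kc (Rd j (ss ! j)), K 0, tT)) [0..<k]"

fun mvg :: "head_move \<Rightarrow> fm" where
  "mvg Move_Left = Eq tP (Plus tP' (K 1))"
| "mvg Move_Stay = Eq tP tP'"
| "mvg Move_Right = Eq tP' (Plus tP (K 1))"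

text \<open>Only the witness is left open: its cells may hold a blank or one of the two letters. So
  that they spell a word, a blank is followed by blanks, and behind the admissible length everything
  is blank.\<close>

definition init_templates :: "template set" where
  "init_templates = {(Tru, [(True, kc (St 0), K 0, K 0)])} \<union>
    {(Tru, [(True, kc (Hd j), t0, K 0)]) | j. j < k} \<union>
    {(Tru, [(True, kc (Cl j 0), tP, K 0)]) | j. 1 \<le> j \<and> j < k} \<union>
    {(Lt tP t0, [(True, kc (Cl 0 0), tP, K 0)])} \<union>
    {(Conj (At y tP') (Disj (Eq tP (Plus t0 (Plus tP' tP'))) (Eq tP (Plus (Plus t0 (Plus tP' tP')) (K 1)))),
       [(True, kc (Cl 0 y), tP, K 0)]) | y. y = 1 \<or> y = 2} \<union>
    {(Eq tP c0, [(True, kc (Cl 0 2), tP, K 0)]), (Eq tP (Plus c0 (K 1)), [(True, kc (Cl 0 1), tP, K 0)]),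
     (Conj (Le (Plus c0 (K 2)) tP) (Lt tP (Plus c0 (Plus (K 2) qt))),
       [(True, kc (Cl 0 0), tP, K 0), (True, kc (Cl 0 1), tP, K 0), (True, kc (Cl 0 2), tP, K 0)]),
     (Conj (Le (Plus c0 (K 2)) tP) (Lt tP (Plus t0 t0)),
       [(False, kc (Cl 0 0), tP, K 0), (True, kc (Cl 0 0), Plus tP (K 1), K 0)]),
     (Le (Plus c0 (Plus (K 2) qt)) tP, [(True, kc (Cl 0 0), tP, K 0)])}"

text \<open>Apart from the last template these are implications towards the scanned symbols and the
  next configuration; none of them states uniqueness of a state or a symbol. An assignment may claim
  too much, but it has to contain the real run. The last clause forbids the letter 1 in the output
  cell at the final time and thereby excludes a rejecting run.\<close>

definition run_templates :: "template set" where
  "run_templates =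
    {(Tru, [(False, kc (Hd j), tP, tT), (False, kc (Cl j s), tP, tT), (True, kc (Rd j s), K 0, tT)]) | j s. j < k \<and> s < G} \<union>
    {(Lt tT t0, base s ss @ [(True, kc (St (fst (stp s ss))), K 0, Plus tT (K 1))]) | s ss.
       s < Q \<and> ss \<in> {ss. set ss \<subseteq> {..<G} \<and> length ss = k}} \<union>
    {(Lt tT t0, base s ss @ [(False, kc (Hd j), tP, tT), (True, kc (Cl j (fst (snd (stp s ss) ! j))), tP, Plus tT (K 1))]) | s ss j.
       s < Q \<and> ss \<in> {ss. set ss \<subseteq> {..<G} \<and> length ss = k} \<and> j < k} \<union>
    {(Conj (Lt tT t0) (mvg (snd (snd (stp s ss) ! j))),
       base s ss @ [(False, kc (Hd j), tP, tT), (True, kc (Hd j), tP', Plus tT (K 1))]) | s ss j.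
       s < Q \<and> ss \<in> {ss. set ss \<subseteq> {..<G} \<and> length ss = k} \<and> j < k} \<union>
    {(Conj (Lt tT t0) (Neg (Eq tP tP')),
       [(False, kc (Hd j), tP, tT), (False, kc (Cl j s), tP', tT), (True, kc (Cl j s), tP', Plus tT (K 1))]) | j s. j < k \<and> s < G} \<union>
    {(Tru, [(False, kc (Cl (k - 1) 1), t0, t0)])}"

lemma finite_templates: "finite init_templates" "finite run_templates"
proof -
  have fs: "finite {ss. set ss \<subseteq> {..<G} \<and> length ss = k}" by (rule finite_lists_length_eq) simp
  have y: "{y::nat. y = 1 \<or> y = 2} = {1, 2}" by auto
  show "finite init_templates"
    unfolding init_templates_def
    by (intro finite_UnI finite.intros finite_image_set) (simp_all add: y)
  have t: "finite {f s ss j | s ss j. s < Q \<and> ss \<in> {ss. set ss \<subseteq> {..<G} \<and> length ss = k} \<and> j < k}"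
    for f :: "nat \<Rightarrow> nat list \<Rightarrow> nat \<Rightarrow> template"
  proof (rule finite_surj[of "{..<Q} \<times> {ss. set ss \<subseteq> {..<G} \<and> length ss = k} \<times> {..<k}" _ "\<lambda>(s, ss, j). f s ss j"], goal_cases)
    case 1
    show ?case using fs by simp
  next
    case 2
    show ?case
    proof
      fix T assume "T \<in> {f s ss j | s ss j. s < Q \<and> ss \<in> {ss. set ss \<subseteq> {..<G} \<and> length ss = k} \<and> j < k}"
      then obtain s ss j where "T = f s ss j" "s < Q" "set ss \<subseteq> {..<G}" "length ss = k" "j < k" by blast
      then show "T \<in> (\<lambda>(s, ss, j). f s ss j) ` ({..<Q} \<times> {ss. set ss \<subseteq> {..<G} \<and> length ss = k} \<times> {..<k})"
        by (intro image_eqI[of _ _ "(s, ss, j)"]) auto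
    qed
  qed
  show "finite run_templates"
    unfolding run_templates_def
    by (intro finite_UnI t finite.intros finite_image_set2) (use fs in simp_all)
qed

lemma closed_templates: "T \<in> init_templates \<union> run_templates \<Longrightarrow> closed3 T"
proof -
  have v: "tfv tT = {10}" "tfv tP = {11}" "tfv tP' = {12}" "tfv t0 = {}" "tfv c0 = {}" "tfv qt = {}"
    by (simp_all add: tT_def tP_def tP'_def t0_def c0_def qt_def)
  have m: "ffv (mvg mv) \<subseteq> {10, 11, 12}" for mv by (cases mv) (auto simp: v)
  have b: "(s', \<kappa>, ta, tb) \<in> set (base s ss) \<Longrightarrow> tfv ta \<subseteq> {10, 11, 12} \<and> tfv tb \<subseteq> {10, 11, 12}" for s' \<kappa> ta tb s ss
    by (auto simp: base_def v)
  show "closed3 T" if "T \<in> init_templates \<union> run_templates"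
    using that unfolding init_templates_def run_templates_def closed3_def
    by (elim UnE) (use m b in \<open>fastforce simp: v\<close>)+
qed

context
  fixes d :: nat and x :: "bool list"
  assumes d: "d \<ge> b1 + 3"
begin

abbreviation "n \<equiv> length x"
definition T0 :: nat where "T0 = (length x + 2) ^ b1"
abbreviation "B \<equiv> rng b2 x"
abbreviation "qn \<equiv> poly q (length x)"

lemma B_gt: "2 * T0 + 1 < B" "B \<le> rng d x" "0 < T0"
proof -
  show p: "0 < T0" by (simp add: T0_def)
  have "4 * T0 \<le> (n + 2) ^ 2 * T0" by (rule mult_le_mono1) (simp add: power2_eq_square)
  also have "\<dots> = B" unfolding rng_def power_add T0_def b2_def by (rule mult.commute)
  finally show "2 * T0 + 1 < B" using p by linarith
  show "B \<le> rng d x" unfolding rng_def b2_def using d by (intro power_increasing) auto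
qed

lemma d1: "d \<ge> 1" using d by simp

lemma ev [simp]:
  assumes "t < B" "p < B" "p' < B"
  shows "tval d x tT (env3 t p p') = t" "tval d x tP (env3 t p p') = p" "tval d x tP' (env3 t p p') = p'"
  using assms B_gt(2) by (simp_all add: tT_def tP_def tP'_def env3_def)

lemma ev0 [simp]: "tval d x t0 e = T0" "tval d x c0 e = T0 + 2 * n" "tval d x qt e = qn"
  using tval_len_trm[OF d1, of x] tval_poly_trm[OF d1, of x "coeffs q"]
  by (simp_all add: t0_def c0_def qt_def T0_def)

lemma qn_le: "2 * n + 2 + qn \<le> T0" unfolding T0_def by (rule b1(2))

lemma fval_mvg:
  assumes "t < B" "p < B" "p' < B"
  shows "fval d x (mvg m) (env3 t p p') \<longleftrightarrow> int p' = int p + offset m"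
  using assms by (cases m) auto

lemma tsatD:
  assumes "tsat d b2 x \<alpha> (g, ls)" "t < B" "p < B" "p' < B" "fval d x g (env3 t p p')"
  shows "\<exists>l\<in>set ls. lit_sat d b2 x \<alpha> (env3 t p p') l"
  using assms unfolding tsat_def by auto

lemma lit_sat_iff: "lit_sat d b2 x \<alpha> e (s, \<kappa>, ta, tb) \<longleftrightarrow>
    tval d x ta e < B \<and> tval d x tb e < B \<and> \<alpha> \<kappa> (tval d x ta e) (tval d x tb e) = s"
  by (simp add: lit_sat_def)

lemma tval_const [simp]: "tval d x (K c) e = c" "tval d x (Plus s t) e = tval d x s e + tval d x t e" by simp_all

lemma templates_complete:
  assumes w: "length w \<le> qn" "word_pair x w \<in> A"
  shows "\<exists>\<alpha>. \<forall>T\<in>init_templates \<union> run_templates. tsat d b2 x \<alpha> T"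
proof -
  define y where "y = word_pair x w"
  define tru where "tru \<kappa> a t = (case \<kappa> of St s \<Rightarrow> s = st y t | Hd j \<Rightarrow> int a - int T0 = hed y t j
     | Rd j s \<Rightarrow> s = cel y t j (hed y t j) | Cl j s \<Rightarrow> s = cel y t j (int a - int T0))" for \<kappa> a t
  \<comment> \<open>Codes of kinds are injective, so the existential merely decodes
    \<open>c\<close>.\<close>
  define \<alpha> where "\<alpha> c a t = (\<exists>\<kappa>. kc \<kappa> = c \<and> tru \<kappa> a t)" for c a t
  have "\<alpha> (kc \<kappa>) a t = tru \<kappa> a t" for \<kappa> a t by (auto simp: \<alpha>_def kc_inj)
  then have \<alpha>: "\<alpha> (kc (St s)) a t \<longleftrightarrow> s = st y t" "\<alpha> (kc (Hd j)) a t \<longleftrightarrow> int a - int T0 = hed y t j"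
    "\<alpha> (kc (Rd j s)) a t \<longleftrightarrow> s = cel y t j (hed y t j)" "\<alpha> (kc (Cl j s)) a t \<longleftrightarrow> s = cel y t j (int a - int T0)"
    for s j a t by (simp_all add: tru_def)
  have leny: "length y = 2 * n + 2 + length w" by (simp add: y_def word_pair_def length_concat o_def sum_list_triv)
  have "poly pV (length y) \<le> poly pV (2 * n + 2 + qn)" by (rule poly_mono_nat) (simp add: leny w(1))
  then have fin: "cel y T0 (k - 1) 0 = 2"
    using cfg_final[of y T0] b1(1)[of n, folded T0_def] w(2) by (simp add: y_def)
  have c00: "cel y 0 0 = word_cells (word_pair x w)" using cfg_0(3)[of 0 y] k1 by (simp add: y_def)
  note wcp = word_cells_pair[of x w]
  have w012: "word_cells w i = 0 \<or> word_cells w i = 1 \<or> word_cells w i = 2" for i by (simp add: word_cells_def)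
  note S = lit_sat_iff \<alpha>
  have base: "\<exists>l\<in>set (base s ss). lit_sat d b2 x \<alpha> (env3 t p p') l"
    if tb: "t < B" "p < B" "p' < B" "length ss = k" "\<not> (s = st y t \<and> ss = rds y t)" for s ss t p p'
  proof (cases "s = st y t")
    case True
    then have "ss \<noteq> rds y t" using tb by simp
    then obtain j where j: "j < k" "ss ! j \<noteq> cel y t j (hed y t j)"
      using nth_equalityI[of ss "rds y t"] tb(4) by (auto simp: rds_def)
    have "lit_sat d b2 x \<alpha> (env3 t p p') (False, kc (Rd j (ss ! j)), K 0, tT)"
      using tb(1-3) j(2) by (simp add: S)
    then show ?thesis using j(1) by (auto simp: base_def)
  next
    case False
    then have "lit_sat d b2 x \<alpha> (env3 t p p') (False, kc (St s), K 0, tT)"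
      using tb(1-3) by (simp add: S)
    then show ?thesis by (auto simp: base_def)
  qed
  have i: "tsat d b2 x \<alpha> T" if "T \<in> init_templates" for T
    unfolding tsat_def
  proof (intro allI impI)
    fix t p p' assume b: "t < B" "p < B" "p' < B" and g: "fval d x (fst T) (env3 t p p')"
    show "\<exists>l\<in>set (snd T). lit_sat d b2 x \<alpha> (env3 t p p') l"
      using that unfolding init_templates_def
    proof (elim UnE)
      assume "T \<in> {(Tru, [(True, kc (St 0), K 0, K 0)])}"
      then show ?thesis using b cfg_0(1)[of y] by (simp add: S)
    next
      assume "T \<in> {(Tru, [(True, kc (Hd j), t0, K 0)]) | j. j < k}"
      then show ?thesis using b B_gt(1) cfg_0(2)[of _ y] by (auto simp: S)
    next
      assume "T \<in> {(Tru, [(True, kc (Cl j 0), tP, K 0)]) | j. 1 \<le> j \<and> j < k}"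
      then show ?thesis using b cfg_0(3)[of _ y] by (auto simp: S word_cells_def)
    next
      assume "T \<in> {(Lt tP t0, [(True, kc (Cl 0 0), tP, K 0)])}"
      then show ?thesis using b g by (auto simp: S c00 wcp)
    next
      assume "T \<in> {(Conj (At y tP') (Disj (Eq tP (Plus t0 (Plus tP' tP'))) (Eq tP (Plus (Plus t0 (Plus tP' tP')) (K 1)))),
       [(True, kc (Cl 0 y), tP, K 0)]) | y. y = 1 \<or> y = 2}"
      then obtain s where T: "T = (Conj (At s tP') (Disj (Eq tP (Plus t0 (Plus tP' tP'))) (Eq tP (Plus (Plus t0 (Plus tP' tP')) (K 1)))),
       [(True, kc (Cl 0 s), tP, K 0)])" "s = 1 \<or> s = 2" by blast
      have s: "word_cells x (int p') = s" "p = T0 + 2 * p' \<or> p = T0 + 2 * p' + 1" using g b by (auto simp: T(1))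
      have "p' < n" using s(1) T(2) by (auto simp: word_cells_def split: if_splits)
      moreover have "(int p - int T0) div 2 = int p'" using s(2) by auto
      ultimately have "word_cells (word_pair x w) (int p - int T0) = s"
        unfolding wcp using s by auto
      then show ?thesis using b by (simp add: S T(1) c00)
    next
      assume "T \<in> {(Eq tP c0, [(True, kc (Cl 0 2), tP, K 0)]), (Eq tP (Plus c0 (K 1)), [(True, kc (Cl 0 1), tP, K 0)]),
     (Conj (Le (Plus c0 (K 2)) tP) (Lt tP (Plus c0 (Plus (K 2) qt))),
       [(True, kc (Cl 0 0), tP, K 0), (True, kc (Cl 0 1), tP, K 0), (True, kc (Cl 0 2), tP, K 0)]),
     (Conj (Le (Plus c0 (K 2)) tP) (Lt tP (Plus t0 t0)),
       [(False, kc (Cl 0 0), tP, K 0), (True, kc (Cl 0 0), Plus tP (K 1), K 0)]),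
     (Le (Plus c0 (Plus (K 2) qt)) tP, [(True, kc (Cl 0 0), tP, K 0)])}"
      then consider "T = (Eq tP c0, [(True, kc (Cl 0 2), tP, K 0)])" | "T = (Eq tP (Plus c0 (K 1)), [(True, kc (Cl 0 1), tP, K 0)])"
        | "T = (Conj (Le (Plus c0 (K 2)) tP) (Lt tP (Plus c0 (Plus (K 2) qt))),
       [(True, kc (Cl 0 0), tP, K 0), (True, kc (Cl 0 1), tP, K 0), (True, kc (Cl 0 2), tP, K 0)])"
        | "T = (Conj (Le (Plus c0 (K 2)) tP) (Lt tP (Plus t0 t0)),
       [(False, kc (Cl 0 0), tP, K 0), (True, kc (Cl 0 0), Plus tP (K 1), K 0)])"
        | "T = (Le (Plus c0 (Plus (K 2) qt)) tP, [(True, kc (Cl 0 0), tP, K 0)])" by blast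
      then show ?thesis
      proof cases
        case 1
        then show ?thesis using b g by (auto simp: S c00 wcp)
      next
        case 2
        then show ?thesis using b g by (auto simp: S c00 wcp)
      next
        case 3
        then have "T0 + 2 * n + 2 \<le> p" using b g by auto
        then have "word_cells (word_pair x w) (int p - int T0) = word_cells w (int p - int T0 - 2 * int n - 2)"
          unfolding wcp by auto
        then show ?thesis using b 3 w012[of "int p - int T0 - 2 * int n - 2"] by (auto simp: S c00)
      next
        case 4
        then have p: "T0 + 2 * n + 2 \<le> p" "p < T0 + T0" using b g by auto
        have "p + 1 < B" using p(2) B_gt(1) by linarith
        moreover have "word_cells (word_pair x w) (int (p + 1) - int T0) = 0"
          if "word_cells (word_pair x w) (int p - int T0) = 0"
          using that p unfolding wcp by (auto simp: word_cells_def split: if_splits)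
        ultimately show ?thesis using b 4
          by (cases "word_cells (word_pair x w) (int p - int T0) = 0") (auto simp: S c00)
      next
        case 5
        then have p: "T0 + 2 * n + 2 + qn \<le> p" using b g by auto
        then have "word_cells (word_pair x w) (int p - int T0) = 0"
          unfolding wcp using w(1) by (auto simp: word_cells_def)
        then show ?thesis using b 5 by (auto simp: S c00)
      qed
    qed
  qed
  have r: "tsat d b2 x \<alpha> T" if "T \<in> run_templates" for T
    unfolding tsat_def
  proof (intro allI impI)
    fix t p p' assume b: "t < B" "p < B" "p' < B" and g: "fval d x (fst T) (env3 t p p')"
    note cs = cfg_step[of y t]
    show "\<exists>l\<in>set (snd T). lit_sat d b2 x \<alpha> (env3 t p p') l"
      using that unfolding run_templates_def
    proof (elim UnE)
      assume "T \<in> {(Tru, [(False, kc (Hd j), tP, tT), (False, kc (Cl j s), tP, tT), (True, kc (Rd j s), K 0, tT)]) | j s. j < k \<and> s < G}"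
      then show ?thesis using b by (auto simp: S)
    next
      assume "T \<in> {(Lt tT t0, base s ss @ [(True, kc (St (fst (stp s ss))), K 0, Plus tT (K 1))]) | s ss.
       s < Q \<and> ss \<in> {ss. set ss \<subseteq> {..<G} \<and> length ss = k}}"
      then obtain s ss where T: "T = (Lt tT t0, base s ss @ [(True, kc (St (fst (stp s ss))), K 0, Plus tT (K 1))])" "length ss = k"
        by blast
      have "t < T0" using g b by (simp add: T(1))
      then show ?thesis using base[OF b T(2), of s] b cs B_gt(1) by (cases "s = st y t \<and> ss = rds y t") (auto simp: T(1) S nxt_def)
    next
      assume "T \<in> {(Lt tT t0, base s ss @ [(False, kc (Hd j), tP, tT), (True, kc (Cl j (fst (snd (stp s ss) ! j))), tP, Plus tT (K 1))]) | s ss j.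
       s < Q \<and> ss \<in> {ss. set ss \<subseteq> {..<G} \<and> length ss = k} \<and> j < k}"
      then obtain s ss j where T: "T = (Lt tT t0, base s ss @ [(False, kc (Hd j), tP, tT), (True, kc (Cl j (fst (snd (stp s ss) ! j))), tP, Plus tT (K 1))])"
        "length ss = k" "j < k" by blast
      have "t < T0" using g b by (simp add: T(1))
      then show ?thesis using base[OF b T(2), of s] b cs B_gt(1) T(3)
        by (cases "s = st y t \<and> ss = rds y t") (auto simp: T(1) S nxt_def)
    next
      assume "T \<in> {(Conj (Lt tT t0) (mvg (snd (snd (stp s ss) ! j))),
       base s ss @ [(False, kc (Hd j), tP, tT), (True, kc (Hd j), tP', Plus tT (K 1))]) | s ss j.
       s < Q \<and> ss \<in> {ss. set ss \<subseteq> {..<G} \<and> length ss = k} \<and> j < k}"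
      then obtain s ss j where T: "T = (Conj (Lt tT t0) (mvg (snd (snd (stp s ss) ! j))),
       base s ss @ [(False, kc (Hd j), tP, tT), (True, kc (Hd j), tP', Plus tT (K 1))])"
        "length ss = k" "j < k" by blast
      have "t < T0" "int p' = int p + offset (snd (snd (stp s ss) ! j))" using g b by (simp_all add: T(1) fval_mvg)
      then show ?thesis using base[OF b T(2), of s] b cs B_gt(1) T(3)
        by (cases "s = st y t \<and> ss = rds y t") (auto simp: T(1) S nxt_def)
    next
      assume "T \<in> {(Conj (Lt tT t0) (Neg (Eq tP tP')),
       [(False, kc (Hd j), tP, tT), (False, kc (Cl j s), tP', tT), (True, kc (Cl j s), tP', Plus tT (K 1))]) | j s. j < k \<and> s < G}"
      then obtain j s where T: "T = (Conj (Lt tT t0) (Neg (Eq tP tP')),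
       [(False, kc (Hd j), tP, tT), (False, kc (Cl j s), tP', tT), (True, kc (Cl j s), tP', Plus tT (K 1))])" "j < k" by blast
      have "t < T0" "p \<noteq> p'" using g b by (simp_all add: T(1))
      then show ?thesis using b cs B_gt(1) T(2) by (auto simp: T(1) S)
    next
      assume "T \<in> {(Tru, [(False, kc (Cl (k - 1) 1), t0, t0)])}"
      then show ?thesis using B_gt(1) fin by (auto simp: S)
    qed
  qed
  show ?thesis using i r by blast
qed

text \<open>The assignment need not describe a single run, so a word is first read off the witness
  cells; then every fact about the real run on that word is shown to be among the claims of
  \<open>\<alpha>\<close>.\<close>

lemma templates_sound:
  assumes sat: "\<forall>T\<in>init_templates \<union> run_templates. tsat d b2 x \<alpha> T"
  shows "\<exists>w. length w \<le> qn \<and> word_pair x w \<in> A"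
proof -
  have one: "\<alpha> \<kappa> (tval d x ta (env3 t p p')) (tval d x tb (env3 t p p'))"
    if "(g, [(True, \<kappa>, ta, tb)]) \<in> init_templates" "fval d x g (env3 t p p')" "t < B" "p < B" "p' < B" for g \<kappa> ta tb t p p'
    using tsatD[of \<alpha> g "[(True, \<kappa>, ta, tb)]" t p p'] that sat by (auto simp: lit_sat_iff)
  have B0: "0 < B" and TB: "T0 < B" and T2: "p \<le> 2 * T0 \<Longrightarrow> p < B" for p using B_gt(1) by auto
  define C where "C l = \<alpha> (kc (Cl 0 0)) (T0 + 2 * n + 2 + l) 0" for l
  \<comment> \<open>The witness is cut at the first cell claimed to be blank, or else at its maximal
    length. Before the cut at least one of the letters is claimed; if both are, \<open>w\<close>
    takes \<open>True\<close>.\<close>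
  define m where "m = (LEAST l. l = qn \<or> C l)"
  have m_le: "m \<le> qn" unfolding m_def by (rule Least_le) simp
  have m_at: "m = qn \<or> C m" unfolding m_def by (rule LeastI[of _ qn]) simp
  have m_below: "\<not> C l" if "l < m" for l using not_less_Least[of l "\<lambda>l. l = qn \<or> C l"] that unfolding m_def by blast
  define w where "w = map (\<lambda>l. \<alpha> (kc (Cl 0 2)) (T0 + 2 * n + 2 + l) 0) [0..<m]"
  define y where "y = word_pair x w"
  have lw: "length w = m" by (simp add: w_def)
  have beyond: "C l" if "qn \<le> l" "T0 + 2 * n + 2 + l \<le> 2 * T0" for l
  proof -
    have mem: "(Le (Plus c0 (Plus (K 2) qt)) tP, [(True, kc (Cl 0 0), tP, K 0)]) \<in> init_templates" by (simp add: init_templates_def)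
    have pB: "T0 + 2 * n + 2 + l < B" using that T2 by blast
    from one[OF mem _ B0 pB B0] show ?thesis using that pB B0 by (simp add: C_def)
  qed
  have prop1: "C (Suc l)" if "C l" "T0 + 2 * n + 2 + l < 2 * T0" for l
  proof -
    let ?p = "T0 + 2 * n + 2 + l"
    have mem: "(Conj (Le (Plus c0 (K 2)) tP) (Lt tP (Plus t0 t0)),
       [(False, kc (Cl 0 0), tP, K 0), (True, kc (Cl 0 0), Plus tP (K 1), K 0)]) \<in> init_templates" by (simp add: init_templates_def)
    have pB: "?p < B" using that(2) T2[of ?p] by simp
    have "\<exists>l\<in>set [(False, kc (Cl 0 0), tP, K 0), (True, kc (Cl 0 0), Plus tP (K 1), K 0)]. lit_sat d b2 x \<alpha> (env3 0 ?p 0) l"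
      by (rule tsatD[OF _ B0 pB B0]) (use sat mem that(2) pB B0 in auto)
    then show ?thesis using that(1) pB B0 by (auto simp: lit_sat_iff C_def)
  qed
  \<comment> \<open>Behind the cut the blanks are forced, by propagation if the cut is at a blank
    and by the clause for large indices otherwise. They are needed up to index
    \<open>2 * T0\<close>, the end of the window.\<close>
  have blank: "C l" if "m \<le> l" "T0 + 2 * n + 2 + l \<le> 2 * T0" for l
  proof (cases "m = qn")
    case True
    then show ?thesis using beyond that by simp
  next
    case False
    then have "C m" using m_at by blast
    have "T0 + 2 * n + 2 + (m + i) \<le> 2 * T0 \<longrightarrow> C (m + i)" for i
    proof (induction i)
      case (Suc i)
      then show ?case using prop1[of "m + i"] by simp
    qed (use \<open>C m\<close> in simp)
    from this[of "l - m"] show ?thesis using that by simp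
  qed
  have init: "\<alpha> (kc (Cl 0 (word_cells y (int p - int T0)))) p 0" if p: "p \<le> 2 * T0" for p
  proof -
    have pB: "p < B" using T2 p by blast
    consider "p < T0" | u where "u < n" "p = T0 + 2 * u \<or> p = T0 + 2 * u + 1" | "p = T0 + 2 * n" | "p = T0 + 2 * n + 1"
      | l where "p = T0 + 2 * n + 2 + l"
    proof (cases "p < T0 + 2 * n")
      case True
      show ?thesis
      proof (cases "p < T0")
        case False
        then have "(p - T0) div 2 < n" "p = T0 + 2 * ((p - T0) div 2) \<or> p = T0 + 2 * ((p - T0) div 2) + 1"
          using True by presburger+
        then show ?thesis by (rule that(2))
      qed (rule that(1))
    next
      case False
      then have "p = T0 + 2 * n \<or> p = T0 + 2 * n + 1 \<or> p = T0 + 2 * n + 2 + (p - (T0 + 2 * n + 2))" by linarith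
      then show ?thesis using that(3,4,5) by blast
    qed
    then show ?thesis
    proof cases
      case 1
      have "(Lt tP t0, [(True, kc (Cl 0 0), tP, K 0)]) \<in> init_templates" by (simp add: init_templates_def)
      from one[OF this _ B0 pB B0] show ?thesis using 1 pB B0 by (simp add: y_def word_cells_pair)
    next
      case (2 u)
      define s where "s = word_cells x (int u)"
      have s: "s = 1 \<or> s = 2" using 2(1) by (simp add: s_def word_cells_def)
      have uB: "u < B" using 2(1) qn_le TB by linarith
      have "(Conj (At s tP') (Disj (Eq tP (Plus t0 (Plus tP' tP'))) (Eq tP (Plus (Plus t0 (Plus tP' tP')) (K 1)))),
       [(True, kc (Cl 0 s), tP, K 0)]) \<in> init_templates" using s by (auto simp: init_templates_def)
      from one[OF this _ B0 pB uB] have "\<alpha> (kc (Cl 0 s)) p 0" using 2(2) pB uB B0 by (auto simp: s_def)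
      moreover have "word_cells y (int p - int T0) = s"
      proof -
        have "(int p - int T0) div 2 = int u" "int p - int T0 < 2 * int n" "\<not> int p - int T0 < 0" using 2 by auto
        then show ?thesis unfolding y_def word_cells_pair s_def by simp
      qed
      ultimately show ?thesis by simp
    next
      case 3
      have "(Eq tP c0, [(True, kc (Cl 0 2), tP, K 0)]) \<in> init_templates" by (simp add: init_templates_def)
      from one[OF this _ B0 pB B0] show ?thesis using 3 pB B0 by (simp add: y_def word_cells_pair)
    next
      case 4
      have "(Eq tP (Plus c0 (K 1)), [(True, kc (Cl 0 1), tP, K 0)]) \<in> init_templates" by (simp add: init_templates_def)
      from one[OF this _ B0 pB B0] show ?thesis using 4 pB B0 by (simp add: y_def word_cells_pair)
    next
      case (5 l)
      have wc: "word_cells y (int p - int T0) = word_cells w (int l)"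
        unfolding y_def word_cells_pair 5 by simp
      show ?thesis
      proof (cases "l < m")
        case True
        let ?ls = "[(True, kc (Cl 0 0), tP, K 0), (True, kc (Cl 0 1), tP, K 0), (True, kc (Cl 0 2), tP, K 0)]"
        have mem: "(Conj (Le (Plus c0 (K 2)) tP) (Lt tP (Plus c0 (Plus (K 2) qt))), ?ls) \<in> init_templates"
          by (simp add: init_templates_def)
        have "\<exists>l\<in>set ?ls. lit_sat d b2 x \<alpha> (env3 0 p 0) l"
          by (rule tsatD[OF _ B0 pB B0]) (use sat mem True m_le 5 pB B0 in auto)
        then have "\<alpha> (kc (Cl 0 1)) p 0 \<or> \<alpha> (kc (Cl 0 2)) p 0"
          using m_below[OF True] pB B0 5 by (auto simp: lit_sat_iff C_def)
        moreover have "word_cells w (int l) = (if \<alpha> (kc (Cl 0 2)) p 0 then 2 else 1)"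
          using True 5 by (simp add: word_cells_def lw w_def)
        ultimately show ?thesis unfolding wc by auto
      next
        case False
        then have "word_cells w (int l) = 0" by (simp add: word_cells_def lw)
        moreover have "C l" using False 5 p by (intro blank) auto
        ultimately show ?thesis unfolding wc using 5 by (simp add: C_def)
      qed
    qed
  qed
  \<comment> \<open>The premises of the transition that really takes place are claimed, so a
    satisfied clause must have a true literal in its remaining part.\<close>
  have nobase: "\<not> (\<exists>l\<in>set (base (st y t) (rds y t)). lit_sat d b2 x \<alpha> (env3 t p p') l)"
    if "t < B" "p < B" "p' < B" "\<alpha> (kc (St (st y t))) 0 t" "\<And>j. j < k \<Longrightarrow> \<alpha> (kc (Rd j (cel y t j (hed y t j)))) 0 t" for t p p'
    using that by (auto simp: base_def lit_sat_iff rds_def)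
  \<comment> \<open>Induction on time, in three layers: the scanned symbols at time \<open>t\<close>
    follow from heads and cells, they select the transition, and this yields state, heads and cells
    at the next time.\<close>
  have main: "\<alpha> (kc (St (st y t))) 0 t \<and> (\<forall>j<k. \<alpha> (kc (Hd j)) (nat (hed y t j + int T0)) t) \<and>
     (\<forall>j<k. \<forall>p\<le>2 * T0. \<alpha> (kc (Cl j (cel y t j (int p - int T0)))) p t)" if "t \<le> T0" for t
    using that
  proof (induction t)
    case 0
    have "(Tru, [(True, kc (St 0), K 0, K 0)]) \<in> init_templates" by (simp add: init_templates_def)
    from one[OF this _ B0 B0 B0] have s: "\<alpha> (kc (St 0)) 0 0" by simp
    have h: "\<alpha> (kc (Hd j)) T0 0" if "j < k" for j
    proof -
      have "(Tru, [(True, kc (Hd j), t0, K 0)]) \<in> init_templates" using that by (auto simp: init_templates_def)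
      from one[OF this _ B0 B0 B0] show ?thesis by simp
    qed
    have wnil: "word_cells [] = (\<lambda>_. 0)" by (auto simp: word_cells_def fun_eq_iff)
    have c: "\<alpha> (kc (Cl j (cel y 0 j (int p - int T0)))) p 0" if j: "j < k" and p: "p \<le> 2 * T0" for j p
    proof (cases "j = 0")
      case True
      then show ?thesis using init[OF p] cfg_0(3)[OF j, of y] by simp
    next
      case False
      have "(Tru, [(True, kc (Cl j 0), tP, K 0)]) \<in> init_templates" using False j by (auto simp: init_templates_def)
      from one[OF this _ B0 T2[OF p] B0] show ?thesis using False cfg_0(3)[OF j, of y] T2[OF p] B0 by (simp add: wnil)
    qed
    show ?case using s h c cfg_0(2)[of _ y] cfg_0(1)[of y] by simp
  next
    case (Suc t)
    then have tT: "t < T0" and IH: "\<alpha> (kc (St (st y t))) 0 t" "\<And>j. j < k \<Longrightarrow> \<alpha> (kc (Hd j)) (nat (hed y t j + int T0)) t"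
      "\<And>j p. j < k \<Longrightarrow> p \<le> 2 * T0 \<Longrightarrow> \<alpha> (kc (Cl j (cel y t j (int p - int T0)))) p t" by auto
    have tB: "t < B" "Suc t < B" using tT TB by auto
    note inv = cfg_inv[of y t] and cs = cfg_step[of y t]
    define P where "P j = nat (hed y t j + int T0)" for j
    have P: "P j \<le> 2 * T0" "int (P j) - int T0 = hed y t j" if "j < k" for j
    proof -
      have "\<bar>hed y t j\<bar> \<le> int t" using inv that by blast
      then show "P j \<le> 2 * T0" "int (P j) - int T0 = hed y t j" using tT unfolding P_def by linarith+
    qed
    have PB: "P j < B" if "j < k" for j using T2 P(1)[OF that] by blast
    have rd: "\<alpha> (kc (Rd j (cel y t j (hed y t j)))) 0 t" if j: "j < k" for j
    proof -
      define s where "s = cel y t j (hed y t j)"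
      have "s < G" using inv j by (simp add: s_def)
      let ?ls = "[(False, kc (Hd j), tP, tT), (False, kc (Cl j s), tP, tT), (True, kc (Rd j s), K 0, tT)]"
      have mem: "(Tru, ?ls) \<in> run_templates" using j \<open>s < G\<close> unfolding run_templates_def by blast
      have "\<exists>l\<in>set ?ls. lit_sat d b2 x \<alpha> (env3 t (P j) 0) l"
        by (rule tsatD[OF _ tB(1) PB[OF j] B0]) (use sat mem in auto)
      moreover have "\<alpha> (kc (Cl j s)) (P j) t" using IH(3)[OF j P(1)[OF j]] by (simp add: P(2)[OF j] s_def)
      ultimately show ?thesis using IH(2)[OF j] tB(1) PB[OF j] B0 by (auto simp: lit_sat_iff s_def P_def)
    qed
    have ssm: "rds y t \<in> {ss. set ss \<subseteq> {..<G} \<and> length ss = k}" using inv by (auto simp: rds_def)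
    have sQ: "st y t < Q" using inv by blast
    have nx: "stp (st y t) (rds y t) = nxt y t" by (simp add: nxt_def)
    have step: "\<exists>l\<in>set rest. lit_sat d b2 x \<alpha> (env3 t p p') l"
      if "(g, base (st y t) (rds y t) @ rest) \<in> run_templates" "fval d x g (env3 t p p')" "p < B" "p' < B" for g rest p p'
    proof -
      have "\<exists>l\<in>set (base (st y t) (rds y t) @ rest). lit_sat d b2 x \<alpha> (env3 t p p') l"
        by (rule tsatD[OF _ tB(1) that(3,4) that(2)]) (use sat that(1) in blast)
      then show ?thesis using nobase[OF tB(1) that(3,4) IH(1) rd] by auto
    qed
    have St: "\<alpha> (kc (St (st y (Suc t)))) 0 (Suc t)"
    proof -
      have mem: "(Lt tT t0, base (st y t) (rds y t) @ [(True, kc (St (fst (nxt y t))), K 0, Plus tT (K 1))]) \<in> run_templates"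
        unfolding run_templates_def nx[symmetric] using sQ ssm by blast
      from step[OF mem _ B0 B0] show ?thesis using tT tB B0 cs by (simp add: lit_sat_iff)
    qed
    have Hd: "\<alpha> (kc (Hd j)) (nat (hed y (Suc t) j + int T0)) (Suc t)" if j: "j < k" for j
    proof -
      define P' where "P' = nat (hed y (Suc t) j + int T0)"
      have h: "hed y (Suc t) j = hed y t j + offset (snd (snd (nxt y t) ! j))" using cs j by blast
      have "\<bar>hed y (Suc t) j\<bar> \<le> int (Suc t)" using cfg_inv[of y "Suc t"] j by blast
      then have P': "P' \<le> 2 * T0" "int P' - int T0 = hed y (Suc t) j" using tT unfolding P'_def by linarith+
      have P'B: "P' < B" using T2 P'(1) by blast
      have mem: "(Conj (Lt tT t0) (mvg (snd (snd (nxt y t) ! j))), base (st y t) (rds y t) @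
          [(False, kc (Hd j), tP, tT), (True, kc (Hd j), tP', Plus tT (K 1))]) \<in> run_templates"
        unfolding run_templates_def nx[symmetric] using sQ ssm j by blast
      have g: "fval d x (Conj (Lt tT t0) (mvg (snd (snd (nxt y t) ! j)))) (env3 t (P j) P')"
        using tT tB(1) PB[OF j] P'B fval_mvg[OF tB(1) PB[OF j] P'B] h P(2)[OF j] P'(2) by simp
      from step[OF mem g PB[OF j] P'B] show ?thesis
        unfolding P'_def[symmetric] using IH(2)[OF j, folded P_def] tB PB[OF j] P'B by (auto simp: lit_sat_iff)
    qed
    have Cl: "\<alpha> (kc (Cl j (cel y (Suc t) j (int p - int T0)))) p (Suc t)" if j: "j < k" and p: "p \<le> 2 * T0" for j p
    proof (cases "p = P j")
      case True
      have c: "cel y (Suc t) j (int p - int T0) = fst (snd (nxt y t) ! j)" using cs j True P(2)[OF j] by simp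
      have mem: "(Lt tT t0, base (st y t) (rds y t) @ [(False, kc (Hd j), tP, tT),
          (True, kc (Cl j (fst (snd (nxt y t) ! j))), tP, Plus tT (K 1))]) \<in> run_templates"
        unfolding run_templates_def nx[symmetric] using sQ ssm j by blast
      have g: "fval d x (Lt tT t0) (env3 t (P j) 0)" using tT tB(1) PB[OF j] B0 by simp
      from step[OF mem g PB[OF j] B0] have "\<alpha> (kc (Cl j (fst (snd (nxt y t) ! j)))) (P j) (Suc t)"
        using IH(2)[OF j, folded P_def] tB PB[OF j] B0 by (auto simp: lit_sat_iff)
      then show ?thesis unfolding c using True by simp
    next
      case False
      define s where "s = cel y t j (int p - int T0)"
      have "int p - int T0 \<noteq> hed y t j" using False P(2)[OF j] by auto
      then have c: "cel y (Suc t) j (int p - int T0) = s" using cs j by (simp add: s_def)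
      have "s < G" using inv j by (simp add: s_def)
      let ?ls = "[(False, kc (Hd j), tP, tT), (False, kc (Cl j s), tP', tT), (True, kc (Cl j s), tP', Plus tT (K 1))]"
      have mem: "(Conj (Lt tT t0) (Neg (Eq tP tP')), ?ls) \<in> run_templates"
        using j \<open>s < G\<close> unfolding run_templates_def by blast
      have pB: "p < B" using T2 p by blast
      have "\<exists>l\<in>set ?ls. lit_sat d b2 x \<alpha> (env3 t (P j) p) l"
        by (rule tsatD[OF _ tB(1) PB[OF j] pB]) (use sat mem tT tB(1) PB[OF j] pB False in auto)
      moreover have "\<alpha> (kc (Cl j s)) p t" using IH(3)[OF j p] by (simp add: s_def)
      ultimately show ?thesis unfolding c using IH(2)[OF j, folded P_def] tB PB[OF j] pB by (auto simp: lit_sat_iff)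
    qed
    show ?case using St Hd Cl by blast
  qed
  have leny: "length y = 2 * n + 2 + length w" by (simp add: y_def word_pair_def length_concat o_def sum_list_triv)
  have "poly pV (length y) \<le> poly pV (2 * n + 2 + qn)" by (rule poly_mono_nat) (simp add: leny lw m_le)
  then have fin: "cel y T0 (k - 1) 0 = (if y \<in> A then 2 else 1)"
    using cfg_final[of y T0] b1(1)[of n, folded T0_def] by simp
  have "\<alpha> (kc (Cl (k - 1) (cel y T0 (k - 1) (int T0 - int T0)))) T0 T0"
  proof -
    have kk: "k - 1 < k" and TT: "T0 \<le> 2 * T0" using k1 by auto
    show ?thesis using conjunct2[OF conjunct2[OF main[OF order_refl]]] kk TT by blast
  qed
  then have fa: "\<alpha> (kc (Cl (k - 1) (if y \<in> A then 2 else 1))) T0 T0" using fin by simp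
  have "y \<in> A"
  proof (rule ccontr)
    assume "y \<notin> A"
    then have 1: "\<alpha> (kc (Cl (k - 1) 1)) T0 T0" using fa by simp
    have mem: "(Tru, [(False, kc (Cl (k - 1) 1), t0, t0)]) \<in> run_templates" by (simp add: run_templates_def)
    have "\<exists>l\<in>set [(False, kc (Cl (k - 1) 1), t0, t0)]. lit_sat d b2 x \<alpha> (env3 0 0 0) l"
      by (rule tsatD[OF _ B0 B0 B0]) (use sat mem in auto)
    then show False using 1 by (simp add: lit_sat_iff)
  qed
  then show ?thesis using lw m_le by (auto simp: y_def)
qed

end

end

text \<open>The templates and \<open>b\<close> depend on \<open>L\<close> only; the input enters
  through the evaluation of guards and index terms. The range parameter \<open>d\<close> stays free
  above \<open>b\<close>, because the grid built later needs larger numbers than the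
  clauses.\<close>

theorem cook_levin_templates:
  assumes "L \<in> NP"
  shows "\<exists>b ts. (\<forall>T\<in>set ts. closed3 T) \<and> (\<forall>d>b. \<forall>x. x \<in> L \<longleftrightarrow> (\<exists>\<alpha>. template_sat d b ts x \<alpha>))"
proof -
  obtain A and q :: "nat poly" where A: "polytime_decidable A"
    "\<And>x. x \<in> L \<longleftrightarrow> (\<exists>w. length w \<le> poly q (length x) \<and> word_pair x w \<in> A)"
    using assms unfolding NP_def by blast
  obtain M and pV :: "nat poly" where M: "wf_tm M" "\<And>y. tm_computes_within M y (poly pV (length y)) [y \<in> A]"
    using A(1) unfolding polytime_decidable_def polytime_def by blast
  obtain c1 where c1: "\<And>n. poly (pcompose pV ([:2, 2:] + q)) n \<le> (n + 2) ^ c1" using poly_le_power by blast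
  obtain c2 where c2: "\<And>n. poly ([:2, 2:] + q) n \<le> (n + 2) ^ c2" using poly_le_power by blast
  define b1 where "b1 = max c1 c2"
  have le: "(n + 2) ^ c1 \<le> (n + 2) ^ b1" "(n + 2) ^ c2 \<le> (n + 2) ^ b1" for n :: nat
    unfolding b1_def by (intro power_increasing; simp)+
  have e: "poly ([:2, 2:] + q) n = 2 * n + 2 + poly q n" for n by simp
  interpret verifier M A pV q b1
  proof
    show "poly pV (2 * n + 2 + poly q n) \<le> (n + 2) ^ b1" for n
      using le_trans[OF c1 le(1), of n] by (simp only: poly_pcompose e)
    show "2 * n + 2 + poly q n \<le> (n + 2) ^ b1" for n
      using le_trans[OF c2 le(2), of n] by (simp only: e)
  qed (use M in auto)
  obtain ts where ts: "set ts = init_templates \<union> run_templates" using finite_list[of "init_templates \<union> run_templates"] finite_templates by auto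
  have "x \<in> L \<longleftrightarrow> (\<exists>\<alpha>. template_sat d b2 ts x \<alpha>)" if "d > b2" for d x
  proof -
    have d: "d \<ge> b1 + 3" using that by (simp add: b2_def)
    show ?thesis unfolding A(2) template_sat_iff ts
      using templates_complete[OF d] templates_sound[OF d] by blast
  qed
  moreover have "\<forall>T\<in>set ts. closed3 T" using ts closed_templates by blast
  ultimately show ?thesis by blast
qed

section \<open>Formulas for adjacency in a tiling\<close>

fun disjs :: "fm list \<Rightarrow> fm" where
  "disjs [] = Neg Tru"
| "disjs (f # fs) = Disj f (disjs fs)"

lemma fval_disjs [simp]: "fval d x (disjs fs) e \<longleftrightarrow> (\<exists>f\<in>set fs. fval d x f e)"
  by (induction fs) auto

definition types :: "ty list" where
  "types = [TX, TA, TS, TE, TH, TV, CL, CR, CD, CU]"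

lemma tab_nonempty_types: "k < length (tab ty) \<Longrightarrow> ty \<in> set types \<and> ty \<noteq> TN \<and> k < 14"
  by (cases ty) (simp_all add: types_def)

definition ex_fm :: "(ty \<Rightarrow> nat \<Rightarrow> nat \<Rightarrow> fm) \<Rightarrow> nat \<Rightarrow> nat \<Rightarrow> nat \<Rightarrow> fm" where
  "ex_fm tyf k u v = disjs (map (\<lambda>ty. tyf ty u v) (filter (\<lambda>ty. k < length (tab ty)) types))"

text \<open>The Boolean concerns the fixed tables of the tiles and is decided when the formula is
  written down.\<close>

definition guarded :: "bool \<Rightarrow> fm \<Rightarrow> fm" where
  "guarded b f = (if b then f else Neg Tru)"

lemma fval_guarded [simp]: "fval d x (guarded b f) e \<longleftrightarrow> b \<and> fval d x f e"
  by (simp add: guarded_def)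

definition link_fm :: "ty \<Rightarrow> ty \<Rightarrow> nat \<Rightarrow> nat \<Rightarrow> fm" where
  "link_fm ty ty' k k' =
    (let p = (\<lambda>dir. Po dir \<in> set (tab ty ! k)); p' = (\<lambda>dir. Po dir \<in> set (tab ty' ! k'));
       eq = (\<lambda>i j. Eq (V i) (V j)); nx = (\<lambda>i j. Eq (V i) (Plus (V j) (K 1)))
     in disjs [guarded (In k' \<in> set (tab ty ! k)) (Conj (eq 2 0) (eq 3 1)),
          guarded (p dR \<and> p' dL) (Conj (eq 2 0) (nx 3 1)), guarded (p dL \<and> p' dR) (Conj (eq 2 0) (nx 1 3)),
          guarded (p dU \<and> p' dD) (Conj (nx 2 0) (eq 3 1)), guarded (p dD \<and> p' dU) (Conj (nx 0 2) (eq 3 1))])"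

definition adj_fm :: "(ty \<Rightarrow> nat \<Rightarrow> nat \<Rightarrow> fm) \<Rightarrow> nat \<Rightarrow> nat \<Rightarrow> fm" where
  "adj_fm tyf k k' = disjs (map (\<lambda>ty. disjs (map (\<lambda>ty'.
      Conj (tyf ty 0 1) (Conj (tyf ty' 2 3) (link_fm ty ty' k k')))
        (filter (\<lambda>ty'. k' < length (tab ty')) types)))
      (filter (\<lambda>ty. k < length (tab ty)) types))"

lemma fval_ex_fm:
  assumes "\<And>ty. ty \<noteq> TN \<Longrightarrow> fval d x (tyf ty u v) e \<longleftrightarrow> \<tau> (e u) (e v) = ty"
  shows "fval d x (ex_fm tyf k u v) e \<longleftrightarrow> isv \<tau> (e u, e v, k)"
proof -
  have "fval d x (ex_fm tyf k u v) e \<longleftrightarrow> (\<exists>ty. k < length (tab ty) \<and> ty \<in> set types \<and> fval d x (tyf ty u v) e)"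
    unfolding ex_fm_def fval_disjs by auto
  also have "\<dots> \<longleftrightarrow> (\<exists>ty. k < length (tab ty) \<and> \<tau> (e u) (e v) = ty)"
    using assms tab_nonempty_types by metis
  finally show ?thesis by simp
qed

lemma fval_link_fm:
  assumes "e 0 < rng d x" "e 1 < rng d x" "e 2 < rng d x" "e 3 < rng d x"
  shows "fval d x (link_fm ty ty' k k') e \<longleftrightarrow>
    (e 2 = e 0 \<and> e 3 = e 1 \<and> In k' \<in> set (tab ty ! k) \<or>
     e 2 = e 0 \<and> e 3 = Suc (e 1) \<and> Po dR \<in> set (tab ty ! k) \<and> Po dL \<in> set (tab ty' ! k') \<or>
     e 2 = e 0 \<and> e 1 = Suc (e 3) \<and> Po dL \<in> set (tab ty ! k) \<and> Po dR \<in> set (tab ty' ! k') \<or>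
     e 2 = Suc (e 0) \<and> e 3 = e 1 \<and> Po dU \<in> set (tab ty ! k) \<and> Po dD \<in> set (tab ty' ! k') \<or>
     e 0 = Suc (e 2) \<and> e 3 = e 1 \<and> Po dD \<in> set (tab ty ! k) \<and> Po dU \<in> set (tab ty' ! k'))"
proof -
  have m: "min (rng d x) (e 0) = e 0" "min (rng d x) (e 1) = e 1" "min (rng d x) (e (Suc 0)) = e 1"
    "min (rng d x) (e 2) = e 2" "min (rng d x) (e 3) = e 3"
    using assms by auto
  show ?thesis
    unfolding link_fm_def Let_def fval_disjs
    by (auto simp: m)
qed

lemma fval_adj_fm:
  assumes "e 0 < rng d x" "e 1 < rng d x" "e 2 < rng d x" "e 3 < rng d x"
    and t: "\<And>ty. ty \<noteq> TN \<Longrightarrow> fval d x (tyf ty 0 1) e \<longleftrightarrow> \<tau> (e 0) (e 1) = ty"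
    and t': "\<And>ty. ty \<noteq> TN \<Longrightarrow> fval d x (tyf ty 2 3) e \<longleftrightarrow> \<tau> (e 2) (e 3) = ty"
  shows "fval d x (adj_fm tyf k k') e \<longleftrightarrow> adjT \<tau> (e 0, e 1, k) (e 2, e 3, k')"
proof -
  have "fval d x (adj_fm tyf k k') e \<longleftrightarrow> (\<exists>ty ty'. k < length (tab ty) \<and> ty \<in> set types \<and>
     k' < length (tab ty') \<and> ty' \<in> set types \<and> fval d x (tyf ty 0 1) e \<and> fval d x (tyf ty' 2 3) e \<and>
     fval d x (link_fm ty ty' k k') e)"
    unfolding adj_fm_def fval_disjs by auto
  also have "\<dots> \<longleftrightarrow> (\<exists>ty ty'. k < length (tab ty) \<and> k' < length (tab ty') \<and> \<tau> (e 0) (e 1) = ty \<and> \<tau> (e 2) (e 3) = ty' \<and>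
     fval d x (link_fm ty ty' k k') e)"
  proof (intro ex_cong1)
    fix ty ty'
    show "(k < length (tab ty) \<and> ty \<in> set types \<and> k' < length (tab ty') \<and> ty' \<in> set types \<and>
        fval d x (tyf ty 0 1) e \<and> fval d x (tyf ty' 2 3) e \<and> fval d x (link_fm ty ty' k k') e) \<longleftrightarrow>
      (k < length (tab ty) \<and> k' < length (tab ty') \<and> \<tau> (e 0) (e 1) = ty \<and> \<tau> (e 2) (e 3) = ty' \<and>
        fval d x (link_fm ty ty' k k') e)"
    proof (cases "k < length (tab ty) \<and> k' < length (tab ty')")
      case True
      then have "ty \<in> set types" "ty \<noteq> TN" "ty' \<in> set types" "ty' \<noteq> TN" using tab_nonempty_types by blast+
      then show ?thesis using True t[of ty] t'[of ty'] by simp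
    qed auto
  qed
  also have "\<dots> \<longleftrightarrow> adjT \<tau> (e 0, e 1, k) (e 2, e 3, k')"
    unfolding adjT.simps isv.simps tgs.simps fval_link_fm[OF assms(1-4)] by simp
  finally show ?thesis .
qed

text \<open>The number 14 is the size of the largest tiles, \<open>TS\<close> and
  \<open>TE\<close>.\<close>

definition tile_vertices :: "(nat \<Rightarrow> nat \<Rightarrow> ty) \<Rightarrow> nat \<Rightarrow> vertex list" where
  "tile_vertices \<tau> N = filter (isv \<tau>) (List.product [0..<N] (List.product [0..<N] [0..<14]))"

lemma set_tile_vertices:
  assumes "\<And>I J. \<tau> I J \<noteq> TN \<Longrightarrow> I < N \<and> J < N"
  shows "set (tile_vertices \<tau> N) = {u. isv \<tau> u}" "distinct (tile_vertices \<tau> N)"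
proof -
  show "distinct (tile_vertices \<tau> N)" unfolding tile_vertices_def by (intro distinct_filter distinct_product) simp_all
  have "I < N \<and> J < N \<and> k < 14" if "isv \<tau> (I, J, k)" for I J k
    using assms[of I J] tab_nonempty_types[of k "\<tau> I J"] that by simp
  then show "set (tile_vertices \<tau> N) = {u. isv \<tau> u}" unfolding tile_vertices_def by auto
qed

lemma concat_map_concat: "concat (map f (concat xss)) = concat (map (\<lambda>xs. concat (map f xs)) xss)"
  by (induction xss) auto

lemma concat_map_product:
  "concat (map f (List.product xs ys)) = concat (map (\<lambda>x. concat (map (\<lambda>y. f (x, y)) ys)) xs)"
  by (simp add: product_concat_map concat_map_concat o_def)

lemma concat_map_if: "concat (map (\<lambda>v. if P v then g v else []) l) = concat (map g (filter P l))"
  by (induction l) auto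

text \<open>The nested loops follow the lexicographic order of \<open>List.product\<close>, and the
  tests by \<open>ex_fm\<close> act as the filter in \<open>tile_vertices\<close>; rows and columns
  thus list the vertices in the same order.\<close>

lemma matrix_output_tiling:
  assumes tyf: "\<And>ty u v e. ty \<noteq> TN \<Longrightarrow> u < 4 \<Longrightarrow> v < 4 \<Longrightarrow> e u < rng d x \<Longrightarrow> e v < rng d x \<Longrightarrow>
       fval d x (tyf ty u v) e \<longleftrightarrow> \<tau> (e u) (e v) = ty"
  shows "matrix_output d 14 (ex_fm tyf) (adj_fm tyf) x =
    concat (map (\<lambda>u. map (adjT \<tau> u) (tile_vertices \<tau> (rng d x))) (tile_vertices \<tau> (rng d x)))"
proof -
  let ?N = "rng d x"
  define l where "l = List.product [0..<?N] (List.product [0..<?N] [0..<14::nat])"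
  define F where "F u v = (if isv \<tau> u then (if isv \<tau> v then [adjT \<tau> u v] else []) else [])" for u v
  have F: "(let e = (\<lambda>i. if i = 0 then I else if i = 1 then J else if i = 2 then I' else if i = 3 then J' else I) in
       if fval d x (ex_fm tyf k 0 1) e then (if fval d x (ex_fm tyf k' 2 3) e then [fval d x (adj_fm tyf k k') e] else []) else [])
     = F (I, J, k) (I', J', k')" if "I < ?N" "J < ?N" "I' < ?N" "J' < ?N" for I J k I' J' k'
  proof -
    define e where "e = (\<lambda>i::nat. if i = 0 then I else if i = 1 then J else if i = 2 then I' else if i = 3 then J' else I)"
    have e: "e 0 = I" "e 1 = J" "e 2 = I'" "e 3 = J'" by (simp_all add: e_def)
    have a: "fval d x (ex_fm tyf k 0 1) e = isv \<tau> (I, J, k)" 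
      using fval_ex_fm[of d x tyf 0 1 e \<tau> k, OF tyf] e that by simp
    have b: "fval d x (ex_fm tyf k' 2 3) e = isv \<tau> (I', J', k')"
      using fval_ex_fm[of d x tyf 2 3 e \<tau> k', OF tyf] e that by simp
    have c: "fval d x (adj_fm tyf k k') e = adjT \<tau> (I, J, k) (I', J', k')"
      using fval_adj_fm[of e d x tyf \<tau> k k', OF _ _ _ _ tyf tyf] e that by simp
    show ?thesis unfolding e_def[symmetric] Let_def a b c F_def ..
  qed
  have "matrix_output d 14 (ex_fm tyf) (adj_fm tyf) x = concat (map (\<lambda>u. concat (map (F u) l)) l)"
    unfolding matrix_output_def l_def concat_map_product
  proof (intro arg_cong[where f = concat] map_cong refl)
    fix I J k I' J' k' assume "I \<in> set [0..<?N]" "J \<in> set [0..<?N]" "I' \<in> set [0..<?N]" "J' \<in> set [0..<?N]"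
    then have b: "I < ?N" "J < ?N" "I' < ?N" "J' < ?N" by auto
    show "(let e = (\<lambda>i. if i = 0 then I else if i = 1 then J else if i = 2 then I' else if i = 3 then J' else I) in
       if fval d x (ex_fm tyf k 0 1) e then (if fval d x (ex_fm tyf k' 2 3) e then [fval d x (adj_fm tyf k k') e] else []) else [])
     = F (I, J, k) (I', J', k')" by (rule F[OF b])
  qed
  also have "\<dots> = concat (map (\<lambda>u. if isv \<tau> u then map (adjT \<tau> u) (filter (isv \<tau>) l) else []) l)"
  proof (intro arg_cong[where f = concat] map_cong refl)
    fix u
    show "concat (map (F u) l) = (if isv \<tau> u then map (adjT \<tau> u) (filter (isv \<tau>) l) else [])"
    proof (cases "isv \<tau> u")
      case True
      have "concat (map (F u) l) = concat (map (\<lambda>v. [adjT \<tau> u v]) (filter (isv \<tau>) l))"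
        unfolding F_def using True by (simp only: if_True concat_map_if)
      then show ?thesis using True by simp
    next
      case False
      then have "F u = (\<lambda>_. [])" by (simp add: F_def fun_eq_iff)
      then show ?thesis using False by simp
    qed
  qed
  also have "\<dots> = concat (map (\<lambda>u. map (adjT \<tau> u) (tile_vertices \<tau> ?N)) (tile_vertices \<tau> ?N))"
    unfolding concat_map_if tile_vertices_def l_def ..
  finally show ?thesis .
qed

lemma list_graph_edges_of:
  "list_graph vs A = edges_of (\<lambda>i j. i < length vs \<and> j < length vs \<and> A (vs ! i) (vs ! j))"
  unfolding list_graph_def edges_of_def by auto

lemma (in tiling) list_graph_tiling:
  assumes vs: "distinct vs" "set vs = {u. isv \<tau> u}"
  defines "n \<equiv> length vs" and "E \<equiv> list_graph vs (adjT \<tau>)"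
  shows "simple_graph {..<n} E" "planar {..<n} E" "colorable 3 {..<n} E" "regular 3 {..<n} E"
    "(\<exists>f. edge_labeling_by_product 2 E f) \<longleftrightarrow> (\<exists>p. port_assignment p)"
proof -
  have in_vs: "u \<in> set vs \<and> v \<in> set vs" if "adjT \<tau> u v" for u v using adj_isv[OF that] vs(2) by simp
  note iso = list_graph_iso[OF adj_sym vs(1) in_vs]
  have bij: "bij_betw ((!) vs) {..<n} {u. isv \<tau> u}" unfolding n_def vs(2)[symmetric] by (rule iso(1))
  have E: "e \<in> E \<longleftrightarrow> e \<subseteq> {..<n} \<and> (!) vs ` e \<in> edges_of (adjT \<tau>)" for e
    unfolding E_def n_def by (rule iso(2))
  have sub: "e \<subseteq> {u. isv \<tau> u}" if "e \<in> edges_of (adjT \<tau>)" for e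
    using simple_graph_tiling that unfolding simple_graph_def by blast
  have Ee: "E = edges_of (\<lambda>i j. i < n \<and> j < n \<and> adjT \<tau> (vs ! i) (vs ! j))"
    unfolding E_def n_def by (rule list_graph_edges_of)
  show "simple_graph {..<n} E"
    unfolding simple_graph_def
  proof (intro conjI ballI)
    fix e assume e: "e \<in> E"
    then show "e \<subseteq> {..<n}" using E by blast
    show "card e = 2" by (rule card_edges_of[OF _ e[unfolded Ee]]) (simp add: adj_irrefl)
  qed simp
  show "planar {..<n} E" by (rule planar_iso[OF bij _ planar_tiling]) (use E in blast)
  obtain c where c: "c \<in> {u. isv \<tau> u} \<rightarrow> {1..3}" "proper_coloring (edges_of (adjT \<tau>)) c"
    using colorable_tiling unfolding colorable_def by blast
  show "colorable 3 {..<n} E"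
    unfolding colorable_def
  proof (intro bexI[of _ "\<lambda>i. c (vs ! i)"])
    show "proper_coloring E (\<lambda>i. c (vs ! i))"
      unfolding proper_coloring_def
    proof (intro allI impI)
      fix i j assume "{i, j} \<in> E"
      then have "(!) vs ` {i, j} \<in> edges_of (adjT \<tau>)" using E by blast
      then have "{vs ! i, vs ! j} \<in> edges_of (adjT \<tau>)" by simp
      then show "c (vs ! i) \<noteq> c (vs ! j)" using c(2) unfolding proper_coloring_def by blast
    qed
    show "(\<lambda>i. c (vs ! i)) \<in> {..<n} \<rightarrow> {1..3}"
    proof
      fix i assume "i \<in> {..<n}"
      then have "vs ! i \<in> {u. isv \<tau> u}" using vs(2) nth_mem[of i vs] unfolding n_def by simp
      then show "c (vs ! i) \<in> {1..3}" using c(1) by blast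
    qed
  qed
  show "regular 3 {..<n} E"
    unfolding regular_def
  proof
    fix i assume i: "i \<in> {..<n}"
    let ?A = "\<lambda>i j. i < n \<and> j < n \<and> adjT \<tau> (vs ! i) (vs ! j)"
    have s: "?A i j \<Longrightarrow> ?A j i" "\<not> ?A i i" for i j using adj_sym adj_irrefl by blast+
    have "{e \<in> E. i \<in> e} = (\<lambda>j. {i, j}) ` {j. ?A i j}" "inj_on (\<lambda>j. {i, j}) {j. ?A i j}"
      unfolding Ee by (rule edges_of_incident[of ?A], erule s(1), rule s(2))+
    then have "card {e \<in> E. i \<in> e} = card {j. ?A i j}" by (simp add: card_image)
    also have "\<dots> = card ((!) vs ` {j. ?A i j})"
    proof (rule card_image[symmetric])
      have "inj_on ((!) vs) {..<n}" using bij by (simp add: bij_betw_def)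
      then show "inj_on ((!) vs) {j. ?A i j}" by (rule inj_on_subset) auto
    qed
    also have "(!) vs ` {j. ?A i j} = {v. adjT \<tau> (vs ! i) v}"
    proof (intro equalityI subsetI)
      fix v assume v: "v \<in> {v. adjT \<tau> (vs ! i) v}"
      then have "v \<in> set vs" using in_vs by blast
      then obtain j where "j < n" "v = vs ! j" unfolding n_def by (metis in_set_conv_nth)
      then show "v \<in> (!) vs ` {j. ?A i j}" using i v by blast
    qed auto
    also have "card \<dots> = 3"
      by (rule card_neighbours) (use vs(2) nth_mem[of i vs] i in \<open>simp add: n_def\<close>)
    finally show "card {e \<in> E. i \<in> e} = 3" .
  qed
  show "(\<exists>f. edge_labeling_by_product 2 E f) \<longleftrightarrow> (\<exists>p. port_assignment p)"
    unfolding labeling_iff_port_assignment[symmetric]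
  proof
    assume "\<exists>f. edge_labeling_by_product 2 (edges_of (adjT \<tau>)) f"
    then obtain f where "edge_labeling_by_product 2 (edges_of (adjT \<tau>)) f" by blast
    from labeling_iso[OF bij E sub this] show "\<exists>f. edge_labeling_by_product 2 E f" by blast
  next
    assume "\<exists>f. edge_labeling_by_product 2 E f"
    then obtain f where f: "edge_labeling_by_product 2 E f" by blast
    define h where "h = inv_into {..<n} ((!) vs)"
    have hb: "bij_betw h {u. isv \<tau> u} {..<n}" unfolding h_def by (rule bij_betw_inv_into[OF bij])
    have c: "(!) vs ` (h ` e) = e" if "e \<subseteq> {u. isv \<tau> u}" for e
      unfolding h_def using bij that by (intro image_inv_into_cancel[of _ "{..<n}"]) (auto simp: bij_betw_def)
    have "e \<in> edges_of (adjT \<tau>) \<longleftrightarrow> e \<subseteq> {u. isv \<tau> u} \<and> h ` e \<in> E" for e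
    proof
      assume e: "e \<in> edges_of (adjT \<tau>)"
      have "h ` e \<subseteq> {..<n}" using hb sub[OF e] unfolding bij_betw_def by blast
      then show "e \<subseteq> {u. isv \<tau> u} \<and> h ` e \<in> E" using e sub[OF e] c[OF sub[OF e]] E by simp
    next
      assume "e \<subseteq> {u. isv \<tau> u} \<and> h ` e \<in> E"
      then have "e \<subseteq> {u. isv \<tau> u}" "(!) vs ` h ` e \<in> edges_of (adjT \<tau>)" using E by blast+
      then show "e \<in> edges_of (adjT \<tau>)" using c[of e] by simp
    qed
    from labeling_iso[OF hb this _ f] show "\<exists>f. edge_labeling_by_product 2 (edges_of (adjT \<tau>)) f"
      using E by blast
  qed
qed

section \<open>Formulas for the grid of the clause templates\<close>

definition Exi :: "nat \<Rightarrow> fm \<Rightarrow> fm" where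
  "Exi i f = Lt (K 0) (Sum i (Cond f (K 1)))"

lemma fval_Exi [simp]: "fval d x (Exi i f) e \<longleftrightarrow> (\<exists>v<rng d x. fval d x f (e(i := v)))"
  by (auto simp: Exi_def neq0_conv[symmetric] simp del: neq0_conv)

definition dbl :: "trm \<Rightarrow> trm" where "dbl t = Plus t t"

lemma tval_dbl [simp]: "tval d x (dbl t) e = 2 * tval d x t e"
  by (simp add: dbl_def)

text \<open>Row \<open>i\<close> of the CNF grid lies at tile row 2 i + 2, and clause
  \<open>c\<close> occupies row c + nv + 2; this gives 2 c + 2 nv + 6. Here \<open>c\<close> is the
  numeral with digits \<rho>, t, p, p' in base \<open>rng b x\<close>, and nv is \<open>Kn\<close>
  times the square of the base. The formula \<open>h\<close> adds a condition on the column.\<close>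

definition clause_fm :: "nat \<Rightarrow> nat \<Rightarrow> template list \<Rightarrow> nat \<Rightarrow> (nat \<Rightarrow> fm) \<Rightarrow> fm" where
  "clause_fm b Kn ts u h = Exi 10 (Exi 11 (Exi 12 (disjs (map (\<lambda>\<rho>.
     Conj (Conj (Lt (V 10) (Scale b (K 1))) (Conj (Lt (V 11) (Scale b (K 1))) (Lt (V 12) (Scale b (K 1)))))
       (Conj (Eq (V u) (Plus (dbl (Plus (Scale (b + b + b) (K \<rho>))
             (Plus (Scale (b + b) (V 10)) (Plus (Scale b (V 11)) (V 12)))))
           (Plus (dbl (Scale (b + b) (K Kn))) (K 6))))
         (Conj (fst (ts ! \<rho>)) (h \<rho>)))) [0..<length ts]))))"

text \<open>All constants come from doubling the positions in \<open>cnf_cell\<close>: indices 0 and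
  1 become 2 and 4, row y + 2 becomes 2 y + 6, and the literal columns 2 y + 2 and 2 y + 3 become 4
  y + 6 and 4 y + 8.\<close>

definition start_fm :: "nat \<Rightarrow> nat \<Rightarrow> template list \<Rightarrow> nat \<Rightarrow> nat \<Rightarrow> fm" where
  "start_fm b Kn ts u v = disjs [Conj (Eq (V u) (K 2)) (Eq (V v) (K 2)), Conj (Eq (V u) (K 4)) (Eq (V v) (K 4)),
     Exi 13 (Conj (Lt (V 13) (Scale (b + b) (K Kn))) (Conj (Eq (V u) (Plus (dbl (V 13)) (K 6)))
       (Eq (V v) (Plus (dbl (dbl (V 13))) (K 6))))),
     clause_fm b Kn ts u (\<lambda>_. Eq (V v) (K 2))]"

definition end_fm :: "nat \<Rightarrow> nat \<Rightarrow> template list \<Rightarrow> nat \<Rightarrow> nat \<Rightarrow> fm" where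
  "end_fm b Kn ts u v = disjs [Conj (Eq (V u) (K 2)) (Eq (V v) (K 4)),
     Conj (Eq (V u) (K 4)) (Eq (V v) (Plus (dbl (dbl (Scale (b + b) (K Kn)))) (K 6))),
     Exi 13 (Conj (Lt (V 13) (Scale (b + b) (K Kn))) (Conj (Eq (V u) (Plus (dbl (V 13)) (K 6)))
       (Eq (V v) (Plus (dbl (dbl (V 13))) (K 8))))),
     clause_fm b Kn ts u (\<lambda>_. Eq (V v) (Plus (dbl (dbl (Scale (b + b) (K Kn)))) (K 6)))]"

definition lit_fm :: "nat \<Rightarrow> nat \<Rightarrow> template list \<Rightarrow> nat \<Rightarrow> nat \<Rightarrow> fm" where
  "lit_fm b Kn ts u v = clause_fm b Kn ts u (\<lambda>\<rho>. disjs (map (\<lambda>(s, \<kappa>, ta, tb).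
     Conj (Conj (Lt ta (Scale b (K 1))) (Lt tb (Scale b (K 1))))
       (Eq (V v) (Plus (dbl (dbl (Plus (Scale (b + b) (K \<kappa>)) (Plus (Scale b ta) tb)))) (K (if s then 6 else 8)))))
     (snd (ts ! \<rho>))))"

definition core_fm :: "nat \<Rightarrow> nat \<Rightarrow> template list \<Rightarrow> nat \<Rightarrow> nat \<Rightarrow> ty \<Rightarrow> fm" where
  "core_fm b Kn ts u v ty = (if ty = TS then start_fm b Kn ts u v else if ty = TE then end_fm b Kn ts u v
     else if ty = TA then lit_fm b Kn ts u v
     else Conj (Neg (start_fm b Kn ts u v)) (Conj (Neg (end_fm b Kn ts u v)) (Neg (lit_fm b Kn ts u v))))"

definition even_fm :: "trm \<Rightarrow> nat \<Rightarrow> fm" where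
  "even_fm t u = Exi 13 (Conj (Lt (V 13) t) (Eq (V u) (Plus (dbl (V 13)) (K 2))))"

fun grid_fm :: "trm \<Rightarrow> trm \<Rightarrow> (nat \<Rightarrow> nat \<Rightarrow> ty \<Rightarrow> fm) \<Rightarrow> ty \<Rightarrow> nat \<Rightarrow> nat \<Rightarrow> fm" where
  "grid_fm r c h TH u v = Conj (even_fm r u) (Conj (Neg (even_fm c v)) (Conj (Lt (K 0) (V v)) (Lt (V v) (Plus (dbl c) (K 2)))))"
| "grid_fm r c h TV u v = Conj (even_fm c v) (Conj (Neg (even_fm r u)) (Conj (Lt (K 0) (V u)) (Lt (V u) (Plus (dbl r) (K 2)))))"
| "grid_fm r c h CR u v = Conj (even_fm r u) (Eq (V v) (K 0))"
| "grid_fm r c h CL u v = Conj (even_fm r u) (Eq (V v) (Plus (dbl c) (K 2)))"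
| "grid_fm r c h CU u v = Conj (even_fm c v) (Eq (V u) (K 0))"
| "grid_fm r c h CD u v = Conj (even_fm c v) (Eq (V u) (Plus (dbl r) (K 2)))"
| "grid_fm r c h ty u v = Conj (even_fm r u) (Conj (even_fm c v) (h u v ty))"

text \<open>Parity conditions are replaced by the existence of a row or column index, which the
  formulas can express directly.\<close>

lemma grid_ty_cases:
  fixes R C :: nat
  assumes ct: "\<And>i j. ct i j \<in> core"
  defines "isrow \<equiv> \<lambda>I. \<exists>i<R. I = 2 * i + 2" and "iscol \<equiv> \<lambda>J. \<exists>j<C. J = 2 * j + 2"
  shows "grid_ty R C ct I J = TH \<longleftrightarrow> isrow I \<and> \<not> iscol J \<and> 0 < J \<and> J < 2 * C + 2"
    "grid_ty R C ct I J = TV \<longleftrightarrow> iscol J \<and> \<not> isrow I \<and> 0 < I \<and> I < 2 * R + 2"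
    "grid_ty R C ct I J = CR \<longleftrightarrow> isrow I \<and> J = 0" "grid_ty R C ct I J = CL \<longleftrightarrow> isrow I \<and> J = 2 * C + 2"
    "grid_ty R C ct I J = CU \<longleftrightarrow> iscol J \<and> I = 0" "grid_ty R C ct I J = CD \<longleftrightarrow> iscol J \<and> I = 2 * R + 2"
    "ty \<in> core \<Longrightarrow> grid_ty R C ct I J = ty \<longleftrightarrow> isrow I \<and> iscol J \<and> ct (I div 2 - 1) (J div 2 - 1) = ty"
    "grid_ty R C ct I J \<noteq> TN \<Longrightarrow> I \<le> 2 * R + 2 \<and> J \<le> 2 * C + 2"
proof -
  have ev: "(\<exists>i<R. I = 2 * i + 2) \<longleftrightarrow> even I \<and> 2 \<le> I \<and> I \<le> 2 * R" for I R :: nat by presburger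
  have r: "isrow I \<longleftrightarrow> even I \<and> 2 \<le> I \<and> I \<le> 2 * R" for I unfolding isrow_def ev ..
  have c: "iscol J \<longleftrightarrow> even J \<and> 2 \<le> J \<and> J \<le> 2 * C" for J unfolding iscol_def ev ..
  have n: "ct i j \<noteq> TH" "ct i j \<noteq> TV" "ct i j \<noteq> CR" "ct i j \<noteq> CL" "ct i j \<noteq> CU" "ct i j \<noteq> CD" "ct i j \<noteq> TN" for i j
    using ct[of i j] by (auto simp: core_def)
  have p: "even (J::nat) \<Longrightarrow> J < 2 * C + 2 \<Longrightarrow> J \<noteq> 0 \<Longrightarrow> 2 \<le> J \<and> J \<le> 2 * C" for J C by presburger
  have q: "odd (J::nat) \<Longrightarrow> 0 < J" for J by presburger
  have G: "grid_ty R C ct I J = (if isrow I then (if J = 0 then CR else if J = 2 * C + 2 then CL else if 2 * C + 2 < J then TN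
        else if iscol J then ct (I div 2 - 1) (J div 2 - 1) else TH)
      else if iscol J then (if I = 0 then CU else if I = 2 * R + 2 then CD else if 2 * R + 2 < I then TN else TV) else TN)"
    unfolding grid_ty_def r c using p[of J C] by auto
  have z: "\<not> iscol 0" "\<not> isrow 0" "\<not> iscol (2 * C + 2)" "\<not> isrow (2 * R + 2)" "iscol J \<Longrightarrow> J \<le> 2 * C" "isrow I \<Longrightarrow> I \<le> 2 * R"
    unfolding r c by auto
  show "grid_ty R C ct I J = TH \<longleftrightarrow> isrow I \<and> \<not> iscol J \<and> 0 < J \<and> J < 2 * C + 2"
    "grid_ty R C ct I J = TV \<longleftrightarrow> iscol J \<and> \<not> isrow I \<and> 0 < I \<and> I < 2 * R + 2"
    "grid_ty R C ct I J = CR \<longleftrightarrow> isrow I \<and> J = 0" "grid_ty R C ct I J = CL \<longleftrightarrow> isrow I \<and> J = 2 * C + 2"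
    "grid_ty R C ct I J = CU \<longleftrightarrow> iscol J \<and> I = 0" "grid_ty R C ct I J = CD \<longleftrightarrow> iscol J \<and> I = 2 * R + 2"
    unfolding G using z n by auto
  show "grid_ty R C ct I J = ty \<longleftrightarrow> isrow I \<and> iscol J \<and> ct (I div 2 - 1) (J div 2 - 1) = ty" if "ty \<in> core"
    using that unfolding G core_def using z by auto
  show "grid_ty R C ct I J \<noteq> TN \<Longrightarrow> I \<le> 2 * R + 2 \<and> J \<le> 2 * C + 2"
    unfolding G using z by (auto split: if_splits)
qed

lemma fval_grid_fm:
  assumes u: "u < 4" "v < 4" "e u < rng d x" "e v < rng d x"
    and r: "\<And>e. tval d x r e = R" "R < rng d x" and c: "\<And>e. tval d x c e = C" "C < rng d x"
    and ct: "\<And>i j. ct i j \<in> core"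
    and h: "\<And>i j ty. ty \<in> core \<Longrightarrow> i < R \<Longrightarrow> j < C \<Longrightarrow> e u = 2 * i + 2 \<Longrightarrow> e v = 2 * j + 2 \<Longrightarrow>
       fval d x (h u v ty) e \<longleftrightarrow> ct i j = ty"
    and ty: "ty \<noteq> TN"
  shows "fval d x (grid_fm r c h ty u v) e \<longleftrightarrow> grid_ty R C ct (e u) (e v) = ty"
proof -
  have m: "min (rng d x) (e u) = e u" "min (rng d x) (e v) = e v" "u \<noteq> 13" "v \<noteq> 13"
    and m': "w < rng d x \<Longrightarrow> min (rng d x) w = w" for w
    using u by auto
  have er: "fval d x (even_fm r u) e \<longleftrightarrow> (\<exists>i<R. e u = 2 * i + 2)"
    unfolding even_fm_def using r(2) by (auto simp: m m' r(1) cong: conj_cong)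
  have ec: "fval d x (even_fm c v) e \<longleftrightarrow> (\<exists>j<C. e v = 2 * j + 2)"
    unfolding even_fm_def using c(2) by (auto simp: m m' c(1) cong: conj_cong)
  have cr: "fval d x (Conj (even_fm r u) (Conj (even_fm c v) (h u v ty))) e \<longleftrightarrow>
     (\<exists>i<R. e u = 2 * i + 2) \<and> (\<exists>j<C. e v = 2 * j + 2) \<and> ct (e u div 2 - 1) (e v div 2 - 1) = ty" if "ty \<in> core"
  proof -
    have "fval d x (h u v ty) e \<longleftrightarrow> ct (e u div 2 - 1) (e v div 2 - 1) = ty"
      if "i < R" "e u = 2 * i + 2" "j < C" "e v = 2 * j + 2" for i j
    proof -
      have "e u div 2 - 1 = i" "e v div 2 - 1 = j" using that by auto
      then show ?thesis using h[OF \<open>ty \<in> core\<close> that(1,3,2,4)] by simp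
    qed
    then show ?thesis unfolding fval.simps er ec by blast
  qed
  note G = grid_ty_cases[where ct = ct and R = R and C = C, OF ct, where I = "e u" and J = "e v"]
  show ?thesis
  proof (cases "ty \<in> core")
    case True
    then have "grid_fm r c h ty u v = Conj (even_fm r u) (Conj (even_fm c v) (h u v ty))"
      by (auto simp: core_def)
    then show ?thesis using cr[OF True] G(7)[OF True] by simp
  next
    case False
    then show ?thesis using ty
      by (cases ty) (simp_all only: grid_fm.simps fval.simps fval_derived er ec G(1-6) tval.simps tval_dbl r(1) c(1) m core_def insert_iff simp_thms)
  qed
qed

text \<open>The nested conditional is brought into disjunctive form, disjunct by disjunct as in
  \<open>start_fm\<close>, \<open>end_fm\<close> and \<open>lit_fm\<close>.\<close>

lemma cnf_cell_cases:
  "cnf_cell nv g lit i j = TS \<longleftrightarrow> i = 0 \<and> j = 0 \<or> i = 1 \<and> j = 1 \<or> (\<exists>y<nv. i = y + 2 \<and> j = 2 * y + 2) \<or>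
     (\<exists>c. i = c + (nv + 2) \<and> g c \<and> j = 0)" (is "_ \<longleftrightarrow> ?S")
  "cnf_cell nv g lit i j = TE \<longleftrightarrow> i = 0 \<and> j = 1 \<or> i = 1 \<and> j = 2 * nv + 2 \<or> (\<exists>y<nv. i = y + 2 \<and> j = 2 * y + 3) \<or>
     (\<exists>c. i = c + (nv + 2) \<and> g c \<and> j = 2 * nv + 2)" (is "_ \<longleftrightarrow> ?E")
  "cnf_cell nv g lit i j = TA \<longleftrightarrow>
     (\<exists>c. i = c + (nv + 2) \<and> g c \<and> (\<exists>y<nv. \<exists>s. lit c y s \<and> j = 2 * y + (if s then 2 else 3)))" (is "_ \<longleftrightarrow> ?A")
proof -
  have l: "j \<in> {2 * y + 2 | y. y < nv \<and> lit c y True} \<union> {2 * y + 3 | y. y < nv \<and> lit c y False} \<longleftrightarrow>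
     (\<exists>y<nv. \<exists>s. lit c y s \<and> j = 2 * y + (if s then 2 else 3))" for c
    by (auto split: if_splits)
  have b: "(\<exists>y<nv. \<exists>s. lit c y s \<and> j = 2 * y + (if s then 2 else 3)) \<Longrightarrow> j \<noteq> 0 \<and> j \<noteq> 2 * nv + 2" for c
    by (auto split: if_splits) presburger+
  consider "i = 0" | "i = 1" | y where "y < nv" "i = y + 2" | c where "i = c + (nv + 2)"
  proof -
    have "i = 0 \<or> i = 1 \<or> (\<exists>y<nv. i = y + 2) \<or> (\<exists>c. i = c + (nv + 2))" by presburger
    then show thesis using that by blast
  qed
  then have "(cnf_cell nv g lit i j = TS \<longleftrightarrow> ?S) \<and> (cnf_cell nv g lit i j = TE \<longleftrightarrow> ?E) \<and> (cnf_cell nv g lit i j = TA \<longleftrightarrow> ?A)"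
  proof cases
    case (4 c)
    have i: "i - (nv + 2) = c" "i \<noteq> 0" "i \<noteq> 1" "\<not> i < nv + 2" using 4 by auto
    have e: "(\<exists>c'. i = c' + (nv + 2) \<and> Q c') \<longleftrightarrow> Q c" for Q using 4 by auto
    have y: "\<not> (\<exists>y<nv. i = y + 2 \<and> Q y)" for Q using 4 by auto
    show ?thesis
      unfolding cnf_cell_def i if_not_P[OF i(2)] if_not_P[OF i(3)] if_not_P[OF i(4)] row_type_def l e using b[of c] y i(2,3) by auto
  qed (auto simp: cnf_cell_def row_type_def)
  then show "cnf_cell nv g lit i j = TS \<longleftrightarrow> ?S" "cnf_cell nv g lit i j = TE \<longleftrightarrow> ?E" "cnf_cell nv g lit i j = TA \<longleftrightarrow> ?A"
    by blast+
qed

text \<open>The assumption \<open>size\<close> keeps the whole grid below \<open>rng d x\<close>, so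
  that no variable is truncated: with nv variables the last tile row is 2 nv + 6 plus twice the
  number of clause indices, and the last tile column is 4 nv + 8.\<close>

locale reduction =
  fixes b Kn d :: nat and ts :: "template list" and x :: "bool list"
  assumes closed: "T \<in> set ts \<Longrightarrow> closed3 T"
    and kinds: "T \<in> set ts \<Longrightarrow> (s, \<kappa>, ta, tb) \<in> set (snd T) \<Longrightarrow> \<kappa> < Kn"
    and size: "4 * (rng b x * rng b x * Kn) + 2 * (rng b x * rng b x * rng b x * length ts) + 8 < rng d x"
    and size_b: "rng b x \<le> rng d x"
begin

abbreviation "B \<equiv> rng b x"
definition "nv = B * B * Kn"
definition idx :: "nat \<Rightarrow> nat \<Rightarrow> nat \<Rightarrow> nat \<Rightarrow> nat" where
  "idx \<rho> t p p' = B * B * B * \<rho> + (B * B * t + (B * p + p'))"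
definition var :: "nat \<Rightarrow> nat \<Rightarrow> nat \<Rightarrow> nat" where
  "var \<kappa> a c = B * B * \<kappa> + (B * a + c)"

definition clause :: "nat \<Rightarrow> nat \<Rightarrow> nat \<Rightarrow> nat \<Rightarrow> nat \<Rightarrow> bool" where
  "clause c \<rho> t p p' \<longleftrightarrow> \<rho> < length ts \<and> t < B \<and> p < B \<and> p' < B \<and> c = idx \<rho> t p p' \<and>
     fval d x (fst (ts ! \<rho>)) (env3 t p p')"
definition literal_at :: "nat \<Rightarrow> nat \<Rightarrow> nat \<Rightarrow> nat \<Rightarrow> nat \<Rightarrow> bool \<Rightarrow> bool" where
  "literal_at \<rho> t p p' y s \<longleftrightarrow> (\<exists>\<kappa> ta tb. (s, \<kappa>, ta, tb) \<in> set (snd (ts ! \<rho>)) \<and>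
     tval d x ta (env3 t p p') < B \<and> tval d x tb (env3 t p p') < B \<and>
     y = var \<kappa> (tval d x ta (env3 t p p')) (tval d x tb (env3 t p p')))"
definition g :: "nat \<Rightarrow> bool" where "g c \<longleftrightarrow> (\<exists>\<rho> t p p'. clause c \<rho> t p p')"
definition lit :: "nat \<Rightarrow> nat \<Rightarrow> bool \<Rightarrow> bool" where
  "lit c y s \<longleftrightarrow> (\<exists>\<rho> t p p'. clause c \<rho> t p p' \<and> literal_at \<rho> t p p' y s)"

lemma B_pos: "0 < B" by (simp add: rng_def)

lemma var_decode:
  assumes "a < B" "c < B"
  shows "var \<kappa> a c mod B = c" "var \<kappa> a c div B mod B = a" "var \<kappa> a c div B div B = \<kappa>"
proof -
  have v: "var \<kappa> a c = (\<kappa> * B + a) * B + c" by (simp add: var_def algebra_simps)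
  show "var \<kappa> a c mod B = c" using assms unfolding v by simp
  have q: "var \<kappa> a c div B = \<kappa> * B + a" using assms B_pos unfolding v by simp
  show "var \<kappa> a c div B mod B = a" "var \<kappa> a c div B div B = \<kappa>" using assms B_pos unfolding q by simp_all
qed

lemma idx_inj:
  assumes "t < B" "p < B" "p' < B" "u < B" "q < B" "q' < B" "idx \<rho> t p p' = idx \<sigma> u q q'"
  shows "\<rho> = \<sigma> \<and> t = u \<and> p = q \<and> p' = q'"
proof -
  have v: "idx \<rho> t p p' = var (B * \<rho> + t) p p'" for \<rho> t p p' by (simp add: idx_def var_def algebra_simps)
  have 1: "p' = q'" "p = q" "B * \<rho> + t = B * \<sigma> + u"
    using var_decode[OF assms(2,3)] var_decode[OF assms(5,6)] assms(7) unfolding v by metis+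
  have "(B * \<rho> + t) mod B = t" "(B * \<sigma> + u) mod B = u" using assms by simp_all
  then have "t = u" using 1(3) by simp
  then show ?thesis using 1 B_pos by simp
qed

lemma var_bound: assumes "\<kappa> < Kn" "a < B" "c < B" shows "var \<kappa> a c < nv"
proof -
  have "B * a + c < B * a + B * 1" using assms by simp
  also have "\<dots> \<le> B * B" using mult_le_mono2[of "Suc a" B B] assms by simp
  finally have "var \<kappa> a c < B * B * Suc \<kappa>" by (simp add: var_def)
  also have "\<dots> \<le> nv" unfolding nv_def using assms by (intro mult_le_mono2) simp
  finally show ?thesis .
qed

lemma idx_bound: assumes "\<rho> < length ts" "t < B" "p < B" "p' < B" shows "idx \<rho> t p p' < B * B * B * length ts"
proof -
  have "B * p + p' < B * p + B * 1" using assms by simp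
  also have "\<dots> \<le> B * B" using mult_le_mono2[of "Suc p" B B] assms by simp
  finally have "B * B * t + (B * p + p') < B * B * Suc t" by simp
  also have "\<dots> \<le> B * B * B" using assms by (intro mult_le_mono2) simp
  finally have "idx \<rho> t p p' < B * B * B * Suc \<rho>" by (simp add: idx_def)
  also have "\<dots> \<le> B * B * B * length ts" using assms by (intro mult_le_mono2) simp
  finally show ?thesis .
qed

lemma template_sat_iff_cnf:
  "(\<exists>\<alpha>. template_sat d b ts x \<alpha>) \<longleftrightarrow> (\<exists>\<beta>. \<forall>c<B * B * B * length ts. g c \<longrightarrow> (\<exists>y<nv. \<exists>s. lit c y s \<and> \<beta> y = s))"
proof
  assume "\<exists>\<alpha>. template_sat d b ts x \<alpha>"
  then obtain \<alpha> where \<alpha>: "template_sat d b ts x \<alpha>" by blast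
  define \<beta> where "\<beta> y = \<alpha> (y div B div B) (y div B mod B) (y mod B)" for y
  have "\<exists>y<nv. \<exists>s. lit c y s \<and> \<beta> y = s" if "g c" for c
  proof -
    obtain \<rho> t p p' where cl: "clause c \<rho> t p p'" using \<open>g c\<close> unfolding g_def by blast
    then have r: "\<rho> < length ts" "t < B" "p < B" "p' < B" "fval d x (fst (ts ! \<rho>)) (env3 t p p')"
      unfolding clause_def by blast+
    have mem: "ts ! \<rho> \<in> set ts" using r by simp
    obtain s \<kappa> ta tb where l: "(s, \<kappa>, ta, tb) \<in> set (snd (ts ! \<rho>))" "tval d x ta (env3 t p p') < B"
      "tval d x tb (env3 t p p') < B" "\<alpha> \<kappa> (tval d x ta (env3 t p p')) (tval d x tb (env3 t p p')) = s"
    proof -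
      obtain G ls where T: "ts ! \<rho> = (G, ls)" by (cases "ts ! \<rho>")
      note \<alpha>[unfolded template_sat_def, THEN bspec, OF mem, unfolded T prod.case, rule_format, OF r(2-4)]
      then show ?thesis using r(5) that unfolding T by auto
    qed
    let ?y = "var \<kappa> (tval d x ta (env3 t p p')) (tval d x tb (env3 t p p'))"
    have "?y < nv" by (rule var_bound[OF kinds[OF mem l(1)] l(2,3)])
    moreover have "lit c ?y s" unfolding lit_def literal_at_def using cl l(1-3) by blast
    moreover have "\<beta> ?y = s" unfolding \<beta>_def var_decode[OF l(2,3)] by (rule l(4))
    ultimately show ?thesis by blast
  qed
  then show "\<exists>\<beta>. \<forall>c<B * B * B * length ts. g c \<longrightarrow> (\<exists>y<nv. \<exists>s. lit c y s \<and> \<beta> y = s)" by blast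
next
  assume "\<exists>\<beta>. \<forall>c<B * B * B * length ts. g c \<longrightarrow> (\<exists>y<nv. \<exists>s. lit c y s \<and> \<beta> y = s)"
  then obtain \<beta> where \<beta>: "\<And>c. c < B * B * B * length ts \<Longrightarrow> g c \<Longrightarrow> \<exists>y. lit c y (\<beta> y)" by blast
  define \<alpha> where "\<alpha> \<kappa> a c = \<beta> (var \<kappa> a c)" for \<kappa> a c
  have "template_sat d b ts x \<alpha>"
    unfolding template_sat_def
  proof (intro ballI, clarify)
    fix G ls t p p' assume T: "(G, ls) \<in> set ts" and b: "t < B" "p < B" "p' < B" "fval d x G (env3 t p p')"
    obtain \<rho> where \<rho>: "\<rho> < length ts" "ts ! \<rho> = (G, ls)" using T by (metis in_set_conv_nth)
    have cl: "clause (idx \<rho> t p p') \<rho> t p p'" unfolding clause_def using \<rho> b by simp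
    obtain y where "lit (idx \<rho> t p p') y (\<beta> y)"
      using \<beta>[OF idx_bound[OF \<rho>(1) b(1-3)]] cl unfolding g_def by blast
    then obtain \<sigma> u q q' where c': "clause (idx \<rho> t p p') \<sigma> u q q'" and l: "literal_at \<sigma> u q q' y (\<beta> y)"
      unfolding lit_def by blast
    \<comment> \<open>The clause number determines the template and the values of its variables, so
      the true literal belongs to the instance at hand.\<close>
    have "\<rho> = \<sigma> \<and> t = u \<and> p = q \<and> p' = q'"
      using c' by (intro idx_inj[OF b(1-3)]) (simp_all add: clause_def)
    then have "literal_at \<rho> t p p' y (\<beta> y)" using l by simp
    then obtain \<kappa> ta tb where "(\<beta> y, \<kappa>, ta, tb) \<in> set ls" "tval d x ta (env3 t p p') < B"
      "tval d x tb (env3 t p p') < B" "y = var \<kappa> (tval d x ta (env3 t p p')) (tval d x tb (env3 t p p'))"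
      unfolding literal_at_def \<rho>(2) by auto
    then show "\<exists>(s, \<kappa>, ta, tb)\<in>set ls. tval d x ta (env3 t p p') < B \<and> tval d x tb (env3 t p p') < B \<and>
       \<alpha> \<kappa> (tval d x ta (env3 t p p')) (tval d x tb (env3 t p p')) = s"
      unfolding \<alpha>_def by (intro bexI[of _ "(\<beta> y, \<kappa>, ta, tb)"]) simp_all
  qed
  then show "\<exists>\<alpha>. template_sat d b ts x \<alpha>" by blast
qed

lemma tval_Scale [simp]:
  "tval d x (Scale b t) e = B * tval d x t e" "tval d x (Scale (b + b) t) e = B * B * tval d x t e"
  "tval d x (Scale (b + b + b) t) e = B * B * B * tval d x t e"
  by (simp_all add: rng_def power_add)

lemma env_closed:
  assumes "T \<in> set ts"
  shows "fval d x (fst T) (e(10 := t, 11 := p, 12 := p')) = fval d x (fst T) (env3 t p p')"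
    "(s, \<kappa>, ta, tb) \<in> set (snd T) \<Longrightarrow> tval d x ta (e(10 := t, 11 := p, 12 := p')) = tval d x ta (env3 t p p') \<and>
       tval d x tb (e(10 := t, 11 := p, 12 := p')) = tval d x tb (env3 t p p')"
proof -
  have e: "(e(10 := t, 11 := p, 12 := p')) i = env3 t p p' i" if "i \<in> {10, 11, 12}" for i
    using that by (auto simp: env3_def)
  note c = closed[OF assms, unfolded closed3_def]
  show "fval d x (fst T) (e(10 := t, 11 := p, 12 := p')) = fval d x (fst T) (env3 t p p')"
    by (rule val_cong(2), rule e) (use c in blast)
  show "tval d x ta (e(10 := t, 11 := p, 12 := p')) = tval d x ta (env3 t p p') \<and>
       tval d x tb (e(10 := t, 11 := p, 12 := p')) = tval d x tb (env3 t p p')" if "(s, \<kappa>, ta, tb) \<in> set (snd T)"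
  proof -
    have "tfv ta \<subseteq> {10, 11, 12}" "tfv tb \<subseteq> {10, 11, 12}" using bspec[OF conjunct2[OF c] that] by simp_all
    then show ?thesis by (intro conjI val_cong(1) e) blast+
  qed
qed

lemma fval_clause_fm:
  assumes u: "u < 4" "e u < rng d x"
  shows "fval d x (clause_fm b Kn ts u h) e \<longleftrightarrow> (\<exists>c \<rho> t p p'. e u = 2 * c + 2 * nv + 6 \<and> clause c \<rho> t p p' \<and>
     fval d x (h \<rho>) (e(10 := t, 11 := p, 12 := p')))"
proof -
  have m: "min (rng d x) (e u) = e u" "u \<noteq> 10" "u \<noteq> 11" "u \<noteq> 12" using u by auto
  have k: "e u = 2 * (B * B * B * \<rho> + (B * B * t + (B * p + p'))) + (2 * (B * B * Kn) + 6) \<longleftrightarrow> e u = 2 * idx \<rho> t p p' + 2 * nv + 6" for \<rho> t p p'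
    unfolding idx_def nv_def by (simp only: add.assoc)
  have v: "fval d x (Conj (Conj (Lt (V 10) (Scale b (K 1))) (Conj (Lt (V 11) (Scale b (K 1))) (Lt (V 12) (Scale b (K 1)))))
       (Conj (Eq (V u) (Plus (dbl (Plus (Scale (b + b + b) (K \<rho>))
             (Plus (Scale (b + b) (V 10)) (Plus (Scale b (V 11)) (V 12)))))
           (Plus (dbl (Scale (b + b) (K Kn))) (K 6))))
         (Conj (fst (ts ! \<rho>)) (h \<rho>)))) (e(10 := t, 11 := p, 12 := p')) \<longleftrightarrow>
     (t < B \<and> p < B \<and> p' < B) \<and> e u = 2 * idx \<rho> t p p' + 2 * nv + 6 \<and> fval d x (fst (ts ! \<rho>)) (env3 t p p') \<and>
       fval d x (h \<rho>) (e(10 := t, 11 := p, 12 := p'))"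
    if "t < rng d x" "p < rng d x" "p' < rng d x" "\<rho> < length ts" for \<rho> t p p'
  proof -
    have e: "tval d x (V 10) (e(10 := t, 11 := p, 12 := p')) = t" "tval d x (V 11) (e(10 := t, 11 := p, 12 := p')) = p"
       "tval d x (V 12) (e(10 := t, 11 := p, 12 := p')) = p'" "tval d x (V u) (e(10 := t, 11 := p, 12 := p')) = e u"
      using that m by simp_all
    show ?thesis
      unfolding fval.simps fval_derived tval_Scale tval_dbl tval.simps(2,4) e mult_1_right k
        env_closed(1)[OF nth_mem[OF that(4)]] ..
  qed
  show ?thesis
    unfolding clause_fm_def fval_Exi fval_disjs set_map bex_simps
  proof (intro iffI; elim exE conjE bexE)
    fix t p p' \<rho> assume r: "t < rng d x" "p < rng d x" "p' < rng d x" "\<rho> \<in> set [0..<length ts]"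
      and f: "fval d x (Conj (Conj (Lt (V 10) (Scale b (K 1))) (Conj (Lt (V 11) (Scale b (K 1))) (Lt (V 12) (Scale b (K 1)))))
       (Conj (Eq (V u) (Plus (dbl (Plus (Scale (b + b + b) (K \<rho>))
             (Plus (Scale (b + b) (V 10)) (Plus (Scale b (V 11)) (V 12)))))
           (Plus (dbl (Scale (b + b) (K Kn))) (K 6))))
         (Conj (fst (ts ! \<rho>)) (h \<rho>)))) (e(10 := t, 11 := p, 12 := p'))"
    have "\<rho> < length ts" using r(4) by simp
    note f' = f[unfolded v[OF r(1-3) this]]
    show "\<exists>c \<rho> t p p'. e u = 2 * c + 2 * nv + 6 \<and> clause c \<rho> t p p' \<and> fval d x (h \<rho>) (e(10 := t, 11 := p, 12 := p'))"
      using f' \<open>\<rho> < length ts\<close> by (intro exI[of _ "idx \<rho> t p p'"] exI[of _ \<rho>] exI[of _ t] exI[of _ p] exI[of _ p']) (simp add: clause_def)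
  next
    fix c \<rho> t p p' assume a: "e u = 2 * c + 2 * nv + 6" "clause c \<rho> t p p'" "fval d x (h \<rho>) (e(10 := t, 11 := p, 12 := p'))"
    have r: "t < rng d x" "p < rng d x" "p' < rng d x" "\<rho> < length ts" using a(2) size_b unfolding clause_def by auto
    note w = v[OF r, THEN iffD2]
    show "\<exists>v<rng d x. \<exists>va<rng d x. \<exists>vb<rng d x. \<exists>\<rho>\<in>set [0..<length ts].
       fval d x (Conj (Conj (Lt (V 10) (Scale b (K 1))) (Conj (Lt (V 11) (Scale b (K 1))) (Lt (V 12) (Scale b (K 1)))))
       (Conj (Eq (V u) (Plus (dbl (Plus (Scale (b + b + b) (K \<rho>))
             (Plus (Scale (b + b) (V 10)) (Plus (Scale b (V 11)) (V 12)))))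
           (Plus (dbl (Scale (b + b) (K Kn))) (K 6))))
         (Conj (fst (ts ! \<rho>)) (h \<rho>)))) (e(10 := v, 11 := va, 12 := vb))"
      by (intro exI[of _ t] exI[of _ p] exI[of _ p'] conjI bexI[of _ \<rho>] w r)
        (use a r in \<open>auto simp: clause_def\<close>)
  qed
qed

abbreviation "ct \<equiv> cnf_cell nv g lit"

lemma fval_core_fm:
  assumes u: "u < 4" "v < 4" "e u < rng d x" "e v < rng d x"
    and ij: "e u = 2 * i + 2" "e v = 2 * j + 2" and ty: "ty \<in> core"
  shows "fval d x (core_fm b Kn ts u v ty) e \<longleftrightarrow> ct i j = ty"
proof -
  have m: "min (rng d x) (e u) = e u" "min (rng d x) (e v) = e v" "u \<noteq> 13" "v \<noteq> 13"
     "v \<noteq> 10" "v \<noteq> 11" "v \<noteq> 12" and m': "w < rng d x \<Longrightarrow> min (rng d x) w = w" for w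
    using u by auto
  have nN: "nv < rng d x" using size unfolding nv_def by simp
  have nvt: "tval d x (Scale (b + b) (K Kn)) e = nv" for e by (simp only: tval_Scale tval.simps(2) nv_def)
  have ex13: "fval d x (Exi 13 (Conj (Lt (V 13) (Scale (b + b) (K Kn))) (Conj (Eq (V u) (Plus (dbl (V 13)) (K 6)))
       (Eq (V v) (Plus (dbl (dbl (V 13))) (K l)))))) e \<longleftrightarrow> (\<exists>y<nv. e u = 2 * y + 6 \<and> e v = 4 * y + l)" for l
    unfolding fval_Exi fval.simps fval_derived nvt tval_dbl tval.simps(1,2,4) using nN by (auto simp: m m' cong: conj_cong)
  have tv: "tval d x (V u) e = 2 * i + 2" "tval d x (V v) e = 2 * j + 2" using m ij by simp_all
  have cv: "2 * i + 2 = 2 \<longleftrightarrow> i = 0" "2 * i + 2 = 4 \<longleftrightarrow> i = 1" "2 * i + 2 = 2 * y + 6 \<longleftrightarrow> i = y + 2"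
    "2 * i + 2 = 4 * y + 6 \<longleftrightarrow> i = 2 * y + 2" "2 * i + 2 = 4 * y + 8 \<longleftrightarrow> i = 2 * y + 3"
    "2 * i + 2 = 2 * (2 * y) + 6 \<longleftrightarrow> i = 2 * y + 2" "2 * i + 2 = 2 * (2 * y) + 8 \<longleftrightarrow> i = 2 * y + 3" for i y :: nat
    by presburger+
  have w: "tval d x (V v) (e(10 := t, 11 := p, 12 := p')) = 2 * j + 2" for t p p' using m ij by simp
  have eu: "e u = 2 * c + 2 * nv + 6 \<longleftrightarrow> i = c + (nv + 2)" for c unfolding ij by presburger
  have cf: "fval d x (clause_fm b Kn ts u h) e \<longleftrightarrow> (\<exists>c. i = c + (nv + 2) \<and> g c \<and> Q)"
    if "\<And>\<rho> t p p'. fval d x (h \<rho>) (e(10 := t, 11 := p, 12 := p')) \<longleftrightarrow> Q" for h Q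
    unfolding fval_clause_fm[of u e, OF u(1,3)] that g_def eu by blast
  have S: "fval d x (start_fm b Kn ts u v) e \<longleftrightarrow> ct i j = TS"
  proof -
    have q: "fval d x (Eq (V v) (K 2)) (e(10 := t, 11 := p, 12 := p')) \<longleftrightarrow> j = 0" for t p p'
      using m ij by simp
    show ?thesis unfolding start_fm_def fval_disjs cnf_cell_cases
      by (simp only: list.set bex_simps fval.simps fval_derived ex13 cf[OF q] tval.simps(2) tv ij cv) blast
  qed
  have E: "fval d x (end_fm b Kn ts u v) e \<longleftrightarrow> ct i j = TE"
  proof -
    have q: "fval d x (Eq (V v) (Plus (dbl (dbl (Scale (b + b) (K Kn)))) (K 6))) (e(10 := t, 11 := p, 12 := p')) \<longleftrightarrow> j = 2 * nv + 2" for t p p'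
      unfolding fval_derived tval.simps(2,4) tval_dbl nvt w cv ..
    show ?thesis unfolding end_fm_def fval_disjs cnf_cell_cases
      by (simp only: list.set bex_simps fval.simps fval_derived ex13 cf[OF q] tval.simps(2,4) tval_dbl nvt tv ij cv) blast
  qed
  have A: "fval d x (lit_fm b Kn ts u v) e \<longleftrightarrow> ct i j = TA"
  proof -
    have q: "fval d x (disjs (map (\<lambda>(s, \<kappa>, ta, tb). Conj (Conj (Lt ta (Scale b (K 1))) (Lt tb (Scale b (K 1))))
       (Eq (V v) (Plus (dbl (dbl (Plus (Scale (b + b) (K \<kappa>)) (Plus (Scale b ta) tb)))) (K (if s then 6 else 8)))))
        (snd (ts ! \<rho>)))) (e(10 := t, 11 := p, 12 := p')) \<longleftrightarrow>
      (\<exists>y<nv. \<exists>s. literal_at \<rho> t p p' y s \<and> j = 2 * y + (if s then 2 else 3))" if r: "\<rho> < length ts" for \<rho> t p p'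
    proof -
      have V1: "fval d x (Conj (Conj (Lt ta (Scale b (K 1))) (Lt tb (Scale b (K 1))))
         (Eq (V v) (Plus (dbl (dbl (Plus (Scale (b + b) (K \<kappa>)) (Plus (Scale b ta) tb)))) (K (if s then 6 else 8))))) (e(10 := t, 11 := p, 12 := p')) \<longleftrightarrow>
         tval d x ta (env3 t p p') < B \<and> tval d x tb (env3 t p p') < B \<and>
         j = 2 * var \<kappa> (tval d x ta (env3 t p p')) (tval d x tb (env3 t p p')) + (if s then 2 else 3)"
        if l: "(s, \<kappa>, ta, tb) \<in> set (snd (ts ! \<rho>))" for s \<kappa> ta tb
      proof -
        note c = env_closed(2)[OF nth_mem[OF r] l, of e t p p']
        show ?thesis
          unfolding fval.simps fval_derived tval_Scale tval_dbl tval.simps(2,4) w conjunct1[OF c] conjunct2[OF c] var_def mult_1_right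
          by (cases s) (simp_all only: if_True if_False cv conj_assoc)
      qed
      have V2: "var \<kappa> (tval d x ta (env3 t p p')) (tval d x tb (env3 t p p')) < nv"
        if "(s, \<kappa>, ta, tb) \<in> set (snd (ts ! \<rho>))" "tval d x ta (env3 t p p') < B" "tval d x tb (env3 t p p') < B" for s \<kappa> ta tb
        using var_bound kinds[OF nth_mem[OF r] that(1)] that(2,3) by blast
      show ?thesis
        unfolding fval_disjs set_map literal_at_def
      proof (intro iffI; elim bexE imageE exE conjE)
        fix f l assume f: "fval d x f (e(10 := t, 11 := p, 12 := p'))" and l: "l \<in> set (snd (ts ! \<rho>))"
          and fl: "f = (case l of (s, \<kappa>, ta, tb) \<Rightarrow> Conj (Conj (Lt ta (Scale b (K 1))) (Lt tb (Scale b (K 1))))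
             (Eq (V v) (Plus (dbl (dbl (Plus (Scale (b + b) (K \<kappa>)) (Plus (Scale b ta) tb)))) (K (if s then 6 else 8)))))"
        obtain s \<kappa> ta tb where ll: "l = (s, \<kappa>, ta, tb)" by (cases l)
        note l' = l[unfolded ll] and f' = f[unfolded fl ll prod.case, unfolded V1[OF l[unfolded ll]]]
        show "\<exists>y<nv. \<exists>s. (\<exists>\<kappa> ta tb. (s, \<kappa>, ta, tb) \<in> set (snd (ts ! \<rho>)) \<and> tval d x ta (env3 t p p') < B \<and>
           tval d x tb (env3 t p p') < B \<and> y = var \<kappa> (tval d x ta (env3 t p p')) (tval d x tb (env3 t p p'))) \<and>
           j = 2 * y + (if s then 2 else 3)"
          using V2[OF l'] f' l' by blast
      next
        fix y s \<kappa> ta tb assume l: "(s, \<kappa>, ta, tb) \<in> set (snd (ts ! \<rho>))" and r: "tval d x ta (env3 t p p') < B"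
           "tval d x tb (env3 t p p') < B" "y = var \<kappa> (tval d x ta (env3 t p p')) (tval d x tb (env3 t p p'))"
           "j = 2 * y + (if s then 2 else 3)"
        show "\<exists>f\<in>(\<lambda>(s, \<kappa>, ta, tb). Conj (Conj (Lt ta (Scale b (K 1))) (Lt tb (Scale b (K 1))))
             (Eq (V v) (Plus (dbl (dbl (Plus (Scale (b + b) (K \<kappa>)) (Plus (Scale b ta) tb)))) (K (if s then 6 else 8))))) `
             set (snd (ts ! \<rho>)). fval d x f (e(10 := t, 11 := p, 12 := p'))"
          by (rule bexI[OF _ imageI[OF l]], unfold prod.case V1[OF l]) (use r in blast)
      qed
    qed
    have "fval d x (lit_fm b Kn ts u v) e \<longleftrightarrow> (\<exists>c \<rho> t p p'. e u = 2 * c + 2 * nv + 6 \<and> clause c \<rho> t p p' \<and>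
       (\<exists>y<nv. \<exists>s. literal_at \<rho> t p p' y s \<and> j = 2 * y + (if s then 2 else 3)))"
      unfolding lit_fm_def fval_clause_fm[of u e, OF u(1,3)] by (intro ex_cong1 conj_cong refl q) (simp add: clause_def)
    also have "\<dots> \<longleftrightarrow> (\<exists>c. i = c + (nv + 2) \<and> (\<exists>\<rho> t p p'. clause c \<rho> t p p' \<and>
       (\<exists>y<nv. \<exists>s. literal_at \<rho> t p p' y s \<and> j = 2 * y + (if s then 2 else 3))))"
      unfolding eu by blast
    also have "\<dots> \<longleftrightarrow> ct i j = TA"
      unfolding cnf_cell_cases lit_def g_def by (intro ex_cong1 conj_cong refl) blast
    finally show ?thesis .
  qed
  from ty consider "ty = TS" | "ty = TE" | "ty = TA" | "ty = TX" unfolding core_def by blast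
  then show ?thesis
  proof cases
    \<comment> \<open>A crossing is whatever is neither a start, an end nor a literal; among the
      core types this is exactly the complement.\<close>
    case 4
    have "ct i j \<in> core" by (rule cnf_cell_core)
    then show ?thesis using 4 S E A unfolding core_fm_def core_def by auto
  qed (simp_all add: core_fm_def S E A)
qed

end

definition tile_fm :: "nat \<Rightarrow> nat \<Rightarrow> template list \<Rightarrow> ty \<Rightarrow> nat \<Rightarrow> nat \<Rightarrow> fm" where
  "tile_fm b Kn ts = grid_fm (Plus (Plus (Scale (b + b) (K Kn)) (K 2)) (Scale (b + b + b) (K (length ts))))
     (Plus (dbl (Scale (b + b) (K Kn))) (K 3)) (core_fm b Kn ts)"

theorem (in reduction) reduction_correct:
  "\<exists>n E. matrix_output d 14 (ex_fm (tile_fm b Kn ts)) (adj_fm (tile_fm b Kn ts)) x = graph_code n E \<and>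
     simple_graph {..<n} E \<and> planar {..<n} E \<and> colorable 3 {..<n} E \<and> regular 3 {..<n} E \<and>
     ((\<exists>f. edge_labeling_by_product 2 E f) \<longleftrightarrow> (\<exists>\<alpha>. template_sat d b ts x \<alpha>))"
proof -
  define R where "R = nv + 2 + B * B * B * length ts"
  define C where "C = 2 * nv + 3"
  interpret grid R C ct by unfold_locales (rule cnf_cell_core)
  have bound: "2 * R + 2 < rng d x" "2 * C + 2 < rng d x"
    using size unfolding R_def C_def nv_def by simp_all
  have tile: "fval d x (tile_fm b Kn ts ty u v) e \<longleftrightarrow> grid_ty R C ct (e u) (e v) = ty"
    if "ty \<noteq> TN" "u < 4" "v < 4" "e u < rng d x" "e v < rng d x" for ty u v e
    unfolding tile_fm_def
  proof (rule fval_grid_fm[of u v e, OF that(2-5) _ _ _ _ cnf_cell_core _ that(1)])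
    show "R < rng d x" "C < rng d x" using bound by simp_all
    show "fval d x (core_fm b Kn ts u v ty) e = (ct i j = ty)"
      if "ty \<in> core" "e u = 2 * i + 2" "e v = 2 * j + 2" for i j ty
      by (rule fval_core_fm[of u v e i j ty, OF \<open>u < 4\<close> \<open>v < 4\<close> \<open>e u < rng d x\<close> \<open>e v < rng d x\<close> that(2,3,1)])
  qed (simp_all only: tval_Scale tval_dbl tval.simps(2,4) R_def C_def nv_def)
  define vs where "vs = tile_vertices (grid_ty R C ct) (rng d x)"
  have small: "I < rng d x \<and> J < rng d x" if "grid_ty R C ct I J \<noteq> TN" for I J
  proof -
    have "I \<le> 2 * R + 2 \<and> J \<le> 2 * C + 2" using that by (rule grid_ty_cases(8)[where ct = ct, OF cnf_cell_core])
    then show ?thesis using bound by simp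
  qed
  note vs = set_tile_vertices[of "grid_ty R C ct" "rng d x", OF small, folded vs_def]
  have out: "matrix_output d 14 (ex_fm (tile_fm b Kn ts)) (adj_fm (tile_fm b Kn ts)) x =
     graph_code (length vs) (list_graph vs (adjT (grid_ty R C ct)))"
  proof (rule trans[OF matrix_output_tiling[where \<tau> = "grid_ty R C ct"]])
    fix ty u v and e :: "nat \<Rightarrow> nat"
    assume "ty \<noteq> TN" "u < 4" "v < 4" "e u < rng d x" "e v < rng d x"
    then show "fval d x (tile_fm b Kn ts ty u v) e \<longleftrightarrow> grid_ty R C ct (e u) (e v) = ty" by (rule tile)
  next
    show "concat (map (\<lambda>u. map (adjT (grid_ty R C ct) u) (tile_vertices (grid_ty R C ct) (rng d x)))
        (tile_vertices (grid_ty R C ct) (rng d x))) = graph_code (length vs) (list_graph vs (adjT (grid_ty R C ct)))"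
      unfolding vs_def[symmetric] by (rule graph_code_list_graph[symmetric]) (rule adj_sym)
  qed
  have sat: "(\<exists>p. port_assignment p) \<longleftrightarrow> (\<exists>\<alpha>. template_sat d b ts x \<alpha>)"
    unfolding port_assignment_iff template_sat_iff_cnf unfolding R_def C_def by (rule cnf_grid_sat)
  show ?thesis
    using out list_graph_tiling[OF vs(2,1)] sat
    by (intro exI[of _ "length vs"] exI[of _ "list_graph vs (adjT (grid_ty R C ct))"]) simp
qed

section \<open>Hardness\<close>

lemma graph_codes_iff:
  assumes "simple_graph {..<n} E"
  shows "graph_code n E \<in> graph_codes Q \<longleftrightarrow> Q {..<n} E"
proof
  assume "graph_code n E \<in> graph_codes Q"
  then obtain n' E' where "graph_code n E = graph_code n' E'" "simple_graph {..<n'} E'" "Q {..<n'} E'"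
    unfolding graph_codes_def by blast
  then show "Q {..<n} E" using graph_code_inj[OF assms] by metis
qed (use assms in \<open>auto simp: graph_codes_def\<close>)

text \<open>The promise \<open>Q\<close> is any property implied by what all produced graphs have in
  common; hardness therefore holds for every such class at once.\<close>

theorem NP_hard_labeling:
  assumes "\<And>n E. simple_graph {..<n} E \<Longrightarrow> planar {..<n} E \<Longrightarrow> colorable 3 {..<n} E \<Longrightarrow> regular 3 {..<n} E \<Longrightarrow> Q {..<n} E"
  shows "NP_hard_on (graph_codes Q) (graph_codes (\<lambda>V E. \<exists>f. edge_labeling_by_product 2 E f))"
  unfolding NP_hard_on_def
proof
  fix L assume "L \<in> NP"
  then obtain b ts where ts: "\<And>T. T \<in> set ts \<Longrightarrow> closed3 T"
    "\<And>d x. d > b \<Longrightarrow> x \<in> L \<longleftrightarrow> (\<exists>\<alpha>. template_sat d b ts x \<alpha>)"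
    using cook_levin_templates by blast
  define kinds where "kinds = (\<Union>T\<in>set ts. (\<lambda>l. fst (snd l)) ` set (snd T))"
  have "finite kinds" unfolding kinds_def by blast
  then obtain Kn where Kn: "\<forall>\<kappa>\<in>kinds. \<kappa> < Kn" using finite_nat_set_iff_bounded by blast
  \<comment> \<open>The inequality \<open>c < (length x + 2) ^ c\<close> absorbs the constant
    factors, and the summand \<open>b + b + b\<close> in \<open>d\<close> pays for the cube of
    \<open>rng b x\<close> that counts the instances of a template.\<close>
  define c where "c = 4 * Kn + 2 * length ts + 8"
  define d where "d = b + b + b + c"
  have "reduction b Kn d ts x" for x
  proof
    show "closed3 T" if "T \<in> set ts" for T using ts(1)[OF that] .
    show "\<kappa> < Kn" if "T \<in> set ts" "(s, \<kappa>, ta, tb) \<in> set (snd T)" for T s \<kappa> ta tb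
    proof -
      have "\<kappa> \<in> kinds" unfolding kinds_def using that by force
      then show ?thesis using Kn by blast
    qed
    let ?B = "rng b x"
    have B: "1 \<le> ?B" by (simp add: rng_def)
    show "?B \<le> rng d x" unfolding rng_def d_def by (rule power_increasing) auto
    have "c < 2 ^ c" by (rule less_exp)
    also have "(2::nat) ^ c \<le> (length x + 2) ^ c" by (rule power_mono) auto
    finally have c: "c < (length x + 2) ^ c" .
    have BB: "?B * ?B * 1 \<le> ?B * ?B * ?B" "1 \<le> ?B * ?B * ?B"
      using B by (intro mult_le_mono order_refl, simp_all)
    have "4 * (?B * ?B * Kn) + 2 * (?B * ?B * ?B * length ts) + 8 \<le>
       4 * (?B * ?B * ?B * Kn) + 2 * (?B * ?B * ?B * length ts) + 8 * (?B * ?B * ?B)"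
      using BB by (intro add_mono mult_le_mono) simp_all
    also have "\<dots> = ?B * ?B * ?B * c" by (simp add: c_def algebra_simps)
    also have "\<dots> < ?B * ?B * ?B * (length x + 2) ^ c" using c BB(2) by simp
    also have "\<dots> = rng d x" by (simp add: rng_def d_def power_add)
    finally show "4 * (?B * ?B * Kn) + 2 * (?B * ?B * ?B * length ts) + 8 < rng d x" .
  qed
  note red = reduction.reduction_correct[OF this]
  let ?f = "matrix_output d 14 (ex_fm (tile_fm b Kn ts)) (adj_fm (tile_fm b Kn ts))"
  have "b < d" by (simp add: d_def c_def)
  have "?f x \<in> graph_codes Q \<and> (x \<in> L \<longleftrightarrow> ?f x \<in> graph_codes (\<lambda>V E. \<exists>f. edge_labeling_by_product 2 E f))" for x
  proof -
    obtain n E where E: "?f x = graph_code n E" "simple_graph {..<n} E" "planar {..<n} E" "colorable 3 {..<n} E"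
      "regular 3 {..<n} E" "(\<exists>f. edge_labeling_by_product 2 E f) \<longleftrightarrow> (\<exists>\<alpha>. template_sat d b ts x \<alpha>)"
      using red[of x] by blast
    have "Q {..<n} E" by (rule assms[OF E(2-5)])
    then show ?thesis unfolding E(1) graph_codes_iff[OF E(2)] ts(2)[OF \<open>b < d\<close>] E(6) by simp
  qed
  then show "\<exists>f. polytime f \<and> (\<forall>x. f x \<in> graph_codes Q \<and>
      (x \<in> L \<longleftrightarrow> f x \<in> graph_codes (\<lambda>V E. \<exists>f. edge_labeling_by_product 2 E f)))"
    using polytime_matrix_output by blast
qed

section \<open>Membership in NP\<close>

text \<open>A product of two variables, obtained by adding one of them as often as the other one
  says. Its value is right only while both variables stay within the range, hence the bounds in
  \<open>tval_mul\<close>.\<close>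

definition mul :: "nat \<Rightarrow> nat \<Rightarrow> trm" where
  "mul a c = Sum 9 (Cond (Lt (V 9) (V a)) (V c))"

lemma tval_mul:
  assumes "a \<noteq> 9" "c \<noteq> 9" "e a \<le> rng d x" "e c \<le> rng d x"
  shows "tval d x (mul a c) e = e a * e c"
proof -
  have "tval d x (mul a c) e = (\<Sum>v<rng d x. if v < e a then e c else 0)"
    unfolding mul_def using assms by (auto intro!: sum.cong simp: min_def)
  also have "\<dots> = (\<Sum>v\<in>{..<rng d x} \<inter> {v. v < e a}. e c)" by (simp add: sum.If_cases)
  also have "{..<rng d x} \<inter> {v. v < e a} = {..<e a}" using assms by auto
  finally show ?thesis by simp
qed

text \<open>Variable 4 holds the number n of vertices. The first component of a pair is doubled, so
  the matrix entry for (i, j) is found at cell 2 (n i + j). In \<open>w_bit\<close> the offset 2 n n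
  + 2 skips the doubled matrix and the separator.\<close>

definition x_bit :: "nat \<Rightarrow> nat \<Rightarrow> fm" where
  "x_bit i j = At 2 (dbl (Plus (mul 4 i) (V j)))"

definition w_bit :: "nat \<Rightarrow> nat \<Rightarrow> fm" where
  "w_bit i j = At 2 (Plus (Plus (dbl (mul 4 4)) (K 2)) (Plus (mul 4 i) (V j)))"

text \<open>The witness is read as a square matrix and symmetrised by the disjunction, so every word
  describes some subgraph and nothing has to be verified about its form.\<close>

definition deg_trm :: "nat \<Rightarrow> trm" where
  "deg_trm i = Sum 7 (Cond (Conj (Lt (V 7) (V 4)) (Conj (x_bit i 7) (Disj (w_bit i 7) (w_bit 7 i)))) (K 1))"

definition unequal_fm :: fm where
  "unequal_fm = Conj (Lt (V 8) (mul 4 4)) (Neg (Disj (Conj (At 2 (dbl (V 8))) (At 2 (Plus (dbl (V 8)) (K 1))))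
     (Conj (Neg (At 2 (dbl (V 8)))) (Neg (At 2 (Plus (dbl (V 8)) (K 1)))))))"

text \<open>This recovers n from the pair: the separator is the first block of two different letters
  and stands right behind the doubled code, whose length before doubling is the square of n.\<close>

definition sep_fm :: fm where
  "sep_fm = Conj (At 2 (dbl (mul 4 4))) (Conj (At 1 (Plus (dbl (mul 4 4)) (K 1))) (Neg (Exi 8 unequal_fm)))"

definition labeling_fm :: fm where
  "labeling_fm = Exi 4 (Conj sep_fm (Neg (Exi 5 (Exi 6 (Conj (Conj (Lt (V 5) (V 4)) (Lt (V 6) (V 4)))
     (Conj (x_bit 5 6) (Eq (deg_trm 5) (deg_trm 6))))))))"

lemma word_cells_eq: "word_cells w (int k) = 2 \<longleftrightarrow> k < length w \<and> w ! k"
  by (simp add: word_cells_def)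

lemma length_rows: "length (concat (map (\<lambda>i. map (f i) [0..<n]) [0..<m])) = n * m"
  by (induction m) simp_all

lemma nth_rows:
  assumes "i < m" "j < n"
  shows "concat (map (\<lambda>i. map (f i) [0..<n]) [0..<m]) ! (n * i + j) = f i j"
  using assms(1)
proof (induction m)
  case (Suc m)
  show ?case
  proof (cases "i < m")
    case True
    have "n * i + j < n * Suc i" using assms(2) by simp
    also have "\<dots> \<le> n * m" using True by (intro mult_le_mono2) simp
    finally show ?thesis using Suc.IH[OF True] by (simp add: nth_append length_rows)
  next
    case False
    then have "i = m" using Suc.prems by simp
    then show ?thesis using assms(2) by (simp add: nth_append length_rows)
  qed
qed simp

lemma length_graph_code: "length (graph_code n E) = n * n"
  unfolding graph_code_def by (rule length_rows)

lemma index_bound: "i < n \<Longrightarrow> j < n \<Longrightarrow> n * i + j < n * (n::nat)"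
proof -
  assume a: "i < n" "j < n"
  then have "n * i + j < n * Suc i" by simp
  also have "\<dots> \<le> n * n" using a by (intro mult_le_mono2) simp
  finally show ?thesis .
qed

lemma word_cells_pair_nat:
  "k < length x \<Longrightarrow> word_cells (word_pair x w) (int (2 * k)) = word_cells x (int k)"
  "k < length x \<Longrightarrow> word_cells (word_pair x w) (int (2 * k + 1)) = word_cells x (int k)"
  "word_cells (word_pair x w) (int (2 * length x)) = 2" "word_cells (word_pair x w) (int (2 * length x + 1)) = 1"
  "word_cells (word_pair x w) (int (2 * length x + 2 + k)) = word_cells w (int k)"
  unfolding word_cells_pair by simp_all

lemma bex_less_eq: "n < N \<Longrightarrow> (\<exists>m<N. m = n \<and> P m) \<longleftrightarrow> P n" for n :: nat
  by blast

lemma not_bex_less: "n < N \<Longrightarrow> (\<not> (\<exists>i<N. \<exists>j<N. i < n \<and> j < n \<and> P i j \<and> Q i j)) \<longleftrightarrow>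
    (\<forall>i<n. \<forall>j<n. P i j \<longrightarrow> \<not> Q i j)" for n :: nat
  by (meson less_trans)

lemma fval_labeling_fm:
  fixes n :: nat and E :: "nat set set" and w :: "bool list"
  defines "y \<equiv> word_pair (graph_code n E) w"
    and "H \<equiv> \<lambda>i j. n * i + j < length w \<and> w ! (n * i + j) \<or> n * j + i < length w \<and> w ! (n * j + i)"
  shows "fval 1 y labeling_fm (\<lambda>_. 0) \<longleftrightarrow> (\<forall>i<n. \<forall>j<n. {i, j} \<in> E \<longrightarrow>
    card {k. k < n \<and> {i, k} \<in> E \<and> H i k} \<noteq> card {k. k < n \<and> {j, k} \<in> E \<and> H j k})"
proof -
  define N where "N = rng 1 y"
  have lx: "length (graph_code n E) = n * n" by (rule length_graph_code)
  have "length y = 2 * (n * n) + 2 + length w"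
  proof -
    have "length (concat (map (\<lambda>b. [b, b]) x)) = 2 * length x" for x :: "bool list" by (induction x) auto
    then show ?thesis by (simp add: y_def word_pair_def lx)
  qed
  then have N: "2 * (n * n) + 2 < N" "N = length y + 2" by (simp_all add: N_def rng_def)
  have "n \<le> n * n" by (rule le_square)
  then have nN: "n < N" using N(1) by linarith
  note wp = word_cells_pair_nat[where x = "graph_code n E" and w = w, folded y_def, unfolded lx]
  have c0: "word_cells y (int (2 * k)) = 2 \<longleftrightarrow> graph_code n E ! k" if "k < n * n" for k
    unfolding wp(1)[OF that] using that by (simp add: word_cells_eq lx)
  have c1: "word_cells y (int (2 * k + 1)) = word_cells y (int (2 * k))" if "k < n * n" for k
    unfolding wp(1,2)[OF that] ..
  note cs = wp(3,4)
  have cw: "word_cells y (int (2 * (n * n) + 2 + k)) = 2 \<longleftrightarrow> k < length w \<and> w ! k" for k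
    unfolding wp(5) by (rule word_cells_eq)
  have sep: "fval 1 y sep_fm e \<longleftrightarrow> e 4 = n" if e4: "e 4 < N" for e
  proof -
    let ?m = "e 4"
    have t: "tval 1 y (mul 4 4) e' = ?m * ?m" if "e' 4 = e 4" for e'
      using e4 that by (subst tval_mul) (simp_all add: N_def)
    have t0: "tval 1 y (mul 4 4) e = ?m * ?m" by (rule t) simp
    have t8: "tval 1 y (mul 4 4) (e(8 := v)) = ?m * ?m" for v by (rule t) simp
    have inner: "fval 1 y unequal_fm (e(8 := v)) \<longleftrightarrow> v < ?m * ?m \<and>
      \<not> (word_cells y (int (2 * v)) = 2 \<longleftrightarrow> word_cells y (int (2 * v + 1)) = 2)" if "v < N" for v
    proof -
      have v8: "tval 1 y (V 8) (e(8 := v)) = v" using that by (simp add: N_def)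
      show ?thesis
        unfolding unequal_fm_def fval.simps fval_derived tval_dbl tval.simps(2,4) v8 t8 by blast
    qed
    have "fval 1 y sep_fm e \<longleftrightarrow> word_cells y (int (2 * (?m * ?m))) = 2 \<and> word_cells y (int (2 * (?m * ?m) + 1)) = 1 \<and>
      (\<forall>v<N. v < ?m * ?m \<longrightarrow> (word_cells y (int (2 * v)) = 2 \<longleftrightarrow> word_cells y (int (2 * v + 1)) = 2))"
      unfolding sep_fm_def fval.simps fval_Exi tval_dbl tval.simps(2,4) t0 N_def[symmetric] using inner by blast
    also have "\<dots> \<longleftrightarrow> ?m = n"
    proof
      assume a: "word_cells y (int (2 * (?m * ?m))) = 2 \<and> word_cells y (int (2 * (?m * ?m) + 1)) = 1 \<and>
        (\<forall>v<N. v < ?m * ?m \<longrightarrow> (word_cells y (int (2 * v)) = 2 \<longleftrightarrow> word_cells y (int (2 * v + 1)) = 2))"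
      \<comment> \<open>A smaller value would put the separator at a block of two equal letters, and
        a larger one would count the true separator among the blocks of equal letters.\<close>
      show "?m = n"
      proof (rule linorder_cases)
        assume "?m < n"
        then have "?m * ?m < n * n" by (intro mult_strict_mono') simp_all
        then have "word_cells y (int (2 * (?m * ?m) + 1)) = word_cells y (int (2 * (?m * ?m)))" by (rule c1)
        then have "(1::nat) = 2" using a by metis
        then show ?thesis by simp
      next
        assume "n < ?m"
        then have "n * n < ?m * ?m" by (intro mult_strict_mono') simp_all
        moreover have "n * n < N" using N(1) by linarith
        ultimately have "word_cells y (int (2 * (n * n))) = 2 \<longleftrightarrow> word_cells y (int (2 * (n * n) + 1)) = 2" using a by blast
        then show ?thesis unfolding cs by simp
      qed
    next
      assume "?m = n"
      then show "word_cells y (int (2 * (?m * ?m))) = 2 \<and> word_cells y (int (2 * (?m * ?m) + 1)) = 1 \<and>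
        (\<forall>v<N. v < ?m * ?m \<longrightarrow> (word_cells y (int (2 * v)) = 2 \<longleftrightarrow> word_cells y (int (2 * v + 1)) = 2))"
        unfolding \<open>?m = n\<close> using cs c1 by metis
    qed
    finally show ?thesis .
  qed
  have xb: "fval 1 y (x_bit i j) e \<longleftrightarrow> {e i, e j} \<in> E"
    if "e 4 = n" "e i < n" "e j < n" "i \<noteq> 9" for e i j
  proof -
    have "tval 1 y (mul 4 i) e = n * e i" using that nN by (subst tval_mul) (simp_all add: N_def)
    moreover have "tval 1 y (V j) e = e j" using that nN by (simp add: N_def)
    ultimately have "fval 1 y (x_bit i j) e \<longleftrightarrow> word_cells y (int (2 * (n * e i + e j))) = 2"
      unfolding x_bit_def fval.simps tval_dbl tval.simps(4) by (simp only:)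
    also have "\<dots> \<longleftrightarrow> {e i, e j} \<in> E"
      unfolding c0[OF index_bound[OF that(2,3)]] graph_code_def by (subst nth_rows) (use that in simp_all)
    finally show ?thesis .
  qed
  have wb: "fval 1 y (w_bit i j) e \<longleftrightarrow> n * e i + e j < length w \<and> w ! (n * e i + e j)"
    if "e 4 = n" "e i < n" "e j < n" "i \<noteq> 9" for e i j
  proof -
    have "tval 1 y (mul 4 i) e = n * e i" "tval 1 y (mul 4 4) e = n * n"
      using that nN by (subst tval_mul, simp_all add: N_def)+
    moreover have "tval 1 y (V j) e = e j" using that nN by (simp add: N_def)
    ultimately have "fval 1 y (w_bit i j) e \<longleftrightarrow> word_cells y (int (2 * (n * n) + 2 + (n * e i + e j))) = 2"
      unfolding w_bit_def fval.simps tval_dbl tval.simps(2,4) by (simp only:)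
    then show ?thesis unfolding cw .
  qed
  have deg: "tval 1 y (deg_trm i) e = card {k. k < n \<and> {e i, k} \<in> E \<and> H (e i) k}"
    if e: "e 4 = n" "e i < n" and i: "i \<noteq> 9" "i \<noteq> 7" for e i
  proof -
    have "tval 1 y (deg_trm i) e = (\<Sum>k<N. if k < n \<and> {e i, k} \<in> E \<and> H (e i) k then 1 else 0)"
      unfolding deg_trm_def tval.simps(5) N_def[symmetric]
    proof (rule sum.cong[OF refl])
      fix k assume k: "k \<in> {..<N}"
      have l: "fval 1 y (Lt (V 7) (V 4)) (e(7 := k)) \<longleftrightarrow> k < n" using k nN e by (simp add: N_def)
      show "tval 1 y (Cond (Conj (Lt (V 7) (V 4)) (Conj (x_bit i 7) (Disj (w_bit i 7) (w_bit 7 i)))) (K 1)) (e(7 := k)) =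
         (if k < n \<and> {e i, k} \<in> E \<and> H (e i) k then 1 else 0)"
      proof (cases "k < n")
        case True
        then show ?thesis
          unfolding tval.simps(2,6) fval.simps(4) fval_derived l H_def using e i by (simp add: xb wb del: One_nat_def)
      next
        case False
        then show ?thesis unfolding tval.simps(2,6) fval.simps(4) l by simp
      qed
    qed
    also have "\<dots> = card ({..<N} \<inter> {k. k < n \<and> {e i, k} \<in> E \<and> H (e i) k})" by (simp add: sum.If_cases)
    also have "{..<N} \<inter> {k. k < n \<and> {e i, k} \<in> E \<and> H (e i) k} = {k. k < n \<and> {e i, k} \<in> E \<and> H (e i) k}"
      using nN by auto
    finally show ?thesis .
  qed
  have body: "fval 1 y (Conj (Conj (Lt (V 5) (V 4)) (Lt (V 6) (V 4))) (Conj (x_bit 5 6) (Eq (deg_trm 5) (deg_trm 6))))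
      (e(4 := n, 5 := i, 6 := j)) \<longleftrightarrow> i < n \<and> j < n \<and> {i, j} \<in> E \<and>
      card {k. k < n \<and> {i, k} \<in> E \<and> H i k} = card {k. k < n \<and> {j, k} \<in> E \<and> H j k}" if "i < N" "j < N" for i j e
  proof -
    have l: "fval 1 y (Conj (Lt (V 5) (V 4)) (Lt (V 6) (V 4))) (e(4 := n, 5 := i, 6 := j)) \<longleftrightarrow> i < n \<and> j < n"
      using that nN by (simp add: N_def)
    show ?thesis
    proof (cases "i < n \<and> j < n")
      case True
      then show ?thesis
        unfolding fval.simps(4)[of _ _ "Conj (Lt (V 5) (V 4)) (Lt (V 6) (V 4))"] l fval.simps(4)[of _ _ "x_bit 5 6"] fval_derived
        by (simp add: xb deg del: One_nat_def)
    next
      case False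
      then show ?thesis unfolding fval.simps(4)[of _ _ "Conj (Lt (V 5) (V 4)) (Lt (V 6) (V 4))"] l by blast
    qed
  qed
  have "fval 1 y labeling_fm (\<lambda>_. 0) \<longleftrightarrow> (\<exists>m<N. m = n \<and> \<not> (\<exists>i<N. \<exists>j<N.
      fval 1 y (Conj (Conj (Lt (V 5) (V 4)) (Lt (V 6) (V 4))) (Conj (x_bit 5 6) (Eq (deg_trm 5) (deg_trm 6))))
      ((\<lambda>_. 0)(4 := m, 5 := i, 6 := j))))"
    unfolding labeling_fm_def fval_Exi fval.simps(3) fval.simps(4)[of _ _ sep_fm] N_def[symmetric]
  proof (intro ex_cong1 conj_cong refl)
    fix m assume "m < N"
    then show "fval 1 y sep_fm ((\<lambda>_. 0)(4 := m)) \<longleftrightarrow> m = n" using sep[of "(\<lambda>_. 0)(4 := m)"] by simp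
  qed
  also have "\<dots> \<longleftrightarrow> \<not> (\<exists>i<N. \<exists>j<N.
      fval 1 y (Conj (Conj (Lt (V 5) (V 4)) (Lt (V 6) (V 4))) (Conj (x_bit 5 6) (Eq (deg_trm 5) (deg_trm 6))))
      ((\<lambda>_. 0)(4 := n, 5 := i, 6 := j)))"
    by (rule bex_less_eq[OF nN])
  also have "\<dots> \<longleftrightarrow> \<not> (\<exists>i<N. \<exists>j<N. i < n \<and> j < n \<and> {i, j} \<in> E \<and>
      card {k. k < n \<and> {i, k} \<in> E \<and> H i k} = card {k. k < n \<and> {j, k} \<in> E \<and> H j k})"
    by (intro arg_cong[where f = Not] ex_cong1 conj_cong refl body)
  also have "\<dots> \<longleftrightarrow> (\<forall>i<n. \<forall>j<n. {i, j} \<in> E \<longrightarrow>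
      card {k. k < n \<and> {i, k} \<in> E \<and> H i k} \<noteq> card {k. k < n \<and> {j, k} \<in> E \<and> H j k})"
    by (rule not_bex_less[OF nN])
  finally show ?thesis .
qed

text \<open>The witness is the adjacency matrix of the subgraph of edges labelled 2. It is as long
  as the code of the graph, so the identity serves as length bound.\<close>

theorem labeling_in_NP:
  "in_NP_on (graph_codes Q) (graph_codes (\<lambda>V E. \<exists>f. edge_labeling_by_product 2 E f))"
proof -
  define A where "A = {y. fval 1 y labeling_fm (\<lambda>_. 0)}"
  define L where "L = {x. \<exists>w. length w \<le> poly [:0, 1:] (length x) \<and> word_pair x w \<in> A}"
  have "L \<in> NP" unfolding NP_def L_def A_def
    by (intro CollectI exI[of _ "{y. fval 1 y labeling_fm (\<lambda>_. 0)}"] exI[of _ "[:0, 1:]"] conjI polytime_decidable_fval allI)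
      (rule mem_Collect_eq)
  moreover have "x \<in> L \<longleftrightarrow> x \<in> graph_codes (\<lambda>V E. \<exists>f. edge_labeling_by_product 2 E f)" if "x \<in> graph_codes Q" for x
  proof -
    obtain n E where x: "x = graph_code n E" and sg: "simple_graph {..<n} E" 
      using \<open>x \<in> graph_codes Q\<close> unfolding graph_codes_def mem_Collect_eq by (elim exE conjE) (rule that, assumption+)
    note sgE = bspec[OF conjunct2[OF sg[unfolded simple_graph_def]]]
    have lt: "i < n \<and> j < n" if "{i, j} \<in> E" for i j
      using conjunct1[OF sgE[OF that]] by simp
    have irr: "{i, i} \<notin> E" for i
    proof
      assume "{i, i} \<in> E"
      from conjunct2[OF sgE[OF this]] have "card {i, i} = 2" .
      then show False by simp
    qed
    have E: "E = edges_of (\<lambda>i j. {i, j} \<in> E)"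
    proof (intro equalityI subsetI)
      fix e assume e: "e \<in> E"
      from conjunct2[OF sgE[OF this]] have "card e = 2" .
      then obtain i j where "e = {i, j}" by (auto simp: card_2_iff)
      then show "e \<in> edges_of (\<lambda>i j. {i, j} \<in> E)" using e unfolding edges_of_def by auto
    next
      fix e assume "e \<in> edges_of (\<lambda>i j. {i, j} \<in> E)"
      then show "e \<in> E" unfolding edges_of_def by auto
    qed
    have fin: "finite {j. {i, j} \<in> E}" for i
    proof (rule finite_subset[of _ "{..<n}"])
      show "{j. {i, j} \<in> E} \<subseteq> {..<n}"
      proof
        fix j assume "j \<in> {j. {i, j} \<in> E}"
        then have "{i, j} \<in> E" by simp
        from conjunct2[OF lt[OF this]] show "j \<in> {..<n}" by simp
      qed
    qed simp
    have s: "{i, j} \<in> E \<Longrightarrow> {j, i} \<in> E" for i j by (simp add: insert_commute)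
    have "x \<in> graph_codes (\<lambda>V E. \<exists>f. edge_labeling_by_product 2 E f) \<longleftrightarrow> (\<exists>f. edge_labeling_by_product 2 E f)"
      unfolding x by (rule graph_codes_iff[OF sg])
    also have "(\<exists>f. edge_labeling_by_product 2 E f) \<longleftrightarrow> (\<exists>H. (\<forall>u v. H u v = H v u) \<and>
      (\<forall>u v. {u, v} \<in> E \<longrightarrow> card {w. {u, w} \<in> E \<and> H u w} \<noteq> card {w. {v, w} \<in> E \<and> H v w}))"
      by (rule labeling_iff_subgraph[of "\<lambda>i j. {i, j} \<in> E", OF s irr fin, folded E])
    also have "\<dots> \<longleftrightarrow> x \<in> L"
    proof
      assume "\<exists>H. (\<forall>u v. H u v = H v u) \<and>
        (\<forall>u v. {u, v} \<in> E \<longrightarrow> card {w. {u, w} \<in> E \<and> H u w} \<noteq> card {w. {v, w} \<in> E \<and> H v w})"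
      then obtain H where H: "\<And>u v. H u v = H v u"
        "\<And>u v. {u, v} \<in> E \<Longrightarrow> card {w. {u, w} \<in> E \<and> H u w} \<noteq> card {w. {v, w} \<in> E \<and> H v w}" by blast
      define w where "w = concat (map (\<lambda>i. map (H i) [0..<n]) [0..<n])"
      have lw: "length w = n * n" unfolding w_def by (rule length_rows)
      have nw: "w ! (n * i + j) = H i j" "n * i + j < length w" if "i < n" "j < n" for i j
      proof -
        show "w ! (n * i + j) = H i j" unfolding w_def by (rule nth_rows[OF that])
        show "n * i + j < length w" unfolding lw by (rule index_bound[OF that])
      qed
      \<comment> \<open>Since \<open>H\<close> is symmetric, the disjunction over the two matrix
        entries says no more than \<open>H i k\<close>.\<close>
      have set: "{k. k < n \<and> {i, k} \<in> E \<and> (n * i + k < length w \<and> w ! (n * i + k) \<or> n * k + i < length w \<and> w ! (n * k + i))} =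
         {k. {i, k} \<in> E \<and> H i k}" for i
      proof (rule Collect_cong)
        fix k
        show "(k < n \<and> {i, k} \<in> E \<and> (n * i + k < length w \<and> w ! (n * i + k) \<or> n * k + i < length w \<and> w ! (n * k + i))) \<longleftrightarrow>
          {i, k} \<in> E \<and> H i k"
        proof (cases "{i, k} \<in> E")
          case True
          note b = conjunct1[OF lt[OF True]] conjunct2[OF lt[OF True]]
          show ?thesis using True b nw[OF b] nw[OF b(2,1)] H(1)[of k i] by simp
        qed simp
      qed
      have "word_pair x w \<in> A"
        unfolding A_def x mem_Collect_eq fval_labeling_fm set by (intro allI impI H(2))
      moreover have "length w \<le> poly [:0, 1:] (length x)" by (simp add: lw x length_graph_code)
      ultimately show "x \<in> L" unfolding L_def mem_Collect_eq by (intro exI[of _ w] conjI)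
    next
      assume "x \<in> L"
      then obtain w where w: "word_pair x w \<in> A" unfolding L_def mem_Collect_eq by (elim exE conjE) (rule that)
      define H where "H i j \<longleftrightarrow> n * i + j < length w \<and> w ! (n * i + j) \<or> n * j + i < length w \<and> w ! (n * j + i)" for i j
      have set: "{k. k < n \<and> {i, k} \<in> E \<and> H i k} = {k. {i, k} \<in> E \<and> H i k}" for i using lt by blast
      have star: "\<forall>i<n. \<forall>j<n. {i, j} \<in> E \<longrightarrow> card {k. {i, k} \<in> E \<and> H i k} \<noteq> card {k. {j, k} \<in> E \<and> H j k}"
        using w unfolding A_def x mem_Collect_eq fval_labeling_fm H_def[symmetric] set .
      have "\<forall>u v. {u, v} \<in> E \<longrightarrow> card {w. {u, w} \<in> E \<and> H u w} \<noteq> card {w. {v, w} \<in> E \<and> H v w}"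
      proof (intro allI impI)
        fix u v assume uv: "{u, v} \<in> E"
        show "card {w. {u, w} \<in> E \<and> H u w} \<noteq> card {w. {v, w} \<in> E \<and> H v w}"
          by (rule star[rule_format, OF conjunct1[OF lt[OF uv]] conjunct2[OF lt[OF uv]] uv])
      qed
      moreover have "\<forall>u v. H u v = H v u" unfolding H_def by (intro allI) (rule disj_commute)
      ultimately show "\<exists>H. (\<forall>u v. H u v = H v u) \<and>
        (\<forall>u v. {u, v} \<in> E \<longrightarrow> card {w. {u, w} \<in> E \<and> H u w} \<noteq> card {w. {v, w} \<in> E \<and> H v w})"
        by (intro exI[of _ H] conjI)
    qed
    finally show ?thesis by (rule sym)
  qed
  ultimately show ?thesis unfolding in_NP_on_def by blast
qed

theorem theorem2:
  shows "NP_complete_on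
           (graph_codes (\<lambda>V E. planar V E \<and> colorable 3 V E))
           (graph_codes (\<lambda>V E. \<exists>f. edge_labeling_by_product 2 E f))
       \<and> NP_complete_on
           (graph_codes (\<lambda>V E. regular 3 V E))
           (graph_codes (\<lambda>V E. \<exists>f. edge_labeling_by_product 2 E f))"
  unfolding NP_complete_on_def by (intro conjI labeling_in_NP NP_hard_labeling)

end
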